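(* Let $k$ be an even integer and let $N\in\{2,3\}$. Let $f$ be a newform of weight $k$ and level $\Gamma_0(N)$, let $r_f^{\mathrm{ev},0}(x,y)=\sum_{(m_1,m_2)\in\mathbf{oo}(k)}a_{m_1,m_2}x^{m_2-1}y^{m_1-1}$ be its restricted even period polynomial, and let $v_f=(a_{m_1,m_2})_{(m_1,m_2)\in\mathbf{oo}(k)}$ be the associated row vector. Then $v_f$ is a left eigenvector of the matrix $\mathcal{D}_{k,2}^{N}\cdot\mathcal{C}_{k,2}^{N}$, i.e. $v_f\,(\mathcal{D}_{k,2}^{N}\cdot\mathcal{C}_{k,2}^{N})=\mu_N\, v_f$, with eigenvalue $$\mu_2=-\left(1+\frac{\varepsilon}{2^{\frac{k-2}{2}}}\right)\quad (N=2),\qquad \mu_3=-\frac12\left(1+\frac{\varepsilon}{3^{\frac{k-2}{2}}}\right)\quad (N=3),$$ where $\varepsilon=\pm1$ is the eigenvalue of the Atkin–Lehner involution $W_N$ on $f$.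
   Context: **Index sets.** For even $k$, $\mathbf{oo}(k)$ is the ordered set $\{(k-3,3),(k-5,5),\dots,(3,k-3)\}$ of pairs of odd integers $\ge 3$ with sum $k$ (empty if $k<6$), and $\mathbf{oo}'(k)$ is the same set in the reverse order $\{(3,k-3),\dots,(k-3,3)\}$. A matrix with rows indexed by $\mathbf{oo}(k)$ and columns indexed by $\mathbf{oo}'(k)$ is regarded as an ordinary $d\times d$ matrix, $d=|\mathbf{oo}(k)|$, by listing rows and columns in these orders; a vector indexed by $\mathbf{oo}(k)$ is regarded as a row vector in $\mathbb{C}^d$ listed in the order of $\mathbf{oo}(k)$. The equation $v M=\mu v$ is the equation for row vectors in $\mathbb{C}^d$ (entries compared by position). **Period polynomials.** For a cusp form $f$ of weight $k$, $r_f(x,y)=\int_0^{i\infty}f(z)(zy-x)^{k-2}\,dz$. The restricted even period polynomial $r_f^{\mathrm{ev},0}(x,y)$ is obtained from $r_f$ by keeping only the monomials $x^iy^j$ with $i,j$ even and then deleting the $x^{k-2}$ and $y^{k-2}$ terms. It is written $\sum_{(m_1,m_2)\in\mathbf{oo}(k)}a_{m_1,m_2}x^{m_2-1}y^{m_1-1}$. **Atkin–Lehner involution.** $W_N f=N^{\frac{2-k}{2}}f|\begin{pmatrix}0&-1\\N&0\end{pmatrix}_k$, where $\left(f|\begin{pmatrix}0&-1\\N&0\end{pmatrix}_k\right)(z)=N^{k-1}(Nz)^{-k}f\left(\frac{-1}{Nz}\right)$; that is, $(W_Nf)(z)=N^{-k/2}z^{-k}f(-1/(Nz))$. **Motivic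 multiple zeta values relative to $\mu_N$.** The multiple zeta values relative to the group $\mu_N$ of $N$th roots of unity are $\zeta\binom{n_1,\dots,n_r}{\varepsilon_1,\dots,\varepsilon_r}=\sum_{0<k_1<\cdots<k_r}\frac{\varepsilon_1^{k_1}\cdots\varepsilon_r^{k_r}}{k_1^{n_1}\cdots k_r^{n_r}}$, with $n_i\ge1$, $\varepsilon_i\in\mu_N$, $(n_r,\varepsilon_r)\ne(1,1)$; the weight is $n_1+\cdots+n_r$ and the depth is $r$. Let $\mathcal H^N$ be the $\mathbb{Q}$-algebra of their motivic versions $\zeta^{\mathfrak m}\binom{n_1,\dots,n_r}{\varepsilon_1,\dots,\varepsilon_r}$, with its weight grading and depth filtration $\mathfrak D$ (associated graded $\mathrm{gr}^{\mathfrak D}_\bullet$). Let $\mathcal{MT}'_N$ be the Tannakian category generated by the motivic fundamental groupoid of $\mathbb P^1\setminus\{0,\mu_N,\infty\}$, with Galois group $\mathbb G_m\ltimes\mathcal U_N$, let $\mathcal A^N=\mathcal O(\mathcal U_N)$ and let $\mathcal L^N=\mathcal A^N_{>0}/(\mathcal A^N_{>0}\cdot\mathcal A^N_{>0})$ be the Lie coalgebra of indecomposables; $\zeta^{\mathfrak l}$ denotes the image of $\zeta^{\mathfrak m}$ in $\mathcal L^N$. The operator $D_p:\mathcal H^N\to\mathcal L^N_p\otimes\mathcal H^N$ is the (Goncharov–Brown) motivic coaction $\mathcal H^N\to\mathcal A^N\otimes\mathcal H^N$ followed by projection of the left factor to the weight $p$ part of $\mathcal L^N$; it induces $D_p:\mathrm{gr}^{\mathfrak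 D}_r\mathcal H^N\to\mathrm{gr}_1^{\mathfrak D}\mathcal L^N_p\otimes\mathrm{gr}^{\mathfrak D}_{r-1}\mathcal H^N$. Explicitly (known formula of Glanois), $D_p\zeta^{\mathfrak m}\binom{n}{\varepsilon}=\delta_{p=n}\zeta^{\mathfrak l}\binom{p}{\varepsilon}\otimes 1$, and for $\varepsilon\in\mu_N$ and $p\le n_1+n_2-2$, $$D_p\zeta^{\mathfrak m}\binom{n_1,n_2}{\varepsilon,\varepsilon^{-1}}=\delta_{p=n_1}\zeta^{\mathfrak l}\binom{p}{\varepsilon}\otimes\zeta^{\mathfrak m}\binom{n_2}{\varepsilon^{-1}}+\Big[(-1)^{n_1}\binom{p-1}{p-n_1}+(-1)^{p-n_2}\binom{p-1}{p-n_2}\Big]\zeta^{\mathfrak l}\binom{p}{\varepsilon^{-1}}\otimes\zeta^{\mathfrak m}\binom{n_1+n_2-p}{1},$$ with $\binom rs=0$ for $s<0$. **Derivations.** Let $N\in\{2,3\}$ and $p\ge3$ odd. In $\mathrm{gr}^{\mathfrak D}_1\mathcal L^N_p$, which is spanned by $\zeta^{\mathfrak l}\binom p1$, one has (Deligne–Goncharov) $\zeta^{\mathfrak l}\binom p\varepsilon=c_{1,\varepsilon,p}\,\zeta^{\mathfrak l}\binom p1$ for $\varepsilon\in\mu_N$, where $c_{1,1,p}=1$; $c_{1,-1,p}=2^{-p+1}-1$ for $N=2$; and $c_{1,\varepsilon,p}=\frac{3^{-p+1}-1}{2}$ for both primitive cube roots of unity $\varepsilon$ when $N=3$. Define $\partial_p:\mathrm{gr}^{\mathfrak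 D}_r\mathcal H^N\to\mathrm{gr}^{\mathfrak D}_{r-1}\mathcal H^N$ as $D_p$ followed by $\zeta^{\mathfrak l}\binom p\varepsilon\otimes X\mapsto c_{1,\varepsilon,p}X$. **The matrices.** Let $\varepsilon_N=e^{2\pi\sqrt{-1}/N}$. The entry of $\mathcal C^N_{k,2}$ in row $(m_1,m_2)\in\mathbf{oo}(k)$ and column $(n_1,n_2)\in\mathbf{oo}'(k)$ is $\partial_{m_2}\partial_{m_1}\zeta^{\mathfrak m}\binom{n_1,n_2}{\varepsilon_N,\varepsilon_N^{-1}}\in\mathbb Q$. The matrix $\mathcal D^N_{k,2}$ is the diagonal matrix with rows and columns both indexed by $\mathbf{oo}(k)$ whose diagonal entry at $(m_1,m_2)$ is $c_{1,\varepsilon_N,m_1}^{-1}$. *)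

theory Defs
  imports
    "HOL-Analysis.Analysis"
    "HOL-Library.Multiset"
    "HOL-Library.Poly_Mapping"
    "HOL-Computational_Algebra.Polynomial"
    "Jordan_Normal_Form.Matrix"
begin

section \<open>Cusp forms and newforms for \<open>\<Gamma>\<^sub>0(N)\<close>\<close>

text \<open>An integral matrix with rows \<open>(a, b)\<close> and \<open>(c, d)\<close> is the tuple \<open>(a, b, c, d)\<close>.\<close>

type_synonym imat2 = "int \<times> int \<times> int \<times> int"

definition uhp :: "complex set" where
  "uhp = {z. Im z > 0}"

definition SL2Z :: "imat2 set" where
  "SL2Z = {(a, b, c, d). a * d - b * c = 1}"

definition Gamma0 :: "nat \<Rightarrow> imat2 set" where
  "Gamma0 N = {(a, b, c, d). a * d - b * c = 1 \<and> int N dvd c}"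

fun imat2_mult :: "imat2 \<Rightarrow> imat2 \<Rightarrow> imat2" where
  "imat2_mult (a, b, c, d) (a', b', c', d') =
     (a * a' + b * c', a * b' + b * d', c * a' + d * c', c * b' + d * d')"

fun slash :: "int \<Rightarrow> (complex \<Rightarrow> complex) \<Rightarrow> imat2 \<Rightarrow> complex \<Rightarrow> complex" where
  "slash k f (a, b, c, d) z =
     (of_int c * z + of_int d) powi (- k)
       * f ((of_int a * z + of_int b) / (of_int c * z + of_int d))"

text \<open>
  A function on the upper half plane is represented by a total function on the complex numbers;
  only its values on \<^const>\<open>uhp\<close> matter.
  Vanishing of all \<open>f|\<gamma>\<close> at \<open>i\<infinity>\<close> is vanishing of \<open>f\<close> at all cusps.
\<close>

definition cusp_form :: "int \<Rightarrow> nat \<Rightarrow> (complex \<Rightarrow> complex) \<Rightarrow> bool" where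
  "cusp_form k N f \<longleftrightarrow>
     f holomorphic_on uhp \<and>
     (\<forall>\<gamma>\<in>Gamma0 N. \<forall>z\<in>uhp. slash k f \<gamma> z = f z) \<and>
     (\<forall>\<gamma>\<in>SL2Z. (slash k f \<gamma> \<longlongrightarrow> 0) (filtercomap Im at_top))"

definition fundamental_domain :: "complex set" where
  "fundamental_domain = {z \<in> uhp. \<bar>Re z\<bar> \<le> 1 / 2 \<and> norm z \<ge> 1}"

definition Gamma0_cosets :: "nat \<Rightarrow> imat2 set set" where
  "Gamma0_cosets N = (\<lambda>\<gamma>. (\<lambda>\<delta>. imat2_mult \<delta> \<gamma>) ` Gamma0 N) ` SL2Z"

text \<open>
  The integral of \<open>f(z) cnj(g(z)) y\<^sup>k dx dy / y\<^sup>2\<close> over the quotient of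
  \<^const>\<open>uhp\<close> by \<open>\<Gamma>\<^sub>0(N)\<close>, for which the union of the
  translates of \<^const>\<open>fundamental_domain\<close> by representatives of the cosets \<open>\<Gamma>\<^sub>0(N)\<gamma>\<close> is a fundamental domain.
\<close>

definition petersson ::
    "int \<Rightarrow> nat \<Rightarrow> (complex \<Rightarrow> complex) \<Rightarrow> (complex \<Rightarrow> complex) \<Rightarrow> complex" where
  "petersson k N f g =
     (\<Sum>C\<in>Gamma0_cosets N. let \<gamma> = (SOME \<gamma>. \<gamma> \<in> C) in
        set_lebesgue_integral lborel fundamental_domain
          (\<lambda>z. slash k f \<gamma> z * cnj (slash k g \<gamma> z) * of_real (Im z powi (k - 2))))"

text \<open>Generators of the space of oldforms.\<close>

definition oldform_generators :: "int \<Rightarrow> nat \<Rightarrow> (complex \<Rightarrow> complex) set" where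
  "oldform_generators k N =
     {(\<lambda>z. g (of_nat d * z)) | g d M. M dvd N \<and> M \<noteq> N \<and> d dvd N div M \<and> cusp_form k M g}"

text \<open>\<open>T\<^sub>p\<close> for a prime \<open>p\<close> not dividing \<open>N\<close>, and \<open>U\<^sub>p\<close> for a prime \<open>p\<close> dividing \<open>N\<close>.\<close>

definition hecke :: "int \<Rightarrow> nat \<Rightarrow> nat \<Rightarrow> (complex \<Rightarrow> complex) \<Rightarrow> complex \<Rightarrow> complex" where
  "hecke k N p f z =
     (if p dvd N then 0 else of_nat p powi (k - 1) * f (of_nat p * z))
       + (\<Sum>j<p. f ((z + of_nat j) / of_nat p)) / of_nat p"

definition fourier_coeff :: "(complex \<Rightarrow> complex) \<Rightarrow> nat \<Rightarrow> complex" where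
  "fourier_coeff f n =
     integral {0..1} (\<lambda>x::real. f (of_real x + \<i>)
                        * exp (- 2 * of_real pi * \<i> * of_nat n * (of_real x + \<i>)))"

definition newform :: "int \<Rightarrow> nat \<Rightarrow> (complex \<Rightarrow> complex) \<Rightarrow> bool" where
  "newform k N f \<longleftrightarrow>
     cusp_form k N f \<and>
     (\<forall>g\<in>oldform_generators k N. petersson k N f g = 0) \<and>
     (\<forall>p. prime p \<longrightarrow> (\<exists>c::complex. \<forall>z\<in>uhp. hecke k N p f z = c * f z)) \<and>
     fourier_coeff f 1 = 1"

definition atkin_lehner :: "int \<Rightarrow> nat \<Rightarrow> (complex \<Rightarrow> complex) \<Rightarrow> complex \<Rightarrow> complex" where
  "atkin_lehner k N f z =
     of_real (real N powr (- of_int k / 2)) * z powi (- k) * f (- 1 / (of_nat N * z))"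


section \<open>Restricted even period polynomials\<close>

definition period_integral :: "int \<Rightarrow> (complex \<Rightarrow> complex) \<Rightarrow> complex \<Rightarrow> complex \<Rightarrow> complex" where
  "period_integral k f x y =
     integral {0<..} (\<lambda>t::real. \<i> * f (\<i> * of_real t)
                        * ((\<i> * of_real t) * y - x) ^ nat (k - 2))"

text \<open>
  A polynomial in \<open>x, y\<close> is a polynomial in \<open>y\<close> whose coefficients are polynomials in \<open>x\<close>; thus
  the coefficient of \<open>x\<^sup>i y\<^sup>j\<close> in \<open>P\<close> is \<open>coeff (coeff P j) i\<close>.
\<close>

definition poly2 :: "complex poly poly \<Rightarrow> complex \<Rightarrow> complex \<Rightarrow> complex" where
  "poly2 P x y = poly (poly P [:y:]) x"

definition period_poly :: "int \<Rightarrow> (complex \<Rightarrow> complex) \<Rightarrow> complex poly poly" where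
  "period_poly k f = (THE P. \<forall>x y. poly2 P x y = period_integral k f x y)"

definition even_restricted :: "nat \<Rightarrow> complex poly poly \<Rightarrow> complex poly poly" where
  "even_restricted w P =
     (\<Sum>(i, j) \<in> {(i, j). i \<le> w \<and> j \<le> w \<and> even i \<and> even j \<and> (i, j) \<noteq> (w, 0) \<and> (i, j) \<noteq> (0, w)}.
        monom (monom (coeff (coeff P j) i) i) j)"

definition period_poly_ev0 :: "int \<Rightarrow> (complex \<Rightarrow> complex) \<Rightarrow> complex poly poly" where
  "period_poly_ev0 k f = even_restricted (nat (k - 2)) (period_poly k f)"

text \<open>The ordered index sets \<open>\<^bold>o\<^bold>o(k)\<close> and \<open>\<^bold>o\<^bold>o'(k)\<close>.\<close>

definition odd_pairs :: "int \<Rightarrow> (nat \<times> nat) list" where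
  "odd_pairs k = [(nat k - m, m). m \<leftarrow> [3..<nat k - 2], odd m]"

definition odd_pairs_rev :: "int \<Rightarrow> (nat \<times> nat) list" where
  "odd_pairs_rev k = rev (odd_pairs k)"

definition period_vec :: "int \<Rightarrow> (complex \<Rightarrow> complex) \<Rightarrow> complex vec" where
  "period_vec k f =
     vec_of_list (map (\<lambda>(m1, m2). coeff (coeff (period_poly_ev0 k f) (m1 - 1)) (m2 - 1)) (odd_pairs k))"


section \<open>Motivic iterated integrals\<close>

text \<open>
  The algebra \<open>\<H>\<^sup>N\<close> of motivic multiple zeta values relative to \<open>\<mu>\<^sub>N\<close> is realised as in Brown's
  description: it is the quotient of an algebra of formal iterated integrals by the largest graded
  ideal that is contained in the kernel of the period map and stable under the motivic coaction.
  The formal algebra is the polynomial algebra over the rationals on symbols \<open>I(0; w; 1)\<close>, one for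
  each nonempty word \<open>w\<close> in the letters \<open>{0} \<union> \<mu>\<^sub>N\<close>. No relations (shuffle or other) are imposed on
  the symbols: all of them lie in the ideal. A multiset of words is a monomial, and a pair of
  multisets is a monomial of the tensor square.
\<close>

type_synonym formal = "complex list multiset \<Rightarrow>\<^sub>0 rat"
type_synonym formal2 = "(complex list multiset \<times> complex list multiset) \<Rightarrow>\<^sub>0 rat"

definition unit_roots :: "nat \<Rightarrow> complex set" where
  "unit_roots N = {z. z ^ N = 1}"

definition eps :: "nat \<Rightarrow> complex" where
  "eps N = exp (2 * of_real pi * \<i> / of_nat N)"

definition formals :: "nat \<Rightarrow> formal set" where
  "formals N = {x. \<forall>m \<in> Poly_Mapping.keys x. \<forall>w \<in># m. w \<noteq> [] \<and> set w \<subseteq> insert 0 (unit_roots N)}"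

definition rscale :: "rat \<Rightarrow> ('a::comm_monoid_add \<Rightarrow>\<^sub>0 rat) \<Rightarrow> ('a \<Rightarrow>\<^sub>0 rat)" where
  "rscale q x = Poly_Mapping.single 0 q * x"

abbreviation rsubspace :: "('a::comm_monoid_add \<Rightarrow>\<^sub>0 rat) set \<Rightarrow> bool" where
  "rsubspace \<equiv> Modules.module.subspace rscale"

abbreviation rspan :: "('a::comm_monoid_add \<Rightarrow>\<^sub>0 rat) set \<Rightarrow> ('a \<Rightarrow>\<^sub>0 rat) set" where
  "rspan \<equiv> Modules.module.span rscale"

lemma vector_space_rscale: "vector_space (rscale :: rat \<Rightarrow> ('a::comm_monoid_add \<Rightarrow>\<^sub>0 rat) \<Rightarrow> _)"
  by unfold_locales
    (simp_all add: rscale_def algebra_simps single_add mult_single flip: mult.assoc)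

definition I01 :: "complex list \<Rightarrow> formal" where
  "I01 w = (if w = [] then 1 else Poly_Mapping.single {#w#} 1)"

definition weight :: "complex list multiset \<Rightarrow> nat" where
  "weight m = (\<Sum>w\<in>#m. length w)"

definition weight_part :: "nat \<Rightarrow> formal \<Rightarrow> formal" where
  "weight_part n x =
     (\<Sum>m \<in> {m \<in> Poly_Mapping.keys x. weight m = n}.
        Poly_Mapping.single m (Poly_Mapping.lookup x m))"

definition left_weight_part :: "nat \<Rightarrow> formal2 \<Rightarrow> formal2" where
  "left_weight_part p x =
     (\<Sum>m \<in> {m \<in> Poly_Mapping.keys x. weight (fst m) = p}.
        Poly_Mapping.single m (Poly_Mapping.lookup x m))"

definition tens :: "formal \<Rightarrow> formal \<Rightarrow> formal2" where
  "tens x y =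
     (\<Sum>m \<in> Poly_Mapping.keys x. \<Sum>n \<in> Poly_Mapping.keys y.
        Poly_Mapping.single (m, n) (Poly_Mapping.lookup x m * Poly_Mapping.lookup y n))"

text \<open>
  The kernel \<open>K \<otimes> P + P \<otimes> M\<close> of the map from the tensor square of \<open>P = formals N\<close> to
  \<open>P/K \<otimes> P/M\<close>, for subspaces \<open>K\<close> and \<open>M\<close> of \<open>P\<close>.
\<close>

definition tens_ker :: "nat \<Rightarrow> formal set \<Rightarrow> formal set \<Rightarrow> formal2 set" where
  "tens_ker N K M =
     rspan ({tens x y | x y. x \<in> K \<and> y \<in> formals N} \<union> {tens x y | x y. x \<in> formals N \<and> y \<in> M})"


subsection \<open>The period map\<close>

fun iter_int_rev :: "real \<Rightarrow> complex list \<Rightarrow> real \<Rightarrow> complex" where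
  "iter_int_rev x [] y = 1"
| "iter_int_rev x (a # w) y = integral {x..y} (\<lambda>t. iter_int_rev x w t / (of_real t - a))"

text \<open>
  The iterated integral of \<open>dt\<^sub>1/(t\<^sub>1 - a\<^sub>1) \<dots> dt\<^sub>n/(t\<^sub>n - a\<^sub>n)\<close> over \<open>x < t\<^sub>1 < \<dots> < t\<^sub>n < y\<close>.
\<close>

definition iter_int :: "real \<Rightarrow> complex list \<Rightarrow> real \<Rightarrow> complex" where
  "iter_int x w y = iter_int_rev x (rev w) y"

text \<open>
  Regularisation with respect to the unit tangent vectors at 0 and 1: the constant term of the
  asymptotic expansion in powers of \<open>log e\<close> of the integral from \<open>e\<close> to \<open>1 - e\<close>.
\<close>

definition reg_int :: "complex list \<Rightarrow> complex" where
  "reg_int w = (THE c. \<exists>P :: complex poly. poly P 0 = c \<and>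
     ((\<lambda>e. iter_int e w (1 - e) - poly P (of_real (ln e))) \<longlongrightarrow> 0) (at_right 0))"

definition period :: "formal \<Rightarrow> complex" where
  "period x = (\<Sum>m \<in> Poly_Mapping.keys x. of_rat (Poly_Mapping.lookup x m) * (\<Prod>w\<in>#m. reg_int w))"


subsection \<open>The motivic coaction\<close>

text \<open>
  The left factors \<open>I(x; w; y)\<close> of the coaction, for \<open>x\<close> and \<open>y\<close> in \<open>{0} \<union> \<mu>\<^sub>N\<close>, are expressed through
  the symbols \<open>I(0; w; 1)\<close> by composition of paths at 0, reversal of paths, and homothety. These
  rules hold in \<open>\<A>\<^sup>N\<close>, though not in \<open>\<H>\<^sup>N\<close>, where tangent vectors at 0 that differ by a root
  of unity contribute powers of \<open>2\<pi>i\<close>.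
\<close>

definition int_from_0 :: "complex list \<Rightarrow> complex \<Rightarrow> formal" where
  "int_from_0 w y = (if w = [] then 1 else if y = 0 then 0 else I01 (map (\<lambda>a. a / y) w))"

definition int_to_0 :: "complex \<Rightarrow> complex list \<Rightarrow> formal" where
  "int_to_0 x w = (- 1) ^ length w * int_from_0 (rev w) x"

definition int_between :: "complex \<Rightarrow> complex list \<Rightarrow> complex \<Rightarrow> formal" where
  "int_between x w y = (\<Sum>i\<le>length w. int_to_0 x (take i w) * int_from_0 (drop i w) y)"

text \<open>
  Goncharov's formula, with \<open>a\<^sub>0 = 0\<close> and \<open>a\<^sub>n\<^sub>+\<^sub>1 = 1\<close>: the coaction of \<open>I(a\<^sub>0; a\<^sub>1 \<dots> a\<^sub>n; a\<^sub>n\<^sub>+\<^sub>1)\<close> is the sum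
  over all \<open>0 = i\<^sub>0 < i\<^sub>1 < \<dots> < i\<^sub>r < i\<^sub>r\<^sub>+\<^sub>1 = n+1\<close> of
  \<open>(\<Prod>\<^sub>p I(a\<^bsub>i\<^sub>p\<^esub>; \<dots>; a\<^bsub>i\<^sub>p\<^sub>+\<^sub>1\<^esub>)) \<otimes> I(a\<^sub>0; a\<^bsub>i\<^sub>1\<^esub> \<dots> a\<^bsub>i\<^sub>r\<^esub>; a\<^sub>n\<^sub>+\<^sub>1)\<close>.
\<close>

definition coact_word :: "complex list \<Rightarrow> formal2" where
  "coact_word w =
     (let n = length w;
          a = (\<lambda>i. if i = 0 then 0 else if i = Suc n then 1 else w ! (i - 1))
      in \<Sum>S \<in> Pow {1..n}.
           let js = 0 # sorted_list_of_set S @ [Suc n]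
           in tens
                (\<Prod>p\<le>card S. int_between (a (js ! p)) (map a [Suc (js ! p)..<js ! Suc p]) (a (js ! Suc p)))
                (I01 (map a (sorted_list_of_set S))))"

definition coact :: "formal \<Rightarrow> formal2" where
  "coact x = (\<Sum>m \<in> Poly_Mapping.keys x. rscale (Poly_Mapping.lookup x m) (\<Prod>w\<in>#m. coact_word w))"


subsection \<open>Motivic multiple zeta values\<close>

text \<open>
  The word \<open>a\<^sub>1 0\<^bsup>n\<^sub>1-1\<^esup> \<dots> a\<^sub>r 0\<^bsup>n\<^sub>r-1\<^esup>\<close> with \<open>a\<^sub>i = (\<epsilon>\<^sub>i \<dots> \<epsilon>\<^sub>r)\<^sup>-\<^sup>1\<close>. With the sign \<open>(-1)\<^sup>r\<close>, the period of
  \<open>zeta_m [(n\<^sub>1, \<epsilon>\<^sub>1), \<dots>, (n\<^sub>r, \<epsilon>\<^sub>r)]\<close> is the sum of \<open>\<epsilon>\<^sub>1\<^bsup>k\<^sub>1\<^esup> \<dots> \<epsilon>\<^sub>r\<^bsup>k\<^sub>r\<^esup> / (k\<^sub>1\<^bsup>n\<^sub>1\<^esup> \<dots> k\<^sub>r\<^bsup>n\<^sub>r\<^esup>)\<close> over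
  \<open>0 < k\<^sub>1 < \<dots> < k\<^sub>r\<close>, whenever \<open>(n\<^sub>r, \<epsilon>\<^sub>r) \<noteq> (1, 1)\<close>.
\<close>

fun mzv_word :: "(nat \<times> complex) list \<Rightarrow> complex list" where
  "mzv_word [] = []"
| "mzv_word ((n, e) # l) =
     inverse (e * prod_list (map snd l)) # replicate (n - 1) 0 @ mzv_word l"

definition zeta_m :: "(nat \<times> complex) list \<Rightarrow> formal" where
  "zeta_m l = (- 1) ^ length l * I01 (mzv_word l)"

definition mzv_index :: "nat \<Rightarrow> (nat \<times> complex) list \<Rightarrow> bool" where
  "mzv_index N l \<longleftrightarrow> (\<forall>(n, e) \<in> set l. n \<ge> 1 \<and> e \<in> unit_roots N) \<and> (l \<noteq> [] \<longrightarrow> last l \<noteq> (1, 1))"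

text \<open>
  \<open>\<A>\<^sup>N\<close> is the quotient of \<open>\<H>\<^sup>N\<close> by the ideal generated by the following element, whose period is a
  nonzero rational multiple of \<open>(2\<pi>i)\<^sup>2\<close> for \<open>N = 2\<close> and of \<open>2\<pi>i\<close> for \<open>N = 3\<close>.
\<close>

definition tate_elt :: "nat \<Rightarrow> formal" where
  "tate_elt N =
     (if N \<le> 2 then zeta_m [(2, 1)] else zeta_m [(1, eps N)] - zeta_m [(1, inverse (eps N))])"

definition plus_tate :: "nat \<Rightarrow> formal set \<Rightarrow> formal set" where
  "plus_tate N K = {x + tate_elt N * y | x y. x \<in> K \<and> y \<in> formals N}"

definition graded_ideal :: "nat \<Rightarrow> formal set \<Rightarrow> bool" where
  "graded_ideal N K \<longleftrightarrow>
     K \<subseteq> formals N \<and> rsubspace K \<and>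
     (\<forall>x \<in> formals N. \<forall>y \<in> K. x * y \<in> K) \<and>
     (\<forall>x \<in> K. \<forall>n. weight_part n x \<in> K)"

text \<open>
  The ideals satisfying the condition below are closed under sums, so their union is the largest
  one. It is the ideal of relations between motivic iterated integrals:
  \<open>\<H>\<^sup>N = formals N / motivic_relations N\<close>.
\<close>

definition motivic_relations :: "nat \<Rightarrow> formal set" where
  "motivic_relations N =
     \<Union> {K. graded_ideal N K \<and> (\<forall>x \<in> K. period x = 0) \<and>
             (\<forall>x \<in> K. coact x \<in> tens_ker N (plus_tate N K) K)}"

text \<open>
  The weight \<open>p\<close> part of the Lie coalgebra \<open>\<L>\<^sup>N\<close>, for \<open>p > 0\<close>, is the weight \<open>p\<close> part of
  \<open>formals N\<close> modulo \<open>indec_ker N\<close>.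
\<close>

definition indec_ker :: "nat \<Rightarrow> formal set" where
  "indec_ker N =
     rspan (plus_tate N (motivic_relations N) \<union>
            {x * y | x y. x \<in> formals N \<and> y \<in> formals N \<and>
                          Poly_Mapping.lookup x 0 = 0 \<and> Poly_Mapping.lookup y 0 = 0})"

text \<open>
  The preimage in \<open>formals N\<close> of the \<open>r\<close>-th step of the depth filtration of \<open>\<H>\<^sup>N\<close>; the index is an
  integer so that the step of index \<open>-1\<close> is the zero subspace of \<open>\<H>\<^sup>N\<close>.
\<close>

definition depth_fil :: "nat \<Rightarrow> int \<Rightarrow> formal set" where
  "depth_fil N r =
     {x + y | x y. x \<in> rspan {zeta_m l | l. mzv_index N l \<and> int (length l) \<le> r} \<and>
                   y \<in> motivic_relations N}"

text \<open>The class of \<open>x \<in> depth_fil N r\<close> in the \<open>r\<close>-th graded piece of \<open>\<H>\<^sup>N\<close>.\<close>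

definition gr_class :: "nat \<Rightarrow> int \<Rightarrow> formal \<Rightarrow> formal set" where
  "gr_class N r x = {y. y - x \<in> depth_fil N (r - 1)}"

text \<open>
  \<open>D\<^sub>p\<close>, with values in the tensor square of \<open>formals N\<close>; it becomes an element of
  \<open>\<L>\<^sup>N\<^sub>p \<otimes> \<H>\<^sup>N\<close> modulo \<open>tens_ker N (indec_ker N) (motivic_relations N)\<close>.
\<close>

definition D_op :: "nat \<Rightarrow> formal \<Rightarrow> formal2" where
  "D_op p x = left_weight_part p (coact x)"

definition c1 :: "nat \<Rightarrow> complex \<Rightarrow> nat \<Rightarrow> rat" where
  "c1 N e p =
     (if e = 1 then 1 else if N = 2 then 1 / 2 ^ (p - 1) - 1 else (1 / 3 ^ (p - 1) - 1) / 2)"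

text \<open>
  \<open>\<partial>\<^sub>p\<close> from the \<open>r\<close>-th to the \<open>(r-1)\<close>-st graded piece, as a function on classes: write \<open>D\<^sub>p x\<close> as
  \<open>\<Sum>\<^sub>e \<zeta>(p; e) \<otimes> X\<^sub>e\<close> with \<open>X\<^sub>e\<close> of depth at most \<open>r-1\<close>, modulo right factors of depth at most \<open>r-2\<close>,
  and replace \<open>\<zeta>(p; e) \<otimes> X\<^sub>e\<close> by \<open>c1 N e p X\<^sub>e\<close>.
\<close>

definition partial_op :: "nat \<Rightarrow> int \<Rightarrow> nat \<Rightarrow> formal set \<Rightarrow> formal set" where
  "partial_op N r p G =
     (THE G'. \<exists>x X. x \<in> G \<and> x \<in> depth_fil N r \<and> (\<forall>e \<in> unit_roots N. X e \<in> depth_fil N (r - 1)) \<and>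
        D_op p x - (\<Sum>e \<in> unit_roots N. tens (zeta_m [(p, e)]) (X e))
          \<in> tens_ker N (indec_ker N) (depth_fil N (r - 2)) \<and>
        G' = gr_class N (r - 1) (\<Sum>e \<in> unit_roots N. rscale (c1 N e p) (X e)))"


section \<open>The matrices\<close>

text \<open>A rational number is identified with its class in the graded piece of depth 0.\<close>

fun C_entry :: "nat \<Rightarrow> nat \<times> nat \<Rightarrow> nat \<times> nat \<Rightarrow> rat" where
  "C_entry N (m1, m2) (n1, n2) =
     (THE q. partial_op N 1 m2
               (partial_op N 2 m1
                  (gr_class N 2 (zeta_m [(n1, eps N), (n2, inverse (eps N))])))
             = gr_class N 0 (rscale q 1))"

definition C_mat :: "nat \<Rightarrow> int \<Rightarrow> rat mat" where
  "C_mat N k =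
     mat (length (odd_pairs k)) (length (odd_pairs k)) (\<lambda>(i, j). C_entry N (odd_pairs k ! i) (odd_pairs_rev k ! j))"

definition D_mat :: "nat \<Rightarrow> int \<Rightarrow> rat mat" where
  "D_mat N k =
     mat (length (odd_pairs k)) (length (odd_pairs k))
       (\<lambda>(i, j). if i = j then inverse (c1 N (eps N) (fst (odd_pairs k ! i))) else 0)"

definition mu :: "nat \<Rightarrow> int \<Rightarrow> complex \<Rightarrow> complex" where
  "mu N k \<epsilon> =
     (if N = 2 then - (1 + \<epsilon> / 2 powi ((k - 2) div 2))
      else - (1 / 2) * (1 + \<epsilon> / 3 powi ((k - 2) div 2)))"

end

theory Submission
  imports
    Defs
    "HOL-Complex_Analysis.Complex_Analysis"
    "HOL-Real_Asymp.Real_Asymp"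
    "HOL-Computational_Algebra.Fundamental_Theorem_Algebra"
begin

text \<open>The proof compares an explicit formula for the matrix with a linear relation between
  the coefficients of the period polynomial.

  \<^emph>\<open>The matrix.\<close> A linear functional on \<open>\<L>\<^sup>N\<^sub>p\<close> with value \<open>1\<close> on \<open>\<zeta>(p)\<close> turns the coaction into \<open>\<partial>\<^sub>p\<close>.
  It exists because \<open>\<zeta>(p)\<close>, for odd \<open>p\<close>, is not decomposable: the coaction is multiplicative, so a
  decomposable primitive element is congruent to a rational multiple of the \<open>p\<close>-th power of the Tate element,
  whose period is purely imaginary for \<open>N = 3\<close> (for \<open>N = 2\<close> its powers have even weight), while the period of \<open>\<zeta>(p)\<close> is real and nonzero.
  The relations needed in depth 1 (\<open>I(0; 0\<^sup>\<alpha> a 0\<^sup>\<beta>; 1)\<close> in terms of \<open>\<zeta>(p)\<close>) follow from the same relations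
  between periods, because both sides are primitive. Goncharov's formula then shows that the entry of \<open>\<D>\<C>\<close> at
  \<open>(m\<^sub>1, m\<^sub>2)\<close>, \<open>(n\<^sub>1, n\<^sub>2)\<close> is the Kronecker delta times \<open>c(m\<^sub>2)\<close>, plus
  \<open>binom(m\<^sub>1-1, n\<^sub>2-1) - binom(m\<^sub>1-1, n\<^sub>1-1)\<close>.

  \<^emph>\<open>The cusp form.\<close> The trace of \<open>f\<close> to level 1 is an oldform \<open>g\<close>, and \<open>\<langle>f, g\<rangle> = 0\<close> is the square
  integral of \<open>g\<close> over the fundamental domain of level 1, so \<open>g = 0\<close>. With representatives of the
  cosets this says \<open>c(f + f|S) + f|ST + f|ST\<^sup>-\<^sup>1 = 0\<close>, where \<open>c = 2\<close> for \<open>N = 2\<close> and \<open>c = 1\<close> for \<open>N = 3\<close>.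
  Eichler integrals convert it into a relation between values of the period polynomial,
  whose coefficients at even monomials express the sum of
  \<open>a(m\<^sub>1, m\<^sub>2) (binom(m\<^sub>1-1, n\<^sub>2-1) - binom(m\<^sub>1-1, n\<^sub>1-1))\<close> as
  \<open>(c/2)(a(n\<^sub>1, n\<^sub>2) - a(n\<^sub>2, n\<^sub>1))\<close>. The Atkin-Lehner involution relates \<open>a(n\<^sub>1, n\<^sub>2)\<close> to
  \<open>a(n\<^sub>2, n\<^sub>1)\<close>, and the eigenvalue comes out.\<close>

subsection \<open>Regularised iterated integrals\<close>

text \<open>Membership in \<open>motivic_relations N\<close> cannot be checked by direct
  calculation, because the ideal is only known as the largest one that is graded, has zero periods
  and is stable under the coaction. Both directions therefore go through periods. To put g into the
  ideal, one shows that the ideal together with g still satisfies these conditions, for which g must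
  have period exactly 0 and a controlled coaction. To keep an element out of it, one uses that its
  period is nonzero. Exactness is why N = 3 needs the imaginary part of the integral at a cube root
  of unity as an explicit rational multiple of pi^p: this multiple has to be subtracted, as a power
  of the Tate element, before the period vanishes. Tensor products of quotients are never formed; an
  element of \<open>tens_ker\<close> is recognised by applying to its left factor all functionals
  that vanish on the left ideal. On the modular side, the doubling for N = 2 makes the trace
  relation symmetric in T and its inverse, and this symmetry cancels the odd part of the period
  polynomial.\<close>

definition dword :: "nat \<Rightarrow> complex \<Rightarrow> nat \<Rightarrow> complex list" where
  "dword \<alpha> a \<beta> = replicate \<alpha> 0 @ a # replicate \<beta> 0"

text \<open>Asymptotic expansions in \<open>ln e\<close> whose error beats all powers of \<open>ln e\<close>,
  so that they can be multiplied.\<close>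

definition log_expansion :: "(real \<Rightarrow> complex) \<Rightarrow> complex \<Rightarrow> bool" where
  "log_expansion f c \<longleftrightarrow> (\<exists>P. poly P 0 = c \<and>
     (\<forall>m. ((\<lambda>e. of_real (ln e) ^ m * (f e - poly P (of_real (ln e)))) \<longlongrightarrow> 0) (at_right 0)))"

lemma log_expansion_const: "log_expansion (\<lambda>_. c) c"
  unfolding log_expansion_def by (rule exI[of _ "[:c:]"]) simp

lemma log_expansion_ln: "log_expansion (\<lambda>e. of_real (ln e)) 0"
  unfolding log_expansion_def by (rule exI[of _ "[:0, 1:]"]) simp

lemma log_expansion_cong:
  assumes "log_expansion f c" "\<And>e. 0 < e \<Longrightarrow> e < 1 / 2 \<Longrightarrow> f e = g e"
  shows "log_expansion g c"
proof -
  have ev: "\<forall>\<^sub>F e in at_right (0::real). 0 < e \<and> e < 1 / 2"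
    by (rule eventually_mono[OF eventually_at_right_real[of 0 "1/2"]]) auto
  show ?thesis
    using assms(1) unfolding log_expansion_def
  proof (elim exE conjE, intro exI conjI allI)
    fix P m
    assume "\<forall>m. ((\<lambda>e. of_real (ln e) ^ m * (f e - poly P (of_real (ln e)))) \<longlongrightarrow> 0) (at_right 0)"
    then have "((\<lambda>e. of_real (ln e) ^ m * (f e - poly P (of_real (ln e)))) \<longlongrightarrow> 0) (at_right 0)" by blast
    then show "((\<lambda>e. of_real (ln e) ^ m * (g e - poly P (of_real (ln e)))) \<longlongrightarrow> 0) (at_right 0)"
      by (rule Lim_transform_eventually) (rule eventually_mono[OF ev], use assms(2) in auto)
  qed
qed

lemma log_expansion_add:
  assumes "log_expansion f c" "log_expansion g d"
  shows "log_expansion (\<lambda>e. f e + g e) (c + d)"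
proof -
  from assms obtain P Q where P: "poly P 0 = c" "\<And>m. ((\<lambda>e. of_real (ln e) ^ m * (f e - poly P (of_real (ln e)))) \<longlongrightarrow> 0) (at_right 0)"
    and Q: "poly Q 0 = d" "\<And>m. ((\<lambda>e. of_real (ln e) ^ m * (g e - poly Q (of_real (ln e)))) \<longlongrightarrow> 0) (at_right 0)"
    unfolding log_expansion_def by blast
  show ?thesis
    unfolding log_expansion_def
  proof (intro exI[of _ "P + Q"] conjI allI)
    fix m
    from tendsto_add[OF P(2)[of m] Q(2)[of m]]
    show "((\<lambda>e. of_real (ln e) ^ m * (f e + g e - poly (P + Q) (of_real (ln e)))) \<longlongrightarrow> 0) (at_right 0)"
      by (simp add: algebra_simps)
  qed (simp add: P Q)
qed

text \<open>The error terms have to survive multiplication by the other factor's polynomial in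
  \<open>ln e\<close>; this is where their decay against every power of the logarithm is
  used.\<close>

lemma log_poly_tendsto:
  fixes Q :: "complex poly"
  assumes "\<And>m. ((\<lambda>e. of_real (ln e) ^ m * g e) \<longlongrightarrow> 0) (at_right 0)"
  shows "((\<lambda>e. of_real (ln e) ^ m * (poly Q (of_real (ln e)) * g e)) \<longlongrightarrow> 0) (at_right (0::real))"
proof -
  have "((\<lambda>e. \<Sum>i\<le>degree Q. coeff Q i * (of_real (ln e) ^ (m + i) * g e)) \<longlongrightarrow> (\<Sum>i\<le>degree Q. coeff Q i * 0)) (at_right 0)"
    by (intro tendsto_sum tendsto_mult tendsto_const assms)
  then show ?thesis
    by (simp add: poly_altdef sum_distrib_left sum_distrib_right power_add mult_ac)
qed

lemma log_expansion_mult: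
  assumes "log_expansion f c" "log_expansion g d"
  shows "log_expansion (\<lambda>e. f e * g e) (c * d)"
proof -
  from assms obtain P Q where P: "poly P 0 = c" "\<And>m. ((\<lambda>e. of_real (ln e) ^ m * (f e - poly P (of_real (ln e)))) \<longlongrightarrow> 0) (at_right 0)"
    and Q: "poly Q 0 = d" "\<And>m. ((\<lambda>e. of_real (ln e) ^ m * (g e - poly Q (of_real (ln e)))) \<longlongrightarrow> 0) (at_right 0)"
    unfolding log_expansion_def by blast
  show ?thesis
    unfolding log_expansion_def
  proof (intro exI[of _ "P * Q"] conjI allI)
    fix m
    let ?p = "\<lambda>e. poly P (of_real (ln e))" and ?q = "\<lambda>e. poly Q (of_real (ln e))"
    have "((\<lambda>e. (of_real (ln e) ^ m * (f e - ?p e)) * (of_real (ln e) ^ 0 * (g e - ?q e)) +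
       of_real (ln e) ^ m * (?q e * (f e - ?p e)) + of_real (ln e) ^ m * (?p e * (g e - ?q e))) \<longlongrightarrow> 0 * 0 + 0 + 0) (at_right 0)"
      by (intro tendsto_add tendsto_mult P Q log_poly_tendsto)
    then show "((\<lambda>e. of_real (ln e) ^ m * (f e * g e - poly (P * Q) (of_real (ln e)))) \<longlongrightarrow> 0) (at_right 0)"
      by (simp add: algebra_simps)
  qed (simp add: P Q)
qed

lemma log_expansion_power: "log_expansion f c \<Longrightarrow> log_expansion (\<lambda>e. f e ^ n) (c ^ n)"
  by (induction n) (auto intro: log_expansion_const log_expansion_mult)

lemma log_expansion_sum:
  "(\<And>i. i \<in> A \<Longrightarrow> log_expansion (f i) (c i)) \<Longrightarrow> log_expansion (\<lambda>e. \<Sum>i\<in>A. f i e) (\<Sum>i\<in>A. c i)"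
  by (induction A rule: infinite_finite_induct) (auto intro: log_expansion_const log_expansion_add)

text \<open>The exponent 1/2 is the price of cutting off an integrand bounded by a multiple of
  \<open>s powr (- (1 / 2))\<close>: its integral over [0, e] is of order
  \<open>e powr (1 / 2)\<close>, which still beats every power of the logarithm.\<close>

lemma log_expansion_small:
  assumes "\<And>e. 0 < e \<Longrightarrow> e < 1 / 2 \<Longrightarrow> norm (f e - c) \<le> C * e powr (1 / 2)"
  shows "log_expansion f c"
  unfolding log_expansion_def
proof (intro exI[of _ "[:c:]"] conjI allI)
  fix m
  have ev: "\<forall>\<^sub>F e in at_right (0::real). 0 < e \<and> e < 1 / 2"
    by (rule eventually_mono[OF eventually_at_right_real[of 0 "1/2"]]) auto
  have "((\<lambda>e::real. \<bar>ln e\<bar> ^ m * e powr (1 / 2)) \<longlongrightarrow> 0) (at_right 0)"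
    by real_asymp
  then have "((\<lambda>e::real. C * (\<bar>ln e\<bar> ^ m * e powr (1 / 2))) \<longlongrightarrow> 0) (at_right 0)"
    by (rule tendsto_mult_right_zero)
  then have "((\<lambda>e. of_real (ln e) ^ m * (f e - c)) \<longlongrightarrow> 0) (at_right 0)"
  proof (rule Lim_null_comparison[rotated])
    show "\<forall>\<^sub>F e in at_right 0. norm (of_real (ln e) ^ m * (f e - c)) \<le> C * (\<bar>ln e\<bar> ^ m * e powr (1 / 2))"
      using ev
    proof eventually_elim
      case (elim e)
      then have "\<bar>ln e\<bar> ^ m * norm (f e - c) \<le> \<bar>ln e\<bar> ^ m * (C * e powr (1 / 2))"
        by (intro mult_left_mono assms) auto
      then show ?case by (simp add: norm_mult norm_power mult_ac)
    qed
  qed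
  then show "((\<lambda>e. of_real (ln e) ^ m * (f e - poly [:c:] (of_real (ln e)))) \<longlongrightarrow> 0) (at_right 0)"
    by simp
qed simp

lemma log_expansion_ln_1_minus: "log_expansion (\<lambda>e. of_real (ln (1 - e))) 0"
proof (rule log_expansion_small[of _ _ 2])
  fix e :: real assume e: "0 < e" "e < 1 / 2"
  have "- ln (1 - e) \<le> e / (1 - e)"
    using ln_le_minus_one[of "1 / (1 - e)"] e by (simp add: ln_div field_simps)
  also have "\<dots> \<le> 2 * e" using e by (simp add: field_simps)
  also have "e \<le> e powr (1 / 2)" using e powr_mono'[of "1/2" 1 e] by simp
  finally have "- ln (1 - e) \<le> 2 * e powr (1 / 2)" by simp
  moreover have "ln (1 - e) \<le> 0" using e by simp
  ultimately show "norm (of_real (ln (1 - e)) - 0 :: complex) \<le> 2 * e powr (1 / 2)" by simp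
qed

text \<open>A nonconstant polynomial is unbounded along \<open>ln e\<close>, which tends to minus
  infinity. This makes the constant term of an expansion unique.\<close>

lemma log_expansion_unique_aux:
  fixes P :: "complex poly"
  assumes "((\<lambda>e. poly P (of_real (ln e))) \<longlongrightarrow> 0) (at_right 0)"
  shows "P = 0"
proof (cases P)
  case (pCons a Q)
  show ?thesis
  proof (cases "Q = 0")
    case True
    with assms pCons have "((\<lambda>e::real. a) \<longlongrightarrow> 0) (at_right 0)" by simp
    then have "a = 0" by (metis tendsto_const_iff trivial_limit_at_right_real)
    with True pCons show ?thesis by simp
  next
    case False
    from poly_infinity[OF this, of 1 a] obtain r where r: "\<And>z. r \<le> norm z \<Longrightarrow> 1 \<le> norm (poly P z)"
      using pCons by blast
    have "\<forall>\<^sub>F e in at_right (0::real). \<bar>ln e\<bar> \<ge> r"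
      by (rule filterlim_at_top[THEN iffD1, rule_format]) real_asymp
    moreover have "\<forall>\<^sub>F e in at_right 0. norm (poly P (of_real (ln e))) < 1"
      using tendstoD[OF assms, of 1] by simp
    ultimately have "\<forall>\<^sub>F e in at_right (0::real). False"
    proof eventually_elim
      case (elim e)
      then show ?case using r[of "of_real (ln e)"] by simp
    qed
    then show ?thesis by simp
  qed
qed

text \<open>The definition of \<open>reg_int\<close> asks only for the plain limit, the case m = 0
  of an expansion; uniqueness of the polynomial justifies its definite description.\<close>

lemma reg_intI:
  assumes "log_expansion (\<lambda>e. iter_int e w (1 - e)) c"
  shows "reg_int w = c"
  unfolding reg_int_def
proof (rule the_equality)
  obtain P where P: "poly P 0 = c" "\<And>m. ((\<lambda>e. of_real (ln e) ^ m * (iter_int e w (1 - e) - poly P (of_real (ln e)))) \<longlongrightarrow> 0) (at_right 0)"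
    using assms unfolding log_expansion_def by blast
  from P(2)[of 0] have P2: "((\<lambda>e. iter_int e w (1 - e) - poly P (of_real (ln e))) \<longlongrightarrow> 0) (at_right 0)" by simp
  with P(1) show "\<exists>P. poly P 0 = c \<and> ((\<lambda>e. iter_int e w (1 - e) - poly P (of_real (ln e))) \<longlongrightarrow> 0) (at_right 0)"
    by blast
  fix d assume "\<exists>P. poly P 0 = d \<and> ((\<lambda>e. iter_int e w (1 - e) - poly P (of_real (ln e))) \<longlongrightarrow> 0) (at_right 0)"
  then obtain Q where Q: "poly Q 0 = d" "((\<lambda>e. iter_int e w (1 - e) - poly Q (of_real (ln e))) \<longlongrightarrow> 0) (at_right 0)" by blast
  from tendsto_diff[OF P2 Q(2)] have "((\<lambda>e. poly (Q - P) (of_real (ln e))) \<longlongrightarrow> 0) (at_right 0)" by simp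
  from log_expansion_unique_aux[OF this] P(1) Q(1) show "d = c" by simp
qed

lemma iter_int_rev_zeros:
  assumes "0 < x" "x \<le> y"
  shows "iter_int_rev x (replicate m 0) y = of_real (ln (y / x) ^ m / fact m)"
  using assms(2)
proof (induction m arbitrary: y)
  case (Suc m)
  have "((\<lambda>t. of_real (ln (t / x) ^ m / fact m * (1 / t)) :: complex) has_integral
      of_real (ln (y / x) ^ Suc m / fact (Suc m)) - of_real (ln (x / x) ^ Suc m / fact (Suc m))) {x..y}"
  proof (rule fundamental_theorem_of_calculus[OF Suc.prems])
    fix t assume t: "t \<in> {x..y}"
    have "((\<lambda>t. ln (t / x) ^ Suc m / fact (Suc m)) has_real_derivative ln (t / x) ^ m / fact m * (1 / t)) (at t within {x..y})"
    proof -
      have "((\<lambda>t. ln (t / x)) has_real_derivative 1 / t) (at t within {x..y})"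
        using assms(1) t by (auto intro!: derivative_eq_intros)
      from DERIV_cdivide[OF DERIV_power_Suc[OF this, of m], of "fact (Suc m)"] show ?thesis
        by (rule DERIV_cong) (simp add: divide_simps)
    qed
    then show "((\<lambda>t. of_real (ln (t / x) ^ Suc m / fact (Suc m)) :: complex) has_vector_derivative
       of_real (ln (t / x) ^ m / fact m * (1 / t))) (at t within {x..y})"
      by (rule has_vector_derivative_of_real)
  qed
  then have "integral {x..y} (\<lambda>t. of_real (ln (t / x) ^ m / fact m * (1 / t)) :: complex) = of_real (ln (y / x) ^ Suc m / fact (Suc m))"
    using assms(1) by (simp add: integral_unique)
  moreover have "integral {x..y} (\<lambda>t. iter_int_rev x (replicate m 0) t / (of_real t - 0)) =
     integral {x..y} (\<lambda>t. of_real (ln (t / x) ^ m / fact m * (1 / t)) :: complex)"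
    by (intro integral_cong) (use Suc.IH in simp)
  ultimately show ?case by simp
qed simp

lemma reg_int_zeros:
  assumes "m > 0"
  shows "reg_int (replicate m 0) = 0"
proof (rule reg_intI)
  have "log_expansion (\<lambda>e. (of_real (ln (1 - e)) + (-1) * of_real (ln e)) ^ m * (1 / fact m)) ((0 + (-1) * 0) ^ m * (1 / fact m))"
    by (intro log_expansion_mult log_expansion_power log_expansion_add log_expansion_ln log_expansion_const log_expansion_ln_1_minus)
  then have "log_expansion (\<lambda>e. (of_real (ln (1 - e)) + (-1) * of_real (ln e)) ^ m * (1 / fact m)) 0"
    using assms by (simp add: zero_power)
  then show "log_expansion (\<lambda>e. iter_int e (replicate m 0) (1 - e)) 0"
    by (rule log_expansion_cong) (simp add: iter_int_def iter_int_rev_zeros ln_div)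
qed

text \<open>The inner integral is taken over \<open>(ln (s/x))\<^sup>\<alpha> / \<alpha>!\<close>, and the outer letters \<open>0\<close> contribute
  \<open>(ln (y/s))\<^sup>\<beta> / \<beta>!\<close>.\<close>

lemma iter_int_rev_dword:
  assumes x: "0 < x" "x \<le> y" "y < 1" and a: "norm a = 1"
  shows "iter_int_rev x (replicate \<beta> 0 @ a # replicate \<alpha> 0) y =
     (\<Sum>j\<le>\<beta>. of_nat (\<beta> choose j) * of_real (ln y) ^ (\<beta> - j) * (-1) ^ j / fact \<beta> *
        integral {x..y} (\<lambda>s. of_real (ln s) ^ j * of_real (ln (s / x) ^ \<alpha> / fact \<alpha>) / (of_real s - a)))"
  using assms(2,3)
proof (induction \<beta> arbitrary: y)
  case 0
  show ?case
    using iter_int_rev_zeros[OF x(1)] by (auto intro!: integral_cong)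
next
  case (Suc \<beta>)
  define h where "h = (\<lambda>j s. of_real (ln s) ^ j * of_real (ln (s / x) ^ \<alpha> / fact \<alpha>) / (of_real s - a))"
  define H where "H = (\<lambda>j t. integral {x..t} (h j))"
  \<comment> \<open>The weight (ln t - ln s)^\<beta> / \<beta>! of the outer zeros is expanded
    binomially, so that t leaves the integral and each summand can be differentiated as a
    product.\<close>
  define F where "F = (\<lambda>\<beta> t. \<Sum>j\<le>\<beta>. of_nat (\<beta> choose j) * of_real (ln t) ^ (\<beta> - j) * (-1) ^ j / fact \<beta> * H j t)"
  have sa: "of_real s \<noteq> a" if "s \<in> {x..y}" for s :: real
  proof
    assume "of_real s = a"
    then have "\<bar>s\<bar> = 1" using a by (metis norm_of_real)
    with that x Suc.prems show False by auto
  qed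
  have cont: "continuous_on {x..y} (h j)" for j
    unfolding h_def using x sa by (intro continuous_intros) auto
  have H: "(H j has_vector_derivative h j t) (at t within {x..y})" if "t \<in> {x..y}" for j t
    unfolding H_def using integral_has_vector_derivative[OF cont that] .
  have F: "(F (Suc \<beta>) has_vector_derivative F \<beta> t / of_real t) (at t within {x..y})" if t: "t \<in> {x..y}" for t
  proof -
    have t0: "t > 0" using t x by auto
    let ?g = "\<lambda>j t. of_nat (Suc \<beta> choose j) * of_real (ln t) ^ (Suc \<beta> - j) * (-1) ^ j / fact (Suc \<beta>) :: complex"
    let ?g' = "\<lambda>j t. of_nat (Suc \<beta> choose j) * (of_nat (Suc \<beta> - j) * of_real (ln t) ^ (Suc \<beta> - j - 1) * of_real (1 / t)) * (-1) ^ j / fact (Suc \<beta>) :: complex"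
    have g: "(?g j has_vector_derivative ?g' j t) (at t within {x..y})" for j
    proof -
      have "((\<lambda>t. real (Suc \<beta> choose j) * ln t ^ (Suc \<beta> - j) * (-1) ^ j / fact (Suc \<beta>)) has_real_derivative
        real (Suc \<beta> choose j) * (real (Suc \<beta> - j) * ln t ^ (Suc \<beta> - j - 1) * (1 / t)) * (-1) ^ j / fact (Suc \<beta>)) (at t within {x..y})"
        using t0 by (auto intro!: derivative_eq_intros simp: mult_ac simp del: fact_Suc)
      from has_vector_derivative_of_real[OF this, where 'a = complex] show ?thesis by simp
    qed
    have "((\<lambda>t. \<Sum>j\<le>Suc \<beta>. ?g j t * H j t) has_vector_derivative (\<Sum>j\<le>Suc \<beta>. ?g j t * h j t + ?g' j t * H j t)) (at t within {x..y})"
      by (intro has_vector_derivative_sum has_vector_derivative_mult g H t)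
    also have "(\<Sum>j\<le>Suc \<beta>. ?g j t * h j t + ?g' j t * H j t) = (\<Sum>j\<le>Suc \<beta>. ?g j t * h j t) + (\<Sum>j\<le>Suc \<beta>. ?g' j t * H j t)"
      by (rule sum.distrib)
    \<comment> \<open>The boundary terms collect to (ln t - ln t)^(\<beta>+1): the weight of the
      outer zeros vanishes at s = t.\<close>
    also have "(\<Sum>j\<le>Suc \<beta>. ?g j t * h j t) = 0"
    proof -
      let ?r = "of_real (ln (t / x) ^ \<alpha> / fact \<alpha>) / (of_real t - a) / fact (Suc \<beta>)"
      have "(\<Sum>j\<le>Suc \<beta>. ?g j t * h j t) =
        (\<Sum>j\<le>Suc \<beta>. (of_nat (Suc \<beta> choose j) * (- of_real (ln t)) ^ j * of_real (ln t) ^ (Suc \<beta> - j)) * ?r)"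
        by (intro sum.cong refl) (simp add: h_def power_minus[of "of_real (ln t)"] mult_ac del: fact_Suc)
      also have "\<dots> = (- of_real (ln t) + of_real (ln t)) ^ Suc \<beta> * ?r"
        unfolding binomial_ring by (simp only: sum_distrib_right)
      finally show ?thesis by simp
    qed
    also have "(\<Sum>j\<le>Suc \<beta>. ?g' j t * H j t) = F \<beta> t / of_real t"
    proof -
      have "?g' j t * H j t = of_nat (\<beta> choose j) * of_real (ln t) ^ (\<beta> - j) * (-1) ^ j / fact \<beta> * H j t / of_real t" if "j \<le> \<beta>" for j
      proof -
        have "(Suc \<beta> choose j) * (Suc \<beta> - j) = Suc \<beta> * (\<beta> choose j)"
          using binomial_absorb_comp[of "Suc \<beta>" j] by (simp add: mult.commute)
        then have "(of_nat (Suc \<beta> choose j) * of_nat (Suc \<beta> - j) :: complex) = of_nat (Suc \<beta>) * of_nat (\<beta> choose j)"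
          by (metis of_nat_mult)
        then have "of_nat (Suc \<beta> choose j) * of_nat (Suc \<beta> - j) / fact (Suc \<beta>) = (of_nat (\<beta> choose j) / fact \<beta> :: complex)"
          by (simp add: field_simps del: of_nat_Suc)
        moreover have "?g' j t * H j t = (of_nat (Suc \<beta> choose j) * of_nat (Suc \<beta> - j) / fact (Suc \<beta>)) * of_real (ln t) ^ (Suc \<beta> - j - 1) * (-1) ^ j * H j t / of_real t"
          by (simp add: field_simps del: fact_Suc of_nat_Suc)
        moreover have "Suc \<beta> - j - 1 = \<beta> - j" by simp
        ultimately show ?thesis by simp
      qed
      then have "(\<Sum>j\<le>\<beta>. ?g' j t * H j t) = F \<beta> t / of_real t"
        by (simp only: F_def sum_divide_distrib) (intro sum.cong refl, simp)
      then show ?thesis by simp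
    qed
    finally show ?thesis by (simp add: F_def)
  qed
  have "((\<lambda>t. F \<beta> t / of_real t) has_integral F (Suc \<beta>) y - F (Suc \<beta>) x) {x..y}"
    by (rule fundamental_theorem_of_calculus[OF Suc.prems(1) F])
  moreover have "F (Suc \<beta>) x = 0" by (simp add: F_def H_def)
  ultimately have "integral {x..y} (\<lambda>t. F \<beta> t / of_real t) = F (Suc \<beta>) y" by (simp add: integral_unique)
  moreover have "integral {x..y} (\<lambda>t. iter_int_rev x (replicate \<beta> 0 @ a # replicate \<alpha> 0) t / (of_real t - 0)) =
      integral {x..y} (\<lambda>t. F \<beta> t / of_real t)"
  proof (rule integral_cong)
    fix t assume "t \<in> {x..y}"
    then show "iter_int_rev x (replicate \<beta> 0 @ a # replicate \<alpha> 0) t / (of_real t - 0) = F \<beta> t / of_real t"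
      using Suc.IH[of t] Suc.prems by (simp add: F_def H_def h_def)
  qed
  ultimately show ?case by (simp add: F_def H_def h_def)
qed

section \<open>The kernels (ln s)^n / (s - a) and their regularised integrals\<close>

definition lnker :: "nat \<Rightarrow> complex \<Rightarrow> real \<Rightarrow> complex" where
  "lnker n a s = of_real (ln s) ^ n / (of_real s - a)"

text \<open>Apply ln x \<le> x - 1 to a small negative power of s and raise to the n-th
  power.\<close>

lemma ln_power_bound:
  assumes "0 < s" "s \<le> 1"
  shows "\<bar>ln s\<bar> ^ n \<le> (2 * real n + 1) ^ n * s powr (- (1 / 2))"
proof (cases "n = 0")
  case True
  have "1 powr (- (1 / 2)) \<le> s powr (- (1 / 2))" using assms by (intro powr_mono2') auto
  with True show ?thesis by simp
next
  case False
  \<comment> \<open>Chosen so that the n-th power of \<open>s powr (- \<eta>)\<close> is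
    \<open>s powr (- (1 / 2))\<close>.\<close>
  define \<eta> where "\<eta> = 1 / (2 * real n)"
  have \<eta>: "\<eta> > 0" "2 * real n * \<eta> = 1" using False by (auto simp: \<eta>_def)
  have "ln (s powr (- \<eta>)) \<le> s powr (- \<eta>) - 1" using assms by (intro ln_le_minus_one) simp
  then have "\<eta> * \<bar>ln s\<bar> \<le> s powr (- \<eta>)" using assms by (simp add: ln_powr)
  then have "2 * real n * (\<eta> * \<bar>ln s\<bar>) \<le> 2 * real n * s powr (- \<eta>)" by (intro mult_left_mono) auto
  then have "\<bar>ln s\<bar> \<le> 2 * real n * s powr (- \<eta>)" using \<eta>(2) by (simp add: mult.assoc[symmetric])
  also have "\<dots> \<le> (2 * real n + 1) * s powr (- \<eta>)" by (intro mult_right_mono) auto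
  finally have "\<bar>ln s\<bar> ^ n \<le> ((2 * real n + 1) * s powr (- \<eta>)) ^ n" by (intro power_mono) auto
  also have "\<dots> = (2 * real n + 1) ^ n * (s powr (- \<eta>)) ^ n" by (rule power_mult_distrib)
  also have "(s powr (- \<eta>)) ^ n = s powr (- (1 / 2))"
    using assms False by (simp add: \<eta>_def powr_power)
  finally show ?thesis .
qed

text \<open>For a \<noteq> 1 the denominator stays away from 0. For a = 1 one factor ln s cancels
  the pole at s = 1, which is why n \<ge> 1 is assumed then. The summand 1 in the bound covers s =
  0, where the \<open>powr\<close> is 0 by convention.\<close>

lemma lnker_bound:
  assumes a: "norm a = 1" "n \<ge> 1 \<or> a \<noteq> 1"
  obtains K where "\<And>s. s \<in> {0..1} \<Longrightarrow> norm (lnker n a s) \<le> K * (1 + s powr (- (1 / 2)))" "K \<ge> 0"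
proof -
  have end0: "norm (lnker n a 0) \<le> 1" using a by (cases n) (auto simp: lnker_def norm_divide)
  have end1: "norm (lnker n a 1) \<le> inverse (norm (1 - a))"
    by (cases n) (auto simp: lnker_def norm_divide norm_inverse divide_inverse)
  have "\<exists>C\<ge>0. \<forall>s. 0 < s \<and> s < 1 \<longrightarrow> norm (lnker n a s) \<le> C * s powr (- (1 / 2))"
  proof (cases "a = 1")
    case False
    have "continuous_on {0..1::real} (\<lambda>s. norm (of_real s - a))" by (intro continuous_intros)
    from continuous_attains_inf[OF _ _ this] obtain s0 :: real where s0: "s0 \<in> {0..1}"
      and min: "\<And>s. s \<in> {0..1} \<Longrightarrow> norm (of_real s0 - a) \<le> norm (of_real s - a)" by force
    define \<delta> where "\<delta> = norm (of_real s0 - a)"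
    have "of_real s0 \<noteq> a"
    proof
      assume "of_real s0 = a"
      moreover from this have "\<bar>s0\<bar> = 1" using a(1) by (metis norm_of_real)
      ultimately show False using s0 False by auto
    qed
    then have \<delta>: "\<delta> > 0" by (simp add: \<delta>_def)
    show ?thesis
    proof (intro exI[of _ "(2 * real n + 1) ^ n / \<delta>"] conjI allI impI)
      fix s :: real assume s: "0 < s \<and> s < 1"
      have "norm (lnker n a s) = \<bar>ln s\<bar> ^ n / norm (of_real s - a)" by (simp add: lnker_def norm_divide norm_power)
      also have "\<dots> \<le> \<bar>ln s\<bar> ^ n / \<delta>" using min[of s] s \<delta> by (intro frac_le) (auto simp: \<delta>_def)
      also have "\<dots> \<le> ((2 * real n + 1) ^ n * s powr (- (1 / 2))) / \<delta>"
        using s \<delta> by (intro divide_right_mono ln_power_bound) auto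
      finally show "norm (lnker n a s) \<le> (2 * real n + 1) ^ n / \<delta> * s powr (- (1 / 2))" by simp
    qed (use \<delta> in auto)
  next
    case True
    with a have n: "n \<ge> 1" by simp
    show ?thesis
    proof (intro exI[of _ "2 * (2 * real n + 1) ^ n"] conjI allI impI)
      fix s :: real assume s: "0 < s \<and> s < 1"
      have "norm (of_real s - a) = 1 - s"
        unfolding True using s by (metis abs_minus_commute abs_of_pos diff_gt_0_iff_gt norm_of_real of_real_1 of_real_diff)
      then have eq: "norm (lnker n a s) = \<bar>ln s\<bar> ^ n / (1 - s)" by (simp add: lnker_def norm_divide norm_power)
      show "norm (lnker n a s) \<le> 2 * (2 * real n + 1) ^ n * s powr (- (1 / 2))"
      proof (cases "s \<le> 1 / 2")
        case True
        have "\<bar>ln s\<bar> ^ n / (1 - s) \<le> \<bar>ln s\<bar> ^ n / (1 / 2)" using True by (intro divide_left_mono) auto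
        also have "\<dots> \<le> ((2 * real n + 1) ^ n * s powr (- (1 / 2))) / (1 / 2)"
          using s by (intro divide_right_mono ln_power_bound) auto
        finally show ?thesis unfolding eq by simp
      next
        case False
        have "- ln s \<le> (1 - s) / s" using ln_le_minus_one[of "1 / s"] s by (simp add: ln_div field_simps)
        also have "\<dots> \<le> (1 - s) / (1 / 2)" using s False by (intro divide_left_mono) auto
        also have "\<dots> = 2 * (1 - s)" by simp
        finally have l: "\<bar>ln s\<bar> \<le> 2 * (1 - s)" using s by simp
        have "2 * (1 - s) \<le> 1" using False by (simp add: field_simps)
        with l have "\<bar>ln s\<bar> \<le> 1" by (rule order_trans)
        then have "\<bar>ln s\<bar> ^ n \<le> \<bar>ln s\<bar> ^ 1" using n by (intro power_decreasing) auto
        with l have "\<bar>ln s\<bar> ^ n / (1 - s) \<le> 2" using s by (simp add: field_simps)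
        also have "2 * (1 * 1) \<le> 2 * ((2 * real n + 1) ^ n * s powr (- (1 / 2)))"
        proof (intro mult_left_mono mult_mono)
          show "1 \<le> (2 * real n + 1) ^ n" by (rule one_le_power) simp
          have "1 powr (- (1 / 2)) \<le> s powr (- (1 / 2))" using s by (intro powr_mono2') auto
          then show "1 \<le> s powr (- (1 / 2))" by simp
        qed auto
        finally show ?thesis unfolding eq by simp
      qed
    qed simp
  qed
  then obtain C where C: "C \<ge> 0" "\<And>s. 0 < s \<Longrightarrow> s < 1 \<Longrightarrow> norm (lnker n a s) \<le> C * s powr (- (1 / 2))" by blast
  define K where "K = C + 1 + inverse (norm (1 - a))"
  have K: "K \<ge> C" "K \<ge> 1" "K \<ge> inverse (norm (1 - a))" "K \<ge> 0" using C by (auto simp: K_def)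
  show ?thesis
  proof (rule that[of K])
    fix s :: real assume s: "s \<in> {0..1}"
    consider "s = 0" | "s = 1" | "0 < s" "s < 1" using s by fastforce
    then show "norm (lnker n a s) \<le> K * (1 + s powr (- (1 / 2)))"
    proof cases
      case 1
      then show ?thesis using end0 K by simp
    next
      case 2
      then show ?thesis using end1 K by simp
    next
      case 3
      have "C * s powr (- (1 / 2)) \<le> K * (1 + s powr (- (1 / 2)))" using K C(1) by (intro mult_mono) auto
      with C(2)[OF 3] show ?thesis by linarith
    qed
  qed (rule K)
qed

lemma of_real_neq_unit:
  assumes "norm a = 1" "0 \<le> s" "s < 1"
  shows "of_real s \<noteq> (a :: complex)"
proof
  assume "of_real s = a"
  then have "\<bar>s\<bar> = 1" using assms by (metis norm_of_real)
  with assms show False by simp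
qed

lemma continuous_on_lnker:
  assumes "norm a = 1" "S \<subseteq> {0<..<1}"
  shows "continuous_on S (lnker n a)"
proof -
  have "0 < s \<and> s < 1" if "s \<in> S" for s using assms(2) that by auto
  then show ?thesis
    unfolding lnker_def using of_real_neq_unit[OF assms(1)]
    by (intro continuous_intros) (auto simp: less_imp_le order_less_le)
qed

lemma integrable_sqrt_bound: "{x..y} \<subseteq> {0..1::real} \<Longrightarrow> (\<lambda>s. K * (1 + s powr (- (1 / 2)))) integrable_on {x..y}"
  by (intro integrable_on_mult_right integrable_add integrable_const_ivl
      integrable_on_subinterval[OF has_integral_integrable[OF has_integral_powr_from_0[of "- (1 / 2)" 1]], of x y])
     auto

lemma lnker_integrable:
  assumes a: "norm a = 1" "n \<ge> 1 \<or> a \<noteq> 1" and xy: "{x..y} \<subseteq> {0..1}"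
  shows "lnker n a integrable_on {x..y}"
proof -
  obtain K where K: "\<And>s. s \<in> {0..1} \<Longrightarrow> norm (lnker n a s) \<le> K * (1 + s powr (- (1 / 2)))"
    using lnker_bound[OF a] by blast
  have "lnker n a absolutely_integrable_on {0<..<1}"
  proof (rule measurable_bounded_by_integrable_imp_absolutely_integrable)
    show "lnker n a \<in> borel_measurable (lebesgue_on {0<..<1})"
      by (intro continuous_imp_measurable_on_sets_lebesgue continuous_on_lnker a) auto
    show "(\<lambda>s. K * (1 + s powr (- (1 / 2)))) integrable_on {0<..<1}"
      using integrable_sqrt_bound[of 0 1 K] by (simp add: integrable_on_Icc_iff_Ioo)
  qed (use K in auto)
  then have "lnker n a integrable_on {0..1}"
    using set_lebesgue_integral_eq_integral(1) by (auto simp: integrable_on_Icc_iff_Ioo)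
  then show ?thesis using xy by (rule integrable_on_subinterval)
qed

text \<open>For n = 0 and a = 1 the integral over [e, 1 - e] is ln e - ln (1 - e), and 0 is the
  constant term of its expansion.\<close>

definition lnint :: "nat \<Rightarrow> complex \<Rightarrow> complex" where
  "lnint n a = (if n = 0 \<and> a = 1 then 0 else integral {0..1} (lnker n a))"

lemma log_expansion_lnker:
  assumes a: "norm a = 1"
  shows "log_expansion (\<lambda>e. integral {e..1 - e} (lnker n a)) (lnint n a)"
proof (cases "n = 0 \<and> a = 1")
  case True
  have "log_expansion (\<lambda>e. of_real (ln e) + (-1) * of_real (ln (1 - e))) (0 + (-1) * 0)"
    by (intro log_expansion_add log_expansion_mult log_expansion_ln log_expansion_ln_1_minus log_expansion_const)
  then have "log_expansion (\<lambda>e. of_real (ln e) + (-1) * of_real (ln (1 - e))) 0" by simp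
  then have "log_expansion (\<lambda>e. integral {e..1 - e} (lnker n a)) 0"
  proof (rule log_expansion_cong)
    fix e :: real assume e: "0 < e" "e < 1 / 2"
    have "((\<lambda>s. of_real (1 / (s - 1)) :: complex) has_integral of_real (ln (1 - (1 - e))) - of_real (ln (1 - e))) {e..1 - e}"
    proof (rule fundamental_theorem_of_calculus)
      fix s assume s: "s \<in> {e..1 - e}"
      have "((\<lambda>s. ln (1 - s)) has_real_derivative 1 / (s - 1)) (at s within {e..1 - e})"
        using s e by (auto intro!: derivative_eq_intros simp: divide_simps)
      then show "((\<lambda>s. of_real (ln (1 - s)) :: complex) has_vector_derivative of_real (1 / (s - 1))) (at s within {e..1 - e})"
        by (rule has_vector_derivative_of_real)
    qed (use e in auto)
    moreover have "lnker n a = (\<lambda>s. of_real (1 / (s - 1)))" using True by (auto simp: lnker_def)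
    ultimately show "of_real (ln e) + (-1) * of_real (ln (1 - e)) = integral {e..1 - e} (lnker n a)"
      by (simp add: integral_unique)
  qed
  with True show ?thesis by (simp add: lnint_def)
next
  case False
  then have na: "n \<ge> 1 \<or> a \<noteq> 1" by auto
  obtain K where K: "\<And>s. s \<in> {0..1} \<Longrightarrow> norm (lnker n a s) \<le> K * (1 + s powr (- (1 / 2)))" "K \<ge> 0"
    using lnker_bound[OF a na] by blast
  note int = lnker_integrable[OF a na]
  have "log_expansion (\<lambda>e. integral {e..1 - e} (lnker n a)) (integral {0..1} (lnker n a))"
  \<comment> \<open>The tail at 0 costs K (e + 2 e^(1/2)), the tail at 1 costs 3 K e, and e \<le>
    e^(1/2).\<close>
  proof (rule log_expansion_small[of _ _ "6 * K"])
    fix e :: real assume e: "0 < e" "e < 1 / 2"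
    have "integral {0..1} (lnker n a) = integral {0..e} (lnker n a) + (integral {e..1 - e} (lnker n a) + integral {1 - e..1} (lnker n a))"
      using e int by (simp add: Henstock_Kurzweil_Integration.integral_combine)
    then have "integral {e..1 - e} (lnker n a) - integral {0..1} (lnker n a) =
       - (integral {0..e} (lnker n a) + integral {1 - e..1} (lnker n a))" by simp
    then have "norm (integral {e..1 - e} (lnker n a) - integral {0..1} (lnker n a)) =
       norm (integral {0..e} (lnker n a) + integral {1 - e..1} (lnker n a))"
      by (simp only: norm_minus_cancel)
    also have "\<dots> \<le> norm (integral {0..e} (lnker n a)) + norm (integral {1 - e..1} (lnker n a))"
      by (rule norm_triangle_ineq)
    also have "norm (integral {0..e} (lnker n a)) \<le> integral {0..e} (\<lambda>s. K * (1 + s powr (- (1 / 2))))"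
      using e K int by (intro integral_norm_bound_integral integrable_sqrt_bound) auto
    also have "\<dots> = K * (e + 2 * e powr (1 / 2))"
    proof -
      have "((\<lambda>s. K * (1 + s powr (- (1 / 2)))) has_integral K * (e + e powr (- (1 / 2) + 1) / (- (1 / 2) + 1))) {0..e}"
        using e has_integral_const_real[of "1::real" 0 e]
        by (intro has_integral_mult_right has_integral_add has_integral_powr_from_0) auto
      from integral_unique[OF this] show ?thesis by (simp only:) (simp add: mult.commute)
    qed
    also have "norm (integral {1 - e..1} (lnker n a)) \<le> integral {1 - e..1} (\<lambda>s. K * 3)"
    proof (rule integral_norm_bound_integral)
      fix s assume s: "s \<in> {1 - e..1}"
      have "s powr (- (1 / 2)) \<le> (1 / 2) powr (- (1 / 2))" using s e by (intro powr_mono2') auto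
      also have "\<dots> \<le> (1 / 2 :: real) powr (- 1)" by (intro powr_mono') auto
      also have "\<dots> = 2" by (simp add: powr_minus)
      finally have "K * (1 + s powr (- (1 / 2))) \<le> K * 3" using K(2) by (intro mult_left_mono) auto
      with K(1)[of s] s e show "norm (lnker n a s) \<le> K * 3" by auto
    qed (use e int in auto)
    also have "integral {1 - e..1} (\<lambda>s. K * 3) = 3 * K * e" using e by simp
    also have "K * (e + 2 * e powr (1 / 2)) + 3 * K * e \<le> 6 * K * e powr (1 / 2)"
    proof -
      have "e \<le> e powr (1 / 2)" using e powr_mono'[of "1/2" 1 e] by simp
      then have "K * e \<le> K * e powr (1 / 2)" using K(2) by (rule mult_left_mono)
      then show ?thesis by (simp add: algebra_simps)
    qed
    finally show "norm (integral {e..1 - e} (lnker n a) - integral {0..1} (lnker n a)) \<le> 6 * K * e powr (1 / 2)" by simp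
  qed
  with False show ?thesis by (auto simp: lnint_def)
qed

lemma sum_zero_power: "(\<Sum>j\<le>(n::nat). f j * (0::complex) ^ (n - j)) = f n"
proof -
  have "(\<Sum>j\<le>n. f j * (0::complex) ^ (n - j)) = (\<Sum>j\<le>n. if j = n then f j else 0)"
    by (intro sum.cong refl) auto
  then show ?thesis by simp
qed

text \<open>Both logarithmic weights are expanded, in powers of ln e and of ln (1 - e). Either
  logarithm has constant term 0, so only the summands without them, i = \<alpha> and j = \<beta>,
  reach the regularised value.\<close>

lemma reg_int_dword_eq:
  assumes a: "norm a = 1"
  shows "reg_int (dword \<alpha> a \<beta>) = (-1) ^ \<beta> / (fact \<alpha> * fact \<beta>) * lnint (\<alpha> + \<beta>) a"
proof (rule reg_intI)
  let ?f = "\<lambda>e. \<Sum>j\<le>\<beta>. (of_nat (\<beta> choose j) * (-1) ^ j / fact \<beta>) *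
     (\<Sum>i\<le>\<alpha>. (of_nat (\<alpha> choose i) / fact \<alpha> * integral {e..1 - e} (lnker (i + j) a)) * ((-1) * of_real (ln e)) ^ (\<alpha> - i)) *
     of_real (ln (1 - e)) ^ (\<beta> - j)"
  have "log_expansion ?f (\<Sum>j\<le>\<beta>. (of_nat (\<beta> choose j) * (-1) ^ j / fact \<beta>) *
     (\<Sum>i\<le>\<alpha>. (of_nat (\<alpha> choose i) / fact \<alpha> * lnint (i + j) a) * ((-1) * 0) ^ (\<alpha> - i)) * 0 ^ (\<beta> - j))"
    by (intro log_expansion_sum log_expansion_mult log_expansion_power log_expansion_const log_expansion_ln
         log_expansion_ln_1_minus log_expansion_lnker a)
  also have "(\<Sum>j\<le>\<beta>. (of_nat (\<beta> choose j) * (-1) ^ j / fact \<beta>) *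
     (\<Sum>i\<le>\<alpha>. (of_nat (\<alpha> choose i) / fact \<alpha> * lnint (i + j) a) * ((-1) * 0) ^ (\<alpha> - i)) * 0 ^ (\<beta> - j))
     = (-1) ^ \<beta> / (fact \<alpha> * fact \<beta>) * lnint (\<alpha> + \<beta>) a"
    by (simp only: sum_zero_power mult_zero_right) simp
  finally have "log_expansion ?f ((-1) ^ \<beta> / (fact \<alpha> * fact \<beta>) * lnint (\<alpha> + \<beta>) a)" .
  then show "log_expansion (\<lambda>e. iter_int e (dword \<alpha> a \<beta>) (1 - e)) ((-1) ^ \<beta> / (fact \<alpha> * fact \<beta>) * lnint (\<alpha> + \<beta>) a)"
  proof (rule log_expansion_cong)
    fix e :: real assume e: "0 < e" "e < 1 / 2"
    have int: "lnker m a integrable_on {e..1 - e}" for m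
      using e by (intro integrable_continuous_interval continuous_on_lnker a) auto
    have *: "integral {e..1 - e} (\<lambda>s. of_real (ln s) ^ j * of_real (ln (s / e) ^ \<alpha> / fact \<alpha>) / (of_real s - a)) =
      (\<Sum>i\<le>\<alpha>. (of_nat (\<alpha> choose i) / fact \<alpha> * integral {e..1 - e} (lnker (i + j) a)) * ((-1) * of_real (ln e)) ^ (\<alpha> - i))" for j
    proof -
      have "integral {e..1 - e} (\<lambda>s. of_real (ln s) ^ j * of_real (ln (s / e) ^ \<alpha> / fact \<alpha>) / (of_real s - a)) =
        integral {e..1 - e} (\<lambda>s. \<Sum>i\<le>\<alpha>. (of_nat (\<alpha> choose i) / fact \<alpha> * ((-1) * of_real (ln e)) ^ (\<alpha> - i)) * lnker (i + j) a s)"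
      proof (rule integral_cong)
        fix s assume s: "s \<in> {e..1 - e}"
        have "of_real (ln (s / e) ^ \<alpha>) = (of_real (ln s) + (-1) * of_real (ln e) :: complex) ^ \<alpha>"
          using s e by (simp add: ln_div)
        also have "\<dots> = (\<Sum>i\<le>\<alpha>. of_nat (\<alpha> choose i) * of_real (ln s) ^ i * ((-1) * of_real (ln e)) ^ (\<alpha> - i))"
          by (rule binomial_ring)
        finally show "of_real (ln s) ^ j * of_real (ln (s / e) ^ \<alpha> / fact \<alpha>) / (of_real s - a) =
           (\<Sum>i\<le>\<alpha>. (of_nat (\<alpha> choose i) / fact \<alpha> * ((-1) * of_real (ln e)) ^ (\<alpha> - i)) * lnker (i + j) a s)"
          by (simp add: lnker_def sum_distrib_left sum_divide_distrib power_add mult_ac)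
      qed
      also have "\<dots> = (\<Sum>i\<le>\<alpha>. integral {e..1 - e} (\<lambda>s. (of_nat (\<alpha> choose i) / fact \<alpha> * ((-1) * of_real (ln e)) ^ (\<alpha> - i)) * lnker (i + j) a s))"
        by (intro integral_sum integrable_on_mult_right int) auto
      finally show ?thesis by (simp add: mult_ac)
    qed
    have "rev (dword \<alpha> a \<beta>) = replicate \<beta> 0 @ a # replicate \<alpha> 0" by (simp add: dword_def)
    then show "?f e = iter_int e (dword \<alpha> a \<beta>) (1 - e)"
      unfolding iter_int_def using e by (simp only:) (subst iter_int_rev_dword[OF _ _ _ a], simp, simp, simp, simp only: * mult_ac times_divide_eq_right times_divide_eq_left)
  qed
qed

text \<open>By \<open>reg_int_dword_eq\<close> the value depends on the split of \<alpha> + \<beta>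
  only through a sign and two factorials, so the shuffle relation for moving zeros is a comparison
  of these factors.\<close>

lemma reg_int_dword:
  assumes "norm a = 1"
  shows "reg_int (dword \<alpha> a \<beta>) = (- 1) ^ \<alpha> * of_nat ((\<alpha> + \<beta>) choose \<alpha>) * reg_int (dword 0 a (\<alpha> + \<beta>))"
proof -
  have 1: "(of_nat ((\<alpha> + \<beta>) choose \<alpha>) :: complex) / fact (\<alpha> + \<beta>) = 1 / (fact \<alpha> * fact \<beta>)"
    using binomial_fact[of \<alpha> "\<alpha> + \<beta>", where 'a = complex] by (simp add: field_simps)
  have 2: "(-1 :: complex) ^ \<alpha> * (-1) ^ (\<alpha> + \<beta>) = (-1) ^ \<beta>"
    by (simp flip: power_add mult_2) (simp add: power_add mult_2)
  have "(- 1) ^ \<alpha> * of_nat ((\<alpha> + \<beta>) choose \<alpha>) * reg_int (dword 0 a (\<alpha> + \<beta>)) =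
    ((-1) ^ \<alpha> * (-1) ^ (\<alpha> + \<beta>)) * (of_nat ((\<alpha> + \<beta>) choose \<alpha>) / fact (\<alpha> + \<beta>)) * lnint (\<alpha> + \<beta>) a"
    by (simp add: reg_int_dword_eq assms)
  then show ?thesis
    unfolding 1 2 by (simp add: reg_int_dword_eq assms)
qed

subsection \<open>Distribution relations and the values at cube roots of unity\<close>

text \<open>General end points are needed because the substitution t = s^N takes [e, 1 - e] to
  [e^N, (1 - e)^N].\<close>

lemma lnint_limit:
  assumes a: "norm a = 1" "n \<ge> 1 \<or> a \<noteq> 1" and u: "(u \<longlongrightarrow> 0) (at_right (0::real))" and v: "(v \<longlongrightarrow> 1) (at_right 0)"
    and uv: "\<And>e. 0 < e \<Longrightarrow> e < 1 / 2 \<Longrightarrow> 0 \<le> u e \<and> u e \<le> v e \<and> v e \<le> (1::real)"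
  shows "((\<lambda>e. integral {u e..v e} (lnker n a)) \<longlongrightarrow> lnint n a) (at_right 0)"
proof -
  let ?J = "\<lambda>x. integral {0..x} (lnker n a)"
  have ev: "\<forall>\<^sub>F e in at_right (0::real). 0 < e \<and> e < 1 / 2"
    by (rule eventually_mono[OF eventually_at_right_real[of 0 "1/2"]]) auto
  have uv': "u e \<in> {0..1} \<and> v e \<in> {0..1}" if "0 < e" "e < 1 / 2" for e
    using uv[OF that] by auto
  note int = lnker_integrable[OF a]
  have J: "continuous_on {0..1} ?J" by (rule indefinite_integral_continuous_1) (rule int, simp)
  have "((\<lambda>e. ?J (u e)) \<longlongrightarrow> ?J 0) (at_right 0)"
    by (rule continuous_on_tendsto_compose[OF J u]) (use uv' in \<open>auto intro!: eventually_mono[OF ev]\<close>)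
  moreover have "((\<lambda>e. ?J (v e)) \<longlongrightarrow> ?J 1) (at_right 0)"
    by (rule continuous_on_tendsto_compose[OF J v]) (use uv' in \<open>auto intro!: eventually_mono[OF ev]\<close>)
  ultimately have "((\<lambda>e. ?J (v e) - ?J (u e)) \<longlongrightarrow> ?J 1 - ?J 0) (at_right 0)" by (intro tendsto_diff)
  then have "((\<lambda>e. integral {u e..v e} (lnker n a)) \<longlongrightarrow> ?J 1 - ?J 0) (at_right 0)"
  proof (rule Lim_transform_eventually)
    show "\<forall>\<^sub>F e in at_right 0. ?J (v e) - ?J (u e) = integral {u e..v e} (lnker n a)"
      using ev
    proof eventually_elim
      case (elim e)
      then have "?J (u e) + integral {u e..v e} (lnker n a) = ?J (v e)"
        using uv[of e] by (intro Henstock_Kurzweil_Integration.integral_combine int) auto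
      then show ?case by (simp add: algebra_simps)
    qed
  qed
  then show ?thesis using a by (auto simp: lnint_def)
qed

text \<open>\<open>R_sum\<close> is the logarithmic derivative of s^N - 1, i.e. R consists of the
  N-th roots of unity. Under t = s^N the kernel of t at a = 1 becomes the sum of the kernels of s,
  and ln t = N ln s yields the factor N^n.\<close>

lemma lnint_distribution:
  assumes N: "N > 0" and R: "finite R" "\<And>a. a \<in> R \<Longrightarrow> norm a = 1" and n: "n \<ge> 1"
    and R_sum: "\<And>s. 0 < s \<Longrightarrow> s < 1 \<Longrightarrow> (\<Sum>a\<in>R. 1 / (of_real s - a)) = of_nat N * of_real s ^ (N - 1) / (of_real s ^ N - 1)"
  shows "of_nat N ^ n * (\<Sum>a\<in>R. lnint n a) = lnint n 1"
proof (rule tendsto_unique[OF trivial_limit_at_right_real])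
  show "((\<lambda>e. of_nat N ^ n * (\<Sum>a\<in>R. integral {e..1 - e} (lnker n a))) \<longlongrightarrow> of_nat N ^ n * (\<Sum>a\<in>R. lnint n a)) (at_right 0)"
    using n R(2) by (intro tendsto_mult tendsto_const tendsto_sum lnint_limit) (auto intro!: tendsto_eq_intros)
  have "((\<lambda>e. integral {e ^ N..(1 - e) ^ N} (lnker n 1)) \<longlongrightarrow> lnint n 1) (at_right 0)"
    using n N by (intro lnint_limit) (auto intro!: tendsto_eq_intros power_mono power_le_one simp: zero_power)
  then show "((\<lambda>e. of_nat N ^ n * (\<Sum>a\<in>R. integral {e..1 - e} (lnker n a))) \<longlongrightarrow> lnint n 1) (at_right 0)"
  proof (rule Lim_transform_eventually)
    have "integral {e ^ N..(1 - e) ^ N} (lnker n 1) = of_nat N ^ n * (\<Sum>a\<in>R. integral {e..1 - e} (lnker n a))"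
      if e: "0 < e" "e < 1 / 2" for e :: real
    proof -
      have "((\<lambda>s. (real N * s ^ (N - 1)) *\<^sub>R lnker n 1 (s ^ N)) has_integral integral {e ^ N..(1 - e) ^ N} (lnker n 1)) {e..1 - e}"
      proof (rule has_integral_substitution[where c = "e ^ N" and d = "(1 - e) ^ N"])
        show "continuous_on {e ^ N..(1 - e) ^ N} (lnker n 1)"
        proof (rule continuous_on_lnker)
          show "{e ^ N..(1 - e) ^ N} \<subseteq> {0<..<1}"
          proof
            fix x assume x: "x \<in> {e ^ N..(1 - e) ^ N}"
            have "0 < e ^ N" "(1 - e) ^ N < 1" using e N power_strict_decreasing[of 0 N "1 - e"] by auto
            with x have "0 < x" "x < 1" by (auto simp del: zero_less_power_eq)
            then show "x \<in> {0<..<1}" by simp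
          qed
        qed simp
      qed (use e in \<open>auto intro!: power_mono derivative_eq_intros\<close>)
      then have 1: "integral {e ^ N..(1 - e) ^ N} (lnker n 1) = integral {e..1 - e} (\<lambda>s. (real N * s ^ (N - 1)) *\<^sub>R lnker n 1 (s ^ N))"
        by (simp add: integral_unique)
      also have "\<dots> = integral {e..1 - e} (\<lambda>s. of_nat N ^ n * (\<Sum>a\<in>R. lnker n a s))"
      proof (rule integral_cong)
        fix s assume s: "s \<in> {e..1 - e}"
        then have s': "0 < s" "s < 1" using e by auto
        have "(\<Sum>a\<in>R. lnker n a s) = of_real (ln s) ^ n * (\<Sum>a\<in>R. 1 / (of_real s - a))"
          by (simp add: lnker_def sum_distrib_left)
        then show "(real N * s ^ (N - 1)) *\<^sub>R lnker n 1 (s ^ N) = of_nat N ^ n * (\<Sum>a\<in>R. lnker n a s)"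
          unfolding R_sum[OF s'] using s'(1)
          by (simp add: lnker_def ln_realpow power_mult_distrib scaleR_conv_of_real)
      qed
      also have "\<dots> = of_nat N ^ n * (\<Sum>a\<in>R. integral {e..1 - e} (lnker n a))"
        using e R n by (subst integral_mult_right, subst integral_sum)
          (auto intro!: integrable_continuous_interval continuous_on_lnker)
      finally show ?thesis .
    qed
    then show "\<forall>\<^sub>F e in at_right 0. integral {e ^ N..(1 - e) ^ N} (lnker n 1) = of_nat N ^ n * (\<Sum>a\<in>R. integral {e..1 - e} (lnker n a))"
      by (intro eventually_mono[OF eventually_at_right_real[of 0 "1/2"]]) auto
  qed
qed

text \<open>The sign (-1)^(n+1) turns the integrand into |ln s|^n / (1 - s), which is nonnegative on
  [0, 1] and at least (ln 2)^n on [1/4, 1/2].\<close>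

lemma lnint_one_real:
  assumes n: "n \<ge> 1"
  shows "\<exists>r::real. r \<noteq> 0 \<and> lnint n 1 = of_real r"
proof -
  define g where "g = (\<lambda>s::real. (-1) ^ (n + 1) * (ln s ^ n / (s - 1)))"
  have lg: "lnker n 1 s = of_real ((-1) ^ (n + 1) * g s)" for s by (simp add: lnker_def g_def)
  have "(Re \<circ> lnker n 1) integrable_on {0..1}"
    using n by (intro integrable_linear lnker_integrable bounded_linear_Re) auto
  then have "(\<lambda>s. (-1) ^ (n + 1) * (Re \<circ> lnker n 1) s) integrable_on {0..1}" by (rule integrable_on_mult_right)
  then have int: "g integrable_on {0..1}" by (simp add: o_def lg flip: power_mult_distrib mult.assoc)
  have g: "g s = \<bar>ln s\<bar> ^ n / (1 - s)" if "0 \<le> s" "s \<le> 1" for s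
  proof -
    have "ln s \<le> 0 \<or> s = 0" using that by (cases "s = 0") auto
    then have "\<bar>ln s\<bar> = - ln s" by auto
    then have "\<bar>ln s\<bar> ^ n = (-1) ^ n * ln s ^ n" by (metis power_minus)
    then have "g s = - (\<bar>ln s\<bar> ^ n / (s - 1))" by (simp add: g_def)
    also have "\<dots> = \<bar>ln s\<bar> ^ n / (1 - s)" by (metis minus_diff_eq minus_divide_right)
    finally show ?thesis .
  qed
  have "0 < ln 2 ^ n * (1 / 4 :: real)" by simp
  also have "\<dots> = integral {1/4..1/2::real} (\<lambda>s. ln 2 ^ n)" by simp
  also have "\<dots> \<le> integral {1/4..1/2} g"
  proof (rule integral_le)
    show "g integrable_on {1 / 4..1 / 2}" by (rule integrable_on_subinterval[OF int]) auto
    fix s :: real assume s: "s \<in> {1/4..1/2}"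
    then have "ln s \<le> ln (1 / 2)" by (subst ln_le_cancel_iff) auto
    then have "ln 2 \<le> \<bar>ln s\<bar>" by (simp add: ln_div)
    then have "ln 2 ^ n \<le> \<bar>ln s\<bar> ^ n" by (intro power_mono) auto
    also have "\<dots> \<le> \<bar>ln s\<bar> ^ n / (1 - s)" using s by (simp add: divide_simps mult_left_le)
    finally show "ln 2 ^ n \<le> g s" using g[of s] s by auto
  qed auto
  also have "\<dots> \<le> integral {0..1} g"
    by (rule integral_subset_le) (use int g in \<open>auto intro: integrable_on_subinterval\<close>)
  finally have pos: "integral {0..1} g > 0" .
  have "lnint n 1 = integral {0..1} (\<lambda>s. of_real ((-1) ^ (n + 1) * g s))"
  proof -
    have "lnker n 1 = (\<lambda>s. of_real ((-1) ^ (n + 1) * g s))" using lg by (rule ext)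
    then show ?thesis using n unfolding lnint_def by auto
  qed
  also have "\<dots> = of_real ((-1) ^ (n + 1) * integral {0..1} g)"
    using has_integral_of_real[OF has_integral_mult_right[OF integrable_integral[OF int], of "(-1) ^ (n + 1)"], where 'b = complex]
    by (intro integral_unique) (simp add: o_def)
  finally show ?thesis using pos by (intro exI[of _ "(-1) ^ (n + 1) * integral {0..1} g"]) simp
qed

lemma reg_int_zeta:
  assumes "p \<ge> 2"
  shows "\<exists>r::real. r \<noteq> 0 \<and> reg_int (dword 0 1 (p - 1)) = of_real r"
proof -
  have "p - 1 \<ge> 1" using assms by simp
  then obtain r :: real where "r \<noteq> 0" "lnint (p - 1) 1 = of_real r"
    using lnint_one_real by blast
  then show ?thesis
    by (intro exI[of _ "(-1) ^ (p - 1) / fact (p - 1) * r"]) (simp add: reg_int_dword_eq)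
qed

lemma reg_int_minus1:
  assumes "p \<ge> 2"
  shows "reg_int (dword 0 (-1) (p - 1)) = (1 / 2 ^ (p - 1) - 1) * reg_int (dword 0 1 (p - 1))"
proof -
  have "of_nat 2 ^ (p - 1) * (\<Sum>a\<in>{1, -1}. lnint (p - 1) a) = lnint (p - 1) 1"
  proof (rule lnint_distribution)
    fix s :: real assume "0 < s" "s < 1"
    then have "(of_real s :: complex) \<noteq> 1" "(of_real s :: complex) \<noteq> -1" "(of_real s :: complex) ^ 2 \<noteq> 1"
      using of_real_neq_unit[of 1 s] of_real_neq_unit[of "-1" s] by (auto simp: power2_eq_1_iff)
    then show "(\<Sum>a\<in>{1, -1}. 1 / (of_real s - a)) = of_nat 2 * of_real s ^ (2 - 1) / ((of_real s :: complex) ^ 2 - 1)"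
      by (simp add: divide_simps add_eq_0_iff2) (simp add: algebra_simps power2_eq_square)
  qed (use assms in auto)
  then have "lnint (p - 1) (-1) = (1 / 2 ^ (p - 1) - 1) * lnint (p - 1) 1"
    by (simp add: field_simps)
  then show ?thesis by (simp add: reg_int_dword_eq)
qed

section \<open>Cube roots of unity\<close>

lemma eps_3_eq: "eps 3 = Complex (-1/2) (sqrt 3 / 2)"
proof -
  have "eps 3 = cis (2 * pi / 3)"
    unfolding eps_def cis_conv_exp by (simp add: mult_ac)
  then show ?thesis by (simp add: complex_eq_iff cos_120 sin_120)
qed

lemma norm_eps_3: "norm (eps 3) = 1"
  by (simp add: eps_def)

lemma inverse_eps_3: "inverse (eps 3) = cnj (eps 3)"
  using norm_eps_3 by (metis complex_norm_square inverse_unique mult.commute of_real_1 one_power2)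

lemma eps_3_neq_1: "eps 3 \<noteq> 1" "inverse (eps 3) \<noteq> 1" "eps 3 \<noteq> inverse (eps 3)"
  unfolding inverse_eps_3 by (auto simp: eps_3_eq complex_eq_iff)

lemma eps_3_sum: "eps 3 + inverse (eps 3) = -1"
  and eps_3_diff: "eps 3 - inverse (eps 3) = \<i> * of_real (sqrt 3)"
  unfolding inverse_eps_3 by (auto simp: eps_3_eq complex_eq_iff)

lemma eps_3_prod: "(z - eps 3) * (z - inverse (eps 3)) = z ^ 2 + z + 1"
proof -
  have "eps 3 * inverse (eps 3) = 1" using norm_eps_3 by (intro right_inverse) auto
  then have "(z - eps 3) * (z - inverse (eps 3)) = z ^ 2 - (eps 3 + inverse (eps 3)) * z + 1"
    by (simp add: algebra_simps power2_eq_square)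
  then show ?thesis unfolding eps_3_sum by simp
qed

text \<open>The denominator is the product of s - \<open>eps 3\<close> and s -
  \<open>inverse (eps 3)\<close>. Up to the factor \<open>sqrt 3 / 2\<close> this is the imaginary
  part of \<open>lnint n (eps 3)\<close>.\<close>

definition cubint :: "nat \<Rightarrow> real" where
  "cubint n = integral {0..1} (\<lambda>s. ln s ^ n / (s ^ 2 + s + 1))"

lemma norm_inverse_eps_3: "norm (inverse (eps 3)) = 1"
  by (simp add: norm_inverse norm_eps_3)

lemma of_real_neq_eps_3: "of_real s \<noteq> eps 3" "of_real s \<noteq> inverse (eps 3)"
  unfolding inverse_eps_3 by (auto simp: eps_3_eq complex_eq_iff)

lemma lnint_eps_3_diff: "lnint n (eps 3) - lnint n (inverse (eps 3)) = \<i> * of_real (sqrt 3 * cubint n)"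
proof -
  let ?g = "\<lambda>s::real. ln s ^ n / (s ^ 2 + s + 1)"
  have int: "lnker n (eps 3) integrable_on {0..1}" "lnker n (inverse (eps 3)) integrable_on {0..1}"
    using lnker_integrable[OF norm_eps_3] lnker_integrable[OF norm_inverse_eps_3] eps_3_neq_1 by auto
  have eq: "lnker n (eps 3) s - lnker n (inverse (eps 3)) s = \<i> * of_real (sqrt 3) * of_real (?g s)" for s
  proof -
    have "lnker n (eps 3) s - lnker n (inverse (eps 3)) s =
      of_real (ln s) ^ n * ((eps 3 - inverse (eps 3)) / ((of_real s - eps 3) * (of_real s - inverse (eps 3))))"
    proof -
      have "L / A - L / B = L * ((B - A) / (A * B))" if "A \<noteq> 0" "B \<noteq> 0" for A B L :: complex
        using that by (simp add: field_simps)
      from this[of "of_real s - eps 3" "of_real s - inverse (eps 3)" "of_real (ln s) ^ n"] show ?thesis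
        using of_real_neq_eps_3[of s] by (simp add: lnker_def)
    qed
    then show ?thesis unfolding eps_3_prod eps_3_diff by simp
  qed
  have "(\<lambda>s. lnker n (eps 3) s - lnker n (inverse (eps 3)) s) integrable_on {0..1}"
    by (intro integrable_diff int)
  from integrable_linear[OF this bounded_linear_Im]
  have "(\<lambda>s. sqrt 3 * ?g s) integrable_on {0..1}" by (simp add: o_def eq)
  then have g: "?g integrable_on {0..1}" by (subst (asm) integrable_on_cmult_iff) auto
  have "lnint n (eps 3) - lnint n (inverse (eps 3)) = integral {0..1} (\<lambda>s. \<i> * of_real (sqrt 3) * of_real (?g s))"
    using eps_3_neq_1 integral_diff[OF int] by (simp add: lnint_def eq)
  also have "\<dots> = \<i> * of_real (sqrt 3) * of_real (integral {0..1} ?g)"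
    using has_integral_mult_right[OF has_integral_of_real[OF integrable_integral[OF g], where 'b = complex], of "\<i> * of_real (sqrt 3)"]
    by (intro integral_unique) (simp add: o_def)
  finally show ?thesis by (simp add: cubint_def)
qed

lemma cubint_0: "cubint 0 = pi / (3 * sqrt 3)"
proof -
  have pos: "s ^ 2 + s + 1 > 0" if "s \<ge> 0" for s :: real using that by (simp add: add_nonneg_pos)
  have "((\<lambda>s. 1 / (s ^ 2 + s + 1)) has_integral
     (2 / sqrt 3 * arctan ((2 * 1 + 1) / sqrt 3)) - (2 / sqrt 3 * arctan ((2 * 0 + 1) / sqrt 3))) {0..1}"
  proof (rule fundamental_theorem_of_calculus)
    fix s :: real assume s: "s \<in> {0..1}"
    have "((\<lambda>s. 2 / sqrt 3 * arctan ((2 * s + 1) / sqrt 3)) has_real_derivative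
      2 / sqrt 3 * (2 / sqrt 3 * (1 / (1 + ((2 * s + 1) / sqrt 3) ^ 2)))) (at s within {0..1})"
    proof -
      have "((\<lambda>s. (2 * s + 1) / sqrt 3) has_real_derivative 2 / sqrt 3) (at s within {0..1})"
      proof -
        have "((\<lambda>s. 2 * s + 1) has_real_derivative 2) (at s within {0..1})"
          by (auto intro!: derivative_eq_intros)
        then show ?thesis by (rule DERIV_cdivide)
      qed
      from DERIV_cmult[OF DERIV_chain2[OF DERIV_arctan this], of "2 / sqrt 3"] show ?thesis
        by (simp add: divide_inverse mult_ac)
    qed
    also have "2 / sqrt 3 * (2 / sqrt 3 * (1 / (1 + ((2 * s + 1) / sqrt 3) ^ 2))) = 1 / (s ^ 2 + s + 1)"
    proof -
      have e1: "1 + ((2 * s + 1) / sqrt 3) ^ 2 = 4 / 3 * (s ^ 2 + s + 1)"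
        by (simp add: power_divide power2_eq_square algebra_simps)
      have e2: "2 / sqrt 3 * (2 / sqrt 3) = 4 / (3::real)" by simp
      have e3: "4 / 3 * (1 / (4 / 3 * q)) = 1 / q" for q :: real by simp
      show ?thesis
        unfolding e1 by (simp only: mult.assoc[symmetric] e2) (rule e3)
    qed
    finally show "((\<lambda>s. 2 / sqrt 3 * arctan ((2 * s + 1) / sqrt 3)) has_vector_derivative 1 / (s ^ 2 + s + 1)) (at s within {0..1})"
      by (simp add: has_real_derivative_iff_has_vector_derivative)
  qed simp
  moreover have "arctan (sqrt 3) = pi / 3"
    by (rule arctan_unique) (use pi_gt_zero in \<open>linarith, linarith, simp add: tan_60\<close>)
  moreover have "arctan (1 / sqrt 3) = pi / 6"
    by (rule arctan_unique) (use pi_gt_zero in \<open>linarith, linarith, simp add: tan_30\<close>)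
  moreover have "(2 * 1 + 1) / sqrt 3 = sqrt 3" "(2 * 0 + 1) / sqrt 3 = 1 / sqrt 3" using real_div_sqrt[of 3] by simp_all
  ultimately have "((\<lambda>s. 1 / (s ^ 2 + s + 1)) has_integral 2 / sqrt 3 * (pi / 3) - 2 / sqrt 3 * (pi / 6)) {0..1}"
    by (simp only:)
  then have "cubint 0 = 2 / sqrt 3 * (pi / 3) - 2 / sqrt 3 * (pi / 6)"
    unfolding cubint_def by (simp add: integral_unique)
  moreover have "2 / r * (pi / 3) - 2 / r * (pi / 6) = pi / (3 * r)" if "r \<noteq> 0" for r
    using that by (simp add: field_simps)
  ultimately show ?thesis by simp
qed

section \<open>Polygamma values at 1/3 and 2/3\<close>

lemma Gamma_reflection_real:
  assumes "0 < z" "z < (1::real)"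
  shows "Gamma z * Gamma (1 - z) = pi / sin (pi * z)"
proof -
  have "complex_of_real (Gamma z * Gamma (1 - z)) = of_real (pi / sin (pi * z))"
    using Gamma_reflection_complex[of "of_real z"] Gamma_complex_of_real[of z] Gamma_complex_of_real[of "1 - z"]
    by (simp add: sin_of_real[symmetric])
  then show ?thesis by (simp only: of_real_eq_iff)
qed

lemma not_nonpos_Ints: "0 < z \<Longrightarrow> (z::real) \<notin> \<int>\<^sub>\<le>\<^sub>0"
  by (auto elim: nonpos_Ints_cases)

lemma Digamma_reflection:
  assumes z: "0 < z" "z < (1::real)"
  shows "Digamma (1 - z) - Digamma z = pi * cot (pi * z)"
proof -
  have s: "sin (pi * z) > 0" using z mult_strict_left_mono[of z 1 pi] by (intro sin_gt_zero) auto
  let ?G = "\<lambda>z. Gamma z * Gamma (1 - z) :: real"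
  have "(?G has_real_derivative ?G z * (Digamma z - Digamma (1 - z))) (at z)"
    using z not_nonpos_Ints[of z] not_nonpos_Ints[of "1 - z"]
    by (auto intro!: derivative_eq_intros simp: algebra_simps)
  moreover have "(?G has_real_derivative - (pi * (cos (pi * z) * pi)) / (sin (pi * z))\<^sup>2) (at z)"
  proof (rule has_field_derivative_transform_within_open)
    show "((\<lambda>z. pi / sin (pi * z)) has_real_derivative - (pi * (cos (pi * z) * pi)) / (sin (pi * z))\<^sup>2) (at z)"
      using s by (auto intro!: derivative_eq_intros simp: power2_eq_square)
    show "open {0<..<1::real}" "z \<in> {0<..<1}" using z by auto
    fix x :: real assume "x \<in> {0<..<1}"
    then show "pi / sin (pi * x) = ?G x" using Gamma_reflection_real[of x] by simp
  qed
  ultimately have "?G z * (Digamma z - Digamma (1 - z)) = - (pi * (cos (pi * z) * pi)) / (sin (pi * z))\<^sup>2"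
    by (rule DERIV_unique)
  then have "pi / sin (pi * z) * (Digamma z - Digamma (1 - z)) = - (pi / sin (pi * z) * (pi * cot (pi * z)))"
    unfolding Gamma_reflection_real[OF z] by (simp add: cot_def power2_eq_square)
  then have "pi / sin (pi * z) * (Digamma z - Digamma (1 - z) + pi * cot (pi * z)) = 0"
    by (simp add: ring_distribs)
  then show ?thesis using s by simp
qed

text \<open>Real polynomials with rational coefficients: their value at cot(pi/3)^2 = 1/3 is
  rational, which is all that is extracted from the reflection formula.\<close>

definition rat_poly :: "real poly \<Rightarrow> bool" where
  "rat_poly P \<longleftrightarrow> (\<forall>i. coeff P i \<in> \<rat>)"

lemma rat_poly_add: "rat_poly P \<Longrightarrow> rat_poly Q \<Longrightarrow> rat_poly (P + Q)"
  and rat_poly_mult: "rat_poly P \<Longrightarrow> rat_poly Q \<Longrightarrow> rat_poly (P * Q)"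
  and rat_poly_pderiv: "rat_poly P \<Longrightarrow> rat_poly (pderiv P)"
  by (auto simp: rat_poly_def coeff_mult coeff_pderiv intro!: Rats_sum Rats_mult Rats_power)

lemma rat_poly_const: "c \<in> \<rat> \<Longrightarrow> rat_poly [:c:]"
  and rat_poly_linear: "c \<in> \<rat> \<Longrightarrow> d \<in> \<rat> \<Longrightarrow> rat_poly [:c, d:]"
  by (auto simp: rat_poly_def coeff_pCons split: nat.split)

lemma poly_rat: "rat_poly P \<Longrightarrow> x \<in> \<rat> \<Longrightarrow> poly P x \<in> \<rat>"
  by (auto simp: poly_altdef rat_poly_def intro!: Rats_sum Rats_mult Rats_power)

text \<open>Derivatives of \<open>cot\<close> are polynomials in \<open>cot\<close> of alternating parity.\<close>

lemma Polygamma_reflection: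
  "\<exists>P. rat_poly P \<and> (\<forall>z. 0 < z \<and> z < 1 \<longrightarrow>
     (-1) ^ n * Polygamma n (1 - z) - Polygamma n z =
       pi ^ (n + 1) * (if even n then cot (pi * z) else 1) * poly P (cot (pi * z) ^ 2))"
proof (induction n)
  case 0
  show ?case
    using Digamma_reflection by (intro exI[of _ "[:1:]"]) (auto intro: rat_poly_const)
next
  case (Suc n)
  then obtain P where P: "rat_poly P" and eq: "\<And>z. 0 < z \<Longrightarrow> z < 1 \<Longrightarrow>
     (-1) ^ n * Polygamma n (1 - z) - Polygamma n z =
       pi ^ (n + 1) * (if even n then cot (pi * z) else 1) * poly P (cot (pi * z) ^ 2)" by blast
  let ?F = "\<lambda>n z. (-1) ^ n * Polygamma n (1 - z) - Polygamma n z :: real"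
  \<comment> \<open>With u = cot^2 as variable and cot' = - pi (1 + u), differentiating cot P(u)
    gives - (1 + u) (P + 2 u P'), and differentiating P(u) gives -2 (1 + u) P' times cot, each up to
    a factor pi.\<close>
  define Q where "Q = (if even n then [:-1, -1:] * (P + [:0, 2:] * pderiv P) else [:-2, -2:] * pderiv P)"
  have "rat_poly Q"
    by (cases "even n"; simp only: Q_def if_True if_False; intro rat_poly_add rat_poly_mult rat_poly_pderiv P rat_poly_linear)
       simp_all
  moreover have "?F (Suc n) z = pi ^ (Suc n + 1) * (if even (Suc n) then cot (pi * z) else 1) * poly Q (cot (pi * z) ^ 2)"
    if z: "0 < z" "z < 1" for z
  proof -
    have s: "sin (pi * z) \<noteq> 0" using sin_gt_zero[of "pi * z"] z mult_strict_left_mono[of z 1 pi] by auto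
    let ?c = "cot (pi * z)"
    have "inverse ((sin (pi * z))\<^sup>2) = 1 + ?c ^ 2"
      using s by (simp add: cot_def field_simps)
    then have cot: "((\<lambda>z. cot (pi * z)) has_real_derivative - (1 + ?c ^ 2) * pi) (at z)"
    proof -
      have "((\<lambda>z. pi * z) has_real_derivative pi) (at z)" by (auto intro!: derivative_eq_intros)
      from DERIV_chain2[OF DERIV_cot[OF s] this] show ?thesis
        unfolding \<open>inverse ((sin (pi * z))\<^sup>2) = _\<close> .
    qed
    have "(?F n has_real_derivative ?F (Suc n) z) (at z)"
      using z not_nonpos_Ints[of z] not_nonpos_Ints[of "1 - z"]
      by (auto intro!: derivative_eq_intros)
    moreover have "(?F n has_real_derivative pi ^ (Suc n + 1) * (if even (Suc n) then ?c else 1) * poly Q (?c ^ 2)) (at z)"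
    proof (rule has_field_derivative_transform_within_open)
      let ?c' = "- (1 + ?c ^ 2) * pi"
      have sq: "((\<lambda>z. cot (pi * z) ^ 2) has_real_derivative 2 * ?c * ?c') (at z)"
        using DERIV_power[OF cot, of 2] by (simp add: mult_ac)
      have p: "((\<lambda>z. poly P (cot (pi * z) ^ 2)) has_real_derivative poly (pderiv P) (?c ^ 2) * (2 * ?c * ?c')) (at z)"
        by (rule DERIV_chain2[OF poly_DERIV sq])
      show "((\<lambda>z. pi ^ (n + 1) * (if even n then cot (pi * z) else 1) * poly P (cot (pi * z) ^ 2)) has_real_derivative
         pi ^ (Suc n + 1) * (if even (Suc n) then ?c else 1) * poly Q (?c ^ 2)) (at z)"
      proof (cases "even n")
        case True
        have D: "((\<lambda>z. pi ^ (n + 1) * cot (pi * z) * poly P (cot (pi * z) ^ 2)) has_real_derivative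
          pi ^ (n + 1) * ?c' * poly P (?c ^ 2) + poly (pderiv P) (?c ^ 2) * (2 * ?c * ?c') * (pi ^ (n + 1) * ?c)) (at z)"
          by (intro DERIV_cmult DERIV_mult cot p)
        have val: "pi ^ (n + 1) * ?c' * poly P (?c ^ 2) + poly (pderiv P) (?c ^ 2) * (2 * ?c * ?c') * (pi ^ (n + 1) * ?c)
          = pi ^ (Suc n + 1) * 1 * poly Q (?c ^ 2)"
          using True by (simp add: Q_def power2_eq_square algebra_simps)
        have "\<not> even (Suc n)" using True by simp
        then show ?thesis
          unfolding if_P[OF True] using DERIV_cong[OF D val] by (simp only: if_False)
      next
        case False
        have D: "((\<lambda>z. pi ^ (n + 1) * 1 * poly P (cot (pi * z) ^ 2)) has_real_derivative
          pi ^ (n + 1) * 1 * (poly (pderiv P) (?c ^ 2) * (2 * ?c * ?c'))) (at z)"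
          by (intro DERIV_cmult p)
        have val: "pi ^ (n + 1) * 1 * (poly (pderiv P) (?c ^ 2) * (2 * ?c * ?c')) = pi ^ (Suc n + 1) * ?c * poly Q (?c ^ 2)"
          using False by (simp add: Q_def power2_eq_square algebra_simps)
        have "even (Suc n)" using False by simp
        then show ?thesis
          unfolding if_not_P[OF False] using DERIV_cong[OF D val] by (simp only: if_True)
      qed
      show "open {0<..<1::real}" "z \<in> {0<..<1}" using z by auto
      fix x :: real assume "x \<in> {0<..<1}"
      then show "pi ^ (n + 1) * (if even n then cot (pi * x) else 1) * poly P (cot (pi * x) ^ 2) = ?F n x"
        using eq[of x] by simp
    qed
    ultimately show ?thesis by (rule DERIV_unique)
  qed
  ultimately show ?case by blast
qed

lemma has_integral_ln_power: "((\<lambda>s. s ^ m * ln s ^ n) has_integral ((-1) ^ n * fact n / (real m + 1) ^ (n + 1))) {0..1::real}"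
proof (induction n)
  case 0
  have "((\<lambda>s. s ^ m) has_integral (1 ^ Suc m / (real m + 1) - 0 ^ Suc m / (real m + 1))) {0..1::real}"
  proof (rule fundamental_theorem_of_calculus)
    fix s :: real
    have "((\<lambda>s. s ^ Suc m / (real m + 1)) has_real_derivative s ^ m) (at s within {0..1})"
      by (rule DERIV_cong[OF DERIV_cdivide[OF DERIV_power_Suc[OF DERIV_ident]]]) (simp add: field_simps)
    then show "((\<lambda>s. s ^ Suc m / (real m + 1)) has_vector_derivative s ^ m) (at s within {0..1})"
      by (simp add: has_real_derivative_iff_has_vector_derivative)
  qed simp
  then show ?case by simp
next
  case (Suc n)
  \<comment> \<open>Integration by parts: the integrand is the derivative of s^(m+1) (ln s)^(n+1),
    which is 0 at both ends.\<close>
  have "((\<lambda>s. (real m + 1) * (s ^ m * ln s ^ Suc n) + real (Suc n) * (s ^ m * ln s ^ n)) has_integral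
    (1 ^ Suc m * ln 1 ^ Suc n - 0 ^ Suc m * ln 0 ^ Suc n)) {0..1::real}"
  proof (rule fundamental_theorem_of_calculus_interior)
    fix s :: real assume s: "s \<in> {0<..<1}"
    have "((\<lambda>s. s ^ Suc m * ln s ^ Suc n) has_real_derivative
      ((1 + of_nat m) * (1 * s ^ m)) * ln s ^ Suc n + ((1 + of_nat n) * (1 / s * ln s ^ n)) * s ^ Suc m) (at s)"
      using s by (intro DERIV_mult DERIV_power_Suc DERIV_ident DERIV_ln_divide) auto
    then have "((\<lambda>s. s ^ Suc m * ln s ^ Suc n) has_real_derivative
      (real m + 1) * (s ^ m * ln s ^ Suc n) + real (Suc n) * (s ^ m * ln s ^ n)) (at s)"
      by (rule DERIV_cong) (use s in \<open>simp add: field_simps\<close>)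
    then show "((\<lambda>s. s ^ Suc m * ln s ^ Suc n) has_vector_derivative
      (real m + 1) * (s ^ m * ln s ^ Suc n) + real (Suc n) * (s ^ m * ln s ^ n)) (at s)"
      by (simp add: has_real_derivative_iff_has_vector_derivative)
  next
    show "continuous_on {0..1} (\<lambda>s::real. s ^ Suc m * ln s ^ Suc n)"
      unfolding continuous_on_eq_continuous_within
    proof
      fix s :: real assume s: "s \<in> {0..1}"
      show "continuous (at s within {0..1}) (\<lambda>s. s ^ Suc m * ln s ^ Suc n)"
      proof (cases "s = 0")
        case False
        with s show ?thesis by (intro continuous_intros) auto
      next
        case True
        have "((\<lambda>s::real. s ^ Suc m * ln s ^ Suc n) \<longlongrightarrow> 0) (at_right 0)"
          by real_asymp
        then have "((\<lambda>s::real. s ^ Suc m * ln s ^ Suc n) \<longlongrightarrow> 0) (at 0 within {0..1})"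
          by (simp add: at_within_Icc_at_right)
        then show ?thesis using True by (simp add: continuous_within)
      qed
    qed
  qed simp
  then have "((\<lambda>s. (real m + 1) * (s ^ m * ln s ^ Suc n) + real (Suc n) * (s ^ m * ln s ^ n)) has_integral 0) {0..1::real}"
    by simp
  from has_integral_diff[OF this has_integral_mult_right[OF Suc.IH, of "real (Suc n)"]]
  have "((\<lambda>s. (real m + 1) * (s ^ m * ln s ^ Suc n)) has_integral
     - (real (Suc n) * ((-1) ^ n * fact n / (real m + 1) ^ (n + 1)))) {0..1::real}" by simp
  note 1 = has_integral_mult_right[OF this, of "1 / (real m + 1)"]
  have m: "real m + 1 \<noteq> 0" by simp
  have 2: "1 / (real m + 1) * ((real m + 1) * x) = x" for x
    using m by simp
  have 3: "1 / (real m + 1) * - (real (Suc n) * ((-1) ^ n * fact n / (real m + 1) ^ (n + 1))) =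
     (-1) ^ Suc n * fact (Suc n) / (real m + 1) ^ (Suc n + 1)"
    by (simp add: divide_simps del: of_nat_Suc)
  show ?case using 1 unfolding 2 3 .
qed

text \<open>Expand 1 / (s^2 + s + 1) = (1 - s) / (1 - s^3) as a geometric series. Integrating
  termwise gives the series of the polygamma function at 1/3 and 2/3; n is even, so all terms are
  nonnegative and monotone convergence applies.\<close>

lemma cubint_Polygamma:
  assumes n: "n > 0" "even n"
  shows "cubint n = (Polygamma n (2 / 3) - Polygamma n (1 / 3)) / 3 ^ (n + 1)"
proof -
  let ?t = "\<lambda>k s::real. ln s ^ n * (s ^ (3 * k) - s ^ (3 * k + 1))"
  let ?i = "\<lambda>k. fact n / (3 * real k + 1) ^ (n + 1) - fact n / (3 * real k + 2) ^ (n + 1)"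
  have t: "(?t k has_integral ?i k) {0..1}" for k
  proof -
    have "((\<lambda>s. s ^ (3 * k) * ln s ^ n - s ^ (3 * k + 1) * ln s ^ n) has_integral
      ((-1) ^ n * fact n / (real (3 * k) + 1) ^ (n + 1) - (-1) ^ n * fact n / (real (3 * k + 1) + 1) ^ (n + 1))) {0..1}"
      by (intro has_integral_diff has_integral_ln_power)
    then show ?thesis using n by (simp add: algebra_simps)
  qed
  have "(\<lambda>k. ?i k) sums ((Polygamma n (2 / 3) - Polygamma n (1 / 3)) / 3 ^ (n + 1))"
  proof -
    have P: "(\<lambda>k. fact n / 3 ^ (n + 1) * inverse ((z + real k) ^ Suc n)) sums
        (fact n / 3 ^ (n + 1) * ((-1) ^ Suc n * Polygamma n z / fact n))" if "z \<noteq> 0" for z :: real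
      by (intro sums_mult Polygamma_LIMSEQ n that)
    have eq: "fact n / 3 ^ (n + 1) * inverse ((z + real k) ^ Suc n) = fact n / (3 * real k + 3 * z) ^ (n + 1)" for z k
    proof -
      have "(3 * real k + 3 * z) ^ (n + 1) = 3 ^ (n + 1) * (z + real k) ^ Suc n"
        by (simp add: power_mult_distrib[symmetric] ring_distribs add.commute del: power_Suc)
      then show ?thesis by (simp add: divide_inverse del: power_Suc)
    qed
    from sums_diff[OF P[of "1 / 3"] P[of "2 / 3"]] n show ?thesis
      unfolding eq by (simp add: diff_divide_distrib del: power_Suc)
  qed
  then have lim: "(\<lambda>K. \<Sum>k<K. ?i k) \<longlonglongrightarrow> (Polygamma n (2 / 3) - Polygamma n (1 / 3)) / 3 ^ (n + 1)"
    by (simp add: sums_def)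
  have "((\<lambda>s::real. ln s ^ n / (s ^ 2 + s + 1)) has_integral (Polygamma n (2 / 3) - Polygamma n (1 / 3)) / 3 ^ (n + 1)) {0..1}"
  proof (rule has_integral_monotone_convergence_increasing[OF _ _ _ lim])
    show "((\<lambda>s. \<Sum>k<K. ?t k s) has_integral (\<Sum>k<K. ?i k)) {0..1}" for K
      by (intro has_integral_sum t) auto
    fix s :: real assume s: "s \<in> {0..1}"
    show "(\<Sum>k<K. ?t k s) \<le> (\<Sum>k<Suc K. ?t k s)" for K
    proof -
      have "s ^ (3 * K + 1) \<le> s ^ (3 * K)" using s by (intro power_decreasing) auto
      moreover have "ln s ^ n \<ge> 0" using n by (simp add: zero_le_even_power)
      ultimately show ?thesis by simp
    qed
    show "(\<lambda>K. \<Sum>k<K. ?t k s) \<longlonglongrightarrow> ln s ^ n / (s ^ 2 + s + 1)"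
    proof (cases "s = 0 \<or> s = 1")
      case True
      then have "ln s = 0" by auto
      then show ?thesis using n by (simp add: zero_power)
    next
      case False
      with s have s': "0 < s" "s < 1" by auto
      have s3: "s ^ 3 < 1" using s' power_strict_decreasing[of 0 3 s] by simp
      have "(\<lambda>k. (s ^ 3) ^ k) sums (1 / (1 - s ^ 3))"
        using s' s3 by (intro geometric_sums) simp
      from sums_mult[OF this, of "ln s ^ n * (1 - s)"]
      moreover have "ln s ^ n * (1 - s) * (s ^ 3) ^ k = ?t k s" for k
        unfolding power_mult power_add by (simp add: algebra_simps)
      ultimately have "(\<lambda>k. ?t k s) sums (ln s ^ n * (1 - s) * (1 / (1 - s ^ 3)))"
        by (simp only:)
      also have "1 - s ^ 3 = (1 - s) * (s ^ 2 + s + 1)" by (simp add: algebra_simps power2_eq_square power3_eq_cube)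
      also have "ln s ^ n * (1 - s) * (1 / ((1 - s) * (s ^ 2 + s + 1))) = ln s ^ n / (s ^ 2 + s + 1)"
        using s' by simp
      finally show ?thesis by (simp add: sums_def)
    qed
  qed
  then show ?thesis by (simp add: cubint_def integral_unique)
qed

text \<open>In the reflection formula at z = 1/3 the odd factor cot(pi/3) = 1 /
  \<open>sqrt 3\<close> cancels the square root, and the polynomial factor takes a rational
  value.\<close>

lemma cubint_even:
  assumes n: "n > 0" "even n"
  shows "\<exists>q::rat. sqrt 3 * cubint n = of_rat q * pi ^ (n + 1)"
proof -
  obtain P where P: "rat_poly P" and eq: "\<And>z. 0 < z \<Longrightarrow> z < 1 \<Longrightarrow>
     (-1) ^ n * Polygamma n (1 - z) - Polygamma n z =
       pi ^ (n + 1) * (if even n then cot (pi * z) else 1) * poly P (cot (pi * z) ^ 2)"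
    using Polygamma_reflection[of n] by blast
  have cot: "cot (pi / 3) = 1 / sqrt 3" by (simp add: cot_def cos_60 sin_60)
  have "poly P ((1 / sqrt 3) ^ 2) \<in> \<rat>" by (rule poly_rat[OF P]) (simp add: power_divide)
  then have "poly P ((1 / sqrt 3) ^ 2) / 3 ^ (n + 1) \<in> \<rat>" by (intro Rats_divide) auto
  then obtain q where q: "poly P ((1 / sqrt 3) ^ 2) / 3 ^ (n + 1) = of_rat q" by (elim Rats_cases)
  have "sqrt 3 * cubint n = sqrt 3 * (pi ^ (n + 1) * (1 / sqrt 3) * poly P ((1 / sqrt 3) ^ 2)) / 3 ^ (n + 1)"
    using eq[of "1 / 3"] n unfolding cubint_Polygamma[OF n] by (simp add: cot)
  also have "\<dots> = pi ^ (n + 1) * (poly P ((1 / sqrt 3) ^ 2) / 3 ^ (n + 1))" by simp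
  finally show ?thesis unfolding q by (intro exI[of _ q]) simp
qed

lemma period_tate3: "reg_int [eps 3] - reg_int [inverse (eps 3)] = \<i> * of_real (pi / 3)"
proof -
  have "reg_int [a] = lnint 0 a" if "norm a = 1" for a
    using reg_int_dword_eq[OF that, of 0 0] by (simp add: dword_def)
  then show ?thesis
    using lnint_eps_3_diff[of 0] by (simp add: norm_eps_3 norm_inverse_eps_3 cubint_0)
qed

lemma lnint_eps_3_sum:
  assumes "n \<ge> 1"
  shows "lnint n (eps 3) + lnint n (inverse (eps 3)) = (1 / 3 ^ n - 1) * lnint n 1"
proof -
  have "of_nat 3 ^ n * (\<Sum>a\<in>{1, eps 3, inverse (eps 3)}. lnint n a) = lnint n 1"
  proof (rule lnint_distribution)
    fix s :: real assume s: "0 < s" "s < 1"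
    let ?s = "of_real s :: complex"
    have s1: "?s \<noteq> 1" using s by auto
    have ne: "?s \<noteq> eps 3" "?s \<noteq> inverse (eps 3)" by (rule of_real_neq_eps_3)+
    have s3: "?s ^ 3 - 1 = (?s - 1) * (?s ^ 2 + ?s + 1)" by (simp add: algebra_simps power2_eq_square power3_eq_cube)
    have nz: "?s ^ 2 + ?s + 1 \<noteq> 0" using ne unfolding eps_3_prod[symmetric] by simp
    have "1 / A + 1 / B = (A + B) / (A * B)" if "A \<noteq> 0" "B \<noteq> 0" for A B :: complex
      using that by (simp add: field_simps)
    from this[of "?s - eps 3" "?s - inverse (eps 3)"] ne
    have "1 / (?s - eps 3) + 1 / (?s - inverse (eps 3)) = (2 * ?s - (eps 3 + inverse (eps 3))) / (?s ^ 2 + ?s + 1)"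
      unfolding eps_3_prod by simp
    then have "(\<Sum>a\<in>{1, eps 3, inverse (eps 3)}. 1 / (?s - a)) = 1 / (?s - 1) + (2 * ?s + 1) / (?s ^ 2 + ?s + 1)"
      using eps_3_neq_1 unfolding eps_3_sum by simp
    also have "\<dots> = of_nat 3 * ?s ^ (3 - 1) / (?s ^ 3 - 1)"
      unfolding s3 using s1 nz by (simp add: divide_simps) (simp add: algebra_simps power2_eq_square)
    finally show "(\<Sum>a\<in>{1, eps 3, inverse (eps 3)}. 1 / (?s - a)) = of_nat 3 * ?s ^ (3 - 1) / (?s ^ 3 - 1)" .
  qed (use assms norm_eps_3 norm_inverse_eps_3 in auto)
  then show ?thesis using eps_3_neq_1 by (simp add: field_simps)
qed

lemma of_real_of_rat: "complex_of_real (of_rat q) = of_rat q"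
  by (cases q) (simp add: of_rat_rat)

text \<open>Half the sum of the values at the two primitive roots is given by the distribution
  relation. Half their difference is imaginary, a rational multiple of i pi^p, and since p is odd
  this is a rational multiple of the p-th power of the Tate period i pi / 3.\<close>

lemma reg_int_eps3:
  assumes p: "p \<ge> 3" "odd p" and e: "e = eps 3 \<or> e = inverse (eps 3)"
  shows "\<exists>q::rat. reg_int (dword 0 e (p - 1)) =
     (1 / 3 ^ (p - 1) - 1) / 2 * reg_int (dword 0 1 (p - 1)) + of_rat q * (reg_int [eps 3] - reg_int [inverse (eps 3)]) ^ p"
proof -
  define n where "n = p - 1"
  have n: "n \<ge> 1" "n > 0" "even n" "p = Suc n" using p by (auto simp: n_def)
  obtain m where m: "n = 2 * m" using n(3) by (elim evenE)
  obtain q where q: "sqrt 3 * cubint n = of_rat q * pi ^ (n + 1)" using cubint_even[OF n(2,3)] by blast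
  \<comment> \<open>The sign records which of the two conjugate roots e is.\<close>
  define \<sigma> :: rat where "\<sigma> = (if e = eps 3 then 1 else -1)"
  define D where "D = \<i> * of_real (sqrt 3 * cubint n)"
  have "lnint n (eps 3) = ((1 / 3 ^ n - 1) * lnint n 1 + D) / 2"
       "lnint n (inverse (eps 3)) = ((1 / 3 ^ n - 1) * lnint n 1 - D) / 2"
    unfolding D_def lnint_eps_3_diff[symmetric] lnint_eps_3_sum[OF n(1), symmetric] by simp_all
  then have le: "lnint n e = (1 / 3 ^ n - 1) / 2 * lnint n 1 + of_rat (\<sigma> / 2) * D"
    using e eps_3_neq_1 by (auto simp: \<sigma>_def field_simps of_rat_divide of_rat_minus)
  have t: "(reg_int [eps 3] - reg_int [inverse (eps 3)]) ^ p = \<i> * (-1) ^ m * of_real pi ^ (n + 1) / 3 ^ (n + 1)"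
  proof -
    have "\<i> ^ Suc n = \<i> * (-1) ^ m" unfolding m by (simp add: power_mult)
    then show ?thesis
      unfolding period_tate3 n(4) power_mult_distrib by (simp add: power_divide)
  qed
  have "D = of_rat (q * (-1) ^ m * 3 ^ (n + 1)) * (reg_int [eps 3] - reg_int [inverse (eps 3)]) ^ p"
    unfolding D_def q t by (simp add: of_rat_mult of_rat_power of_rat_minus of_real_of_rat power_mult_distrib[symmetric])
  with le have "lnint n e = (1 / 3 ^ n - 1) / 2 * lnint n 1 +
     of_rat (\<sigma> / 2 * (q * (-1) ^ m * 3 ^ (n + 1))) * (reg_int [eps 3] - reg_int [inverse (eps 3)]) ^ p"
    by (simp only: of_rat_mult mult.assoc)
  note le' = this
  have "norm e = 1" using e norm_eps_3 norm_inverse_eps_3 by auto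
  have "reg_int (dword 0 e n) = (1 / 3 ^ n - 1) / 2 * reg_int (dword 0 1 n) +
     of_rat (\<sigma> / 2 * (q * (-1) ^ m * 3 ^ (n + 1)) / fact n) * (reg_int [eps 3] - reg_int [inverse (eps 3)]) ^ p"
  proof -
    have "complex_of_rat (fact n) = fact n" by (metis of_nat_fact of_rat_of_nat_eq)
    then show ?thesis
      using le' n(3) \<open>norm e = 1\<close> by (simp add: reg_int_dword_eq of_rat_divide of_rat_mult add_divide_distrib)
  qed
  then show ?thesis unfolding n_def by blast
qed

subsection \<open>Linear maps on formal combinations\<close>

interpretation rvs: vector_space "rscale :: rat \<Rightarrow> ('a::comm_monoid_add \<Rightarrow>\<^sub>0 rat) \<Rightarrow> _"
  by (rule vector_space_rscale)

lemma lookup_rscale [simp]: "Poly_Mapping.lookup (rscale c x) m = c * Poly_Mapping.lookup x m"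
  by (simp add: rscale_def Poly_Mapping.map_key_def mult_map_scale_conv_mult[symmetric] map.rep_eq)
     (simp add: Poly_Mapping.map.rep_eq when_def)

lemma rscale_single [simp]: "rscale c (Poly_Mapping.single m d) = Poly_Mapping.single m (c * d)"
  by (simp add: rscale_def mult_single)

lemma mult_rscale [simp]: "x * rscale c y = rscale c (x * y)" "rscale c x * y = rscale c (x * y)"
  by (simp_all add: rscale_def algebra_simps)

lemma poly_mapping_induct [case_names zero single add]:
  fixes x :: "'a \<Rightarrow>\<^sub>0 'b::comm_monoid_add"
  assumes "P 0" and "\<And>m c. P (Poly_Mapping.single m c)" and "\<And>x y. P x \<Longrightarrow> P y \<Longrightarrow> P (x + y)"
  shows "P x"
proof (induction x rule: update_induct)
  case const
  show ?case by (rule assms)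
next
  case (update f a b)
  have "Poly_Mapping.update a b f = Poly_Mapping.single a b + f"
    using update.hyps
    by (intro poly_mapping_eqI) (auto simp: lookup_update lookup_add lookup_single in_keys_iff)
  with update assms show ?case by simp
qed

lemma sum_monomials: "(\<Sum>m\<in>Poly_Mapping.keys x. Poly_Mapping.single m (Poly_Mapping.lookup x m)) = x"
  by (rule poly_mapping_eqI)
     (auto simp: lookup_sum lookup_single in_keys_iff when_def)

text \<open>The map h embeds the rational scalars into the target: \<open>of_rat\<close> for the
  period, \<open>Poly_Mapping.single 0\<close> for the coaction and for maps on the tensor
  square.\<close>

definition lin_ext :: "(rat \<Rightarrow> 'r::comm_ring_1) \<Rightarrow> ('a \<Rightarrow> 'r) \<Rightarrow> ('a \<Rightarrow>\<^sub>0 rat) \<Rightarrow> 'r" where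
  "lin_ext h f x = (\<Sum>m\<in>Poly_Mapping.keys x. h (Poly_Mapping.lookup x m) * f m)"

locale rat_hom =
  fixes h :: "rat \<Rightarrow> 'r::comm_ring_1"
  assumes add: "h (a + b) = h a + h b" and mult: "h (a * b) = h a * h b" and one: "h 1 = 1"
begin

lemma zero: "h 0 = 0"
  using add[of 0 0] by simp

lemma lin_ext_superset:
  assumes "finite A" "Poly_Mapping.keys x \<subseteq> A"
  shows "lin_ext h f x = (\<Sum>m\<in>A. h (Poly_Mapping.lookup x m) * f m)"
  unfolding lin_ext_def
  by (rule sum.mono_neutral_left) (use assms in \<open>auto simp: in_keys_iff zero\<close>)

lemma lin_ext_0 [simp]: "lin_ext h f 0 = 0"
  by (simp add: lin_ext_def)

lemma lin_ext_single [simp]: "lin_ext h f (Poly_Mapping.single m c) = h c * f m"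
  by (simp add: lin_ext_def zero)

lemma lin_ext_add: "lin_ext h f (x + y) = lin_ext h f x + lin_ext h f y"
proof -
  let ?A = "Poly_Mapping.keys x \<union> Poly_Mapping.keys y"
  show ?thesis
    using keys_add[of x y]
    by (simp add: lin_ext_superset[of ?A] lookup_add add ring_distribs sum.distrib)
qed

lemma lin_ext_rscale: "lin_ext h f (rscale c x) = h c * lin_ext h f x"
  by (induction x rule: poly_mapping_induct)
     (simp_all add: lin_ext_add rvs.scale_right_distrib mult mult.assoc ring_distribs)

lemma lin_ext_1:
  assumes "f 0 = 1"
  shows "lin_ext h f 1 = 1"
  using assms by (simp add: lin_ext_def one)

lemma lin_ext_mult:
  assumes f: "\<And>m n. f (m + n) = f m * f n"
  shows "lin_ext h f (x * y) = lin_ext h f x * lin_ext h f y"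
proof (induction x rule: poly_mapping_induct)
  case (single m c)
  show ?case
    by (induction y rule: poly_mapping_induct)
       (simp_all add: mult_single lin_ext_add ring_distribs f mult algebra_simps)
qed (simp_all add: lin_ext_add ring_distribs)

end

interpretation id_hom: rat_hom "\<lambda>x. x"
  by unfold_locales auto
interpretation complex_of_rat_hom: rat_hom "of_rat :: rat \<Rightarrow> complex"
  by unfold_locales (auto simp: of_rat_add of_rat_mult)
interpretation single_hom: rat_hom "Poly_Mapping.single 0 :: rat \<Rightarrow> ('a::comm_monoid_add \<Rightarrow>\<^sub>0 rat)"
  by unfold_locales (auto simp: single_add mult_single)

definition functional :: "(('a::comm_monoid_add \<Rightarrow>\<^sub>0 rat) \<Rightarrow> rat) \<Rightarrow> bool" where
  "functional \<phi> \<longleftrightarrow> (\<forall>x y. \<phi> (x + y) = \<phi> x + \<phi> y) \<and> (\<forall>c x. \<phi> (rscale c x) = c * \<phi> x)"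

lemma functionalI:
  assumes "\<And>x y. \<phi> (x + y) = \<phi> x + \<phi> y" "\<And>c x. \<phi> (rscale c x) = c * \<phi> x"
  shows "functional \<phi>"
  using assms by (simp add: functional_def)

lemma functional_add: "functional \<phi> \<Longrightarrow> \<phi> (x + y) = \<phi> x + \<phi> y"
  and functional_rscale: "functional \<phi> \<Longrightarrow> \<phi> (rscale c x) = c * \<phi> x"
  by (simp_all add: functional_def)

lemma functional_0: "functional \<phi> \<Longrightarrow> \<phi> 0 = 0"
  using functional_rscale[of \<phi> 0 0] by simp

lemma functional_minus: "functional \<phi> \<Longrightarrow> \<phi> (- x) = - \<phi> x"
  using functional_rscale[of \<phi> "-1" x] by (simp add: rvs.scale_minus_left)

lemma functional_diff: "functional \<phi> \<Longrightarrow> \<phi> (x - y) = \<phi> x - \<phi> y"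
  using functional_add[of \<phi> x "- y"] functional_minus[of \<phi> y] by simp

lemma functional_sum: "functional \<phi> \<Longrightarrow> \<phi> (sum f A) = (\<Sum>a\<in>A. \<phi> (f a))"
  by (induction A rule: infinite_finite_induct) (simp_all add: functional_0 functional_add)

lemma functional_linear:
  "functional \<phi> \<longleftrightarrow> Vector_Spaces.linear rscale (*) \<phi>"
proof -
  have "vector_space ((*) :: rat \<Rightarrow> rat \<Rightarrow> rat)"
    by unfold_locales (auto simp: algebra_simps)
  then show ?thesis
    by (auto simp: functional_def Vector_Spaces.linear_iff vector_space_rscale)
qed

lemma dual_functional:
  fixes B :: "('a::comm_monoid_add \<Rightarrow>\<^sub>0 rat) set"
  assumes "rvs.independent B"
  shows "\<exists>\<phi>. functional \<phi> \<and> (\<forall>b\<in>B. \<phi> b = g b)"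
proof -
  interpret vector_space_pair "rscale :: rat \<Rightarrow> ('a \<Rightarrow>\<^sub>0 rat) \<Rightarrow> _" "(*) :: rat \<Rightarrow> rat \<Rightarrow> rat"
    by unfold_locales (auto simp: algebra_simps)
  show ?thesis
    using linear_construct[OF assms, of g] construct_basis[OF assms, of _ g]
    by (auto simp: functional_linear)
qed

lemma functional_zero_on_span:
  assumes "functional \<phi>" "\<And>x. x \<in> S \<Longrightarrow> \<phi> x = 0" "x \<in> rspan S"
  shows "\<phi> x = 0"
  using assms(3)
  by (induction rule: rvs.span_induct_alt)
     (use assms(1,2) in \<open>simp_all add: functional_0 functional_add functional_rscale\<close>)

lemma separating_functional:
  assumes "rsubspace S" "x \<notin> S"
  shows "\<exists>\<phi>. functional \<phi> \<and> (\<forall>y\<in>S. \<phi> y = 0) \<and> \<phi> x = 1"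
proof -
  obtain B where B: "B \<subseteq> S" "rvs.independent B" "S \<subseteq> rspan B"
    using rvs.maximal_independent_subset[of S] by auto
  have sp: "rspan B = S"
    using B assms(1) by (metis rvs.span_eq_iff rvs.span_mono subset_antisym)
  have "rvs.independent (insert x B)"
    using assms(2) B sp by (simp add: rvs.independent_insertI)
  from dual_functional[OF this, of "\<lambda>b. if b = x then 1 else 0"]
  obtain \<phi> where \<phi>: "functional \<phi>" "\<forall>b\<in>insert x B. \<phi> b = (if b = x then 1 else 0)"
    by blast
  have "x \<notin> B"
    using B(1) assms(2) by auto
  then have *: "\<phi> b = 0" if "b \<in> B" for b
    using \<phi>(2) that by auto
  have "\<phi> y = 0" if "y \<in> S" for y
    using functional_zero_on_span[OF \<phi>(1), of B y] * sp that by blast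
  with \<phi> show ?thesis by auto
qed


subsection \<open>Tensors and contractions\<close>

lemma tens_single: "tens (Poly_Mapping.single m c) (Poly_Mapping.single n d) = Poly_Mapping.single (m, n) (c * d)"
  by (simp add: tens_def)

lemma lookup_tens [simp]:
  "Poly_Mapping.lookup (tens x y) (m, n) = Poly_Mapping.lookup x m * Poly_Mapping.lookup y n"
proof -
  have "Poly_Mapping.lookup (tens x y) (m, n) =
      (\<Sum>m'\<in>Poly_Mapping.keys x. \<Sum>n'\<in>Poly_Mapping.keys y.
        (if m' = m then Poly_Mapping.lookup x m' else 0) * (if n' = n then Poly_Mapping.lookup y n' else 0))"
    unfolding tens_def lookup_sum by (intro sum.cong refl) (auto simp: lookup_single when_def)
  also have "\<dots> = (\<Sum>m'\<in>Poly_Mapping.keys x. if m' = m then Poly_Mapping.lookup x m' else 0)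
      * (\<Sum>n'\<in>Poly_Mapping.keys y. if n' = n then Poly_Mapping.lookup y n' else 0)"
    unfolding sum_product by (rule refl)
  also have "\<dots> = Poly_Mapping.lookup x m * Poly_Mapping.lookup y n"
    by (auto simp: in_keys_iff)
  finally show ?thesis .
qed

lemma formal2_eqI:
  fixes u v :: formal2
  assumes "\<And>m n. Poly_Mapping.lookup u (m, n) = Poly_Mapping.lookup v (m, n)"
  shows "u = v"
  by (rule poly_mapping_eqI) (use assms in auto)

lemma tens_0 [simp]: "tens 0 y = 0" "tens x 0 = 0"
  by (simp_all add: tens_def)

lemma tens_add_left: "tens (x + x') y = tens x y + tens x' y"
  by (rule formal2_eqI) (simp add: lookup_add algebra_simps)

lemma tens_add_right: "tens x (y + y') = tens x y + tens x y'"
  by (rule formal2_eqI) (simp add: lookup_add algebra_simps)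

lemma tens_rscale_left: "tens (rscale c x) y = rscale c (tens x y)"
  by (rule formal2_eqI) simp

lemma tens_rscale_right: "tens x (rscale c y) = rscale c (tens x y)"
  by (rule formal2_eqI) simp

lemma tens_minus_left: "tens (- x) y = - tens x y"
  using tens_rscale_left[of "-1" x y] by (simp add: rvs.scale_minus_left)

lemma tens_minus_right: "tens x (- y) = - tens x y"
  using tens_rscale_right[of x "-1" y] by (simp add: rvs.scale_minus_left)

lemma tens_diff_left: "tens (x - x') y = tens x y - tens x' y"
  using tens_add_left[of x "- x'" y] by (simp add: tens_minus_left)

lemma tens_diff_right: "tens x (y - y') = tens x y - tens x y'"
  using tens_add_right[of x y "- y'"] by (simp add: tens_minus_right)

lemma tens_sum_left: "tens (sum f A) y = (\<Sum>a\<in>A. tens (f a) y)"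
  by (induction A rule: infinite_finite_induct) (simp_all add: tens_add_left)

lemma tens_mult: "tens x y * tens x' y' = tens (x * x') (y * y')"
proof (induction x rule: poly_mapping_induct)
  case (single m c)
  show ?case
  proof (induction y rule: poly_mapping_induct)
    case (single n d)
    show ?case
    proof (induction x' rule: poly_mapping_induct)
      case (single m' c')
      show ?case
        by (induction y' rule: poly_mapping_induct)
           (simp_all add: tens_single mult_single tens_add_right ring_distribs mult_ac)
    qed (simp_all add: tens_add_left ring_distribs)
  qed (simp_all add: tens_add_right ring_distribs)
qed (simp_all add: tens_add_left ring_distribs)

lemma tens_1_1: "tens 1 1 = 1"
  using tens_single[of 0 1 0 1] by (simp add: zero_prod_def[symmetric])

lemma formal2_induct [case_names zero tens add]:
  fixes u :: formal2
  assumes "P 0" and "\<And>m c n. P (tens (Poly_Mapping.single m c) (Poly_Mapping.single n 1))"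
    and "\<And>x y. P x \<Longrightarrow> P y \<Longrightarrow> P (x + y)"
  shows "P u"
proof (induction u rule: poly_mapping_induct)
  case (single m c)
  show ?case
    using assms(2)[of "fst m" c "snd m"] by (simp add: tens_single)
qed (use assms in auto)

text \<open>This is \<phi> tensored with the identity. If \<phi> vanishes on K, it maps
  \<open>tens_ker N K M\<close> into M, and \<open>tens_ker_if_contract\<close> is the converse;
  together they replace calculations in tensor products of quotients.\<close>

definition contract :: "(formal \<Rightarrow> rat) \<Rightarrow> formal2 \<Rightarrow> formal" where
  "contract \<phi> = lin_ext (Poly_Mapping.single 0)
     (\<lambda>(m, n). Poly_Mapping.single n (\<phi> (Poly_Mapping.single m 1)))"

lemma contract_0 [simp]: "contract \<phi> 0 = 0"
  by (simp add: contract_def)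

lemma contract_add: "contract \<phi> (u + v) = contract \<phi> u + contract \<phi> v"
  by (simp add: contract_def single_hom.lin_ext_add)

lemma contract_rscale: "contract \<phi> (rscale c u) = rscale c (contract \<phi> u)"
  unfolding contract_def single_hom.lin_ext_rscale by (simp add: rscale_def)

lemma contract_minus: "contract \<phi> (- u) = - contract \<phi> u"
  using contract_rscale[of \<phi> "-1" u] by (simp add: rvs.scale_minus_left)

lemma contract_diff: "contract \<phi> (u - v) = contract \<phi> u - contract \<phi> v"
  using contract_add[of \<phi> u "- v"] by (simp add: contract_minus)

lemma contract_sum: "contract \<phi> (sum f A) = (\<Sum>a\<in>A. contract \<phi> (f a))"
  by (induction A rule: infinite_finite_induct) (simp_all add: contract_add)

lemma contract_tens:
  assumes "functional \<phi>"
  shows "contract \<phi> (tens x y) = rscale (\<phi> x) y"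
proof (induction x rule: poly_mapping_induct)
  case (single m c)
  have *: "\<phi> (Poly_Mapping.single m c) = c * \<phi> (Poly_Mapping.single m 1)"
    using functional_rscale[OF assms, of c "Poly_Mapping.single m 1"] by simp
  show ?case
    by (induction y rule: poly_mapping_induct)
       (simp_all add: tens_single tens_add_right contract_add rvs.scale_right_distrib,
        simp_all add: contract_def mult_single * mult_ac)
qed (use assms in \<open>simp_all add: tens_add_left contract_add functional_add functional_0 rvs.scale_left_distrib\<close>)

lemma functional_mult: "functional \<phi> \<Longrightarrow> functional (\<lambda>z. \<phi> (x * z))"
  by (rule functionalI) (simp_all add: ring_distribs functional_add functional_rscale)

lemma contract_mult_left:
  assumes "functional \<phi>"
  shows "contract \<phi> (tens x 1 * u) = contract (\<lambda>z. \<phi> (x * z)) u"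
  by (induction u rule: formal2_induct)
     (simp_all add: tens_mult contract_tens assms functional_mult contract_add ring_distribs del: lookup_rscale)

lemma contract_mult_right:
  assumes "functional \<phi>"
  shows "contract \<phi> (tens 1 y * u) = y * contract \<phi> u"
  by (induction u rule: formal2_induct)
     (simp_all only: tens_mult contract_tens[OF assms] contract_add contract_0 ring_distribs mult_rscale mult_1_left mult_zero_right)

definition okm :: "nat \<Rightarrow> complex list multiset \<Rightarrow> bool" where
  "okm N m \<longleftrightarrow> (\<forall>w \<in># m. w \<noteq> [] \<and> set w \<subseteq> insert 0 (unit_roots N))"

lemma formals_okm: "formals N = {x. \<forall>m \<in> Poly_Mapping.keys x. okm N m}"
  by (simp add: formals_def okm_def)

lemma okm_0 [simp]: "okm N 0" and okm_empty [simp]: "okm N {#}"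
  and okm_add [simp]: "okm N (m + n) \<longleftrightarrow> okm N m \<and> okm N n"
  by (auto simp: okm_def)

lemma formals_0 [simp]: "0 \<in> formals N"
  and formals_1 [simp]: "1 \<in> formals N"
  by (simp_all add: formals_okm)

lemma formals_single [simp]: "okm N m \<Longrightarrow> Poly_Mapping.single m c \<in> formals N"
  by (simp add: formals_okm)

lemma formals_add: "x \<in> formals N \<Longrightarrow> y \<in> formals N \<Longrightarrow> x + y \<in> formals N"
  using keys_add[of x y] by (auto simp: formals_okm)

lemma formals_rscale: "x \<in> formals N \<Longrightarrow> rscale c x \<in> formals N"
  by (auto simp: formals_okm in_keys_iff)

lemma formals_mult: "x \<in> formals N \<Longrightarrow> y \<in> formals N \<Longrightarrow> x * y \<in> formals N"
  using keys_mult[of x y] by (auto simp: formals_okm dest!: subsetD)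

lemma subspace_formals: "rsubspace (formals N)"
  by (simp add: rvs.subspace_def formals_add formals_rscale)

lemmas formals_minus = rvs.subspace_neg[OF subspace_formals]
lemmas formals_diff = rvs.subspace_diff[OF subspace_formals]
lemmas formals_sum = rvs.subspace_sum[OF subspace_formals]

lemma formals_prod: "(\<And>a. a \<in> A \<Longrightarrow> f a \<in> formals N) \<Longrightarrow> prod f A \<in> formals N"
  by (induction A rule: infinite_finite_induct) (simp_all add: formals_mult)

lemma formals_power: "x \<in> formals N \<Longrightarrow> x ^ n \<in> formals N"
  by (induction n) (simp_all add: formals_mult)

lemma I01_formals: "set w \<subseteq> insert 0 (unit_roots N) \<Longrightarrow> I01 w \<in> formals N"
  by (simp add: I01_def okm_def)

definition formals2 :: "nat \<Rightarrow> formal2 set" where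
  "formals2 N = {u. \<forall>(m, n) \<in> Poly_Mapping.keys u. okm N m \<and> okm N n}"

lemma subspace_formals2: "rsubspace (formals2 N)"
  unfolding rvs.subspace_def
proof (intro conjI ballI allI)
  fix u v assume "u \<in> formals2 N" "v \<in> formals2 N"
  then show "u + v \<in> formals2 N"
    using keys_add[of u v] unfolding formals2_def by blast
qed (auto simp: formals2_def in_keys_iff)

lemma formals2_mult: "u \<in> formals2 N \<Longrightarrow> v \<in> formals2 N \<Longrightarrow> u * v \<in> formals2 N"
  using keys_mult[of u v] unfolding formals2_def by (auto dest!: subsetD)

lemma formals2_tens: "x \<in> formals N \<Longrightarrow> y \<in> formals N \<Longrightarrow> tens x y \<in> formals2 N"
  unfolding formals2_def formals_okm by (auto simp: in_keys_iff)

lemma formals2_1: "1 \<in> formals2 N"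
  using formals2_tens[of 1 N 1] by (simp add: tens_1_1)

lemma formals2_induct [consumes 1, case_names zero tens add]:
  assumes "u \<in> formals2 N"
    and "P 0" and "\<And>x y. x \<in> formals N \<Longrightarrow> y \<in> formals N \<Longrightarrow> P (tens x y)"
    and "\<And>u v. P u \<Longrightarrow> P v \<Longrightarrow> P (u + v)"
  shows "P u"
proof -
  have sum: "P (sum g A)" if "finite A" "\<And>a. a \<in> A \<Longrightarrow> P (g a)" for g and A :: "(complex list multiset \<times> complex list multiset) set"
    using that
  proof (induction A rule: finite_induct)
    case (insert a A)
    then have "P (g a + sum g A)" by (intro assms(4)) auto
    with insert show ?case by simp
  qed (use assms(2) in simp)
  have "P (\<Sum>mn\<in>Poly_Mapping.keys u. Poly_Mapping.single mn (Poly_Mapping.lookup u mn))"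
  proof (rule sum)
    fix mn assume mn: "mn \<in> Poly_Mapping.keys u"
    obtain m n where "mn = (m, n)" by (cases mn)
    with mn assms(1) have "okm N m" "okm N n"
      by (auto simp: formals2_def)
    then have "P (tens (Poly_Mapping.single m (Poly_Mapping.lookup u mn)) (Poly_Mapping.single n 1))"
      by (intro assms) simp_all
    then show "P (Poly_Mapping.single mn (Poly_Mapping.lookup u mn))"
      by (simp add: tens_single \<open>mn = (m, n)\<close>)
  qed simp
  then show ?thesis by (simp add: sum_monomials)
qed

definition fideal :: "nat \<Rightarrow> formal set \<Rightarrow> bool" where
  "fideal N K \<longleftrightarrow> K \<subseteq> formals N \<and> rsubspace K \<and> (\<forall>x \<in> formals N. \<forall>y \<in> K. x * y \<in> K)"

lemma subspace_tens_ker: "rsubspace (tens_ker N K M)"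
  by (simp add: tens_ker_def)

lemma tens_kerL: "x \<in> K \<Longrightarrow> y \<in> formals N \<Longrightarrow> tens x y \<in> tens_ker N K M"
  and tens_kerR: "x \<in> formals N \<Longrightarrow> y \<in> M \<Longrightarrow> tens x y \<in> tens_ker N K M"
  unfolding tens_ker_def by (rule rvs.span_base; blast)+

lemma tens_ker_induct [consumes 3, case_names zero left right add]:
  assumes "u \<in> tens_ker N K M" "rsubspace K" "rsubspace M"
    and "P 0" and "\<And>x y. x \<in> K \<Longrightarrow> y \<in> formals N \<Longrightarrow> P (tens x y)"
    and "\<And>x y. x \<in> formals N \<Longrightarrow> y \<in> M \<Longrightarrow> P (tens x y)"
    and "\<And>u v. P u \<Longrightarrow> P v \<Longrightarrow> P (u + v)"
  shows "P u"
  using assms(1) unfolding tens_ker_def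
proof (induction rule: rvs.span_induct_alt)
  case (step c x u)
  from step(1) have "P (rscale c x)"
  proof safe
    fix x y assume "x \<in> K" "y \<in> formals N"
    then have "P (tens (rscale c x) y)"
      by (intro assms(5) rvs.subspace_scale[OF assms(2)])
    then show "P (rscale c (tens x y))" by (simp add: tens_rscale_left)
  next
    fix x y assume "x \<in> formals N" "y \<in> M"
    then have "P (tens (rscale c x) y)"
      by (intro assms(6) formals_rscale)
    then show "P (rscale c (tens x y))" by (simp add: tens_rscale_left)
  qed
  with step show ?case using assms(7) by blast
qed (rule assms)

lemma tens_ker_mono: "K \<subseteq> K' \<Longrightarrow> M \<subseteq> M' \<Longrightarrow> tens_ker N K M \<subseteq> tens_ker N K' M'"
  unfolding tens_ker_def by (rule rvs.span_mono) blast

lemma contract_tens_ker: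
  assumes "u \<in> tens_ker N K M" "functional \<phi>" "\<And>x. x \<in> K \<Longrightarrow> \<phi> x = 0" "rsubspace K" "rsubspace M"
  shows "contract \<phi> u \<in> M"
  using assms(1,4,5)
  by (induction rule: tens_ker_induct)
     (simp_all add: assms contract_tens contract_add rvs.subspace_0 rvs.subspace_add rvs.subspace_scale)

lemma tens_ker_mult:
  assumes "u \<in> tens_ker N K M" "v \<in> formals2 N" "fideal N K" "fideal N M"
  shows "u * v \<in> tens_ker N K M"
proof -
  note sub = rvs.subspace_add[OF subspace_tens_ker] rvs.subspace_0[OF subspace_tens_ker]
  have K: "rsubspace K" "rsubspace M" using assms by (auto simp: fideal_def)
  have K': "x * y \<in> K" if "x \<in> K" "y \<in> formals N" for x y
    using that assms(3) by (metis fideal_def mult.commute)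
  have M': "x * y \<in> M" if "x \<in> M" "y \<in> formals N" for x y
    using that assms(4) by (metis fideal_def mult.commute)
  show ?thesis
  proof (rule tens_ker_induct[OF assms(1) K], goal_cases zero left right add)
    case (left x y)
    show ?case using assms(2)
      by (induction rule: formals2_induct)
         (use left in \<open>auto simp: tens_mult ring_distribs sub intro: tens_kerL formals_mult K'\<close>)
  next
    case (right x y)
    show ?case using assms(2)
      by (induction rule: formals2_induct)
         (use right in \<open>auto simp: tens_mult ring_distribs sub intro: tens_kerR formals_mult M'\<close>)
  qed (simp_all add: ring_distribs sub)
qed

text \<open>A basis of \<open>K\<close>, extended to one of \<^term>\<open>formals N\<close>, expands \<open>u\<close>
  into \<open>\<Sum> tens b (y b)\<close>, and the dual functionals read off the \<open>y b\<close>.\<close>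

lemma tens_ker_if_contract:
  assumes u: "u \<in> formals2 N" and K: "rsubspace K" "K \<subseteq> formals N"
    and *: "\<And>\<phi>. functional \<phi> \<Longrightarrow> (\<And>x. x \<in> K \<Longrightarrow> \<phi> x = 0) \<Longrightarrow> contract \<phi> u \<in> M"
  shows "u \<in> tens_ker N K M"
proof -
  obtain B where B: "B \<subseteq> K" "rvs.independent B" "K \<subseteq> rspan B"
    using rvs.maximal_independent_subset[of K] by auto
  obtain B' where B': "B \<subseteq> B'" "B' \<subseteq> formals N" "rvs.independent B'" "formals N \<subseteq> rspan B'"
    using rvs.maximal_independent_subset_extend[of B "formals N"] B K(2) by blast
  have "\<exists>F y. finite F \<and> F \<subseteq> B' \<and> (\<forall>b. y b \<in> formals N) \<and> u = (\<Sum>b\<in>F. tens b (y b))"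
    using u
  proof (induction rule: formals2_induct)
    case zero
    show ?case by (rule exI[of _ "{}"], rule exI[of _ "\<lambda>_. 0"]) simp
  next
    case (tens x y)
    then have "x \<in> rspan B'" using B' by blast
    then obtain F r where F: "finite F" "F \<subseteq> B'" "x = (\<Sum>b\<in>F. rscale (r b) b)"
      by (auto simp: rvs.span_explicit)
    then show ?case
      by (intro exI[of _ F] exI[of _ "\<lambda>b. rscale (r b) y"])
         (use tens in \<open>simp add: formals_rscale tens_sum_left tens_rscale_left tens_rscale_right\<close>)
  next
    case (add u v)
    from add(1) obtain F y where Fy: "finite F" "F \<subseteq> B'" "\<forall>b. y b \<in> formals N" "u = (\<Sum>b\<in>F. tens b (y b))"
      by blast
    from add(2) obtain G z where Gz: "finite G" "G \<subseteq> B'" "\<forall>b. z b \<in> formals N" "v = (\<Sum>b\<in>G. tens b (z b))"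
      by blast
    let ?y = "\<lambda>b. (if b \<in> F then y b else 0) + (if b \<in> G then z b else 0)"
    have "u + v = (\<Sum>b\<in>F \<union> G. tens b (?y b))"
    proof -
      have "u = (\<Sum>b\<in>F \<union> G. tens b (if b \<in> F then y b else 0))"
        unfolding Fy by (rule sum.mono_neutral_cong_left) (use Fy Gz in auto)
      moreover have "v = (\<Sum>b\<in>F \<union> G. tens b (if b \<in> G then z b else 0))"
        unfolding Gz by (rule sum.mono_neutral_cong_left) (use Fy Gz in auto)
      ultimately show ?thesis by (simp only: tens_add_right sum.distrib)
    qed
    with Fy Gz show ?case
      by (intro exI[of _ "F \<union> G"] exI[of _ ?y]) (auto intro: formals_add)
  qed
  then obtain F y where F: "finite F" "F \<subseteq> B'" "\<And>b. y b \<in> formals N" "u = (\<Sum>b\<in>F. tens b (y b))"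
    by blast
  have "tens b (y b) \<in> tens_ker N K M" if b: "b \<in> F" for b
  proof (cases "b \<in> B")
    case True
    then show ?thesis using B(1) F(3) by (blast intro: tens_kerL)
  next
    case False
    obtain \<phi> where \<phi>: "functional \<phi>" "\<forall>c\<in>B'. \<phi> c = (if c = b then 1 else 0)"
      using dual_functional[OF B'(3), of "\<lambda>c. if c = b then 1 else 0"] by blast
    have "\<phi> c = 0" if "c \<in> B" for c
      using \<phi>(2) that False B'(1) by auto
    then have "contract \<phi> u \<in> M"
      using B(3) by (intro * \<phi>(1)) (blast intro: functional_zero_on_span[OF \<phi>(1)])
    also have "contract \<phi> u = (\<Sum>c\<in>F. if c = b then y c else 0)"
      unfolding F(4) contract_sum contract_tens[OF \<phi>(1)]
      using \<phi>(2) F(2) by (intro sum.cong refl) auto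
    also have "\<dots> = y b"
      using F(1) b by simp
    finally show ?thesis
      using F(2) B'(2) b by (blast intro: tens_kerR)
  qed
  then show ?thesis
    unfolding F(4) by (rule rvs.subspace_sum[OF subspace_tens_ker])
qed


subsection \<open>The coaction and the period are ring homomorphisms\<close>

lemma coact_eq_lin_ext: "coact x = lin_ext (Poly_Mapping.single 0) (\<lambda>m. \<Prod>w\<in>#m. coact_word w) x"
  by (simp add: coact_def lin_ext_def rscale_def)

lemma coact_add: "coact (x + y) = coact x + coact y"
  by (simp add: coact_eq_lin_ext single_hom.lin_ext_add)

lemma coact_rscale: "coact (rscale c x) = rscale c (coact x)"
  unfolding coact_eq_lin_ext single_hom.lin_ext_rscale by (simp add: rscale_def)

lemma coact_0 [simp]: "coact 0 = 0"
  by (simp add: coact_def)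

lemma coact_minus: "coact (- x) = - coact x"
  using coact_rscale[of "-1" x] by (simp add: rvs.scale_minus_left)

lemma coact_diff: "coact (x - y) = coact x - coact y"
  using coact_add[of x "- y"] by (simp add: coact_minus)

lemma coact_sum: "coact (sum f A) = (\<Sum>a\<in>A. coact (f a))"
  by (induction A rule: infinite_finite_induct) (simp_all add: coact_add)

lemma coact_1 [simp]: "coact 1 = 1"
  unfolding coact_eq_lin_ext by (rule single_hom.lin_ext_1) simp

lemma coact_mult: "coact (x * y) = coact x * coact y"
  unfolding coact_eq_lin_ext by (rule single_hom.lin_ext_mult) simp

lemma coact_single: "coact (Poly_Mapping.single m c) = rscale c (\<Prod>w\<in>#m. coact_word w)"
  by (simp add: coact_eq_lin_ext rscale_def)

lemma coact_I01: "w \<noteq> [] \<Longrightarrow> coact (I01 w) = coact_word w"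
  by (simp add: I01_def coact_single rscale_def)

lemma period_eq_lin_ext: "period x = lin_ext of_rat (\<lambda>m. \<Prod>w\<in>#m. reg_int w) x"
  by (simp add: period_def lin_ext_def)

lemma period_add: "period (x + y) = period x + period y"
  by (simp add: period_eq_lin_ext complex_of_rat_hom.lin_ext_add)

lemma period_rscale: "period (rscale c x) = of_rat c * period x"
  by (simp add: period_eq_lin_ext complex_of_rat_hom.lin_ext_rscale)

lemma period_0 [simp]: "period 0 = 0"
  by (simp add: period_def)

lemma period_minus: "period (- x) = - period x"
  using period_rscale[of "-1" x] by (simp add: rvs.scale_minus_left)

lemma period_diff: "period (x - y) = period x - period y"
  using period_add[of x "- y"] by (simp add: period_minus)

lemma period_1 [simp]: "period 1 = 1"
  unfolding period_eq_lin_ext by (rule complex_of_rat_hom.lin_ext_1) simp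

lemma period_mult: "period (x * y) = period x * period y"
  unfolding period_eq_lin_ext by (rule complex_of_rat_hom.lin_ext_mult) simp

lemma period_power: "period (x ^ n) = period x ^ n"
  by (induction n) (simp_all add: period_mult)

lemma period_I01: "w \<noteq> [] \<Longrightarrow> period (I01 w) = reg_int w"
  by (simp add: I01_def period_eq_lin_ext)


subsection \<open>The weight grading\<close>

lemma weight_0 [simp]: "weight 0 = 0" "weight {#} = 0"
  and weight_add [simp]: "weight (m + n) = weight m + weight n"
  by (simp_all add: weight_def)

lemma lookup_weight_part [simp]:
  "Poly_Mapping.lookup (weight_part n x) m = (if weight m = n then Poly_Mapping.lookup x m else 0)"
  unfolding weight_part_def lookup_sum
  by (auto simp: lookup_single when_def in_keys_iff intro!: sum.neutral)

lemma weight_part_add: "weight_part n (x + y) = weight_part n x + weight_part n y"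
  and weight_part_rscale: "weight_part n (rscale c x) = rscale c (weight_part n x)"
  and weight_part_0 [simp]: "weight_part n 0 = 0"
  by (rule poly_mapping_eqI; simp add: lookup_add)+

lemma weight_part_minus: "weight_part n (- x) = - weight_part n x"
  and weight_part_diff: "weight_part n (x - y) = weight_part n x - weight_part n y"
  by (rule poly_mapping_eqI; simp add: lookup_minus)+

lemma weight_part_formals: "x \<in> formals N \<Longrightarrow> weight_part n x \<in> formals N"
  by (auto simp: formals_okm in_keys_iff split: if_splits)

definition homog :: "nat \<Rightarrow> formal \<Rightarrow> bool" where
  "homog d x \<longleftrightarrow> (\<forall>m \<in> Poly_Mapping.keys x. weight m = d)"

lemma homog_weight_part [simp]: "homog n (weight_part n x)"
  by (auto simp: homog_def in_keys_iff split: if_splits)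

lemma weight_part_homog: "homog d x \<Longrightarrow> weight_part n x = (if n = d then x else 0)"
  by (rule poly_mapping_eqI) (auto simp: homog_def in_keys_iff)

lemma homog_0 [simp]: "homog d 0"
  and homog_1 [simp]: "homog 0 1"
  and homog_single: "weight m = d \<Longrightarrow> homog d (Poly_Mapping.single m c)"
  by (simp_all add: homog_def)

lemma homog_add: "homog d x \<Longrightarrow> homog d y \<Longrightarrow> homog d (x + y)"
  using keys_add[of x y] by (auto simp: homog_def)

lemma homog_rscale: "homog d x \<Longrightarrow> homog d (rscale c x)"
  by (auto simp: homog_def in_keys_iff)

lemma homog_minus: "homog d x \<Longrightarrow> homog d (- x)"
  and homog_diff: "homog d x \<Longrightarrow> homog d y \<Longrightarrow> homog d (x - y)"
  by (auto simp: homog_def in_keys_iff lookup_minus)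

lemma homog_mult: "homog d x \<Longrightarrow> homog e y \<Longrightarrow> homog (d + e) (x * y)"
  using keys_mult[of x y] by (auto simp: homog_def dest!: subsetD)

lemma homog_power: "homog d x \<Longrightarrow> homog (n * d) (x ^ n)"
  by (induction n) (auto dest: homog_mult)

lemma homog_I01: "homog (length w) (I01 w)"
  by (auto simp: I01_def homog_def weight_def)

lemma weight_part_mult_homog:
  assumes "homog d x"
  shows "weight_part n (x * y) = (if d \<le> n then x * weight_part (n - d) y else 0)"
proof (induction y rule: poly_mapping_induct)
  case (single m c)
  have "homog (d + weight m) (x * Poly_Mapping.single m c)"
    by (intro homog_mult assms homog_single refl)
  moreover have "homog (weight m) (Poly_Mapping.single m c)"
    by (intro homog_single refl)
  ultimately show ?case
    by (auto simp: weight_part_homog)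
qed (auto simp: weight_part_add ring_distribs)

text \<open>Words inside a monomial of \<open>formals N\<close> are nonempty, so the empty monomial
  is the only one of weight 0.\<close>

lemma homog_0_iff:
  assumes "homog 0 x" "x \<in> formals N"
  shows "x = rscale (Poly_Mapping.lookup x 0) 1"
proof (rule poly_mapping_eqI)
  fix m
  have "m = 0" if "m \<in> Poly_Mapping.keys x"
  proof -
    have "okm N m" "weight m = 0"
      using that assms by (auto simp: homog_def formals_okm)
    then show ?thesis
      by (cases m) (auto simp: okm_def weight_def)
  qed
  then show "Poly_Mapping.lookup x m = Poly_Mapping.lookup (rscale (Poly_Mapping.lookup x 0) 1) m"
    by (auto simp: lookup_one when_def in_keys_iff)
qed

subsection \<open>The ideal of motivic relations\<close>

lemma unit_roots_mult: "x \<in> unit_roots N \<Longrightarrow> y \<in> unit_roots N \<Longrightarrow> x * y \<in> unit_roots N"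
  and unit_roots_divide: "x \<in> unit_roots N \<Longrightarrow> y \<in> unit_roots N \<Longrightarrow> x / y \<in> unit_roots N"
  and unit_roots_inverse: "x \<in> unit_roots N \<Longrightarrow> inverse x \<in> unit_roots N"
  and unit_roots_1 [simp]: "1 \<in> unit_roots N"
  by (auto simp: unit_roots_def power_mult_distrib power_divide power_inverse)

lemma eps_unit_root: "N > 0 \<Longrightarrow> eps N \<in> unit_roots N"
  by (auto simp: eps_def unit_roots_def simp flip: exp_of_nat_mult)

lemma mzv_word_letters:
  assumes "\<And>n e. (n, e) \<in> set l \<Longrightarrow> e \<in> unit_roots N"
  shows "set (mzv_word l) \<subseteq> insert 0 (unit_roots N) \<and> prod_list (map snd l) \<in> unit_roots N"
  using assms
proof (induction l)
  case (Cons ne l)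
  obtain n e where "ne = (n, e)" by (cases ne)
  with Cons have "e \<in> unit_roots N" "set (mzv_word l) \<subseteq> insert 0 (unit_roots N)"
    "prod_list (map snd l) \<in> unit_roots N" by auto
  with \<open>ne = (n, e)\<close> show ?case
    by (auto intro!: unit_roots_mult unit_roots_inverse simp del: inverse_mult_distrib)
qed simp

lemma formals_numeral: "(- 1) ^ n \<in> formals N"
  by (intro formals_power formals_minus formals_1)

lemma zeta_m_formals:
  assumes "\<And>n e. (n, e) \<in> set l \<Longrightarrow> e \<in> unit_roots N"
  shows "zeta_m l \<in> formals N"
  unfolding zeta_m_def using mzv_word_letters[OF assms]
  by (intro formals_mult formals_numeral I01_formals) auto

lemma tate_formals: "N > 0 \<Longrightarrow> tate_elt N \<in> formals N"
  unfolding tate_elt_def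
  by (auto intro!: zeta_m_formals formals_diff eps_unit_root unit_roots_inverse)

lemma fidealD:
  assumes "fideal N K"
  shows "K \<subseteq> formals N" "rsubspace K" "\<And>x y. x \<in> formals N \<Longrightarrow> y \<in> K \<Longrightarrow> x * y \<in> K"
    "\<And>x y. x \<in> K \<Longrightarrow> y \<in> formals N \<Longrightarrow> x * y \<in> K"
proof -
  show "K \<subseteq> formals N" "rsubspace K" "\<And>x y. x \<in> formals N \<Longrightarrow> y \<in> K \<Longrightarrow> x * y \<in> K"
    using assms by (auto simp: fideal_def)
  then show "\<And>x y. x \<in> K \<Longrightarrow> y \<in> formals N \<Longrightarrow> x * y \<in> K"
    by (metis mult.commute)
qed

lemma graded_ideal_iff: "graded_ideal N K \<longleftrightarrow> fideal N K \<and> (\<forall>x \<in> K. \<forall>n. weight_part n x \<in> K)"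
  by (auto simp: graded_ideal_def fideal_def)

definition isum :: "formal set \<Rightarrow> formal set \<Rightarrow> formal set" where
  "isum K M = {x + y | x y. x \<in> K \<and> y \<in> M}"

lemma isumI: "x \<in> K \<Longrightarrow> y \<in> M \<Longrightarrow> x + y \<in> isum K M"
  and isumE: "z \<in> isum K M \<Longrightarrow> (\<And>x y. z = x + y \<Longrightarrow> x \<in> K \<Longrightarrow> y \<in> M \<Longrightarrow> P) \<Longrightarrow> P"
  unfolding isum_def by blast+

lemma fideal_isum:
  assumes "fideal N K" "fideal N M"
  shows "fideal N (isum K M)"
  unfolding fideal_def
proof (intro conjI ballI subsetI)
  show "rsubspace (isum K M)"
    unfolding isum_def using assms by (intro rvs.subspace_sums) (auto simp: fideal_def)
next
  fix z assume "z \<in> isum K M"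
  then show "z \<in> formals N"
    using assms by (auto elim!: isumE intro!: formals_add simp: fideal_def)
next
  fix x z assume "x \<in> formals N" "z \<in> isum K M"
  then show "x * z \<in> isum K M"
    using assms by (auto elim!: isumE intro!: isumI simp: fideal_def ring_distribs)
qed

lemma fideal_principal:
  assumes "g \<in> formals N"
  shows "fideal N {g * y | y. y \<in> formals N}"
  unfolding fideal_def rvs.subspace_def
proof (safe, goal_cases)
  case 2
  show ?case by (rule exI[of _ 0]) simp
next
  case (3 _ _ y z)
  then show ?case by (intro exI[of _ "y + z"]) (auto simp: ring_distribs formals_add)
next
  case (4 c _ y)
  then show ?case by (intro exI[of _ "rscale c y"]) (auto simp: formals_rscale)
next
  case (5 x _ y)
  then show ?case by (intro exI[of _ "x * y"]) (auto simp: formals_mult)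
qed (auto intro: formals_mult assms)

lemma plus_tate_isum: "plus_tate N K = isum K {tate_elt N * y | y. y \<in> formals N}"
  unfolding plus_tate_def isum_def by blast

lemma fideal_plus_tate: "N > 0 \<Longrightarrow> fideal N K \<Longrightarrow> fideal N (plus_tate N K)"
  unfolding plus_tate_isum by (intro fideal_isum fideal_principal tate_formals)

lemma plus_tate_mono: "K \<subseteq> K' \<Longrightarrow> plus_tate N K \<subseteq> plus_tate N K'"
  unfolding plus_tate_def by blast

lemma plus_tate_superset: "K \<subseteq> plus_tate N K"
proof
  fix x assume "x \<in> K"
  then show "x \<in> plus_tate N K"
    unfolding plus_tate_def by (intro CollectI exI[of _ x] exI[of _ 0]) simp
qed

lemma plus_tateI: "x \<in> K \<Longrightarrow> y \<in> formals N \<Longrightarrow> x + tate_elt N * y \<in> plus_tate N K"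
  unfolding plus_tate_def by blast

definition admissible :: "nat \<Rightarrow> formal set \<Rightarrow> bool" where
  "admissible N K \<longleftrightarrow> graded_ideal N K \<and> (\<forall>x \<in> K. period x = 0) \<and>
     (\<forall>x \<in> K. coact x \<in> tens_ker N (plus_tate N K) K)"

lemma motivic_relations_eq: "motivic_relations N = \<Union> {K. admissible N K}"
  by (simp add: motivic_relations_def admissible_def)

lemma admissible_isum:
  assumes "admissible N K" "admissible N M"
  shows "admissible N (isum K M)"
proof -
  have K: "fideal N K" "fideal N M"
    using assms by (auto simp: admissible_def graded_ideal_iff)
  have sup: "K \<subseteq> isum K M" "M \<subseteq> isum K M"
    using isumI[of _ K 0 M] isumI[of 0 K _ M] rvs.subspace_0[OF fidealD(2)[OF K(1)]]
      rvs.subspace_0[OF fidealD(2)[OF K(2)]] by auto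
  have co: "coact x \<in> tens_ker N (plus_tate N (isum K M)) (isum K M)" if "x \<in> K \<or> x \<in> M" for x
    using that assms subsetD[OF tens_ker_mono[OF plus_tate_mono[OF sup(1)] sup(1)]]
      subsetD[OF tens_ker_mono[OF plus_tate_mono[OF sup(2)] sup(2)]] by (auto simp: admissible_def)
  show ?thesis
    unfolding admissible_def graded_ideal_iff
  proof (intro conjI fideal_isum K ballI allI)
    fix z n assume "z \<in> isum K M"
    then obtain x y where z: "z = x + y" "x \<in> K" "y \<in> M" by (rule isumE)
    then show "weight_part n z \<in> isum K M" "period z = 0"
      using assms by (auto simp: admissible_def graded_ideal_iff weight_part_add period_add intro!: isumI)
    show "coact z \<in> tens_ker N (plus_tate N (isum K M)) (isum K M)"
      unfolding z coact_add using z by (intro rvs.subspace_add[OF subspace_tens_ker] co) auto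
  qed
qed

lemma admissible_0: "admissible N {0}"
  unfolding admissible_def graded_ideal_iff fideal_def
  by (auto simp: rvs.subspace_0[OF subspace_tens_ker])

lemma admissible_le: "admissible N K \<Longrightarrow> K \<subseteq> motivic_relations N"
  unfolding motivic_relations_eq by blast

lemma admissible_motivic_relations: "admissible N (motivic_relations N)" (is "admissible N ?J")
proof -
  have ad: "\<exists>K. admissible N K \<and> x \<in> K" if "x \<in> ?J" for x
    using that unfolding motivic_relations_eq by blast
  have sub: "rsubspace ?J"
    unfolding rvs.subspace_def
  proof (intro conjI ballI allI)
    show "0 \<in> ?J" using admissible_le[OF admissible_0] by blast
    fix x y assume "x \<in> ?J" "y \<in> ?J"
    then obtain K M where "admissible N K" "x \<in> K" "admissible N M" "y \<in> M" using ad by metis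
    with admissible_le[OF admissible_isum[of N K M]] isumI[of x K y M] show "x + y \<in> ?J" by blast
  next
    fix c x assume "x \<in> ?J"
    then obtain K where K: "admissible N K" "x \<in> K" using ad by metis
    then have "rscale c x \<in> K" by (auto simp: admissible_def graded_ideal_def rvs.subspace_scale)
    with K admissible_le show "rscale c x \<in> ?J" by blast
  qed
  have "x \<in> formals N \<and> (\<forall>y\<in>formals N. y * x \<in> ?J) \<and> (\<forall>n. weight_part n x \<in> ?J) \<and> period x = 0 \<and>
      coact x \<in> tens_ker N (plus_tate N ?J) ?J" if x: "x \<in> ?J" for x
  proof -
    obtain K where K: "admissible N K" "x \<in> K" using ad[OF x] by metis
    then have KJ: "K \<subseteq> ?J" by (blast dest: admissible_le)
    with tens_ker_mono[of "plus_tate N K" "plus_tate N ?J" K ?J N] plus_tate_mono[OF KJ, of N]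
    show ?thesis
      using K unfolding admissible_def graded_ideal_def by blast
  qed
  with sub show ?thesis
    unfolding admissible_def graded_ideal_def by blast
qed

abbreviation "mrel \<equiv> motivic_relations"
abbreviation "tmrel N \<equiv> plus_tate N (mrel N)"

lemma fideal_mrel: "fideal N (mrel N)"
  and mrel_weight_part: "x \<in> mrel N \<Longrightarrow> weight_part n x \<in> mrel N"
  and period_mrel: "x \<in> mrel N \<Longrightarrow> period x = 0"
  and coact_mrel: "x \<in> mrel N \<Longrightarrow> coact x \<in> tens_ker N (tmrel N) (mrel N)"
  using admissible_motivic_relations[of N] unfolding admissible_def graded_ideal_iff by auto

lemmas mrelD = fidealD[OF fideal_mrel]
lemmas mrel_add = rvs.subspace_add[OF mrelD(2)]
lemmas mrel_diff = rvs.subspace_diff[OF mrelD(2)]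
lemmas mrel_rscale = rvs.subspace_scale[OF mrelD(2)]
lemmas mrel_sum = rvs.subspace_sum[OF mrelD(2)]

lemma one_not_mrel: "1 \<notin> mrel N"
  using period_mrel[of 1 N] by auto


subsection \<open>The coaction on words\<close>

lemma int_from_0_formals:
  assumes "set w \<subseteq> insert 0 (unit_roots N)" "y \<in> insert 0 (unit_roots N)"
  shows "int_from_0 w y \<in> formals N"
proof -
  have "set (map (\<lambda>a. a / y) w) \<subseteq> insert 0 (unit_roots N)" if "y \<noteq> 0"
    using assms that by (auto intro!: unit_roots_divide)
  then show ?thesis
    by (auto simp: int_from_0_def simp del: set_map intro!: I01_formals)
qed

lemma int_to_0_formals:
  assumes "set w \<subseteq> insert 0 (unit_roots N)" "y \<in> insert 0 (unit_roots N)"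
  shows "int_to_0 y w \<in> formals N"
  unfolding int_to_0_def using assms
  by (intro formals_mult formals_numeral int_from_0_formals) auto

lemma int_between_formals:
  assumes "set w \<subseteq> insert 0 (unit_roots N)" "x \<in> insert 0 (unit_roots N)" "y \<in> insert 0 (unit_roots N)"
  shows "int_between x w y \<in> formals N"
  unfolding int_between_def using assms set_take_subset[of _ w] set_drop_subset[of _ w]
  by (intro formals_sum formals_mult int_to_0_formals int_from_0_formals) blast+

definition ext :: "complex list \<Rightarrow> nat \<Rightarrow> complex" where
  "ext w i = (if i = 0 then 0 else if i = Suc (length w) then 1 else w ! (i - 1))"

text \<open>S is the set of positions kept in the right factor of Goncharov's formula. With the two
  end points added, the entries number p and p + 1 bound the p-th interval of dropped
  letters.\<close>

definition cut :: "nat \<Rightarrow> nat set \<Rightarrow> nat list" where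
  "cut n S = 0 # sorted_list_of_set S @ [Suc n]"

definition gap :: "complex list \<Rightarrow> nat set \<Rightarrow> nat \<Rightarrow> formal" where
  "gap w S p = (let js = cut (length w) S in
     int_between (ext w (js ! p)) (map (ext w) [Suc (js ! p)..<js ! Suc p]) (ext w (js ! Suc p)))"

definition rest :: "complex list \<Rightarrow> nat set \<Rightarrow> formal" where
  "rest w S = I01 (map (ext w) (sorted_list_of_set S))"

lemma coact_word_eq:
  "coact_word w = (\<Sum>S \<in> Pow {1..length w}. tens (\<Prod>p\<le>card S. gap w S p) (rest w S))"
  unfolding coact_word_def Let_def gap_def rest_def cut_def ext_def[abs_def] ..

lemma ext_letters:
  assumes "set w \<subseteq> insert 0 (unit_roots N)" "i \<le> Suc (length w)"
  shows "ext w i \<in> insert 0 (unit_roots N)"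
proof -
  have "w ! (i - 1) \<in> set w" if "i \<noteq> 0" "i \<noteq> Suc (length w)"
    using that assms(2) by (intro nth_mem) auto
  then show ?thesis using assms(1) by (auto simp: ext_def)
qed

context
  fixes n :: nat and S :: "nat set"
  assumes S: "S \<subseteq> {1..n}"
begin

lemma finite_cut: "finite S"
  using S finite_subset by blast

lemma length_cut: "length (cut n S) = card S + 2"
  using finite_cut by (simp add: cut_def)

lemma set_cut: "set (cut n S) = insert 0 (insert (Suc n) S)"
  using finite_cut by (auto simp: cut_def)

lemma sorted_cut: "sorted_wrt (<) (cut n S)"
  using S finite_cut by (auto simp: cut_def sorted_wrt_append)

lemma cut_mono: "p < q \<Longrightarrow> q \<le> Suc (card S) \<Longrightarrow> cut n S ! p < cut n S ! q"
  using sorted_wrt_nth_less[OF sorted_cut, of p q] by (simp add: length_cut)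

lemma cut_le: "p \<le> Suc (card S) \<Longrightarrow> cut n S ! p \<le> Suc n"
  using nth_mem[of p "cut n S"] S by (force simp: length_cut set_cut)

lemma cut_between:
  assumes "s \<in> S" "p \<le> card S"
  shows "\<not> (cut n S ! p < s \<and> s < cut n S ! Suc p)"
proof
  assume *: "cut n S ! p < s \<and> s < cut n S ! Suc p"
  obtain r where r: "r < length (cut n S)" "s = cut n S ! r"
    using assms(1) set_cut by (metis in_set_conv_nth insertI2)
  have "r \<noteq> p" "r \<noteq> Suc p" using * r by auto
  then have "r < p \<or> Suc p < r" by auto
  then show False
    using * r cut_mono[of r p] cut_mono[of "Suc p" r] assms(2) by (auto simp: length_cut)
qed

lemma cut_missing:
  assumes "q \<in> {1..n}" "q \<notin> S"
  obtains p where "p \<le> card S" "cut n S ! p < q" "q < cut n S ! Suc p"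
proof -
  define p where "p = (LEAST p. q < cut n S ! Suc p)"
  have "cut n S ! Suc (card S) = Suc n"
    using finite_cut by (simp add: cut_def nth_append)
  then have ex: "q < cut n S ! Suc (card S)" using assms by simp
  have 1: "q < cut n S ! Suc p" "p \<le> card S"
    unfolding p_def using ex by (rule LeastI, rule Least_le)
  have "cut n S ! p < q"
  proof (cases p)
    case 0
    then show ?thesis using assms by (simp add: cut_def)
  next
    case (Suc p')
    then have "\<not> q < cut n S ! p"
      using not_less_Least[of p' "\<lambda>p. q < cut n S ! Suc p"] unfolding p_def by auto
    moreover have "cut n S ! p \<noteq> q"
      using nth_mem[of p "cut n S"] 1 assms by (auto simp: length_cut set_cut)
    ultimately show ?thesis by simp
  qed
  with 1 that show ?thesis by blast
qed

end

lemma gap_formals: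
  assumes "set w \<subseteq> insert 0 (unit_roots N)" "S \<subseteq> {1..length w}" "p \<le> card S"
  shows "gap w S p \<in> formals N"
  unfolding gap_def Let_def
  using assms cut_le[OF assms(2), of p] cut_le[OF assms(2), of "Suc p"]
  by (intro int_between_formals ext_letters) (auto intro!: ext_letters[OF assms(1)] simp del: insert_iff)

lemma rest_formals:
  assumes "set w \<subseteq> insert 0 (unit_roots N)" "S \<subseteq> {1..length w}"
  shows "rest w S \<in> formals N"
proof -
  have "finite S" "\<And>i. i \<in> S \<Longrightarrow> i \<le> Suc (length w)"
    using assms(2) finite_subset by (auto simp: le_SucI)
  then show ?thesis
    unfolding rest_def using ext_letters[OF assms(1)] by (intro I01_formals) auto
qed

lemma coact_word_formals2:
  assumes "set w \<subseteq> insert 0 (unit_roots N)"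
  shows "coact_word w \<in> formals2 N"
  unfolding coact_word_eq using assms
  by (intro rvs.subspace_sum[OF subspace_formals2] formals2_tens formals_prod gap_formals rest_formals) auto

lemma coact_formals2:
  assumes "x \<in> formals N"
  shows "coact x \<in> formals2 N"
proof -
  have prod: "(\<Prod>w\<in>#m. coact_word w) \<in> formals2 N" if "okm N m" for m
    using that
    by (induction m) (auto simp: okm_def formals2_1 intro!: formals2_mult coact_word_formals2)
  have "coact x = coact (\<Sum>m\<in>Poly_Mapping.keys x. Poly_Mapping.single m (Poly_Mapping.lookup x m))"
    by (simp add: sum_monomials)
  also have "\<dots> \<in> formals2 N"
    unfolding coact_sum coact_single
    using assms by (intro rvs.subspace_sum[OF subspace_formals2] rvs.subspace_scale[OF subspace_formals2] prod)
      (auto simp: formals_okm)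
  finally show ?thesis .
qed

lemma gap_empty: "\<not> Suc (cut (length w) S ! p) < cut (length w) S ! Suc p \<Longrightarrow> gap w S p = 1"
  by (simp add: gap_def int_between_def int_to_0_def int_from_0_def)

lemma ext_map_full: "map (ext w) [Suc 0..<Suc (length w)] = w"
  by (rule nth_equalityI) (auto simp: ext_def simp del: upt_Suc)

lemma int_between_0_1: "int_between 0 w 1 = I01 w"
proof -
  have "(\<Sum>i\<le>length w. int_to_0 0 (take i w) * int_from_0 (drop i w) 1) =
     (\<Sum>i\<le>length w. if i = 0 then I01 w else 0)"
    by (intro sum.cong refl) (auto simp: int_to_0_def int_from_0_def I01_def)
  then show ?thesis by (simp add: int_between_def)
qed

lemma coact_term_empty: "tens (\<Prod>p\<le>card {}. gap w {} p) (rest w {}) = tens (I01 w) 1"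
  using ext_map_full[of w] by (simp add: gap_def cut_def rest_def I01_def ext_def int_between_0_1 del: upt_Suc)

lemma sorted_list_of_set_1n: "sorted_list_of_set {Suc 0..n} = [Suc 0..<Suc n]"
  by (metis atLeastLessThanSuc_atLeastAtMost sorted_list_of_set_range)

lemma coact_term_full:
  "tens (\<Prod>p\<le>card {1..length w}. gap w {1..length w} p) (rest w {1..length w}) = tens 1 (I01 w)"
proof -
  have cut: "cut (length w) {1..length w} = [0..<length w + 2]"
  proof -
    have "[0..<length w + 2] = 0 # [Suc 0..<Suc (length w)] @ [Suc (length w)]"
      using upt_conv_Cons[of 0 "length w + 2"] upt_Suc_append[of "Suc 0" "Suc (length w)"]
      by (simp del: upt_Suc)
    then show ?thesis
      by (simp add: cut_def sorted_list_of_set_1n del: upt_Suc)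
  qed
  have "gap w {1..length w} p = 1" if "p \<le> length w" for p
    by (rule gap_empty, unfold cut) (use that in \<open>simp del: upt_Suc\<close>)
  then show ?thesis
    by (simp add: rest_def sorted_list_of_set_1n ext_map_full del: upt_Suc)
qed

lemma sum_insert2:
  "finite B \<Longrightarrow> a \<noteq> b \<Longrightarrow> a \<notin> B \<Longrightarrow> b \<notin> B \<Longrightarrow> sum f (insert a (insert b B)) = f a + (f b + sum f B)"
  by simp

text \<open>Dropping all letters or none gives the two primitive terms. Every other term has a
  nonempty right factor and at least one nonempty gap, so both sides have smaller weight than
  w.\<close>

lemma coact_word_split:
  assumes "w \<noteq> []"
  shows "coact_word w = tens (I01 w) 1 + tens 1 (I01 w) +
    (\<Sum>S \<in> Pow {1..length w} - {{}, {1..length w}}. tens (\<Prod>p\<le>card S. gap w S p) (rest w S))"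
proof -
  let ?f = "\<lambda>S. tens (\<Prod>p\<le>card S. gap w S p) (rest w S)"
  define B where "B = Pow {1..length w} - {{}, {1..length w}}"
  have Pow: "Pow {1..length w} = insert {} (insert {1..length w} B)"
    by (auto simp: B_def)
  have "finite B" "{} \<noteq> {1..length w}" "{} \<notin> B" "{1..length w} \<notin> B"
    using assms by (auto simp: B_def Suc_le_eq)
  then have "coact_word w = ?f {} + (?f {1..length w} + (\<Sum>S\<in>B. ?f S))"
    unfolding coact_word_eq Pow by (rule sum_insert2)
  then show ?thesis
    unfolding coact_term_empty coact_term_full by (simp add: B_def add.assoc)
qed

text \<open>The ideal generated by g and \<open>mrel N\<close> is admissible again, hence contained
  in the largest one. The correction y is allowed since the left factor counts only modulo the Tate
  element; this matters for powers of the Tate element, which are not primitive.\<close>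

lemma mrel_extend:
  assumes N: "N > 0" and g: "g \<in> formals N" "homog d g" "period g = 0"
    and y: "y \<in> formals N"
    and co: "coact g - tens (g + tate_elt N * y) 1 - tens 1 g \<in> tens_ker N (tmrel N) (mrel N)"
  shows "g \<in> mrel N"
proof -
  define K where "K = isum (mrel N) {g * y | y. y \<in> formals N}"
  have K: "fideal N K"
    unfolding K_def by (intro fideal_isum fideal_mrel fideal_principal g)
  note TK = fideal_plus_tate[OF N K]
  have sub: "mrel N \<subseteq> K" and gK: "g \<in> K"
  proof -
    have "g * y \<in> {g * y | y. y \<in> formals N}" if "y \<in> formals N" for y using that by blast
    from this[of 0] this[of 1] have *: "0 \<in> {g * y | y. y \<in> formals N}" "g \<in> {g * y | y. y \<in> formals N}"
      by simp_all
    show "mrel N \<subseteq> K"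
      unfolding K_def using isumI[OF _ *(1)] by fastforce
    show "g \<in> K"
      unfolding K_def using isumI[OF rvs.subspace_0[OF mrelD(2)] *(2)] by simp
  qed
  have ker: "tens_ker N (tmrel N) (mrel N) \<subseteq> tens_ker N (plus_tate N K) K"
    by (intro tens_ker_mono plus_tate_mono sub)
  have "tens (g + tate_elt N * y) 1 + tens 1 g \<in> tens_ker N (plus_tate N K) K"
    using gK y by (intro rvs.subspace_add[OF subspace_tens_ker] tens_kerL tens_kerR plus_tateI) auto
  from rvs.subspace_add[OF subspace_tens_ker this subsetD[OF ker co]]
  have cog: "coact g \<in> tens_ker N (plus_tate N K) K" by (simp add: algebra_simps)
  have "admissible N K"
    unfolding admissible_def graded_ideal_iff
  proof (intro conjI K ballI allI)
    fix x assume "x \<in> K"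
    then obtain j z where x: "x = j + g * z" "j \<in> mrel N" "z \<in> formals N"
      unfolding K_def by (auto elim!: isumE)
    show "period x = 0"
      by (simp add: x period_add period_mult period_mrel[of j N] g)
    show "coact x \<in> tens_ker N (plus_tate N K) K"
      unfolding x coact_add coact_mult
      by (intro rvs.subspace_add[OF subspace_tens_ker] tens_ker_mult cog coact_formals2 x K TK
           subsetD[OF ker] coact_mrel)
    fix n
    have "weight_part n (g * z) \<in> K"
      using fidealD(4)[OF K gK weight_part_formals[OF x(3)]] rvs.subspace_0[OF fidealD(2)[OF K]]
      by (auto simp: weight_part_mult_homog[OF g(2)])
    then show "weight_part n x \<in> K"
      unfolding x weight_part_add using sub x
      by (intro rvs.subspace_add[OF fidealD(2)[OF K]]) (auto intro: mrel_weight_part)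
  qed
  from admissible_le[OF this] gK show ?thesis by blast
qed

lemma mrel_extend_primitive:
  assumes "N > 0" "g \<in> formals N" "homog d g" "period g = 0"
    and "coact g - tens g 1 - tens 1 g \<in> tens_ker N (tmrel N) (mrel N)"
  shows "g \<in> mrel N"
  using mrel_extend[of N g d 0] assms by simp

lemma tmrel_mrel_ker: "tens_ker N (mrel N) (mrel N) \<subseteq> tens_ker N (tmrel N) (mrel N)"
  by (intro tens_ker_mono plus_tate_superset) auto

lemma map_ext_zeros:
  assumes "\<And>i. i \<in> set l \<Longrightarrow> ext w i = 0"
  shows "map (ext w) l = replicate (length l) 0"
  using assms by (intro replicate_eqI) auto

text \<open>Induction on the length: every intermediate right factor is a shorter word of zeros, so
  the word is primitive modulo relations, and its regularised period is 0.\<close>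

lemma zeros_mrel:
  assumes "N > 0" "m > 0"
  shows "I01 (replicate m 0) \<in> mrel N"
  using assms(2)
proof (induction m rule: less_induct)
  case (less m)
  define w where "w = replicate m (0::complex)"
  have w: "w \<noteq> []" "length w = m" "set w \<subseteq> insert 0 (unit_roots N)"
    using less.prems by (auto simp: w_def)
  have "coact (I01 w) - tens (I01 w) 1 - tens 1 (I01 w) \<in> tens_ker N (tmrel N) (mrel N)"
    unfolding coact_I01[OF w(1)] coact_word_split[OF w(1)] add_diff_cancel_left' diff_diff_add
  proof (intro rvs.subspace_sum[OF subspace_tens_ker] tens_kerR)
    fix S assume S: "S \<in> Pow {1..length w} - {{}, {1..length w}}"
    then have fin: "finite S" using finite_subset by auto
    have "card S > 0" "card S < m"
      using S fin psubset_card_mono[of "{1..m}" S] by (auto simp: card_gt_0_iff w)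
    have "ext w i = 0" if "i \<in> S" for i
    proof -
      have "1 \<le> i" "i \<le> m" using that S w by auto
      then show ?thesis by (auto simp: ext_def w_def)
    qed
    then have "rest w S = I01 (replicate (card S) 0)"
      unfolding rest_def using fin by (subst map_ext_zeros) auto
    then show "rest w S \<in> mrel N"
      using less.IH \<open>card S > 0\<close> \<open>card S < m\<close> by simp
    show "(\<Prod>p\<le>card S. gap w S p) \<in> formals N"
      using S w by (intro formals_prod gap_formals) auto
  qed
  then show ?case
    using mrel_extend_primitive[OF assms(1) I01_formals[OF w(3)] homog_I01] w
    by (simp add: period_I01 w_def reg_int_zeros less.prems)
qed

lemma int_from_zeros_mrel:
  assumes "N > 0" "m > 0"
  shows "int_from_0 (replicate m 0) y \<in> mrel N"
  using zeros_mrel[OF assms] assms(2) rvs.subspace_0[OF mrelD(2)]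
  by (auto simp: int_from_0_def)

lemma int_to_zeros_mrel:
  assumes "N > 0" "m > 0"
  shows "int_to_0 y (replicate m 0) \<in> mrel N"
  unfolding int_to_0_def
  by (intro mrelD(3) formals_numeral) (simp add: int_from_zeros_mrel[OF assms])

lemma int_between_zeros_mrel:
  assumes "N > 0" "m > 0" "x \<in> insert 0 (unit_roots N)" "y \<in> insert 0 (unit_roots N)"
  shows "int_between x (replicate m 0) y \<in> mrel N"
  unfolding int_between_def
proof (rule mrel_sum)
  fix i assume i: "i \<in> {..length (replicate m (0::complex))}"
  have *: "take i (replicate m (0::complex)) = replicate i 0" "drop i (replicate m (0::complex)) = replicate (m - i) 0"
    using i by auto
  show "int_to_0 x (take i (replicate m 0)) * int_from_0 (drop i (replicate m 0)) y \<in> mrel N"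
  proof (cases "i = 0")
    case True
    then show ?thesis
      using int_from_zeros_mrel[OF assms(1,2)] by (simp add: int_to_0_def int_from_0_def[of "[]"])
  next
    case False
    then show ?thesis
      unfolding * using assms
      by (intro mrelD(4) int_to_zeros_mrel int_from_0_formals) auto
  qed
qed

lemma norm_unit_root: "N > 0 \<Longrightarrow> a \<in> unit_roots N \<Longrightarrow> norm a = 1"
  by (auto simp: unit_roots_def dest: power_eq_1_iff)

lemma unit_root_nonzero: "N > 0 \<Longrightarrow> a \<in> unit_roots N \<Longrightarrow> a \<noteq> 0"
  by (metis norm_unit_root norm_zero zero_neq_one)

lemma length_dword [simp]: "length (dword \<alpha> a \<beta>) = Suc (\<alpha> + \<beta>)"
  and dword_nonempty [simp]: "dword \<alpha> a \<beta> \<noteq> []"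
  and set_dword: "set (dword \<alpha> a \<beta>) \<subseteq> {0, a}"
  by (auto simp: dword_def)

lemma dword_formals: "a \<in> unit_roots N \<Longrightarrow> I01 (dword \<alpha> a \<beta>) \<in> formals N"
  using set_dword[of \<alpha> a \<beta>] by (intro I01_formals) auto

lemma ext_dword: "1 \<le> i \<Longrightarrow> i \<le> Suc (\<alpha> + \<beta>) \<Longrightarrow> i \<noteq> Suc \<alpha> \<Longrightarrow> ext (dword \<alpha> a \<beta>) i = 0"
  by (auto simp: ext_def dword_def nth_append nth_Cons split: nat.split)

lemma prod_in_fideal:
  assumes "fideal N K" "finite A" "a \<in> A" "f a \<in> K" "\<And>b. b \<in> A \<Longrightarrow> f b \<in> formals N"
  shows "prod f A \<in> K"
  using assms prod.remove[OF assms(2,3), of f]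
  by (metis DiffD1 fidealD(4) formals_prod)

text \<open>If the only nonzero letter is dropped, the right factor is a word of zeros. If it is
  kept, some gap is nonempty and has only zeros as inner letters. Either way the factor is a
  relation already in \<open>mrel N\<close>, without help of the Tate element.\<close>

lemma coact_dword:
  assumes N: "N > 0" and a: "a \<in> unit_roots N"
  shows "coact (I01 (dword \<alpha> a \<beta>)) - tens (I01 (dword \<alpha> a \<beta>)) 1 - tens 1 (I01 (dword \<alpha> a \<beta>))
    \<in> tens_ker N (mrel N) (mrel N)"
proof -
  define w where "w = dword \<alpha> a \<beta>"
  have w: "w \<noteq> []" "length w = Suc (\<alpha> + \<beta>)" "set w \<subseteq> insert 0 (unit_roots N)"
    using set_dword[of \<alpha> a \<beta>] a by (auto simp: w_def)
  have "coact (I01 w) - tens (I01 w) 1 - tens 1 (I01 w) \<in> tens_ker N (mrel N) (mrel N)"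
    unfolding coact_I01[OF w(1)] coact_word_split[OF w(1)] add_diff_cancel_left' diff_diff_add
  proof (intro rvs.subspace_sum[OF subspace_tens_ker])
    fix S assume "S \<in> Pow {1..length w} - {{}, {1..length w}}"
    then have S: "S \<subseteq> {1..length w}" "S \<noteq> {}" "S \<noteq> {1..length w}" by auto
    have fin: "finite S" using S(1) finite_subset by auto
    have gaps: "p \<in> {..card S} \<Longrightarrow> gap w S p \<in> formals N" for p
      using S w by (intro gap_formals) auto
    show "tens (\<Prod>p\<le>card S. gap w S p) (rest w S) \<in> tens_ker N (mrel N) (mrel N)"
    proof (cases "Suc \<alpha> \<in> S")
      case False
      have "ext w i = 0" if "i \<in> S" for i
      proof -
        have "1 \<le> i" "i \<le> Suc (\<alpha> + \<beta>)" "i \<noteq> Suc \<alpha>" using that S w False by auto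
        then show ?thesis unfolding w_def by (rule ext_dword)
      qed
      then have "rest w S = I01 (replicate (card S) 0)"
        unfolding rest_def using fin by (subst map_ext_zeros) auto
      moreover have "card S > 0" using S fin by (simp add: card_gt_0_iff)
      ultimately show ?thesis
        by (intro tens_kerR formals_prod gaps) (auto intro: zeros_mrel[OF N])
    next
      case True
      obtain q where "q \<in> {1..length w}" "q \<notin> S" using S by blast
      from cut_missing[OF S(1) this] obtain p
        where p: "p \<le> card S" "cut (length w) S ! p < q" "q < cut (length w) S ! Suc p" .
      let ?i = "cut (length w) S ! p" and ?j = "cut (length w) S ! Suc p"
      have j: "?j \<le> Suc (length w)" using cut_le[OF S(1), of "Suc p"] p by simp
      have "ext w i = 0" if "i \<in> set [Suc ?i..<?j]" for i
      proof -
        have "i \<noteq> Suc \<alpha>" using cut_between[OF S(1) True p(1)] that by auto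
        then show ?thesis
          unfolding w_def by (rule ext_dword[rotated 2]) (use that j w in auto)
      qed
      from map_ext_zeros[of "[Suc ?i..<?j]" w, OF this]
      have "gap w S p = int_between (ext w ?i) (replicate (?j - Suc ?i) 0) (ext w ?j)"
        by (simp add: gap_def Let_def)
      also have "\<dots> \<in> mrel N"
        using p j by (intro int_between_zeros_mrel N ext_letters w) auto
      finally have "(\<Prod>p\<le>card S. gap w S p) \<in> mrel N"
        using p(1) gaps by (intro prod_in_fideal[OF fideal_mrel, of _ p]) auto
      then show ?thesis
        using S w by (intro tens_kerL rest_formals) auto
    qed
  qed
  then show ?thesis by (simp add: w_def)
qed

lemma dword_shuffle_mrel:
  assumes N: "N > 0" and a: "a \<in> unit_roots N" and "\<alpha> + \<beta> > 0"
  shows "I01 (dword \<alpha> a \<beta>) - rscale ((- 1) ^ \<alpha> * of_nat ((\<alpha> + \<beta>) choose \<alpha>)) (I01 (dword 0 a (\<alpha> + \<beta>))) \<in> mrel N"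
    (is "?x - rscale ?c ?y \<in> _")
proof (rule mrel_extend_primitive[OF N, of _ "Suc (\<alpha> + \<beta>)"])
  show "?x - rscale ?c ?y \<in> formals N"
    by (intro formals_diff formals_rscale dword_formals a)
  show "homog (Suc (\<alpha> + \<beta>)) (?x - rscale ?c ?y)"
    using homog_I01[of "dword \<alpha> a \<beta>"] homog_I01[of "dword 0 a (\<alpha> + \<beta>)"]
    by (intro homog_diff homog_rscale) auto
  show "period (?x - rscale ?c ?y) = 0"
    using reg_int_dword[of a \<alpha> \<beta>] assms
    by (simp add: period_diff period_rscale period_I01 norm_unit_root of_rat_mult of_rat_power of_rat_minus)
  have "(coact ?x - tens ?x 1 - tens 1 ?x) - rscale ?c (coact ?y - tens ?y 1 - tens 1 ?y) \<in> tens_ker N (mrel N) (mrel N)"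
    by (intro rvs.subspace_diff[OF subspace_tens_ker] rvs.subspace_scale[OF subspace_tens_ker] coact_dword N a)
  moreover have "(coact ?x - tens ?x 1 - tens 1 ?x) - rscale ?c (coact ?y - tens ?y 1 - tens 1 ?y) =
    coact (?x - rscale ?c ?y) - tens (?x - rscale ?c ?y) 1 - tens 1 (?x - rscale ?c ?y)"
    by (simp add: coact_diff coact_rscale tens_diff_left tens_diff_right tens_rscale_left tens_rscale_right
        rvs.scale_right_diff_distrib algebra_simps)
  ultimately show "coact (?x - rscale ?c ?y) - tens (?x - rscale ?c ?y) 1 - tens 1 (?x - rscale ?c ?y) \<in> tens_ker N (tmrel N) (mrel N)"
    using tmrel_mrel_ker by auto
qed

lemma zeta_m_1: "zeta_m [(p, e)] = - I01 (dword 0 (inverse e) (p - 1))"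
  by (simp add: zeta_m_def dword_def)

lemma coact_zeta:
  assumes "N > 0" "e \<in> unit_roots N"
  shows "coact (zeta_m [(p, e)]) - tens (zeta_m [(p, e)]) 1 - tens 1 (zeta_m [(p, e)]) \<in> tens_ker N (mrel N) (mrel N)"
  using rvs.subspace_neg[OF subspace_tens_ker coact_dword[OF assms(1) unit_roots_inverse[OF assms(2)], of 0 "p - 1"]]
  unfolding zeta_m_1 by (simp add: coact_minus tens_minus_left tens_minus_right algebra_simps)

lemma coact_tate:
  assumes "N > 0"
  shows "coact (tate_elt N) - tens (tate_elt N) 1 - tens 1 (tate_elt N) \<in> tens_ker N (mrel N) (mrel N)"
proof (cases "N \<le> 2")
  case True
  then show ?thesis using coact_zeta[OF assms unit_roots_1, of 2] by (simp add: tate_elt_def)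
next
  case False
  note * = coact_zeta[OF assms eps_unit_root[OF assms], of 1]
    coact_zeta[OF assms unit_roots_inverse[OF eps_unit_root[OF assms]], of 1]
  from False rvs.subspace_diff[OF subspace_tens_ker *] show ?thesis
    by (simp add: tate_elt_def coact_diff tens_diff_left tens_diff_right algebra_simps)
qed

subsection \<open>Odd zeta values are indecomposable\<close>

definition tmul :: "formal2 \<Rightarrow> formal" where
  "tmul = lin_ext (Poly_Mapping.single 0) (\<lambda>(m, n). Poly_Mapping.single (m + n) 1)"

lemma tmul_0 [simp]: "tmul 0 = 0"
  and tmul_add: "tmul (u + v) = tmul u + tmul v"
  and tmul_rscale: "tmul (rscale c u) = rscale c (tmul u)"
  unfolding tmul_def single_hom.lin_ext_add single_hom.lin_ext_rscale by (simp_all add: rscale_def)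

lemma tmul_diff: "tmul (u - v) = tmul u - tmul v"
  using tmul_add[of "u - v" v] by simp

lemma tmul_sum: "tmul (sum f A) = (\<Sum>a\<in>A. tmul (f a))"
  by (induction A rule: infinite_finite_induct) (simp_all add: tmul_add)

lemma tmul_tens: "tmul (tens x y) = x * y"
proof (induction x rule: poly_mapping_induct)
  case (single m c)
  show ?case
    by (induction y rule: poly_mapping_induct)
       (simp_all add: tens_single tens_add_right tmul_add ring_distribs, simp add: tmul_def mult_single)
qed (simp_all add: tens_add_left tmul_add ring_distribs)

lemma tmul_mult: "tmul (u * v) = tmul u * tmul v"
  unfolding tmul_def by (rule single_hom.lin_ext_mult) (auto simp: mult_single add_ac)

lemma tmul_1: "tmul 1 = 1"
  using tmul_tens[of 1 1] by (simp add: tens_1_1)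

lemma tmul_formals: "u \<in> formals2 N \<Longrightarrow> tmul u \<in> formals N"
  by (induction rule: formals2_induct) (simp_all add: tmul_tens tmul_add formals_mult formals_add)

text \<open>The convolution square of the identity, known as the second Adams operation of a
  commutative Hopf algebra.\<close>

definition Psi :: "formal \<Rightarrow> formal" where
  "Psi x = tmul (coact x)"

lemma Psi_0 [simp]: "Psi 0 = 0"
  and Psi_1 [simp]: "Psi 1 = 1"
  and Psi_add: "Psi (x + y) = Psi x + Psi y"
  and Psi_rscale: "Psi (rscale c x) = rscale c (Psi x)"
  and Psi_mult: "Psi (x * y) = Psi x * Psi y"
  by (simp_all add: Psi_def tmul_1 coact_add tmul_add coact_rscale tmul_rscale coact_mult tmul_mult)

lemma Psi_sum: "Psi (sum f A) = (\<Sum>a\<in>A. Psi (f a))"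
  by (induction A rule: infinite_finite_induct) (simp_all add: Psi_add)

lemma Psi_diff: "Psi (x - y) = Psi x - Psi y"
  by (simp add: Psi_def coact_diff tmul_diff)

lemma Psi_formals: "x \<in> formals N \<Longrightarrow> Psi x \<in> formals N"
  unfolding Psi_def by (intro tmul_formals coact_formals2)

text \<open>The n-th power of the augmentation ideal; in a polynomial algebra it is visible as the
  number of words in each monomial.\<close>

definition fil :: "nat \<Rightarrow> nat \<Rightarrow> formal set" where
  "fil N n = {x \<in> formals N. \<forall>m \<in> Poly_Mapping.keys x. n \<le> size m}"

lemma subspace_fil: "rsubspace (fil N n)"
  unfolding rvs.subspace_def
proof (intro conjI ballI allI)
  fix x y assume "x \<in> fil N n" "y \<in> fil N n"
  then show "x + y \<in> fil N n"
    using keys_add[of x y] by (auto simp: fil_def intro: formals_add)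
qed (auto simp: fil_def in_keys_iff intro: formals_rscale)

lemma fil_mult:
  assumes "x \<in> fil N a" "y \<in> fil N b"
  shows "x * y \<in> fil N (a + b)"
proof -
  have "a + b \<le> size m" if m: "m \<in> Poly_Mapping.keys (x * y)" for m
  proof -
    obtain m' n' where "m = m' + n'" "m' \<in> Poly_Mapping.keys x" "n' \<in> Poly_Mapping.keys y"
      using subsetD[OF keys_mult m] by blast
    then show ?thesis using assms by (auto simp: fil_def intro: add_mono)
  qed
  then show ?thesis using assms by (auto simp: fil_def intro: formals_mult)
qed

lemma fil_mono: "a \<le> b \<Longrightarrow> fil N b \<subseteq> fil N a"
  by (auto simp: fil_def)

lemma fil_0: "fil N 0 = formals N"
  by (auto simp: fil_def)

lemma fil_1: "fil N (Suc 0) = {x \<in> formals N. Poly_Mapping.lookup x 0 = 0}"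
proof -
  have "(\<forall>m\<in>Poly_Mapping.keys x. Suc 0 \<le> size m) \<longleftrightarrow> Poly_Mapping.lookup x 0 = 0" for x :: formal
  proof -
    have "Suc 0 \<le> size m \<longleftrightarrow> m \<noteq> 0" for m :: "complex list multiset"
      by (cases m) auto
    then show ?thesis by (auto simp: in_keys_iff)
  qed
  then show ?thesis by (auto simp: fil_def)
qed

lemma I01_fil_1: "set w \<subseteq> insert 0 (unit_roots N) \<Longrightarrow> w \<noteq> [] \<Longrightarrow> I01 w \<in> fil N (Suc 0)"
  using I01_formals[of w N] by (auto simp: fil_def I01_def)

lemma int_from_0_fil_1:
  assumes "set w \<subseteq> insert 0 (unit_roots N)" "y \<in> insert 0 (unit_roots N)" "w \<noteq> []"
  shows "int_from_0 w y \<in> fil N (Suc 0)"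
proof -
  have "set (map (\<lambda>a. a / y) w) \<subseteq> insert 0 (unit_roots N)" if "y \<noteq> 0"
    using assms that by (auto intro!: unit_roots_divide)
  then show ?thesis
    using assms(3) rvs.subspace_0[OF subspace_fil]
    by (auto simp: int_from_0_def simp del: set_map intro!: I01_fil_1)
qed

lemma fil_1_mult: "x \<in> fil N (Suc 0) \<Longrightarrow> y \<in> formals N \<Longrightarrow> x * y \<in> fil N (Suc 0)"
    "x \<in> formals N \<Longrightarrow> y \<in> fil N (Suc 0) \<Longrightarrow> x * y \<in> fil N (Suc 0)"
  using fil_mult[of x N "Suc 0" y 0] fil_mult[of x N 0 y "Suc 0"] by (auto simp: fil_0)

lemma int_between_fil_1:
  assumes "set w \<subseteq> insert 0 (unit_roots N)" "x \<in> insert 0 (unit_roots N)" "y \<in> insert 0 (unit_roots N)" "w \<noteq> []"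
  shows "int_between x w y \<in> fil N (Suc 0)"
  unfolding int_between_def
proof (rule rvs.subspace_sum[OF subspace_fil])
  fix i assume "i \<in> {..length w}"
  have sub: "set (take i w) \<subseteq> insert 0 (unit_roots N)" "set (drop i w) \<subseteq> insert 0 (unit_roots N)"
    using assms(1) set_take_subset[of i w] set_drop_subset[of i w] by blast+
  show "int_to_0 x (take i w) * int_from_0 (drop i w) y \<in> fil N (Suc 0)"
  proof (cases "i = 0")
    case True
    then show ?thesis using assms by (intro fil_1_mult(2) int_to_0_formals int_from_0_fil_1) auto
  next
    case False
    have "int_to_0 x (take i w) \<in> fil N (Suc 0)"
      unfolding int_to_0_def using sub assms False
      by (intro fil_1_mult(2) formals_numeral int_from_0_fil_1) auto
    then show ?thesis using sub assms by (intro fil_1_mult(1) int_from_0_formals) auto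
  qed
qed

lemma gap_fil_1:
  assumes "set w \<subseteq> insert 0 (unit_roots N)" "S \<subseteq> {1..length w}" "p \<le> card S"
    "Suc (cut (length w) S ! p) < cut (length w) S ! Suc p"
  shows "gap w S p \<in> fil N (Suc 0)"
  unfolding gap_def Let_def
  using assms cut_le[OF assms(2), of p] cut_le[OF assms(2), of "Suc p"]
  by (intro int_between_fil_1 ext_letters) (auto intro!: ext_letters[OF assms(1)] simp del: insert_iff)

lemma rest_fil_1:
  assumes "set w \<subseteq> insert 0 (unit_roots N)" "S \<subseteq> {1..length w}" "S \<noteq> {}"
  shows "rest w S \<in> fil N (Suc 0)"
proof -
  have "finite S" "\<And>i. i \<in> S \<Longrightarrow> i \<le> Suc (length w)"
    using assms(2) finite_subset by (auto simp: le_SucI)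
  then show ?thesis
    unfolding rest_def using ext_letters[OF assms(1)] assms(3) by (intro I01_fil_1) auto
qed

lemma rscale_2: "rscale 2 x = x + x"
  by (metis one_add_one rvs.scale_left_distrib rvs.scale_one)

text \<open>The two primitive terms of the coaction multiply to 2 w; in every other term both
  factors lie in the augmentation ideal.\<close>

lemma Psi_word:
  assumes w: "set w \<subseteq> insert 0 (unit_roots N)" "w \<noteq> []"
  shows "Psi (I01 w) - rscale 2 (I01 w) \<in> fil N 2"
proof -
  have "Psi (I01 w) - rscale 2 (I01 w) =
      (\<Sum>S \<in> Pow {1..length w} - {{}, {1..length w}}. (\<Prod>p\<le>card S. gap w S p) * rest w S)"
    unfolding Psi_def coact_I01[OF w(2)] coact_word_split[OF w(2)] tmul_add tmul_sum tmul_tens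
    by (simp add: rscale_2)
  also have "\<dots> \<in> fil N 2"
  proof (rule rvs.subspace_sum[OF subspace_fil])
    fix S assume "S \<in> Pow {1..length w} - {{}, {1..length w}}"
    then have S: "S \<subseteq> {1..length w}" "S \<noteq> {}" "S \<noteq> {1..length w}" by auto
    then obtain q where "q \<in> {1..length w}" "q \<notin> S" by blast
    from cut_missing[OF S(1) this] obtain p
      where p: "p \<le> card S" "cut (length w) S ! p < q" "q < cut (length w) S ! Suc p" .
    have "(\<Prod>p\<le>card S. gap w S p) = gap w S p * (\<Prod>p\<in>{..card S} - {p}. gap w S p)"
      using p by (intro prod.remove) auto
    also have "\<dots> \<in> fil N (Suc 0)"
      using p w S by (intro fil_1_mult(1) gap_fil_1 formals_prod gap_formals) auto
    finally have "(\<Prod>p\<le>card S. gap w S p) * rest w S \<in> fil N (Suc 0 + Suc 0)"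
      using w S by (intro fil_mult rest_fil_1)
    then show "(\<Prod>p\<le>card S. gap w S p) * rest w S \<in> fil N 2"
      by (simp add: numeral_2_eq_2)
  qed
  finally show ?thesis .
qed

text \<open>\<open>Psi\<close> is multiplicative, so each word of the monomial contributes a factor
  2 up to longer products. The induction step compares two products by changing one factor at a
  time.\<close>

lemma Psi_single:
  assumes "okm N m"
  shows "Psi (Poly_Mapping.single m 1) - rscale (2 ^ size m) (Poly_Mapping.single m 1) \<in> fil N (Suc (size m))"
  using assms
proof (induction m)
  case empty
  have "Psi (Poly_Mapping.single {#} 1) = 1"
    using Psi_1 by (simp only: single_one[symmetric])
  then show ?case
    using rvs.subspace_0[OF subspace_fil] by (simp flip: single_one)
next
  case (add w m)
  let ?s = "\<lambda>m. Poly_Mapping.single m (1::rat) :: formal"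
  have w: "set w \<subseteq> insert 0 (unit_roots N)" "w \<noteq> []" and m: "okm N m"
    using add.prems by (auto simp: okm_def)
  have split: "?s (add_mset w m) = I01 w * ?s m"
    using w by (simp add: I01_def mult_single)
  have "Psi (?s (add_mset w m)) - rscale (2 ^ size (add_mset w m)) (?s (add_mset w m)) =
    Psi (I01 w) * (Psi (?s m) - rscale (2 ^ size m) (?s m)) +
    (Psi (I01 w) - rscale 2 (I01 w)) * rscale (2 ^ size m) (?s m)"
    unfolding split Psi_mult by (simp add: algebra_simps del: rscale_single)
  also have "\<dots> \<in> fil N (Suc (size (add_mset w m)))"
  proof (rule rvs.subspace_add[OF subspace_fil])
    have "rscale 2 (I01 w) \<in> fil N (Suc 0)"
      by (intro rvs.subspace_scale[OF subspace_fil] I01_fil_1 w)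
    moreover have "Psi (I01 w) - rscale 2 (I01 w) \<in> fil N (Suc 0)"
      using Psi_word[OF w] fil_mono[of "Suc 0" 2 N] by auto
    ultimately have "Psi (I01 w) - rscale 2 (I01 w) + rscale 2 (I01 w) \<in> fil N (Suc 0)"
      by (intro rvs.subspace_add[OF subspace_fil])
    then have "Psi (I01 w) \<in> fil N (Suc 0)" by simp
    from fil_mult[OF this add.IH[OF m]]
    show "Psi (I01 w) * (Psi (?s m) - rscale (2 ^ size m) (?s m)) \<in> fil N (Suc (size (add_mset w m)))"
      by simp
    have "rscale (2 ^ size m) (?s m) \<in> fil N (size m)"
      using m by (simp add: fil_def)
    from fil_mult[OF Psi_word[OF w] this]
    show "(Psi (I01 w) - rscale 2 (I01 w)) * rscale (2 ^ size m) (?s m) \<in> fil N (Suc (size (add_mset w m)))"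
      by simp
  qed
  finally show ?case .
qed

lemma Psi_fil:
  assumes "x \<in> fil N n"
  shows "Psi x - rscale (2 ^ n) x \<in> fil N (Suc n)"
proof -
  let ?s = "\<lambda>m. Poly_Mapping.single m (1::rat) :: formal"
  have "Psi x - rscale (2 ^ n) x = (\<Sum>m\<in>Poly_Mapping.keys x.
      rscale (Poly_Mapping.lookup x m) (Psi (?s m) - rscale (2 ^ n) (?s m)))"
  proof -
    have x: "x = (\<Sum>m\<in>Poly_Mapping.keys x. rscale (Poly_Mapping.lookup x m) (?s m))"
      using sum_monomials[of x] by simp
    have "Psi x - rscale (2 ^ n) x = Psi (\<Sum>m\<in>Poly_Mapping.keys x. rscale (Poly_Mapping.lookup x m) (?s m))
        - rscale (2 ^ n) (\<Sum>m\<in>Poly_Mapping.keys x. rscale (Poly_Mapping.lookup x m) (?s m))"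
      using x by simp
    also have "\<dots> = (\<Sum>m\<in>Poly_Mapping.keys x.
      rscale (Poly_Mapping.lookup x m) (Psi (?s m) - rscale (2 ^ n) (?s m)))"
      unfolding Psi_sum Psi_rscale rvs.scale_sum_right sum_subtractf[symmetric] rvs.scale_right_diff_distrib
      by (simp add: mult.commute)
    finally show ?thesis .
  qed
  also have "\<dots> \<in> fil N (Suc n)"
  proof (intro rvs.subspace_sum[OF subspace_fil] rvs.subspace_scale[OF subspace_fil])
    fix m assume "m \<in> Poly_Mapping.keys x"
    then have m: "okm N m" "n \<le> size m"
      using assms by (auto simp: fil_def formals_okm)
    show "Psi (?s m) - rscale (2 ^ n) (?s m) \<in> fil N (Suc n)"
    proof (cases "size m = n")
      case True
      then show ?thesis using Psi_single[OF m(1)] by simp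
    next
      case False
      then have 1: "\<And>c. rscale c (?s m) \<in> fil N (Suc n)"
        using m by (auto simp: fil_def)
      have "Psi (?s m) - rscale (2 ^ size m) (?s m) \<in> fil N (Suc n)"
        using Psi_single[OF m(1)] fil_mono[of "Suc n" "Suc (size m)"] m by auto
      from rvs.subspace_add[OF subspace_fil this 1[of "2 ^ size m - 2 ^ n"]] show ?thesis
        by (simp add: single_diff algebra_simps)
    qed
  qed
  finally show ?thesis .
qed

lemma size_le_weight: "okm N m \<Longrightarrow> size m \<le> weight m"
proof (induction m)
  case (add w m)
  then have "size m \<le> weight m" "length w \<ge> 1" by (auto simp: okm_def Suc_le_eq)
  then show ?case by (simp add: weight_def)
qed simp

text \<open>Each word has weight at least 1. Within a fixed weight the filtration is therefore
  finite, which ends the iteration in \<open>primitive_decomposable\<close>.\<close>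

lemma weight_part_fil:
  assumes "x \<in> fil N n" "p < n"
  shows "weight_part p x = 0"
proof (rule poly_mapping_eqI)
  fix m
  have "weight m \<noteq> p" if "m \<in> Poly_Mapping.keys x"
    using that assms size_le_weight[of N m] by (fastforce simp: fil_def formals_okm)
  then show "Poly_Mapping.lookup (weight_part p x) m = Poly_Mapping.lookup 0 m"
    by (auto simp: in_keys_iff)
qed

lemma tmul_tens_ker:
  assumes "u \<in> tens_ker N K M" "fideal N K" "fideal N M" "K \<subseteq> L" "M \<subseteq> L" "rsubspace L"
  shows "tmul u \<in> L"
  using assms(1) fidealD(2)[OF assms(2)] fidealD(2)[OF assms(3)]
proof (induction rule: tens_ker_induct)
  case (left x y)
  then show ?case using fidealD(4)[OF assms(2)] assms(4) by (auto simp: tmul_tens)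
next
  case (right x y)
  then show ?case using fidealD(3)[OF assms(3)] assms(5) by (auto simp: tmul_tens)
qed (use assms(6) in \<open>auto simp: tmul_add rvs.subspace_0 rvs.subspace_add\<close>)

lemma fideal_tmrel: "N > 0 \<Longrightarrow> fideal N (tmrel N)"
  by (intro fideal_plus_tate fideal_mrel)

lemma mrel_tmrel: "mrel N \<subseteq> tmrel N"
  by (rule plus_tate_superset)

lemma tate_tmrel:
  assumes "N > 0"
  shows "y \<in> formals N \<Longrightarrow> tate_elt N * y \<in> tmrel N"
  using plus_tateI[of 0 "mrel N" y N] rvs.subspace_0[OF mrelD(2)] by simp

lemma Psi_primitive:
  assumes N: "N > 0" and "coact x - tens x 1 - tens 1 x \<in> tens_ker N (tmrel N) (mrel N)"
  shows "Psi x - rscale 2 x \<in> tmrel N"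
  using tmul_tens_ker[OF assms(2) fideal_tmrel[OF N] fideal_mrel subset_refl mrel_tmrel fidealD(2)[OF fideal_tmrel[OF N]]]
  unfolding tmul_diff tmul_tens Psi_def rscale_2 by (simp add: diff_diff_eq)

text \<open>This lets \<open>Psi\<close> descend to the quotient that represents \<A>: relations are
  stable under the coaction, and the Tate element is primitive.\<close>

lemma Psi_tmrel:
  assumes N: "N > 0" and "x \<in> tmrel N"
  shows "Psi x \<in> tmrel N"
proof -
  note T = fideal_tmrel[OF N]
  obtain j y where x: "x = j + tate_elt N * y" "j \<in> mrel N" "y \<in> formals N"
    using assms(2) unfolding plus_tate_def by blast
  have "Psi j \<in> tmrel N"
    unfolding Psi_def
    by (rule tmul_tens_ker[OF coact_mrel[OF x(2)] T fideal_mrel subset_refl mrel_tmrel fidealD(2)[OF T]])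
  moreover have "Psi (tate_elt N) - rscale 2 (tate_elt N) \<in> tmrel N"
    using coact_tate[OF N] tmrel_mrel_ker by (intro Psi_primitive[OF N]) auto
  moreover have "rscale 2 (tate_elt N) \<in> tmrel N"
    using tate_tmrel[OF N formals_1] by (intro rvs.subspace_scale[OF fidealD(2)[OF T]]) simp
  ultimately have "Psi j \<in> tmrel N" "Psi (tate_elt N) \<in> tmrel N"
    using rvs.subspace_add[OF fidealD(2)[OF T]] by fastforce+
  then show ?thesis
    unfolding x Psi_add Psi_mult using x
    by (intro rvs.subspace_add[OF fidealD(2)[OF T]] fidealD(4)[OF T] Psi_formals)
qed

lemma homog_tate: "homog (if N \<le> 2 then 2 else 1) (tate_elt N)"
proof -
  have "homog (length (mzv_word l)) (zeta_m l)" for l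
    using homog_I01[of "mzv_word l"]
    by (cases "even (length l)") (auto simp: zeta_m_def intro: homog_minus)
  from this[of "[(2, 1)]"] this[of "[(1, e)]" for e] show ?thesis
    by (auto simp: tate_elt_def numeral_2_eq_2 intro!: homog_diff)
qed

lemma weight_part_tmrel:
  assumes "x \<in> tmrel N"
  shows "weight_part n x \<in> tmrel N"
proof -
  obtain j y where x: "x = j + tate_elt N * y" "j \<in> mrel N" "y \<in> formals N"
    using assms unfolding plus_tate_def by blast
  define d :: nat where "d = (if N \<le> 2 then 2 else 1)"
  have "weight_part n x = weight_part n j + tate_elt N * (if d \<le> n then weight_part (n - d) y else 0)"
    unfolding x weight_part_add using weight_part_mult_homog[OF homog_tate[of N], of n y]
    by (simp add: d_def)
  also have "\<dots> \<in> tmrel N"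
    using x by (intro plus_tateI mrel_weight_part) (auto intro: weight_part_formals)
  finally show ?thesis .
qed

text \<open>The operator \<^const>\<open>Psi\<close> acts on products of \<open>n\<close> words as \<open>2\<^sup>n\<close>, up to longer products,
  but on primitive elements as \<open>2\<close>.\<close>

lemma primitive_decomposable:
  assumes N: "N > 0" and x: "x \<in> formals N" "homog p x"
    and prim: "Psi x - rscale 2 x \<in> tmrel N"
    and dec: "x = d + \<tau>" "d \<in> fil N 2" "\<tau> \<in> tmrel N"
  shows "x \<in> tmrel N"
proof -
  note T = fidealD(2)[OF fideal_tmrel[OF N]]
  \<comment> \<open>Modulo relations a nonzero multiple of x is pushed ever deeper into the
    filtration. Applying \<open>Psi\<close> minus 2^(n+2) moves y one step further, while x is only
    multiplied by 2 - 2^(n+2), which is nonzero.\<close>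
  have "\<exists>y c. c \<noteq> 0 \<and> y \<in> fil N (n + 2) \<and> y - rscale c x \<in> tmrel N" for n
  proof (induction n)
    case 0
    have "d - rscale 1 x = - \<tau>" using dec by simp
    with dec show ?case
      by (intro exI[of _ d] exI[of _ 1]) (auto simp: numeral_2_eq_2 intro: rvs.subspace_neg[OF T])
  next
    case (Suc n)
    then obtain y c where y: "c \<noteq> 0" "y \<in> fil N (n + 2)" "y - rscale c x \<in> tmrel N" by blast
    let ?e = "2 ^ (n + 2) :: rat"
    have "Psi (y - rscale c x) - rscale ?e (y - rscale c x) + rscale c (Psi x - rscale 2 x) \<in> tmrel N"
      by (rule rvs.subspace_add[OF T rvs.subspace_diff[OF T Psi_tmrel[OF N y(3)] rvs.subspace_scale[OF T y(3)]]
            rvs.subspace_scale[OF T prim]])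
    also have "Psi (y - rscale c x) - rscale ?e (y - rscale c x) + rscale c (Psi x - rscale 2 x) =
      (Psi y - rscale ?e y) - rscale (c * (2 - ?e)) x"
      by (simp add: Psi_diff Psi_rscale rvs.scale_right_diff_distrib rvs.scale_left_diff_distrib algebra_simps)
    finally have "(Psi y - rscale ?e y) - rscale (c * (2 - ?e)) x \<in> tmrel N" .
    moreover have "(2::rat) - ?e \<noteq> 0"
    proof -
      have "(2::rat) ^ 1 < 2 ^ (n + 2)" by (rule power_strict_increasing) auto
      then show ?thesis by simp
    qed
    ultimately show ?case
      using Psi_fil[OF y(2)] y(1)
      by (intro exI[of _ "Psi y - rscale ?e y"] exI[of _ "c * (2 - ?e)"]) simp
  qed
  then obtain y c where y: "c \<noteq> 0" "y \<in> fil N (p + 2)" "y - rscale c x \<in> tmrel N" by blast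
  \<comment> \<open>At depth p + 2 of the filtration y has no part of weight p, so the weight p part
    of the relation is a multiple of x alone.\<close>
  have "weight_part p (y - rscale c x) = - rscale c x"
    using weight_part_fil[OF y(2), of p] x by (simp add: weight_part_diff weight_part_rscale weight_part_homog)
  with weight_part_tmrel[OF y(3), of p] have "- rscale c x \<in> tmrel N" by simp
  from rvs.subspace_scale[OF T this, of "- inverse c"] y(1) show ?thesis
    by (simp flip: rvs.scale_minus_right)
qed

lemma contract_formals:
  assumes "functional \<phi>" "u \<in> formals2 N"
  shows "contract \<phi> u \<in> formals N"
  using assms(2) by (induction rule: formals2_induct)
    (simp_all add: contract_tens[OF assms(1)] contract_add formals_rscale formals_add)

lemma contract_zero:
  assumes "functional \<phi>" "u \<in> formals2 N" "\<And>x. x \<in> formals N \<Longrightarrow> \<phi> x = 0"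
  shows "contract \<phi> u = 0"
  using assms(2) by (induction rule: formals2_induct)
    (simp_all add: contract_tens[OF assms(1)] contract_add assms(3))

lemma period_tate_nonzero:
  assumes "N = 2 \<or> N = 3"
  shows "period (tate_elt N) \<noteq> 0"
proof (cases "N = 2")
  case True
  then show ?thesis
    using reg_int_zeta[of 2] unfolding tate_elt_def zeta_m_1 by (auto simp: period_minus period_I01)
next
  case False
  with assms have "N = 3" by simp
  then show ?thesis
    using period_tate3 unfolding tate_elt_def zeta_m_1
    by (auto simp: period_minus period_diff period_I01 dword_def)
qed

definition colon :: "nat \<Rightarrow> formal set" where
  "colon N = {z \<in> formals N. tate_elt N * z \<in> mrel N}"

lemma mrel_colon: "N > 0 \<Longrightarrow> mrel N \<subseteq> colon N"
  using mrelD(1)[of N] mrelD(3)[OF tate_formals] by (auto simp: colon_def)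

text \<open>Hence the Tate element is a nonzerodivisor modulo the motivic relations:
  \<^term>\<open>colon N\<close> satisfies the conditions of which \<^term>\<open>mrel N\<close> is the largest solution.\<close>

lemma admissible_colon:
  assumes N: "N = 2 \<or> N = 3"
  shows "admissible N (colon N)"
proof -
  have N0: "N > 0" using N by auto
  note t = tate_formals[OF N0]
  have id: "fideal N (colon N)"
    unfolding fideal_def rvs.subspace_def
  proof (intro conjI ballI allI subsetI)
    fix x y assume "x \<in> formals N" "y \<in> colon N"
    moreover have "tate_elt N * (x * y) = x * (tate_elt N * y)" by (simp only: mult_ac)
    ultimately show "x * y \<in> colon N"
      using mrelD(3)[of x N "tate_elt N * y"] unfolding colon_def by (metis (mono_tags, lifting) formals_mult mem_Collect_eq)
  qed (auto simp: colon_def ring_distribs rvs.subspace_0[OF mrelD(2)] intro: formals_add formals_rscale mrel_add mrel_rscale)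
  show ?thesis
    unfolding admissible_def graded_ideal_iff
  proof (intro conjI id ballI allI)
    fix z assume "z \<in> colon N"
    then have z: "z \<in> formals N" "tate_elt N * z \<in> mrel N" by (auto simp: colon_def)
    from period_mrel[OF z(2)] period_tate_nonzero[OF N] show "period z = 0"
      by (simp add: period_mult)
    define d :: nat where "d = (if N \<le> 2 then 2 else 1)"
    fix n
    have "weight_part (n + d) (tate_elt N * z) = tate_elt N * weight_part n z"
      using weight_part_mult_homog[OF homog_tate[of N], of "n + d" z] by (simp add: d_def split: if_splits)
    with mrel_weight_part[OF z(2), of "n + d"] show "weight_part n z \<in> colon N"
      using z by (auto simp: colon_def weight_part_formals)
    show "coact z \<in> tens_ker N (plus_tate N (colon N)) (colon N)"
    proof (rule tens_ker_if_contract)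
      fix \<phi> :: "formal \<Rightarrow> rat"
      assume \<phi>: "functional \<phi>" "\<And>x. x \<in> plus_tate N (colon N) \<Longrightarrow> \<phi> x = 0"
      have \<phi>T: "\<phi> x = 0" if "x \<in> tmrel N" for x
        using that plus_tate_mono[OF mrel_colon[OF N0], of N] by (intro \<phi>(2)) auto
      \<comment> \<open>Splitting off the primitive part of the Tate element t: the term t \<otimes>
        1 is killed by \<phi>, and 1 \<otimes> t pulls t out of the contraction. Hence t times the
        contracted coaction of z is a relation, as the colon ideal requires.\<close>
      define k where "k = coact (tate_elt N) - tens (tate_elt N) 1 - tens 1 (tate_elt N)"
      have cz: "coact z \<in> formals2 N" by (intro coact_formals2 z)
      have "k * coact z \<in> tens_ker N (tmrel N) (mrel N)"
        using coact_tate[OF N0] tmrel_mrel_ker unfolding k_def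
        by (intro tens_ker_mult cz fideal_tmrel[OF N0] fideal_mrel) auto
      then have 1: "contract \<phi> (k * coact z) \<in> mrel N"
        by (rule contract_tens_ker) (use \<phi> \<phi>T in \<open>auto intro: fidealD fideal_tmrel[OF N0] mrelD\<close>)
      have 2: "contract \<phi> (coact (tate_elt N * z)) \<in> mrel N"
        by (rule contract_tens_ker[OF coact_mrel[OF z(2)]])
           (use \<phi> \<phi>T in \<open>auto intro: fidealD fideal_tmrel[OF N0] mrelD\<close>)
      have "contract \<phi> (tens (tate_elt N) 1 * coact z) = 0"
        unfolding contract_mult_left[OF \<phi>(1)]
        by (rule contract_zero[OF functional_mult[OF \<phi>(1)] cz]) (intro \<phi>T tate_tmrel[OF N0])
      moreover have "coact (tate_elt N * z) = k * coact z + tens (tate_elt N) 1 * coact z + tens 1 (tate_elt N) * coact z"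
        unfolding coact_mult k_def by (simp add: ring_distribs)
      ultimately have "contract \<phi> (coact (tate_elt N * z)) = contract \<phi> (k * coact z) + tate_elt N * contract \<phi> (coact z)"
        by (simp add: contract_add contract_mult_right[OF \<phi>(1)])
      with mrel_diff[OF 2 1] have "tate_elt N * contract \<phi> (coact z) \<in> mrel N" by simp
      then show "contract \<phi> (coact z) \<in> colon N"
        using contract_formals[OF \<phi>(1) cz] by (simp add: colon_def)
    qed (use z N0 id in \<open>auto intro: coact_formals2 dest: fideal_plus_tate fidealD(1,2)\<close>)
  qed
qed

lemma tate_cancel: "N = 2 \<or> N = 3 \<Longrightarrow> z \<in> formals N \<Longrightarrow> tate_elt N * z \<in> mrel N \<Longrightarrow> z \<in> mrel N"
  using admissible_le[OF admissible_colon] by (auto simp: colon_def)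

section \<open>The right counit and the coinvariants of the coaction\<close>

definition rcounit :: "formal2 \<Rightarrow> formal" where
  "rcounit = lin_ext (Poly_Mapping.single 0) (\<lambda>(m, n). if n = 0 then Poly_Mapping.single m 1 else 0)"

lemma rcounit_0 [simp]: "rcounit 0 = 0"
  and rcounit_add: "rcounit (u + v) = rcounit u + rcounit v"
  and rcounit_rscale: "rcounit (rscale c u) = rscale c (rcounit u)"
  unfolding rcounit_def single_hom.lin_ext_add single_hom.lin_ext_rscale by (simp_all add: rscale_def)

lemma rcounit_diff: "rcounit (u - v) = rcounit u - rcounit v"
  using rcounit_add[of "u - v" v] by simp

lemma rcounit_sum: "rcounit (sum f A) = (\<Sum>a\<in>A. rcounit (f a))"
  by (induction A rule: infinite_finite_induct) (simp_all add: rcounit_add)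

lemma rcounit_tens: "rcounit (tens x y) = rscale (Poly_Mapping.lookup y 0) x"
proof (induction x rule: poly_mapping_induct)
  case (single m c)
  show ?case
  proof (induction y rule: poly_mapping_induct)
    case (single n d)
    show ?case
      by (simp add: tens_single, simp add: rcounit_def mult_single lookup_single when_def mult.commute)
  qed (simp_all add: tens_add_right rcounit_add lookup_add rvs.scale_left_distrib del: rscale_single)
qed (simp_all add: tens_add_left rcounit_add rvs.scale_right_distrib)

lemma rcounit_mult: "rcounit (u * v) = rcounit u * rcounit v"
  unfolding rcounit_def by (rule single_hom.lin_ext_mult) (auto simp: mult_single split: prod.splits)

lemma rcounit_1: "rcounit 1 = 1"
  using rcounit_tens[of 1 1] by (simp add: tens_1_1)

lemma rcounit_coact_word:
  assumes "set w \<subseteq> insert 0 (unit_roots N)" "w \<noteq> []"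
  shows "rcounit (coact_word w) = I01 w"
proof -
  have 0: "Poly_Mapping.lookup (I01 w) 0 = 0"
    using I01_fil_1[OF assms] by (simp add: fil_1)
  have "(\<Sum>S \<in> Pow {1..length w} - {{}, {1..length w}}. rcounit (tens (\<Prod>p\<le>card S. gap w S p) (rest w S))) = 0"
  proof (rule sum.neutral, rule ballI)
    fix S assume "S \<in> Pow {1..length w} - {{}, {1..length w}}"
    then have "S \<subseteq> {1..length w}" "S \<noteq> {}" by auto
    from rest_fil_1[OF assms(1) this] show "rcounit (tens (\<Prod>p\<le>card S. gap w S p) (rest w S)) = 0"
      by (simp add: rcounit_tens fil_1)
  qed
  then show ?thesis
    unfolding coact_word_split[OF assms(2)] rcounit_add rcounit_sum by (simp add: rcounit_tens 0)
qed

lemma rcounit_coact: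
  assumes "x \<in> formals N"
  shows "rcounit (coact x) = x"
proof -
  have prod: "rcounit (\<Prod>w\<in>#m. coact_word w) = Poly_Mapping.single m 1" if "okm N m" for m
    using that
  proof (induction m)
    case empty
    show ?case using rcounit_1 by (simp flip: single_one)
  next
    case (add w m)
    then have "set w \<subseteq> insert 0 (unit_roots N)" "w \<noteq> []" "okm N m" by (auto simp: okm_def)
    then show ?case
      using add.IH by (simp add: rcounit_mult rcounit_coact_word) (simp add: I01_def mult_single)
  qed
  have "rcounit (coact x) = rcounit (coact (\<Sum>m\<in>Poly_Mapping.keys x. Poly_Mapping.single m (Poly_Mapping.lookup x m)))"
    by (simp add: sum_monomials)
  also have "\<dots> = (\<Sum>m\<in>Poly_Mapping.keys x. Poly_Mapping.single m (Poly_Mapping.lookup x m))"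
    unfolding coact_sum rcounit_sum coact_single rcounit_rscale
    using assms by (intro sum.cong refl) (simp add: prod formals_okm)
  finally show ?thesis by (simp add: sum_monomials)
qed

text \<open>The ideal is graded, and the period of the weight 0 part is the constant coefficient
  itself.\<close>

lemma lookup_mrel_0:
  assumes "y \<in> mrel N"
  shows "Poly_Mapping.lookup y 0 = 0"
proof -
  have "weight_part 0 y = rscale (Poly_Mapping.lookup (weight_part 0 y) 0) 1"
    using mrelD(1)[of N] assms by (intro homog_0_iff[of _ N] weight_part_formals[of _ N]) auto
  then have "period (weight_part 0 y) = of_rat (Poly_Mapping.lookup y 0)"
    by (metis lookup_weight_part mult.right_neutral period_1 period_rscale weight_0(1))
  with period_mrel[OF mrel_weight_part[OF assms]] show ?thesis by simp
qed

lemma rcounit_tens_ker: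
  assumes N: "N > 0" and "u \<in> tens_ker N (tmrel N) (mrel N)"
  shows "rcounit u \<in> tmrel N"
  using assms(2) fidealD(2)[OF fideal_tmrel[OF N]] mrelD(2)[of N]
  by (induction rule: tens_ker_induct)
     (simp_all add: rcounit_tens rcounit_add lookup_mrel_0 rvs.subspace_0 rvs.subspace_add rvs.subspace_scale
       fidealD(2)[OF fideal_tmrel[OF N]])

text \<open>The coinvariants of \<H> are the polynomials in the Tate element. In positive weight the
  counit shows that y vanishes in \<A>, so modulo relations y is t times some z; cancelling t shows
  that z is coinvariant of smaller weight.\<close>

lemma coinvariant:
  assumes N: "N = 2 \<or> N = 3" and d: "d = (if N \<le> 2 then 2 else 1)"
    and "y \<in> formals N" "homog n y" "coact y - tens 1 y \<in> tens_ker N (tmrel N) (mrel N)"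
  shows "y \<in> mrel N \<or> (\<exists>q m. n = m * d \<and> y - rscale q (tate_elt N ^ m) \<in> mrel N)"
  using assms(3-)
proof (induction n arbitrary: y rule: less_induct)
  case (less n)
  let ?t = "tate_elt N" and ?ker = "tens_ker N (tmrel N) (mrel N)"
  have N0: "N > 0" using N by auto
  note T = fideal_tmrel[OF N0] and t = tate_formals[OF N0]
  show ?case
  proof (cases "n = 0")
    case True
    then have "y = rscale (Poly_Mapping.lookup y 0) 1"
      using less.prems by (intro homog_0_iff) auto
    then have "y - rscale (Poly_Mapping.lookup y 0) (?t ^ 0) = 0" by simp
    then show ?thesis
      using True rvs.subspace_0[OF mrelD(2)[of N]] by (intro disjI2 exI[of _ "Poly_Mapping.lookup y 0"] exI[of _ 0]) simp
  next
    case False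
    then have "Poly_Mapping.lookup y 0 = 0"
      using less.prems(2) by (metis homog_def in_keys_iff weight_0(1))
    then have "y \<in> tmrel N"
      using rcounit_tens_ker[OF N0 less.prems(3)] less.prems(1)
      by (simp add: rcounit_diff rcounit_coact rcounit_tens)
    then obtain j z where y: "y = j + ?t * z" "j \<in> mrel N" "z \<in> formals N"
      unfolding plus_tate_def by blast
    have "y = weight_part n y" using less.prems(2) by (simp add: weight_part_homog)
    also have "\<dots> = weight_part n j + (if d \<le> n then ?t * weight_part (n - d) z else 0)"
      unfolding y weight_part_add using weight_part_mult_homog[OF homog_tate[of N], of n z] by (simp add: d)
    finally have y': "y = weight_part n j + (if d \<le> n then ?t * weight_part (n - d) z else 0)" .
    have j': "weight_part n j \<in> mrel N" by (intro mrel_weight_part y)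
    show ?thesis
    proof (cases "d \<le> n")
      case False
      with y' j' show ?thesis by simp
    next
      case True
      define z' where "z' = weight_part (n - d) z"
      have z': "z' \<in> formals N" "homog (n - d) z'" and y'': "y = weight_part n j + ?t * z'"
        using y(3) y' True by (auto simp: z'_def weight_part_formals)
      have cz: "coact z' \<in> formals2 N" "coact z' - tens 1 z' \<in> formals2 N"
        using z' by (auto intro!: rvs.subspace_diff[OF subspace_formals2] coact_formals2 formals2_tens)
      define k where "k = coact ?t - tens ?t 1 - tens 1 ?t"
      have "k * coact z' \<in> ?ker"
        using coact_tate[OF N0] tmrel_mrel_ker unfolding k_def by (intro tens_ker_mult cz T fideal_mrel) auto
      moreover have "tens ?t 1 * coact z' \<in> ?ker"
        using tate_tmrel[OF N0 formals_1] by (intro tens_ker_mult cz T fideal_mrel tens_kerL) auto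
      moreover have "coact (weight_part n j) - tens 1 (weight_part n j) \<in> ?ker"
        by (intro rvs.subspace_diff[OF subspace_tens_ker] coact_mrel tens_kerR j') simp
      ultimately have "(coact y - tens 1 y) - (coact (weight_part n j) - tens 1 (weight_part n j))
          - k * coact z' - tens ?t 1 * coact z' \<in> ?ker"
        by (metis less.prems(3) rvs.subspace_diff[OF subspace_tens_ker])
      \<comment> \<open>All terms removed are in the kernel; what is left is the coinvariance defect
        of z' times 1 \<otimes> t.\<close>
      also have "(coact y - tens 1 y) - (coact (weight_part n j) - tens 1 (weight_part n j))
          - k * coact z' - tens ?t 1 * coact z' = tens 1 ?t * (coact z' - tens 1 z')"
        unfolding y'' coact_add coact_mult k_def
        by (simp add: ring_distribs tens_add_right tens_mult)
      finally have ker: "tens 1 ?t * (coact z' - tens 1 z') \<in> ?ker" .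
      have "coact z' - tens 1 z' \<in> ?ker"
      \<comment> \<open>After contraction with a functional, 1 \<otimes> t becomes multiplication by
        t, and \<open>tate_cancel\<close> removes it.\<close>
      proof (rule tens_ker_if_contract[OF cz(2)])
        fix \<phi> :: "formal \<Rightarrow> rat"
        assume \<phi>: "functional \<phi>" "\<And>x. x \<in> tmrel N \<Longrightarrow> \<phi> x = 0"
        have "contract \<phi> (tens 1 ?t * (coact z' - tens 1 z')) \<in> mrel N"
          by (rule contract_tens_ker[OF ker \<phi>]) (auto intro: fidealD(2)[OF T] mrelD(2))
        then show "contract \<phi> (coact z' - tens 1 z') \<in> mrel N"
          unfolding contract_mult_right[OF \<phi>(1)]
          by (rule tate_cancel[OF N contract_formals[OF \<phi>(1) cz(2)]])
      qed (use fidealD(1,2)[OF T] in auto)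
      moreover have "n - d < n" using True d False by (auto simp: \<open>n \<noteq> 0\<close>)
      ultimately consider "z' \<in> mrel N" | q m where "n - d = m * d" "z' - rscale q (?t ^ m) \<in> mrel N"
        using less.IH[OF _ z'] by blast
      then show ?thesis
      proof cases
        case 1
        then have "y \<in> mrel N"
          unfolding y'' by (intro mrel_add j' mrelD(3) t)
        then show ?thesis ..
      next
        case (2 q m)
        have "weight_part n j + ?t * (z' - rscale q (?t ^ m)) \<in> mrel N"
          by (intro mrel_add j' mrelD(3) t 2)
        also have "weight_part n j + ?t * (z' - rscale q (?t ^ m)) = y - rscale q (?t ^ Suc m)"
          unfolding y'' by (simp add: right_diff_distrib)
        finally show ?thesis
          using 2 True by (intro disjI2 exI[of _ q] exI[of _ "Suc m"]) auto
      qed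
    qed
  qed
qed

lemma indec_ker_formals: "N > 0 \<Longrightarrow> indec_ker N \<subseteq> formals N"
  unfolding indec_ker_def
  by (rule rvs.span_minimal) (use fidealD(1)[OF fideal_tmrel] in \<open>auto intro: formals_mult subspace_formals\<close>)

lemma subspace_indec_ker: "rsubspace (indec_ker N)"
  by (simp add: indec_ker_def)

lemma indec_ker_decompose:
  assumes N: "N > 0" and "x \<in> indec_ker N"
  shows "\<exists>d \<tau>. x = d + \<tau> \<and> d \<in> fil N 2 \<and> \<tau> \<in> tmrel N"
proof -
  note T = fidealD(2)[OF fideal_tmrel[OF N]]
  have "indec_ker N \<subseteq> {d + \<tau> | d \<tau>. d \<in> fil N 2 \<and> \<tau> \<in> tmrel N}"
    unfolding indec_ker_def
  proof (rule rvs.span_minimal)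
    show "rsubspace {d + \<tau> | d \<tau>. d \<in> fil N 2 \<and> \<tau> \<in> tmrel N}"
      by (rule rvs.subspace_sums[OF subspace_fil T])
    have 1: "x \<in> {d + \<tau> | d \<tau>. d \<in> fil N 2 \<and> \<tau> \<in> tmrel N}" if "x \<in> tmrel N" for x
      using that rvs.subspace_0[OF subspace_fil] by (intro CollectI exI[of _ 0] exI[of _ x]) auto
    have 2: "x * y \<in> {d + \<tau> | d \<tau>. d \<in> fil N 2 \<and> \<tau> \<in> tmrel N}"
      if "x \<in> formals N" "y \<in> formals N" "Poly_Mapping.lookup x 0 = 0" "Poly_Mapping.lookup y 0 = 0" for x y
    proof -
      have "x * y \<in> fil N (Suc 0 + Suc 0)" using that by (intro fil_mult) (auto simp: fil_1)
      then show ?thesis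
        using rvs.subspace_0[OF T] by (intro CollectI exI[of _ "x * y"] exI[of _ 0]) (auto simp: numeral_2_eq_2)
    qed
    show "tmrel N \<union> {x * y |x y. x \<in> formals N \<and> y \<in> formals N \<and>
            Poly_Mapping.lookup x 0 = 0 \<and> Poly_Mapping.lookup y 0 = 0}
       \<subseteq> {d + \<tau> | d \<tau>. d \<in> fil N 2 \<and> \<tau> \<in> tmrel N}"
      using 1 2 by blast
  qed
  with assms(2) show ?thesis by blast
qed

lemma zeta_formals: "e \<in> unit_roots N \<Longrightarrow> zeta_m [(p, e)] \<in> formals N"
  by (rule zeta_m_formals) auto

lemma homog_zeta: "p > 0 \<Longrightarrow> homog p (zeta_m [(p, e)])"
  unfolding zeta_m_1 using homog_I01[of "dword 0 (inverse e) (p - 1)"] by (intro homog_minus) simp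

theorem odd_zeta_indecomposable:
  assumes N: "N = 2 \<or> N = 3" and p: "p \<ge> 3" "odd p"
  shows "zeta_m [(p, 1)] \<notin> indec_ker N"
proof
  let ?z = "zeta_m [(p, 1)]" and ?t = "tate_elt N"
  assume dec: "?z \<in> indec_ker N"
  have N0: "N > 0" using N by auto
  note T = fideal_tmrel[OF N0] and z = zeta_formals[OF unit_roots_1, of p N]
  obtain d \<tau> where d: "?z = d + \<tau>" "d \<in> fil N 2" "\<tau> \<in> tmrel N"
    using indec_ker_decompose[OF N0 dec] by blast
  have prim: "coact ?z - tens ?z 1 - tens 1 ?z \<in> tens_ker N (tmrel N) (mrel N)"
    using coact_zeta[OF N0 unit_roots_1] tmrel_mrel_ker by auto
  have zT: "?z \<in> tmrel N"
    by (rule primitive_decomposable[OF N0 z homog_zeta Psi_primitive[OF N0 prim] d]) (use p in auto)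
  \<comment> \<open>An element that is primitive and zero in \<A> has no left term left: it is
    coinvariant.\<close>
  then have "tens ?z 1 \<in> tens_ker N (tmrel N) (mrel N)" by (intro tens_kerL) auto
  from rvs.subspace_add[OF subspace_tens_ker prim this]
  have "coact ?z - tens 1 ?z \<in> tens_ker N (tmrel N) (mrel N)" by simp
  from coinvariant[OF N refl z homog_zeta this] p
  consider "?z \<in> mrel N" | q m where "p = m * (if N \<le> 2 then 2 else 1)" "?z - rscale q (?t ^ m) \<in> mrel N"
    by auto
  then have "\<exists>q. (N = 3 \<or> q = 0) \<and> ?z - rscale q (?t ^ p) \<in> mrel N"
  proof cases
    case 1
    then show ?thesis by (intro exI[of _ 0]) simp
  next
    case (2 q m)
    with p N have "N = 3" "m = p" by auto
    with 2 show ?thesis by (intro exI[of _ q]) simp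
  qed
  then obtain q where "N = 3 \<or> q = 0" "?z - rscale q (?t ^ p) \<in> mrel N"
    by blast
  then have q: "N = 3 \<or> q = 0" "period ?z = of_rat q * period ?t ^ p"
    using period_mrel by (fastforce simp: period_diff period_rscale period_power)+
  obtain r :: real where "r \<noteq> 0" "reg_int (dword 0 1 (p - 1)) = of_real r"
    using reg_int_zeta[of p] p by auto
  then have r: "r \<noteq> 0" "period ?z = - of_real r"
    unfolding zeta_m_1 by (auto simp: period_minus period_I01)
  show False
  proof (cases "N = 3")
    case False
    then show ?thesis using q r by simp
  next
    case True
    obtain s :: real where "reg_int [eps 3] - reg_int [inverse (eps 3)] = \<i> * of_real s"
      using period_tate3 by blast
    then have "period ?t = \<i> * of_real s"
      using True unfolding tate_elt_def zeta_m_1 by (simp add: period_minus period_diff period_I01 dword_def)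
    moreover obtain n where "p = 2 * n + 1" using p by (elim oddE)
    moreover from this have "\<i> ^ p = \<i> * (- 1) ^ n"
      by (simp add: power_add power_mult)
    ultimately have "period ?t ^ p = \<i> * of_real ((- 1) ^ n * s ^ p)"
      by (simp only: power_mult_distrib) simp
    with q r have "- of_real r = of_rat q * (\<i> * of_real ((- 1) ^ n * s ^ p))" by simp
    then have "Re (- of_real r) = Re (of_rat q * (\<i> * of_real ((- 1) ^ n * s ^ p)))" by metis
    moreover have "Im (of_rat q :: complex) = 0" by (cases q) (simp add: of_rat_rat Im_divide)
    ultimately show False using r(1) by simp
  qed
qed

lemma coact_tate_power:
  assumes N: "N > 0"
  shows "coact (tate_elt N ^ n) - tens 1 (tate_elt N ^ n) \<in> tens_ker N (tmrel N) (mrel N)"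
proof (induction n)
  case 0
  show ?case using rvs.subspace_0[OF subspace_tens_ker] by (simp add: tens_1_1)
next
  case (Suc n)
  let ?t = "tate_elt N" and ?ker = "tens_ker N (tmrel N) (mrel N)"
  note t = tate_formals[OF N]
  have "tens ?t 1 \<in> ?ker" using tate_tmrel[OF N formals_1] by (intro tens_kerL) auto
  moreover have "coact ?t - tens ?t 1 - tens 1 ?t \<in> ?ker" using coact_tate[OF N] tmrel_mrel_ker by auto
  ultimately have "coact ?t - tens ?t 1 - tens 1 ?t + tens ?t 1 \<in> ?ker"
    by (intro rvs.subspace_add[OF subspace_tens_ker])
  then have 1: "coact ?t - tens 1 ?t \<in> ?ker" by simp
  have "(coact ?t - tens 1 ?t) * coact (?t ^ n) + (coact (?t ^ n) - tens 1 (?t ^ n)) * tens 1 ?t \<in> ?ker"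
    by (intro rvs.subspace_add[OF subspace_tens_ker] tens_ker_mult 1 Suc.IH fideal_tmrel N fideal_mrel
        coact_formals2 formals_power formals2_tens t) auto
  also have "(coact ?t - tens 1 ?t) * coact (?t ^ n) + (coact (?t ^ n) - tens 1 (?t ^ n)) * tens 1 ?t =
     coact (?t ^ Suc n) - tens 1 (?t ^ Suc n)"
  proof -
    have "tens 1 (?t ^ Suc n) = tens 1 (?t ^ n) * tens 1 ?t" by (simp add: tens_mult mult.commute)
    then show ?thesis by (simp add: coact_mult ring_distribs mult_ac)
  qed
  finally show ?case .
qed

lemma unit_roots_2: "unit_roots 2 = {1, -1}"
  by (auto simp: unit_roots_def power2_eq_1_iff)

lemma eps_2: "eps 2 = -1"
  by (simp add: eps_def)

lemma unit_roots_3: "unit_roots 3 = {1, eps 3, inverse (eps 3)}"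
proof -
  have "z \<in> {1, eps 3, inverse (eps 3)}" if "z ^ 3 = 1" for z
  proof -
    have "(z - 1) * ((z - eps 3) * (z - inverse (eps 3))) = z ^ 3 - 1"
      unfolding eps_3_prod by (simp add: algebra_simps power2_eq_square power3_eq_cube)
    with that show ?thesis by simp
  qed
  then show ?thesis
    using eps_unit_root[of 3] unit_roots_inverse[OF eps_unit_root[of 3]] by (auto simp: unit_roots_def)
qed

text \<open>The combination x of zeta elements is primitive, but its period is q times a power of
  the Tate period. Subtracting q t^m makes the period 0; t^m is coinvariant instead of primitive, so
  the general form of \<open>mrel_extend\<close> is needed.\<close>

lemma zeta_distribution_aux:
  assumes N: "N > 0" and e: "e \<in> unit_roots N" and p: "p > 0" and h: "p = m * (if N \<le> 2 then 2 else 1) \<or> q = 0"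
    and m: "m > 0"
    and per: "period (zeta_m [(p, e)]) = of_rat c * period (zeta_m [(p, 1)]) + of_rat q * period (tate_elt N) ^ m"
  shows "zeta_m [(p, e)] - rscale c (zeta_m [(p, 1)]) \<in> tmrel N"
proof -
  let ?t = "tate_elt N" and ?ker = "tens_ker N (tmrel N) (mrel N)"
  note t = tate_formals[OF N]
  define x where "x = zeta_m [(p, e)] - rscale c (zeta_m [(p, 1)])"
  define g where "g = x - rscale q (?t ^ m)"
  \<comment> \<open>Chosen so that g + t y is the primitive element x.\<close>
  define y where "y = rscale q (?t ^ (m - 1))"
  have xg: "x = g + ?t * y"
    using m by (cases m) (simp_all add: g_def y_def)
  have x: "x \<in> formals N" unfolding x_def
    by (intro formals_diff formals_rscale zeta_formals e) auto
  have y: "y \<in> formals N" unfolding y_def by (intro formals_rscale formals_power t)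
  have hq: "homog p (rscale q (?t ^ m))"
  proof (cases "q = 0")
    case False
    then have "p = m * (if N \<le> 2 then 2 else 1)" using h by blast
    then show ?thesis using homog_rscale[OF homog_power[OF homog_tate[of N], of m], of q] by simp
  qed simp
  have hom: "homog p g" unfolding g_def x_def
    by (rule homog_diff[OF _ hq]) (intro homog_diff homog_rscale homog_zeta p)
  have co: "coact x - tens x 1 - tens 1 x \<in> ?ker"
  proof -
    have "(coact (zeta_m [(p, e)]) - tens (zeta_m [(p, e)]) 1 - tens 1 (zeta_m [(p, e)]))
       - rscale c (coact (zeta_m [(p, 1)]) - tens (zeta_m [(p, 1)]) 1 - tens 1 (zeta_m [(p, 1)])) \<in> ?ker"
      by (intro rvs.subspace_diff[OF subspace_tens_ker] rvs.subspace_scale[OF subspace_tens_ker]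
           subsetD[OF tmrel_mrel_ker] coact_zeta N e) auto
    then show ?thesis
      by (simp add: x_def coact_diff coact_rscale tens_diff_left tens_diff_right tens_rscale_left
          tens_rscale_right rvs.scale_right_diff_distrib algebra_simps)
  qed
  have "g \<in> mrel N"
  proof (rule mrel_extend[OF N _ hom _ y])
    show "g \<in> formals N" unfolding g_def by (intro formals_diff formals_rscale formals_power x t)
    show "period g = 0" by (simp add: g_def x_def period_diff period_rscale period_power per)
    have "(coact x - tens x 1 - tens 1 x) - rscale q (coact (?t ^ m) - tens 1 (?t ^ m)) \<in> ?ker"
      by (intro rvs.subspace_diff[OF subspace_tens_ker co] rvs.subspace_scale[OF subspace_tens_ker] coact_tate_power N)
    also have "(coact x - tens x 1 - tens 1 x) - rscale q (coact (?t ^ m) - tens 1 (?t ^ m)) =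
        coact g - tens (g + ?t * y) 1 - tens 1 g"
      unfolding xg[symmetric] by (simp add: g_def coact_diff coact_rscale tens_diff_right tens_rscale_right
          rvs.scale_right_diff_distrib algebra_simps)
    finally show "coact g - tens (g + ?t * y) 1 - tens 1 g \<in> ?ker" .
  qed
  then have "g + ?t * y \<in> tmrel N" by (intro plus_tateI y)
  with xg show ?thesis by (simp add: x_def)
qed

lemma zeta_distribution:
  assumes N: "N = 2 \<or> N = 3" and p: "p \<ge> 3" "odd p" and e: "e \<in> unit_roots N"
  shows "zeta_m [(p, e)] - rscale (c1 N e p) (zeta_m [(p, 1)]) \<in> tmrel N"
proof (cases "e = 1")
  case True
  then show ?thesis
    using rvs.subspace_0[OF fidealD(2)[OF fideal_tmrel[of N]]] N by (auto simp: c1_def)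
next
  case e1: False
  show ?thesis
  proof (cases "N = 2")
    case True
    with e e1 have "e = -1" by (simp add: unit_roots_2)
    \<comment> \<open>For N = 2 the periods agree exactly, so q = 0 and the exponent 1 is a
      placeholder.\<close>
    have "period (zeta_m [(p, e)]) = of_rat (c1 N e p) * period (zeta_m [(p, 1)]) + of_rat 0 * period (tate_elt N) ^ 1"
      using reg_int_minus1[of p] p True \<open>e = -1\<close>
      by (simp add: zeta_m_1 period_minus period_I01 c1_def of_rat_diff of_rat_divide of_rat_power)
    from zeta_distribution_aux[OF _ e _ _ _ this] p True show ?thesis by auto
  next
    case False
    with N have N3: "N = 3" by simp
    with e e1 have e': "inverse e = eps 3 \<or> inverse e = inverse (eps 3)"
      by (auto simp: unit_roots_3)
    obtain q where q: "reg_int (dword 0 (inverse e) (p - 1)) = (1 / 3 ^ (p - 1) - 1) / 2 * reg_int (dword 0 1 (p - 1))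
        + of_rat q * (reg_int [eps 3] - reg_int [inverse (eps 3)]) ^ p"
      using reg_int_eps3[OF p e'] by blast
    have t: "period (tate_elt N) = reg_int [eps 3] - reg_int [inverse (eps 3)]"
      using N3 unfolding tate_elt_def zeta_m_1 by (simp add: period_minus period_diff period_I01 dword_def)
    have "period (zeta_m [(p, e)]) = of_rat (c1 N e p) * period (zeta_m [(p, 1)]) + of_rat (- q) * period (tate_elt N) ^ p"
      unfolding t using q N3 e1
      by (simp add: zeta_m_1 period_minus period_I01 c1_def of_rat_diff of_rat_divide of_rat_power of_rat_minus)
    from zeta_distribution_aux[OF _ e _ _ _ this] p N3 show ?thesis by auto
  qed
qed

subsection \<open>The derivations\<close>

text \<open>Functionals that vanish on 1 and on products, i.e. elements of the Lie algebra dual to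
  the indecomposables. Contracting the coaction with one of them linearises Goncharov's
  formula.\<close>

definition infinitesimal :: "nat \<Rightarrow> (formal \<Rightarrow> rat) \<Rightarrow> bool" where
  "infinitesimal N \<psi> \<longleftrightarrow> functional \<psi> \<and> \<psi> 1 = 0 \<and>
     (\<forall>x \<in> fil N (Suc 0). \<forall>y \<in> fil N (Suc 0). \<psi> (x * y) = 0)"

lemma prod_gap_full: "(\<Prod>p\<le>card {1..length w}. gap w {1..length w} p) = 1"
proof -
  have "tens (\<Prod>p\<le>card {1..length w}. gap w {1..length w} p) (rest w {1..length w}) = tens 1 (I01 w)"
    by (rule coact_term_full)
  moreover have "rest w {1..length w} = I01 w"
    by (simp add: rest_def sorted_list_of_set_1n ext_map_full del: upt_Suc)
  ultimately have eq: "tens (\<Prod>p\<le>card {1..length w}. gap w {1..length w} p) (I01 w) = tens 1 (I01 w)" by simp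
  \<comment> \<open>Comparing coefficients of this monomial of the right factor cancels that factor
    from the tensor identity.\<close>
  obtain n where n: "Poly_Mapping.lookup (I01 w) n = 1"
    by (cases "w = []") (auto simp: I01_def intro: that[of 0] that[of "{#w#}"])
  show ?thesis
  proof (rule poly_mapping_eqI)
    fix m
    from eq have "Poly_Mapping.lookup (tens (\<Prod>p\<le>card {1..length w}. gap w {1..length w} p) (I01 w)) (m, n)
      = Poly_Mapping.lookup (tens 1 (I01 w)) (m, n)" by simp
    then show "Poly_Mapping.lookup (\<Prod>p\<le>card {1..length w}. gap w {1..length w} p) m = Poly_Mapping.lookup 1 m"
      using n by (simp only: lookup_tens mult_1_right)
  qed
qed

text \<open>On \<open>gaps n\<close> this gives the index sets that omit exactly one nonempty block
  of consecutive letters: the terms of the coaction that survive modulo products.\<close>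

definition skip :: "nat \<Rightarrow> nat \<times> nat \<Rightarrow> nat set" where
  "skip n = (\<lambda>(i, j). {1..n} - {i<..<j})"

definition gaps :: "nat \<Rightarrow> (nat \<times> nat) set" where
  "gaps n = {(i, j). Suc i < j \<and> j \<le> Suc n}"

lemma finite_gaps: "finite (gaps n)"
  by (rule finite_subset[of _ "{..n} \<times> {..Suc n}"]) (auto simp: gaps_def)

lemma inj_on_skip: "inj_on (skip n) (gaps n)"
proof (rule inj_onI, safe)
  fix i j i' j' assume *: "(i, j) \<in> gaps n" "(i', j') \<in> gaps n" "skip n (i, j) = skip n (i', j')"
  then have sub: "{i<..<j} \<subseteq> {1..n}" "{i'<..<j'} \<subseteq> {1..n}" by (auto simp: gaps_def)
  have "{i<..<j} = {1..n} - skip n (i, j)" "{i'<..<j'} = {1..n} - skip n (i', j')"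
    using sub by (auto simp: skip_def)
  with *(3) have eq: "{i<..<j} = {i'<..<j'}" by simp
  have "Suc i \<in> {i<..<j}" "Suc i' \<in> {i'<..<j'}" "j - 1 \<in> {i<..<j}" "j' - 1 \<in> {i'<..<j'}"
    using * by (auto simp: gaps_def)
  with eq have "Suc i \<in> {i'<..<j'}" "Suc i' \<in> {i<..<j}" "j - 1 \<in> {i'<..<j'}" "j' - 1 \<in> {i<..<j}"
    by simp_all
  then show "i = i'" "j = j'" by auto
qed

lemma sorted_list_skip:
  assumes "(i, j) \<in> gaps n"
  shows "sorted_list_of_set (skip n (i, j)) = [Suc 0..<Suc i] @ [j..<Suc n]"
proof -
  have "skip n (i, j) = set ([Suc 0..<Suc i] @ [j..<Suc n])"
    using assms by (auto simp: gaps_def skip_def)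
  moreover have "sorted ([Suc 0..<Suc i] @ [j..<Suc n])" "distinct ([Suc 0..<Suc i] @ [j..<Suc n])"
    using assms by (auto simp: gaps_def sorted_append simp del: upt_Suc)
  ultimately show ?thesis
    by (simp only: sorted_list_of_set.idem_if_sorted_distinct)
qed

lemma prod_gap_skip:
  assumes "(i, j) \<in> gaps (length w)"
  shows "(\<Prod>p\<le>card (skip (length w) (i, j)). gap w (skip (length w) (i, j)) p) =
    int_between (ext w i) (map (ext w) [Suc i..<j]) (ext w j)"
proof -
  define n where "n = length w"
  define S where "S = skip n (i, j)"
  have ij: "Suc i < j" "j \<le> Suc n" using assms by (auto simp: gaps_def n_def)
  have sl: "sorted_list_of_set S = [Suc 0..<Suc i] @ [j..<Suc n]"
    using sorted_list_skip assms by (simp add: S_def n_def)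
  have card: "card S = i + (Suc n - j)"
    using sl length_sorted_list_of_set[of S] by (simp del: upt_Suc)
  have cut: "cut n S ! p = (if p \<le> i then p else j + (p - Suc i))" if "p \<le> Suc (card S)" for p
  proof -
    have "cut n S = [0..<Suc i] @ [j..<Suc (Suc n)]"
      unfolding cut_def sl using ij upt_conv_Cons[of 0 "Suc i"] upt_Suc_append[of j "Suc n"]
      by (simp del: upt_Suc)
    then show ?thesis
      using that ij by (auto simp: nth_append card simp del: upt_Suc)
  qed
  have "(\<Prod>p\<le>card S. gap w S p) = gap w S i * (\<Prod>p\<in>{..card S} - {i}. gap w S p)"
    by (rule prod.remove) (auto simp: card)
  also have "(\<Prod>p\<in>{..card S} - {i}. gap w S p) = 1"
    by (intro prod.neutral ballI gap_empty) (auto simp: cut simp flip: n_def)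
  also have "gap w S i = int_between (ext w i) (map (ext w) [Suc i..<j]) (ext w j)"
    by (simp add: gap_def Let_def cut card flip: n_def)
  finally show ?thesis by (simp add: S_def n_def)
qed

text \<open>Such an S either omits nothing, and the left factor is 1, or leaves letters out in two
  different intervals, and the left factor is a product of two elements of the augmentation
  ideal.\<close>

lemma infinitesimal_other:
  assumes \<psi>: "infinitesimal N \<psi>" and w: "set w \<subseteq> insert 0 (unit_roots N)"
    and S: "S \<subseteq> {1..length w}" and no: "S \<notin> skip (length w) ` gaps (length w)"
  shows "\<psi> (\<Prod>p\<le>card S. gap w S p) = 0"
proof (cases "S = {1..length w}")
  case True
  then show ?thesis using \<psi> prod_gap_full[of w] by (simp add: infinitesimal_def)
next
  case False
  then obtain q where q: "q \<in> {1..length w}" "q \<notin> S" using S by blast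
  from cut_missing[OF S this] obtain p
    where p: "p \<le> card S" "cut (length w) S ! p < q" "q < cut (length w) S ! Suc p" .
  let ?i = "cut (length w) S ! p" and ?j = "cut (length w) S ! Suc p"
  have "?j \<le> Suc (length w)" using cut_le[OF S, of "Suc p"] p by simp
  then have ij: "(?i, ?j) \<in> gaps (length w)" using p by (auto simp: gaps_def)
  have "S \<subseteq> skip (length w) (?i, ?j)"
    using S cut_between[OF S _ p(1)] by (auto simp: skip_def)
  moreover have "S \<noteq> skip (length w) (?i, ?j)" using ij no by blast
  ultimately obtain q' where "q' \<in> skip (length w) (?i, ?j)" "q' \<notin> S" by blast
  then have q': "q' \<in> {1..length w}" "q' \<notin> S" "\<not> (?i < q' \<and> q' < ?j)"
    by (auto simp: skip_def)
  from cut_missing[OF S q'(1,2)] obtain p'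
    where p': "p' \<le> card S" "cut (length w) S ! p' < q'" "q' < cut (length w) S ! Suc p'" .
  have "p' \<noteq> p" using p' q'(3) by auto
  have "(\<Prod>p\<le>card S. gap w S p) = gap w S p * (\<Prod>p\<in>{..card S} - {p}. gap w S p)"
    using p by (intro prod.remove) auto
  also have "(\<Prod>p\<in>{..card S} - {p}. gap w S p) = gap w S p' * (\<Prod>p\<in>{..card S} - {p} - {p'}. gap w S p)"
    using p' \<open>p' \<noteq> p\<close> by (intro prod.remove) auto
  finally have "(\<Prod>p\<le>card S. gap w S p) = gap w S p * (gap w S p' * (\<Prod>p\<in>{..card S} - {p} - {p'}. gap w S p))" .
  moreover have "gap w S p \<in> fil N (Suc 0)"
    using p by (intro gap_fil_1 w S) auto
  moreover have "gap w S p' * (\<Prod>p\<in>{..card S} - {p} - {p'}. gap w S p) \<in> fil N (Suc 0)"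
    using p' by (intro fil_1_mult(1) gap_fil_1 formals_prod gap_formals w S) auto
  ultimately show ?thesis using \<psi> by (simp add: infinitesimal_def)
qed

text \<open>The infinitesimal coaction of Goncharov and Brown: one block of letters is cut out at a
  time and evaluated between its two neighbours.\<close>

lemma contract_coact_word:
  assumes \<psi>: "infinitesimal N \<psi>" and w: "set w \<subseteq> insert 0 (unit_roots N)"
  shows "contract \<psi> (coact_word w) = (\<Sum>(i, j) \<in> gaps (length w).
    rscale (\<psi> (int_between (ext w i) (map (ext w) [Suc i..<j]) (ext w j)))
      (I01 (map (ext w) ([Suc 0..<Suc i] @ [j..<Suc (length w)]))))"
proof -
  have f: "functional \<psi>" using \<psi> by (simp add: infinitesimal_def)
  let ?n = "length w"
  let ?f = "\<lambda>S. rscale (\<psi> (\<Prod>p\<le>card S. gap w S p)) (rest w S)"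
  have "contract \<psi> (coact_word w) = (\<Sum>S \<in> Pow {1..?n}. ?f S)"
    unfolding coact_word_eq contract_sum contract_tens[OF f] ..
  also have "\<dots> = (\<Sum>S \<in> skip ?n ` gaps ?n. ?f S)"
  proof (rule sum.mono_neutral_right)
    show "\<forall>S\<in>Pow {1..?n} - skip ?n ` gaps ?n. ?f S = 0"
      using infinitesimal_other[OF \<psi> w] by auto
  qed (auto simp: skip_def)
  also have "\<dots> = (\<Sum>ij \<in> gaps ?n. ?f (skip ?n ij))"
    by (rule sum.reindex_cong[OF inj_on_skip refl]) simp
  also have "\<dots> = (\<Sum>(i, j) \<in> gaps ?n. rscale (\<psi> (int_between (ext w i) (map (ext w) [Suc i..<j]) (ext w j)))
      (I01 (map (ext w) ([Suc 0..<Suc i] @ [j..<Suc ?n]))))"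
    by (intro sum.cong refl) (auto simp: prod_gap_skip rest_def sorted_list_skip simp del: upt_Suc)
  finally show ?thesis .
qed

lemma homog_int_from_0: "homog (length w) (int_from_0 w y)"
  using homog_I01[of "map (\<lambda>a. a / y) w"] by (auto simp: int_from_0_def)

lemma homog_int_to_0: "homog (length w) (int_to_0 x w)"
  using homog_int_from_0[of "rev w" x] homog_mult[of 0 "(-1) ^ length w" "length w" "int_from_0 (rev w) x"]
  by (cases "even (length w)") (auto simp: int_to_0_def intro: homog_minus)

lemma homog_sum: "(\<And>a. a \<in> A \<Longrightarrow> homog d (f a)) \<Longrightarrow> homog d (sum f A)"
  by (induction A rule: infinite_finite_induct) (auto intro: homog_add)

lemma homog_int_between: "homog (length w) (int_between x w y)"
  unfolding int_between_def
proof (rule homog_sum)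
  fix i assume "i \<in> {..length w}"
  then show "homog (length w) (int_to_0 x (take i w) * int_from_0 (drop i w) y)"
    using homog_mult[OF homog_int_to_0[of "take i w" x] homog_int_from_0[of "drop i w" y]] by simp
qed

text \<open>Weight is word length, so a functional concentrated in weight p sees only blocks of
  exactly p letters; i is the position just before the block.\<close>

lemma contract_coact_word_weight:
  assumes \<psi>: "infinitesimal N \<psi>" and w: "set w \<subseteq> insert 0 (unit_roots N)"
    and hom: "\<And>x d. homog d x \<Longrightarrow> d \<noteq> p \<Longrightarrow> \<psi> x = 0" and p: "0 < p" "p \<le> length w"
  shows "contract \<psi> (coact_word w) = (\<Sum>i\<le>length w - p.
    rscale (\<psi> (int_between (ext w i) (map (ext w) [Suc i..<Suc (i + p)]) (ext w (Suc (i + p)))))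
      (I01 (map (ext w) ([Suc 0..<Suc i] @ [Suc (i + p)..<Suc (length w)]))))"
proof -
  let ?n = "length w"
  let ?f = "\<lambda>i j. rscale (\<psi> (int_between (ext w i) (map (ext w) [Suc i..<j]) (ext w j)))
      (I01 (map (ext w) ([Suc 0..<Suc i] @ [j..<Suc ?n])))"
  let ?g = "\<lambda>i. (i, Suc (i + p))"
  have "contract \<psi> (coact_word w) = (\<Sum>(i, j) \<in> gaps ?n. ?f i j)"
    by (rule contract_coact_word[OF \<psi> w])
  also have "\<dots> = (\<Sum>(i, j) \<in> ?g ` {..?n - p}. ?f i j)"
  proof (rule sum.mono_neutral_right[OF finite_gaps], goal_cases)
    case 1
    show ?case using p by (auto simp: gaps_def)
  next
    case 2
    have *: "?f i j = 0" if ij: "(i, j) \<in> gaps ?n" "(i, j) \<notin> ?g ` {..?n - p}" for i j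
    proof -
    have "j - Suc i \<noteq> p"
    proof
      assume "j - Suc i = p"
      then have "(i, j) = ?g i" "i \<le> ?n - p" using ij by (auto simp: gaps_def)
      with ij show False by blast
    qed
    then have "\<psi> (int_between (ext w i) (map (ext w) [Suc i..<j]) (ext w j)) = 0"
      using homog_int_between[of "map (ext w) [Suc i..<j]"] by (intro hom) auto
    then show ?thesis by simp
    qed
    show ?case
    proof (rule ballI)
      fix x assume x: "x \<in> gaps ?n - ?g ` {..?n - p}"
      obtain i j where ij: "x = (i, j)" by (cases x)
      show "(case x of (i, j) \<Rightarrow> ?f i j) = 0"
        using x unfolding ij prod.case by (intro *) auto
    qed
  qed
  also have "\<dots> = (\<Sum>i\<le>?n - p. ?f i (Suc (i + p)))"
    by (subst sum.reindex) (auto simp: inj_on_def simp del: upt_Suc)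
  finally show ?thesis .
qed

text \<open>In the composition of paths through 0 only the two extreme splittings are not products.
  Reversal of the first path gives the sign, homothety moves an end point to 1, and a path from 0 to
  0 contributes nothing.\<close>

lemma infinitesimal_int_between:
  assumes \<psi>: "infinitesimal N \<psi>" and w: "set w \<subseteq> insert 0 (unit_roots N)" "w \<noteq> []"
    and xy: "x \<in> insert 0 (unit_roots N)" "y \<in> insert 0 (unit_roots N)"
  shows "\<psi> (int_between x w y) = (if x = 0 then 0 else (- 1) ^ length w * \<psi> (I01 (map (\<lambda>a. a / x) (rev w))))
     + (if y = 0 then 0 else \<psi> (I01 (map (\<lambda>a. a / y) w)))"
proof -
  have f: "functional \<psi>" using \<psi> by (simp add: infinitesimal_def)
  define n where "n = length w"
  have n: "n > 0" using w by (simp add: n_def)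
  let ?f = "\<lambda>i. \<psi> (int_to_0 x (take i w) * int_from_0 (drop i w) y)"
  have "?f i = 0" if "i \<in> {..n} - {0, n}" for i
  proof -
    have sub: "set (rev (take i w)) \<subseteq> insert 0 (unit_roots N)" "set (drop i w) \<subseteq> insert 0 (unit_roots N)"
      using w(1) set_take_subset[of i w] set_drop_subset[of i w] by auto
    have "int_to_0 x (take i w) \<in> fil N (Suc 0)"
      unfolding int_to_0_def using sub xy w that
      by (intro fil_1_mult(2) formals_numeral int_from_0_fil_1) (auto simp: n_def)
    moreover have "int_from_0 (drop i w) y \<in> fil N (Suc 0)"
      using sub xy that by (intro int_from_0_fil_1) (auto simp: n_def)
    ultimately show ?thesis using \<psi> by (simp add: infinitesimal_def)
  qed
  then have "(\<Sum>i\<le>n. ?f i) = (\<Sum>i\<in>{0, n}. ?f i)"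
    by (intro sum.mono_neutral_right) auto
  also have "\<dots> = ?f 0 + ?f n" using n by simp
  finally have "\<psi> (int_between x w y) = ?f 0 + ?f n"
    unfolding int_between_def functional_sum[OF f] n_def .
  moreover have "?f 0 = (if y = 0 then 0 else \<psi> (I01 (map (\<lambda>a. a / y) w)))"
    using w functional_0[OF f] by (simp add: int_to_0_def int_from_0_def)
  moreover have "?f n = (if x = 0 then 0 else (- 1) ^ n * \<psi> (I01 (map (\<lambda>a. a / x) (rev w))))"
    using w functional_0[OF f] functional_minus[OF f]
    by (cases "even n") (simp_all add: int_to_0_def int_from_0_def n_def)
  ultimately show ?thesis by (simp add: n_def)
qed

section \<open>The operators D_p on the depth filtration\<close>

lemma lookup_left_weight_part [simp]:
  "Poly_Mapping.lookup (left_weight_part p u) (m, n) = (if weight m = p then Poly_Mapping.lookup u (m, n) else 0)"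
proof -
  have "Poly_Mapping.lookup (left_weight_part p u) (m, n) =
    (\<Sum>mn\<in>{mn \<in> Poly_Mapping.keys u. weight (fst mn) = p}. if mn = (m, n) then Poly_Mapping.lookup u mn else 0)"
    unfolding left_weight_part_def lookup_sum by (intro sum.cong refl) (auto simp: lookup_single when_def)
  also have "\<dots> = (if weight m = p then Poly_Mapping.lookup u (m, n) else 0)"
    by (subst sum.delta) (auto simp: in_keys_iff)
  finally show ?thesis .
qed

lemma left_weight_part_tens: "left_weight_part p (tens x y) = tens (weight_part p x) y"
  and left_weight_part_add: "left_weight_part p (u + v) = left_weight_part p u + left_weight_part p v"
  and left_weight_part_0: "left_weight_part p 0 = 0"
  by (rule formal2_eqI; simp add: lookup_add)+

lemma left_weight_part_formals2: "u \<in> formals2 N \<Longrightarrow> left_weight_part p u \<in> formals2 N"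
  by (induction rule: formals2_induct)
     (auto simp: left_weight_part_tens left_weight_part_add left_weight_part_0
       intro!: rvs.subspace_0[OF subspace_formals2] rvs.subspace_add[OF subspace_formals2] formals2_tens weight_part_formals)

lemma functional_weight_part: "functional \<phi> \<Longrightarrow> functional (\<lambda>x. \<phi> (weight_part p x))"
  by (rule functionalI) (simp_all add: weight_part_add weight_part_rscale functional_add functional_rscale)

lemma contract_left_weight_part:
  assumes "functional \<phi>"
  shows "contract \<phi> (left_weight_part p u) = contract (\<lambda>x. \<phi> (weight_part p x)) u"
  by (induction u rule: formal2_induct)
     (simp_all add: left_weight_part_tens left_weight_part_add left_weight_part_0 contract_add
       contract_tens[OF assms] contract_tens[OF functional_weight_part[OF assms]])

lemma subspace_depth_fil: "rsubspace (depth_fil N r)"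
  unfolding depth_fil_def by (rule rvs.subspace_sums[OF rvs.subspace_span mrelD(2)])

lemma mrel_depth_fil: "mrel N \<subseteq> depth_fil N r"
proof
  fix x assume "x \<in> mrel N"
  then show "x \<in> depth_fil N r"
    unfolding depth_fil_def by (intro CollectI exI[of _ 0] exI[of _ x]) (auto intro: rvs.span_zero)
qed

lemma zeta_depth_fil: "mzv_index N l \<Longrightarrow> int (length l) \<le> r \<Longrightarrow> zeta_m l \<in> depth_fil N r"
  unfolding depth_fil_def using rvs.subspace_0[OF mrelD(2)[of N]]
  by (intro CollectI exI[of _ "zeta_m l"] exI[of _ 0]) (auto intro!: rvs.span_base)

lemma zeta_m_mzv_formals: "mzv_index N l \<Longrightarrow> zeta_m l \<in> formals N"
  by (rule zeta_m_formals) (auto simp: mzv_index_def)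

lemma depth_fil_induct [consumes 1, case_names zeta mrel add scale]:
  assumes "x \<in> depth_fil N r"
    and "\<And>l. mzv_index N l \<Longrightarrow> int (length l) \<le> r \<Longrightarrow> P (zeta_m l)"
    and "\<And>x. x \<in> mrel N \<Longrightarrow> P x" "\<And>x y. P x \<Longrightarrow> P y \<Longrightarrow> P (x + y)" "\<And>c x. P x \<Longrightarrow> P (rscale c x)"
  shows "P x"
proof -
  obtain y z where x: "x = y + z" "y \<in> rspan {zeta_m l | l. mzv_index N l \<and> int (length l) \<le> r}" "z \<in> mrel N"
    using assms(1) unfolding depth_fil_def by blast
  from x(2) have "P y"
  proof (induction rule: rvs.span_induct_alt)
    case base
    show ?case using assms(3) rvs.subspace_0[OF mrelD(2)] by blast
  next
    case (step c x y)
    then show ?case using assms(2,4,5) by blast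
  qed
  with assms(3,4) x show ?thesis by blast
qed

lemma depth_fil_formals: "depth_fil N r \<subseteq> formals N"
proof
  fix x assume "x \<in> depth_fil N r"
  then show "x \<in> formals N"
    using mrelD(1) by (induction rule: depth_fil_induct) (auto intro: zeta_m_mzv_formals formals_add formals_rscale)
qed

lemma depth_fil_neg:
  assumes "r < 0"
  shows "depth_fil N r = mrel N"
proof
  show "depth_fil N r \<subseteq> mrel N"
  proof
    fix x assume "x \<in> depth_fil N r"
    then show "x \<in> mrel N"
      by (induction rule: depth_fil_induct) (use assms in \<open>auto intro: mrel_add mrel_rscale\<close>)
  qed
qed (rule mrel_depth_fil)

lemma gr_class_eq_iff: "gr_class N r x = gr_class N r y \<longleftrightarrow> x - y \<in> depth_fil N (r - 1)"
proof
  assume "gr_class N r x = gr_class N r y"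
  moreover have "x \<in> gr_class N r x" by (simp add: gr_class_def rvs.subspace_0[OF subspace_depth_fil])
  ultimately show "x - y \<in> depth_fil N (r - 1)" by (auto simp: gr_class_def)
next
  assume *: "x - y \<in> depth_fil N (r - 1)"
  have "z - x \<in> depth_fil N (r - 1) \<longleftrightarrow> z - y \<in> depth_fil N (r - 1)" for z
    using rvs.subspace_add[OF subspace_depth_fil _ *, of "z - x"] rvs.subspace_diff[OF subspace_depth_fil _ *, of "z - y"]
    by auto
  then show "gr_class N r x = gr_class N r y" by (auto simp: gr_class_def)
qed

lemma weight_part_fil_1: "x \<in> fil N (Suc 0) \<Longrightarrow> weight_part n x \<in> fil N (Suc 0)"
  by (auto simp: fil_1 weight_part_formals)

lemma weight_part_mult: "weight_part n (x * y) = (\<Sum>i\<le>n. weight_part i x * weight_part (n - i) y)"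
proof (induction x rule: poly_mapping_induct)
  case (single m c)
  have m: "homog (weight m) (Poly_Mapping.single m c)" by (rule homog_single) simp
  have "(\<Sum>i\<le>n. weight_part i (Poly_Mapping.single m c) * weight_part (n - i) y) =
    (\<Sum>i\<le>n. if i = weight m then Poly_Mapping.single m c * weight_part (n - i) y else 0)"
    by (intro sum.cong refl) (simp add: weight_part_homog[OF m])
  then show ?case by (simp add: weight_part_mult_homog[OF m])
qed (simp_all add: weight_part_add ring_distribs sum.distrib)

lemma tmrel_indec_ker: "tmrel N \<subseteq> indec_ker N"
  unfolding indec_ker_def using rvs.span_superset by blast

lemma infinitesimal_weight_part:
  assumes "functional \<phi>" "\<And>x. x \<in> indec_ker N \<Longrightarrow> \<phi> x = 0" "p > 0"
  shows "infinitesimal N (\<lambda>x. \<phi> (weight_part p x))"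
  unfolding infinitesimal_def
proof (intro conjI ballI)
  show "functional (\<lambda>x. \<phi> (weight_part p x))" by (intro functional_weight_part assms)
  show "\<phi> (weight_part p 1) = 0"
    using assms(3) by (simp add: weight_part_homog[of 0] functional_0[OF assms(1)])
  fix x y assume xy: "x \<in> fil N (Suc 0)" "y \<in> fil N (Suc 0)"
  have "\<phi> (a * b) = 0" if "a \<in> fil N (Suc 0)" "b \<in> fil N (Suc 0)" for a b
  proof (rule assms(2), unfold indec_ker_def, intro rvs.span_base UnI2)
    have "a \<in> formals N" "Poly_Mapping.lookup a 0 = 0" "b \<in> formals N" "Poly_Mapping.lookup b 0 = 0"
      using that by (simp_all add: fil_1)
    then show "a * b \<in> {x * y |x y. x \<in> formals N \<and> y \<in> formals N \<and>
        Poly_Mapping.lookup x 0 = 0 \<and> Poly_Mapping.lookup y 0 = 0}" by blast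
  qed
  then have "\<phi> (weight_part i x * weight_part (p - i) y) = 0" for i
    using weight_part_fil_1 xy by blast
  then show "\<phi> (weight_part p (x * y)) = 0"
    unfolding weight_part_mult functional_sum[OF assms(1)] by simp
qed

lemma contract_coact_primitive:
  assumes "infinitesimal N \<psi>" "\<And>x. x \<in> tmrel N \<Longrightarrow> \<psi> x = 0"
    and "coact x - tens x 1 - tens 1 x \<in> tens_ker N (mrel N) (mrel N)"
  shows "contract \<psi> (coact x) - rscale (\<psi> x) 1 \<in> mrel N"
proof -
  have f: "functional \<psi>" using assms by (simp add: infinitesimal_def)
  have "contract \<psi> (coact x - tens x 1 - tens 1 x) \<in> mrel N"
    by (rule contract_tens_ker[OF assms(3) f]) (use assms(2) mrel_tmrel mrelD(2) in auto)
  then show ?thesis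
    using assms(1) by (simp add: contract_diff contract_tens[OF f] infinitesimal_def)
qed

lemma contract_coact_mrel:
  assumes "functional \<psi>" "\<And>x. x \<in> tmrel N \<Longrightarrow> \<psi> x = 0" "x \<in> mrel N" "N > 0"
  shows "contract \<psi> (coact x) \<in> mrel N"
  by (rule contract_tens_ker[OF coact_mrel[OF assms(3)] assms(1,2)])
     (auto intro: fidealD(2)[OF fideal_tmrel[OF assms(4)]] mrelD(2))

text \<open>Independence of the representative of a class: changing it by an element of lower depth
  changes the result by lower depth. For r \<le> 2 that element has depth at most 1, where the
  generators are primitive modulo relations.\<close>

lemma contract_D_op_lower:
  assumes N: "N > 0" and \<phi>: "functional \<phi>" "\<And>x. x \<in> indec_ker N \<Longrightarrow> \<phi> x = 0" and p: "p > 0"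
    and r: "r \<le> 2" and x: "x \<in> depth_fil N (r - 1)"
  shows "contract \<phi> (D_op p x) \<in> depth_fil N (r - 2)"
proof -
  let ?\<psi> = "\<lambda>x. \<phi> (weight_part p x)"
  note inf = infinitesimal_weight_part[OF \<phi> p]
  have T: "?\<psi> x = 0" if "x \<in> tmrel N" for x
    using tmrel_indec_ker weight_part_tmrel[OF that] by (intro \<phi>(2)) blast
  have "contract ?\<psi> (coact x) \<in> depth_fil N (r - 2)"
    using x
  proof (induction rule: depth_fil_induct)
    case (zeta l)
    with r have "length l = 0 \<or> length l = 1" by linarith
    then consider "l = []" | n e where "l = [(n, e)]" "r = 2"
      using zeta r by (cases l) auto
    then show ?case
    proof cases
      case 1
      then have "zeta_m l = 1" by (simp add: zeta_m_def I01_def)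
      then have "contract ?\<psi> (coact (zeta_m l)) = rscale (?\<psi> 1) 1"
        using contract_tens[OF functional_weight_part[OF \<phi>(1)], of p 1 1] by (simp add: tens_1_1)
      then show ?thesis
        using inf rvs.subspace_0[OF subspace_depth_fil] by (simp add: infinitesimal_def)
    next
      case 2
      then have "e \<in> unit_roots N" using zeta by (auto simp: mzv_index_def)
      from contract_coact_primitive[OF inf T coact_zeta[OF N this]]
      have "contract ?\<psi> (coact (zeta_m l)) - rscale (?\<psi> (zeta_m l)) 1 \<in> depth_fil N 0"
        using mrel_depth_fil 2 by blast
      moreover have "1 \<in> depth_fil N 0"
        using zeta_depth_fil[of N "[]" 0] by (simp add: mzv_index_def zeta_m_def I01_def)
      ultimately have "contract ?\<psi> (coact (zeta_m l)) - rscale (?\<psi> (zeta_m l)) 1 + rscale (?\<psi> (zeta_m l)) 1 \<in> depth_fil N 0"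
        by (intro rvs.subspace_add[OF subspace_depth_fil] rvs.subspace_scale[OF subspace_depth_fil])
      then show ?thesis using 2 by simp
    qed
  next
    case (mrel x)
    then show ?case
      using contract_coact_mrel[OF functional_weight_part[OF \<phi>(1)] T _ N] mrel_depth_fil by blast
  qed (auto simp: coact_add contract_add coact_rscale contract_rscale
       intro: rvs.subspace_add[OF subspace_depth_fil] rvs.subspace_scale[OF subspace_depth_fil])
  then show ?thesis by (simp add: D_op_def contract_left_weight_part[OF \<phi>(1)])
qed

lemma D_op_add: "D_op p (x + y) = D_op p x + D_op p y"
  by (simp add: D_op_def coact_add left_weight_part_add)

lemma finite_unit_roots: "N > 0 \<Longrightarrow> finite (unit_roots N)"
  unfolding unit_roots_def by (rule finite_roots_unity) simp

lemma functional_zeta: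
  assumes N: "N = 2 \<or> N = 3" and p: "p \<ge> 3" "odd p" and e: "e \<in> unit_roots N"
    and \<phi>: "functional \<phi>" "\<And>x. x \<in> indec_ker N \<Longrightarrow> \<phi> x = 0"
  shows "\<phi> (zeta_m [(p, e)]) = c1 N e p * \<phi> (zeta_m [(p, 1)])"
proof -
  have "\<phi> (zeta_m [(p, e)] - rscale (c1 N e p) (zeta_m [(p, 1)])) = 0"
    using zeta_distribution[OF N p e] tmrel_indec_ker by (intro \<phi>(2)) blast
  then show ?thesis by (simp add: functional_diff[OF \<phi>(1)] functional_rscale[OF \<phi>(1)])
qed

text \<open>A functional on \<open>\<L>\<^sup>N\<^sub>p\<close> that is \<open>1\<close> on \<open>\<zeta>(p)\<close> computes \<open>\<partial>\<^sub>p\<close>,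
  which gives uniqueness in the definition of \<^const>\<open>partial_op\<close>.\<close>

lemma partial_op_eq:
  assumes N: "N = 2 \<or> N = 3" and p: "p \<ge> 3" "odd p" and r: "r \<le> 2"
    and x: "x \<in> depth_fil N r" and X: "\<And>e. e \<in> unit_roots N \<Longrightarrow> X e \<in> depth_fil N (r - 1)"
    and *: "\<And>\<phi>. functional \<phi> \<Longrightarrow> (\<And>x. x \<in> indec_ker N \<Longrightarrow> \<phi> x = 0) \<Longrightarrow>
       contract \<phi> (D_op p x) - (\<Sum>e\<in>unit_roots N. rscale (\<phi> (zeta_m [(p, e)])) (X e)) \<in> depth_fil N (r - 2)"
  shows "partial_op N r p (gr_class N r x) = gr_class N (r - 1) (\<Sum>e\<in>unit_roots N. rscale (c1 N e p) (X e))"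
proof -
  have N0: "N > 0" using N by auto
  have D2: "D_op p y \<in> formals2 N" if "y \<in> formals N" for y
    unfolding D_op_def by (intro left_weight_part_formals2 coact_formals2 that)
  show ?thesis
    unfolding partial_op_def
  proof (rule the_equality, goal_cases)
    case 1
    show ?case
    proof (rule exI[of _ x], rule exI[of _ X], intro conjI x ballI X refl)
      show "x \<in> gr_class N r x" by (simp add: gr_class_def rvs.subspace_0[OF subspace_depth_fil])
      show "D_op p x - (\<Sum>e\<in>unit_roots N. tens (zeta_m [(p, e)]) (X e)) \<in> tens_ker N (indec_ker N) (depth_fil N (r - 2))"
      proof (rule tens_ker_if_contract[OF _ subspace_indec_ker indec_ker_formals[OF N0]])
        show "D_op p x - (\<Sum>e\<in>unit_roots N. tens (zeta_m [(p, e)]) (X e)) \<in> formals2 N"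
          using x X depth_fil_formals
          by (intro rvs.subspace_diff[OF subspace_formals2] rvs.subspace_sum[OF subspace_formals2] D2
              formals2_tens zeta_formals) blast+
        fix \<phi> :: "formal \<Rightarrow> rat"
        assume \<phi>: "functional \<phi>" "\<And>x. x \<in> indec_ker N \<Longrightarrow> \<phi> x = 0"
        from *[OF this] show "contract \<phi> (D_op p x - (\<Sum>e\<in>unit_roots N. tens (zeta_m [(p, e)]) (X e))) \<in> depth_fil N (r - 2)"
          by (simp add: contract_diff contract_sum contract_tens[OF \<phi>(1)])
      qed
    qed
  next
    case (2 G')
    then obtain y Y where y: "y \<in> gr_class N r x" "\<And>e. e \<in> unit_roots N \<Longrightarrow> Y e \<in> depth_fil N (r - 1)"
      and ker: "D_op p y - (\<Sum>e \<in> unit_roots N. tens (zeta_m [(p, e)]) (Y e)) \<in> tens_ker N (indec_ker N) (depth_fil N (r - 2))"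
      and G': "G' = gr_class N (r - 1) (\<Sum>e \<in> unit_roots N. rscale (c1 N e p) (Y e))"
      by blast
    obtain \<phi> where \<phi>: "functional \<phi>" "\<And>x. x \<in> indec_ker N \<Longrightarrow> \<phi> x = 0" "\<phi> (zeta_m [(p, 1)]) = 1"
      using separating_functional[OF subspace_indec_ker odd_zeta_indecomposable[OF N p]] by blast
    have c1: "\<phi> (zeta_m [(p, e)]) = c1 N e p" if "e \<in> unit_roots N" for e
      using functional_zeta[OF N p that \<phi>(1,2)] \<phi>(3) by simp
    have A: "contract \<phi> (D_op p y) - (\<Sum>e \<in> unit_roots N. rscale (c1 N e p) (Y e)) \<in> depth_fil N (r - 2)"
      using contract_tens_ker[OF ker \<phi>(1,2) subspace_indec_ker subspace_depth_fil]
      by (simp add: contract_diff contract_sum contract_tens[OF \<phi>(1)] c1 cong: sum.cong)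
    have B: "contract \<phi> (D_op p x) - (\<Sum>e \<in> unit_roots N. rscale (c1 N e p) (X e)) \<in> depth_fil N (r - 2)"
      using *[OF \<phi>(1,2)] by (simp add: c1 cong: sum.cong)
    \<comment> \<open>The definition allows any representative y of the class; its difference from x
      is invisible in the target piece.\<close>
    have "y - x \<in> depth_fil N (r - 1)" using y(1) by (simp add: gr_class_def)
    from contract_D_op_lower[OF N0 \<phi>(1,2) _ r this] p
    have "contract \<phi> (D_op p (y - x)) \<in> depth_fil N (r - 2)" by auto
    moreover have "D_op p y = D_op p (y - x) + D_op p x" by (simp flip: D_op_add)
    ultimately have C: "contract \<phi> (D_op p y) - contract \<phi> (D_op p x) \<in> depth_fil N (r - 2)"
      by (simp add: contract_add)
    from rvs.subspace_add[OF subspace_depth_fil rvs.subspace_diff[OF subspace_depth_fil C A] B]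
    have "(\<Sum>e \<in> unit_roots N. rscale (c1 N e p) (Y e)) - (\<Sum>e \<in> unit_roots N. rscale (c1 N e p) (X e)) \<in> depth_fil N (r - 1 - 1)"
      by (simp add: algebra_simps)
    then show ?case unfolding G' gr_class_eq_iff .
  qed
qed

section \<open>The derivations in depth 2 and depth 1\<close>

lemma upt_split: "j \<le> q \<Longrightarrow> q < l \<Longrightarrow> [j..<l] = [j..<q] @ q # [Suc q..<l]"
  by (metis le_add_diff_inverse less_imp_le_nat upt_add_eq_append upt_conv_Cons)

lemma map_ext_interval:
  assumes "\<And>i. j \<le> i \<Longrightarrow> i < l \<Longrightarrow> ext w i = 0"
  shows "map (ext w) [j..<l] = replicate (l - j) 0"
  using map_ext_zeros[of "[j..<l]" w] assms by (simp del: upt_Suc)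

lemma map_ext_dword:
  assumes "j \<le> q" "q < l" "ext w q = e" "\<And>i. j \<le> i \<Longrightarrow> i < l \<Longrightarrow> i \<noteq> q \<Longrightarrow> ext w i = 0"
  shows "map (ext w) [j..<l] = dword (q - j) e (l - Suc q)"
proof -
  have "map (ext w) [j..<q] = replicate (q - j) 0" "map (ext w) [Suc q..<l] = replicate (l - Suc q) 0"
    using map_ext_zeros[of "[j..<q]" w] map_ext_zeros[of "[Suc q..<l]" w] assms by auto
  then show ?thesis
    using upt_split[OF assms(1,2)] assms(3) by (simp add: dword_def)
qed

lemma map_divide_dword: "map (\<lambda>a. a / y) (dword \<alpha> a \<beta>) = dword \<alpha> (a / y) \<beta>"
  by (simp add: dword_def)

lemma rev_dword: "rev (dword \<alpha> a \<beta>) = dword \<beta> a \<alpha>"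
  by (simp add: dword_def)

lemma zeta_m_2:
  assumes "e \<noteq> 0"
  shows "zeta_m [(n1, e), (n2, inverse e)] = I01 (1 # replicate (n1 - 1) 0 @ e # replicate (n2 - 1) 0)"
  using assms by (simp add: zeta_m_def)

text \<open>The word is 1 0...0 e 0...0. A block can contribute only if it contains a nonzero letter
  and has a nonzero neighbour. This leaves the blocks starting at the first letter, starting at the
  second one, and ending at the last one. The result is Glanois' formula: for odd indices its signs
  are -1 and 1, and the binomials are rewritten by symmetry.\<close>

lemma contract_zeta2:
  assumes N: "N > 0" and inf: "infinitesimal N \<psi>" and T: "\<And>x. x \<in> tmrel N \<Longrightarrow> \<psi> x = 0"
    and hom: "\<And>x d. homog d x \<Longrightarrow> d \<noteq> p \<Longrightarrow> \<psi> x = 0" and e: "e \<in> unit_roots N"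
    and n: "n1 \<ge> 3" "n2 \<ge> 3" "odd n1" "odd n2" and p: "p \<ge> 3" "odd p" "p + 3 \<le> n1 + n2"
  shows "contract \<psi> (coact (zeta_m [(n1, e), (n2, inverse e)])) -
      ((if p = n1 then rscale (\<psi> (zeta_m [(p, e)])) (zeta_m [(n2, inverse e)]) else 0) +
       rscale ((of_nat ((p - 1) choose (n2 - 1)) - of_nat ((p - 1) choose (n1 - 1))) * \<psi> (zeta_m [(p, inverse e)]))
         (zeta_m [(n1 + n2 - p, 1)])) \<in> mrel N"
proof -
  define w where "w = 1 # replicate (n1 - 1) 0 @ e # replicate (n2 - 1) 0"
  define k where "k = n1 + n2"
  have f: "functional \<psi>" using inf by (simp add: infinitesimal_def)
  have e0: "e \<noteq> 0" using unit_root_nonzero[OF N e] .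
  have len: "length w = k" using n by (simp add: w_def k_def)
  have w: "w \<noteq> []" "set w \<subseteq> insert 0 (unit_roots N)" using e by (auto simp: w_def)
  have ext: "ext w i = (if i = 1 \<or> i = Suc k then 1 else if i = Suc n1 then e else 0)" if "i \<le> Suc k" for i
    using that n by (auto simp: ext_def w_def k_def nth_Cons nth_append split: nat.split)
  have ext_in: "ext w i \<in> insert 0 (unit_roots N)" if "i \<le> Suc k" for i
    using ext_letters[OF w(2)] that len by simp
  have zeros: "\<psi> (int_between x (replicate m 0) y) = 0"
    if "m > 0" "x \<in> insert 0 (unit_roots N)" "y \<in> insert 0 (unit_roots N)" for x y m
    using int_between_zeros_mrel[OF N that] mrel_tmrel by (intro T) blast
  \<comment> \<open>Zeros in front of e are moved behind it by the shuffle relation; the overall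
    minus is the depth 1 sign of \<open>zeta_m\<close>.\<close>
  have dw: "\<psi> (I01 (dword \<alpha> e \<beta>)) = - ((- 1) ^ \<alpha> * of_nat ((\<alpha> + \<beta>) choose \<alpha>) * \<psi> (zeta_m [(p, inverse e)]))"
    if "\<alpha> + \<beta> = p - 1" for \<alpha> \<beta>
  proof -
    have "\<psi> (I01 (dword \<alpha> e \<beta>) - rscale ((- 1) ^ \<alpha> * of_nat ((\<alpha> + \<beta>) choose \<alpha>)) (I01 (dword 0 e (\<alpha> + \<beta>)))) = 0"
      using dword_shuffle_mrel[OF N e, of \<alpha> \<beta>] mrel_tmrel that p by (intro T) auto
    then show ?thesis
      by (simp add: functional_diff[OF f] functional_rscale[OF f] zeta_m_1 functional_minus[OF f] that)
  qed
  define z where "z = \<psi> (zeta_m [(p, inverse e)])"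
  define Z where "Z = zeta_m [(k - p, 1)]"
  have Z: "I01 (dword 0 1 (k - p - 1)) = - Z" by (simp add: Z_def zeta_m_1)
  define t where "t = (\<lambda>i. rscale (\<psi> (int_between (ext w i) (map (ext w) [Suc i..<Suc (i + p)]) (ext w (Suc (i + p)))))
      (I01 (map (ext w) ([Suc 0..<Suc i] @ [Suc (i + p)..<Suc k]))))"
  have sum: "contract \<psi> (coact_word w) = (\<Sum>i\<le>k - p. t i)"
    using contract_coact_word_weight[OF inf w(2) hom, of p] p n by (simp add: len t_def k_def)
  have t_other: "t i = 0" if i: "i \<in> {..k - p} - {0, 1, k - p}" for i
  proof -
    have i': "2 \<le> i" "i + p < k" using i by auto
    show ?thesis
    proof (cases "i \<le> n1 \<and> n1 < i + p")
      case False
      have "map (ext w) [Suc i..<Suc (i + p)] = replicate p 0"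
        using map_ext_interval[of "Suc i" "Suc (i + p)" w] False i' by (auto simp: ext simp del: upt_Suc)
      then show ?thesis
        using zeros[OF _ ext_in ext_in, of p i "Suc (i + p)"] i' p by (simp add: t_def)
    next
      case True
      have eq: "map (ext w) [Suc i..<Suc (i + p)] = dword (n1 - i) e (i + p - Suc n1)"
        using map_ext_dword[of "Suc i" "Suc n1" "Suc (i + p)" w e] True i' n by (auto simp: ext k_def)
      have "ext w i = 0" "ext w (Suc (i + p)) = 0" using True i' by (auto simp: ext)
      then show ?thesis unfolding t_def eq
        by (subst infinitesimal_int_between[OF inf]) (use set_dword[of _ e] e in auto)
    qed
  qed
  \<comment> \<open>The block starts at the letter 1 and its left neighbour is 0. It contributes
    only for p = n1, where its right neighbour is e and homothety turns the letter 1 into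
    \<open>inverse e\<close>. For p < n1 the right neighbour is 0 too, and for p > n1 only zeros
    remain on the right of the tensor.\<close>
  have t0: "t 0 - (if p = n1 then rscale (\<psi> (zeta_m [(p, e)])) (zeta_m [(n2, inverse e)]) else 0) \<in> mrel N"
  proof -
    consider "p < n1" | "p = n1" | "p > n1" by linarith
    then show ?thesis
    proof cases
      case 1
      have eq: "map (ext w) [Suc 0..<Suc (0 + p)] = dword 0 1 (p - 1)"
        using map_ext_dword[of "Suc 0" "Suc 0" "Suc p" w 1] 1 p by (simp add: ext k_def)
      have "ext w 0 = 0" "ext w (Suc (0 + p)) = 0" using 1 p by (auto simp: ext k_def)
      then have "t 0 = 0" unfolding t_def eq
        by (subst infinitesimal_int_between[OF inf]) (use set_dword[of 0 1 "p - 1"] in auto)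
      with 1 show ?thesis using rvs.subspace_0[OF mrelD(2)] by simp
    next
      case 2
      have eq: "map (ext w) [Suc 0..<Suc (0 + p)] = dword 0 1 (p - 1)"
        using map_ext_dword[of "Suc 0" "Suc 0" "Suc p" w 1] 2 p n by (simp add: ext k_def)
      have "map (ext w) [Suc p..<Suc k] = dword 0 e (n2 - 1)"
        using map_ext_dword[of "Suc p" "Suc n1" "Suc k" w e] 2 n by (simp add: ext k_def)
      then have eq2: "map (ext w) ([Suc 0..<Suc 0] @ [Suc (0 + p)..<Suc k]) = dword 0 e (n2 - 1)" by simp
      have x: "ext w 0 = 0" "ext w (Suc (0 + p)) = e" using 2 p n by (auto simp: ext k_def)
      have "t 0 = rscale (\<psi> (I01 (dword 0 (inverse e) (p - 1)))) (I01 (dword 0 e (n2 - 1)))"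
        unfolding t_def eq eq2 x
        by (subst infinitesimal_int_between[OF inf]) (use set_dword[of 0 1 "p - 1"] e e0 in \<open>auto simp: map_divide_dword inverse_eq_divide\<close>)
      also have "\<dots> = rscale (\<psi> (zeta_m [(p, e)])) (zeta_m [(n2, inverse e)])"
        by (simp add: zeta_m_1 functional_minus[OF f])
      finally show ?thesis using 2 rvs.subspace_0[OF mrelD(2)] by simp
    next
      case 3
      have "map (ext w) ([Suc 0..<Suc 0] @ [Suc (0 + p)..<Suc k]) = replicate (k - p) 0"
        using map_ext_interval[of "Suc p" "Suc k" w] 3 n by (auto simp: ext simp del: upt_Suc)
      then have "t 0 \<in> mrel N"
        unfolding t_def using p by (auto intro!: mrel_rscale zeros_mrel N simp: k_def)
      with 3 show ?thesis by simp
    qed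
  qed
  \<comment> \<open>The left neighbour is 1, so the block is read backwards: this moves its zeros
    across e and gives the sign (-1)^p = -1, while the two depth 1 signs cancel.\<close>
  have t1: "t 1 = rscale (- of_nat ((p - 1) choose (n1 - 1)) * z) Z"
  proof (cases "p < n1")
    case True
    have "map (ext w) [Suc 1..<Suc (1 + p)] = replicate p 0"
      using map_ext_interval[of "Suc 1" "Suc (1 + p)" w] True n p by (auto simp: ext k_def simp del: upt_Suc)
    then have "t 1 = 0"
      using zeros[OF _ ext_in ext_in, of p 1 "Suc (1 + p)"] p by (simp add: t_def k_def)
    moreover have "(p - 1) choose (n1 - 1) = 0" using True p by (intro binomial_eq_0) auto
    ultimately show ?thesis by simp
  next
    case False
    have eq: "map (ext w) [Suc 1..<Suc (1 + p)] = dword (n1 - 1) e (p - n1)"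
      using map_ext_dword[of "Suc 1" "Suc n1" "Suc (1 + p)" w e] False n p by (auto simp: ext k_def)
    have x: "ext w 1 = 1" "ext w (Suc (1 + p)) = 0" using False n p by (auto simp: ext k_def)
    have "map (ext w) [Suc (1 + p)..<Suc k] = replicate (k - p - 1) 0"
      using map_ext_interval[of "Suc (1 + p)" "Suc k" w] False n p by (auto simp: ext simp del: upt_Suc)
    then have eq2: "map (ext w) ([Suc 0..<Suc 1] @ [Suc (1 + p)..<Suc k]) = dword 0 1 (k - p - 1)"
      using x by (simp add: dword_def)
    have "t 1 = rscale ((- 1) ^ p * \<psi> (I01 (dword (p - n1) e (n1 - 1)))) (- Z)"
      unfolding t_def eq eq2 x Z using p n False
      by (subst infinitesimal_int_between[OF inf]) (use set_dword[of "n1 - 1" e "p - n1"] e in \<open>auto simp: rev_dword\<close>)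
    also have "\<psi> (I01 (dword (p - n1) e (n1 - 1))) = - of_nat ((p - 1) choose (n1 - 1)) * z"
    proof -
      have "even (p - n1)" using p n False by simp
      moreover have "(p - n1 + (n1 - 1)) choose (p - n1) = (p - 1) choose (n1 - 1)"
        using False n p binomial_symmetric[of "p - n1" "p - 1"] by simp
      ultimately show ?thesis using dw[of "p - n1" "n1 - 1"] False n p by (simp add: z_def)
    qed
    finally show ?thesis using p by (simp add: rvs.scale_minus_left)
  qed
  \<comment> \<open>The right neighbour is the end point 1. An even number p - n2 of zeros precedes
    e, so no sign remains besides the two depth 1 signs, which cancel.\<close>
  have tk: "t (k - p) = rscale (of_nat ((p - 1) choose (n2 - 1)) * z) Z"
  proof (cases "p < n2")
    case True
    have "map (ext w) [Suc (k - p)..<Suc (k - p + p)] = replicate p 0"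
    proof -
      have "ext w i = 0" if "Suc (k - p) \<le> i" "i < Suc (k - p + p)" for i
      proof -
        have "i \<le> k" "i \<noteq> 1" "i \<noteq> Suc n1" using that True n p by (auto simp: k_def)
        then show ?thesis using ext[of i] by simp
      qed
      from map_ext_interval[OF this] show ?thesis by (simp del: upt_Suc)
    qed
    then have "t (k - p) = 0"
      using zeros[OF _ ext_in ext_in, of p "k - p" "Suc (k - p + p)"] p by (simp add: t_def k_def del: upt_Suc)
    moreover have "(p - 1) choose (n2 - 1) = 0" using True p by (intro binomial_eq_0) auto
    ultimately show ?thesis by simp
  next
    case False
    have eq: "map (ext w) [Suc (k - p)..<Suc (k - p + p)] = dword (p - n2) e (n2 - 1)"
      using map_ext_dword[of "Suc (k - p)" "Suc n1" "Suc (k - p + p)" w e] False n p by (auto simp: ext k_def)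
    have x: "ext w (k - p) = 0" "ext w (Suc (k - p + p)) = 1" using False n p by (auto simp: ext k_def)
    have "map (ext w) [Suc 0..<Suc (k - p)] = dword 0 1 (k - p - 1)"
    proof -
      have "map (ext w) [Suc 0..<Suc (k - p)] = dword (Suc 0 - Suc 0) 1 (Suc (k - p) - Suc (Suc 0))"
      proof (rule map_ext_dword)
        show "ext w (Suc 0) = 1" "Suc 0 < Suc (k - p)" using p by (simp_all add: ext k_def)
        fix i assume i: "Suc 0 \<le> i" "i < Suc (k - p)" "i \<noteq> Suc 0"
        then have "i \<le> k" "i \<noteq> 1" "i \<noteq> Suc n1" using False p by (auto simp: k_def)
        then show "ext w i = 0" using ext[of i] by simp
      qed simp
      then show ?thesis by (simp del: upt_Suc)
    qed
    then have eq2: "map (ext w) ([Suc 0..<Suc (k - p)] @ [Suc (k - p + p)..<Suc k]) = dword 0 1 (k - p - 1)"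
      using p by (simp add: k_def)
    have "t (k - p) = rscale (\<psi> (I01 (dword (p - n2) e (n2 - 1)))) (- Z)"
      unfolding t_def eq eq2 x Z
      by (subst infinitesimal_int_between[OF inf]) (use set_dword[of "p - n2" e "n2 - 1"] e in \<open>auto simp: map_divide_dword\<close>)
    also have "\<psi> (I01 (dword (p - n2) e (n2 - 1))) = - of_nat ((p - 1) choose (n2 - 1)) * z"
    proof -
      have "even (p - n2)" using p n False by simp
      moreover have "(p - n2 + (n2 - 1)) choose (p - n2) = (p - 1) choose (n2 - 1)"
        using False n p binomial_symmetric[of "p - n2" "p - 1"] by simp
      ultimately show ?thesis using dw[of "p - n2" "n2 - 1"] False n p by (simp add: z_def)
    qed
    finally show ?thesis by (simp add: rvs.scale_minus_left)
  qed
  \<comment> \<open>The three positions are distinct since k - p \<ge> 3.\<close>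
  have "(\<Sum>i\<le>k - p. t i) = (\<Sum>i\<in>{0, 1, k - p}. t i)"
    using t_other p by (intro sum.mono_neutral_right) (auto simp: k_def)
  also have "\<dots> = t 0 + t 1 + t (k - p)" using p by (simp add: k_def)
  finally have "contract \<psi> (coact_word w) = t 0 + rscale ((of_nat ((p - 1) choose (n2 - 1)) - of_nat ((p - 1) choose (n1 - 1))) * z) Z"
    unfolding sum t1 tk by (simp add: left_diff_distrib rvs.scale_left_diff_distrib rvs.scale_minus_left)
  with t0 show ?thesis
    unfolding zeta_m_2[OF e0] w_def[symmetric] coact_I01[OF w(1)] by (simp add: z_def Z_def k_def algebra_simps)
qed

lemma eps_facts:
  assumes "N = 2 \<or> N = 3"
  shows "eps N \<in> unit_roots N" "inverse (eps N) \<in> unit_roots N" "eps N \<noteq> 1" "inverse (eps N) \<noteq> 1"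
    "c1 N (inverse (eps N)) p = c1 N (eps N) p"
proof -
  show 1: "eps N \<in> unit_roots N" "inverse (eps N) \<in> unit_roots N" "eps N \<noteq> 1"
    using assms eps_3_neq_1(1) eps_unit_root[of N] unit_roots_inverse[OF eps_unit_root[of N]] by (auto simp: eps_2)
  then show "inverse (eps N) \<noteq> 1" by (metis inverse_1 inverse_inverse_eq)
  with 1 show "c1 N (inverse (eps N)) p = c1 N (eps N) p" by (simp add: c1_def)
qed

lemma partial_op_depth2:
  assumes N: "N = 2 \<or> N = 3"
    and n: "n1 \<ge> 3" "n2 \<ge> 3" "odd n1" "odd n2" and p: "p \<ge> 3" "odd p" "p + 3 \<le> n1 + n2"
  shows "partial_op N 2 p (gr_class N 2 (zeta_m [(n1, eps N), (n2, inverse (eps N))])) =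
    gr_class N 1 (rscale (c1 N (eps N) p) ((if p = n1 then zeta_m [(n2, inverse (eps N))] else 0) +
       rscale (of_nat ((p - 1) choose (n2 - 1)) - of_nat ((p - 1) choose (n1 - 1))) (zeta_m [(n1 + n2 - p, 1)])))"
proof -
  have N0: "N > 0" using N by auto
  note eps = eps_facts[OF N]
  let ?x = "zeta_m [(n1, eps N), (n2, inverse (eps N))]"
  let ?Y = "(if p = n1 then zeta_m [(n2, inverse (eps N))] else 0) +
       rscale (of_nat ((p - 1) choose (n2 - 1)) - of_nat ((p - 1) choose (n1 - 1))) (zeta_m [(n1 + n2 - p, 1)])"
  \<comment> \<open>All contributions are put on the root \<open>eps N\<close>: functionals on the
    indecomposables take the same value on the zeta elements at \<open>eps N\<close> and at its
    inverse.\<close>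
  define X where "X = (\<lambda>e. if e = eps N then ?Y else 0)"
  have sum: "(\<Sum>e\<in>unit_roots N. rscale (g e) (X e)) = rscale (g (eps N)) ?Y" for g
  proof -
    have "(\<Sum>e\<in>unit_roots N. rscale (g e) (X e)) = (\<Sum>e\<in>unit_roots N. if e = eps N then rscale (g e) ?Y else 0)"
      by (intro sum.cong refl) (auto simp: X_def)
    also have "\<dots> = rscale (g (eps N)) ?Y"
      using eps(1) finite_unit_roots[OF N0] by (subst sum.delta) simp_all
    finally show ?thesis .
  qed
  have "partial_op N 2 p (gr_class N 2 ?x) = gr_class N (2 - 1) (\<Sum>e\<in>unit_roots N. rscale (c1 N e p) (X e))"
  proof (rule partial_op_eq[OF N p(1,2)])
    show "?x \<in> depth_fil N 2"
      using eps n by (intro zeta_depth_fil) (auto simp: mzv_index_def)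
    have "?Y \<in> depth_fil N 1"
      using eps n p by (auto intro!: rvs.subspace_add[OF subspace_depth_fil] rvs.subspace_scale[OF subspace_depth_fil]
         zeta_depth_fil simp: mzv_index_def rvs.subspace_0[OF subspace_depth_fil])
    then show "X e \<in> depth_fil N (2 - 1)" for e
      using rvs.subspace_0[OF subspace_depth_fil] by (simp add: X_def)
    fix \<phi> :: "formal \<Rightarrow> rat"
    assume \<phi>: "functional \<phi>" "\<And>x. x \<in> indec_ker N \<Longrightarrow> \<phi> x = 0"
    let ?\<psi> = "\<lambda>x. \<phi> (weight_part p x)"
    have T: "?\<psi> x = 0" if "x \<in> tmrel N" for x
      using tmrel_indec_ker weight_part_tmrel[OF that] by (intro \<phi>(2)) blast
    have hom: "?\<psi> x = 0" if "homog d x" "d \<noteq> p" for x d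
      using that functional_0[OF \<phi>(1)] by (simp add: weight_part_homog)
    have z: "?\<psi> (zeta_m [(p, e)]) = \<phi> (zeta_m [(p, e)])" for e
      using homog_zeta[of p e] p by (simp add: weight_part_homog)
    have zz: "\<phi> (zeta_m [(p, inverse (eps N))]) = \<phi> (zeta_m [(p, eps N)])"
      using functional_zeta[OF N p(1,2) eps(1) \<phi>] functional_zeta[OF N p(1,2) eps(2) \<phi>] eps(5) by simp
    have "contract ?\<psi> (coact ?x) - rscale (\<phi> (zeta_m [(p, eps N)])) ?Y \<in> mrel N"
      using contract_zeta2[OF N0 infinitesimal_weight_part[OF \<phi>] T hom eps(1) n p] p
      unfolding z zz by (simp add: rvs.scale_right_distrib mult.commute if_distrib[of "rscale _"] cong: if_cong)
    then show "contract \<phi> (D_op p ?x) - (\<Sum>e\<in>unit_roots N. rscale (\<phi> (zeta_m [(p, e)])) (X e)) \<in> depth_fil N (2 - 2)"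
      unfolding sum D_op_def contract_left_weight_part[OF \<phi>(1)] by (rule subsetD[OF mrel_depth_fil])
  qed simp
  then show ?thesis unfolding sum by simp
qed

lemma partial_op_depth1:
  assumes N: "N = 2 \<or> N = 3" and p: "p \<ge> 3" "odd p"
  shows "partial_op N 1 p (gr_class N 1 (rscale a (zeta_m [(p, inverse (eps N))]) + rscale b (zeta_m [(p, 1)]))) =
    gr_class N 0 (rscale (a * c1 N (eps N) p + b) 1)"
proof -
  have N0: "N > 0" using N by auto
  note eps = eps_facts[OF N]
  let ?e = "inverse (eps N)"
  let ?x = "rscale a (zeta_m [(p, ?e)]) + rscale b (zeta_m [(p, 1)])"
  define X :: "complex \<Rightarrow> formal" where "X = (\<lambda>e. if e = ?e then rscale a 1 else if e = 1 then rscale b 1 else 0)"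
  have sum: "(\<Sum>e\<in>unit_roots N. rscale (g e) (X e)) = rscale (g ?e * a + g 1 * b) 1" for g
  proof -
    have "(\<Sum>e\<in>unit_roots N. rscale (g e) (X e)) = (\<Sum>e\<in>unit_roots N. (if e = ?e then rscale (g e * a) 1 else 0)
        + (if e = 1 then rscale (g e * b) 1 else 0))"
      using eps(4) by (intro sum.cong refl) (auto simp: X_def)
    also have "\<dots> = rscale (g ?e * a) 1 + rscale (g 1 * b) 1"
      unfolding sum.distrib using eps(2) finite_unit_roots[OF N0] by (subst (1 2) sum.delta) simp_all
    finally show ?thesis by (simp add: rvs.scale_left_distrib)
  qed
  have "partial_op N 1 p (gr_class N 1 ?x) = gr_class N (1 - 1) (\<Sum>e\<in>unit_roots N. rscale (c1 N e p) (X e))"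
  proof (rule partial_op_eq[OF N p])
    show "?x \<in> depth_fil N 1"
      using eps p by (auto intro!: rvs.subspace_add[OF subspace_depth_fil] rvs.subspace_scale[OF subspace_depth_fil]
         zeta_depth_fil simp: mzv_index_def)
    have "1 \<in> depth_fil N 0"
      using zeta_depth_fil[of N "[]" 0] by (simp add: mzv_index_def zeta_m_def I01_def)
    then show "X e \<in> depth_fil N (1 - 1)" for e
      using rvs.subspace_0[OF subspace_depth_fil] by (auto simp: X_def intro: rvs.subspace_scale[OF subspace_depth_fil])
    fix \<phi> :: "formal \<Rightarrow> rat"
    assume \<phi>: "functional \<phi>" "\<And>x. x \<in> indec_ker N \<Longrightarrow> \<phi> x = 0"
    let ?\<psi> = "\<lambda>x. \<phi> (weight_part p x)"
    have T: "?\<psi> x = 0" if "x \<in> tmrel N" for x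
      using tmrel_indec_ker weight_part_tmrel[OF that] by (intro \<phi>(2)) blast
    have z: "?\<psi> (zeta_m [(p, e)]) = \<phi> (zeta_m [(p, e)])" for e
      using homog_zeta[of p e] p by (simp add: weight_part_homog)
    have 1: "contract ?\<psi> (coact (zeta_m [(p, e)])) - rscale (\<phi> (zeta_m [(p, e)])) 1 \<in> mrel N" if "e \<in> unit_roots N" for e
      using contract_coact_primitive[OF infinitesimal_weight_part[OF \<phi>] T coact_zeta[OF N0 that, of p]] p unfolding z by auto
    have "rscale a (contract ?\<psi> (coact (zeta_m [(p, ?e)])) - rscale (\<phi> (zeta_m [(p, ?e)])) 1)
      + rscale b (contract ?\<psi> (coact (zeta_m [(p, 1)])) - rscale (\<phi> (zeta_m [(p, 1)])) 1) \<in> mrel N"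
      by (intro mrel_add mrel_rscale 1 eps) simp
    also have "rscale a (contract ?\<psi> (coact (zeta_m [(p, ?e)])) - rscale (\<phi> (zeta_m [(p, ?e)])) 1)
      + rscale b (contract ?\<psi> (coact (zeta_m [(p, 1)])) - rscale (\<phi> (zeta_m [(p, 1)])) 1)
      = contract ?\<psi> (coact ?x) - rscale (\<phi> (zeta_m [(p, ?e)]) * a + \<phi> (zeta_m [(p, 1)]) * b) 1"
      by (simp add: coact_add coact_rscale contract_add contract_rscale rvs.scale_left_distrib
          rvs.scale_right_diff_distrib mult.commute algebra_simps)
    finally show "contract \<phi> (D_op p ?x) - (\<Sum>e\<in>unit_roots N. rscale (\<phi> (zeta_m [(p, e)])) (X e)) \<in> depth_fil N (1 - 2)"
      unfolding sum D_op_def contract_left_weight_part[OF \<phi>(1)] by (rule subsetD[OF mrel_depth_fil])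
  qed simp
  then show ?thesis unfolding sum by (simp add: eps(5) c1_def[of N 1] mult.commute)
qed

theorem C_entry_eq:
  assumes N: "N = 2 \<or> N = 3" and m: "m1 \<ge> 3" "m2 \<ge> 3" "odd m1" "odd m2"
    and n: "n1 \<ge> 3" "n2 \<ge> 3" "odd n1" "odd n2" and k: "m1 + m2 = n1 + n2"
  shows "C_entry N (m1, m2) (n1, n2) = c1 N (eps N) m1 *
    ((if m1 = n1 then c1 N (eps N) m2 else 0) + (of_nat ((m1 - 1) choose (n2 - 1)) - of_nat ((m1 - 1) choose (n1 - 1))))"
proof -
  let ?b = "of_nat ((m1 - 1) choose (n2 - 1)) - of_nat ((m1 - 1) choose (n1 - 1)) :: rat"
  let ?c = "c1 N (eps N) m1"
  have eq: "n1 + n2 - m1 = m2" "m1 = n1 \<Longrightarrow> n2 = m2" using k by auto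
  have "partial_op N 2 m1 (gr_class N 2 (zeta_m [(n1, eps N), (n2, inverse (eps N))])) =
    gr_class N 1 (rscale (?c * (if m1 = n1 then 1 else 0)) (zeta_m [(m2, inverse (eps N))]) + rscale (?c * ?b) (zeta_m [(m2, 1)]))"
    using partial_op_depth2[OF N n m(1,3)] m k eq by (cases "m1 = n1") (auto simp: rvs.scale_right_distrib)
  also have "partial_op N 1 m2 \<dots> = gr_class N 0 (rscale (?c * ((if m1 = n1 then c1 N (eps N) m2 else 0) + ?b)) 1)"
    unfolding partial_op_depth1[OF N m(2,4)] by (simp add: ring_distribs)
  finally have *: "partial_op N 1 m2 (partial_op N 2 m1 (gr_class N 2 (zeta_m [(n1, eps N), (n2, inverse (eps N))]))) =
     gr_class N 0 (rscale (?c * ((if m1 = n1 then c1 N (eps N) m2 else 0) + ?b)) 1)" .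
  \<comment> \<open>The depth step of index -1 is the ideal of relations, which does not contain 1,
    so a rational number is determined by its class.\<close>
  have inj: "q = q'" if "gr_class N 0 (rscale q 1) = gr_class N 0 (rscale q' 1)" for q q'
  proof (rule ccontr)
    assume "q \<noteq> q'"
    from that have "rscale (q - q') 1 \<in> mrel N"
      unfolding gr_class_eq_iff by (simp add: depth_fil_neg rvs.scale_left_diff_distrib)
    from mrel_rscale[OF this, of "inverse (q - q')"] \<open>q \<noteq> q'\<close> one_not_mrel[of N] show False
      by simp
  qed
  show ?thesis
    unfolding C_entry.simps * by (rule the_equality) (auto dest: inj)
qed

subsection \<open>Exponential decay at the cusp\<close>

lemma open_uhp: "open uhp"
  unfolding uhp_def by (rule open_halfspace_Im_gt)

lemma convex_uhp: "convex uhp"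
  unfolding uhp_def by (rule convex_halfspace_Im_gt)

lemma eventually_Im_at_top: "eventually P (filtercomap Im at_top) \<longleftrightarrow> (\<exists>Y. \<forall>z. Im z \<ge> Y \<longrightarrow> P z)"
  by (auto simp: eventually_filtercomap eventually_at_top_linorder)

lemma tendsto_Im_at_top:
  "(h \<longlongrightarrow> (0::complex)) (filtercomap Im at_top) \<longleftrightarrow> (\<forall>e>0. \<exists>Y. \<forall>z. Im z \<ge> Y \<longrightarrow> norm (h z) < e)"
  by (simp add: tendsto_iff eventually_Im_at_top)

text \<open>A periodic function is a function of \<open>q = exp (2\<pi>iz/N)\<close>, holomorphic and zero at \<open>q = 0\<close>.\<close>

lemma exp_decay:
  fixes h :: "complex \<Rightarrow> complex" and N :: nat
  assumes N: "N > 0" and hol: "h holomorphic_on uhp"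
    and per: "\<And>z. z \<in> uhp \<Longrightarrow> h (z + of_nat N) = h z"
    and lim: "(h \<longlongrightarrow> 0) (filtercomap Im at_top)" and y0: "y0 > 0"
  shows "\<exists>C c. C \<ge> 0 \<and> c > 0 \<and> (\<forall>z. Im z \<ge> y0 \<longrightarrow> norm (h z) \<le> C * exp (- c * Im z))"
proof -
  define \<kappa> where "\<kappa> = 2 * of_real pi * \<i> / of_nat N"
  have \<kappa>0: "\<kappa> \<noteq> 0" using N by (simp add: \<kappa>_def)
  have per_nat: "h (z + of_nat (m * N)) = h z" if "z \<in> uhp" for z m
  proof (induction m)
    case (Suc m)
    have "z + of_nat (m * N) \<in> uhp" using that by (simp add: uhp_def)
    from per[OF this] Suc show ?case by (simp add: algebra_simps)
  qed simp
  have per_int: "h (z + of_int m * of_nat N) = h z" if "z \<in> uhp" for z and m :: int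
  proof (cases "m \<ge> 0")
    case True
    then show ?thesis using per_nat[OF that, of "nat m"] by simp
  next
    case False
    have "z + of_int m * of_nat N \<in> uhp" using that by (simp add: uhp_def)
    from per_nat[OF this, of "nat (- m)"] False show ?thesis by (simp add: algebra_simps)
  qed
  have Im_div: "Im (w / \<kappa>) = - (real N * Re w / (2 * pi))" for w
  proof -
    have "w / \<kappa> = - (\<i> * w) * of_real (real N / (2 * pi))"
      using N by (simp add: \<kappa>_def field_simps)
    then show ?thesis by simp
  qed
  \<comment> \<open>\<open>Ln\<close> jumps across the negative axis, but by an integral multiple of
    2 pi i, which the periodicity of h absorbs.\<close>
  define \<phi> where "\<phi> = (\<lambda>q. if q = 0 then 0 else h (Ln q / \<kappa>))"
  have \<phi>0: "\<phi> 0 = 0" by (simp add: \<phi>_def)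
  have Im_Ln: "Im (Ln q / \<kappa>) = - (real N * ln (norm q) / (2 * pi))" if "q \<noteq> 0" for q
    unfolding Im_div using that by simp
  have in_uhp: "Ln q / \<kappa> \<in> uhp" if "q \<noteq> 0" "norm q < 1" for q
    using that N by (auto simp: uhp_def Im_Ln divide_less_0_iff mult_less_0_iff)
  have \<phi>_exp: "\<phi> (exp (\<kappa> * z)) = h z" if "z \<in> uhp" for z
  proof -
    obtain m :: int where m: "Ln (exp (\<kappa> * z)) = \<kappa> * z + of_int (2 * m) * (of_real pi * \<i>)"
      using exp_Ln[of "exp (\<kappa> * z)"] exp_eq[of "Ln (exp (\<kappa> * z))" "\<kappa> * z"] by (auto simp: algebra_simps)
    have "Ln (exp (\<kappa> * z)) / \<kappa> = z + of_int m * of_nat N"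
      unfolding m using N \<kappa>0 by (simp add: \<kappa>_def field_simps)
    then show ?thesis using per_int[OF that] by (simp add: \<phi>_def)
  qed
  have hol0: "\<phi> holomorphic_on (ball 0 1 - {0})"
    unfolding holomorphic_on_def
  proof
    fix q0 :: complex assume q0: "q0 \<in> ball 0 1 - {0}"
    then have q0': "q0 \<noteq> 0" "norm q0 < 1" by auto
    define U where "U = ball q0 (norm q0) \<inter> ball 0 1"
    have U: "open U" "q0 \<in> U" using q0' by (auto simp: U_def)
    have q_nz: "q \<noteq> 0" "norm q < 1" "Re (q / q0) > 0" if "q \<in> U" for q
    proof -
      have d: "norm (q - q0) < norm q0" "norm q < 1" using that by (auto simp: U_def dist_norm norm_minus_commute)
      then show "q \<noteq> 0" "norm q < 1" by auto
      have "norm (q / q0 - 1) = norm (q - q0) / norm q0"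
        using q0' by (simp add: diff_divide_distrib norm_divide[symmetric])
      also have "\<dots> < 1" using d q0' by simp
      finally have "norm (q / q0 - 1) < 1" .
      then show "Re (q / q0) > 0" using abs_Re_le_cmod[of "q / q0 - 1"] by simp
    qed
    \<comment> \<open>A branch of the logarithm near q0: on U the quotient q / q0 has positive real
      part, so it avoids the cut of \<open>Ln\<close>.\<close>
    define L where "L = (\<lambda>q. Ln (q / q0) + Ln q0)"
    have expL: "exp (L q) = q" if "q \<in> U" for q
      using q_nz[OF that] q0' by (simp add: L_def exp_add)
    have L_uhp: "L q / \<kappa> \<in> uhp" if "q \<in> U" for q
    proof -
      have "exp (Re (L q)) = norm q" using expL[OF that] by (metis norm_exp_eq_Re)
      then have "Re (L q) < 0" using q_nz[OF that] by (metis exp_less_one_iff)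
      then show ?thesis using N by (simp add: uhp_def Im_div divide_less_0_iff mult_less_0_iff)
    qed
    have "(\<lambda>q. L q / \<kappa>) holomorphic_on U"
      unfolding L_def using q_nz \<kappa>0
      by (intro holomorphic_intros) (auto simp: complex_nonpos_Reals_iff dest!: q_nz(3))
    then have "(h \<circ> (\<lambda>q. L q / \<kappa>)) holomorphic_on U"
      by (rule holomorphic_on_compose_gen[OF _ hol]) (use L_uhp in auto)
    then obtain D where "((h \<circ> (\<lambda>q. L q / \<kappa>)) has_field_derivative D) (at q0)"
      using U holomorphic_on_imp_differentiable_at unfolding field_differentiable_def by blast
    moreover have "(h \<circ> (\<lambda>q. L q / \<kappa>)) q = \<phi> q" if "q \<in> U" for q
    proof -
      have "\<kappa> * (L q / \<kappa>) = L q" using \<kappa>0 by simp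
      then show ?thesis using \<phi>_exp[OF L_uhp[OF that]] expL[OF that] by simp
    qed
    ultimately have "(\<phi> has_field_derivative D) (at q0)"
      using U has_field_derivative_transform_within_open by blast
    then have "\<phi> field_differentiable at q0"
      by (auto simp: field_differentiable_def)
    then show "\<phi> field_differentiable at q0 within ball 0 1 - {0}"
      by (rule field_differentiable_at_within)
  qed
  have cont0: "(\<phi> \<longlongrightarrow> 0) (at 0)"
  proof (rule tendstoI)
    fix e :: real assume "e > 0"
    with lim obtain Y where Y: "\<And>z. Im z \<ge> Y \<Longrightarrow> norm (h z) < e" unfolding tendsto_Im_at_top by blast
    define r where "r = exp (- (2 * pi * Y / real N))"
    have "norm (\<phi> q) < e" if "q \<noteq> 0" "norm q < r" for q
    proof -
      have "ln (norm q) < - (2 * pi * Y / real N)"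
        using that unfolding r_def by (metis exp_ln exp_less_cancel_iff zero_less_norm_iff)
      then have "real N * ln (norm q) \<le> - (2 * pi * Y)"
        using N by (simp add: field_simps)
      then have "Im (Ln q / \<kappa>) \<ge> Y"
        unfolding Im_Ln[OF that(1)] by (simp add: field_simps)
      from Y[OF this] show ?thesis using that(1) by (simp add: \<phi>_def)
    qed
    then show "\<forall>\<^sub>F q in at 0. dist (\<phi> q) 0 < e"
      unfolding eventually_at by (intro exI[of _ r]) (auto simp: r_def)
  qed
  have hol\<phi>: "\<phi> holomorphic_on ball 0 1"
  proof (rule no_isolated_singularity'[of "{0}"])
    fix z :: complex assume "z \<in> {0}"
    then show "(\<phi> \<longlongrightarrow> \<phi> z) (at z within ball 0 1)"
      using cont0 by (auto simp: \<phi>_def intro: tendsto_within_subset)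
  qed (use hol0 in auto)
  then obtain D where "(\<phi> has_field_derivative D) (at 0)"
    using holomorphic_on_imp_differentiable_at[OF hol\<phi>, of 0] by (auto simp: field_differentiable_def)
  then have "((\<lambda>q. \<phi> q / q) \<longlongrightarrow> D) (at 0)"
    using \<phi>0 by (simp add: DERIV_def)
  then have "\<forall>\<^sub>F q in at 0. dist (\<phi> q / q) D < 1" by (rule tendstoD) simp
  then obtain \<delta> where \<delta>: "\<delta> > 0" "\<And>q. q \<noteq> 0 \<Longrightarrow> norm q < \<delta> \<Longrightarrow> dist (\<phi> q / q) D < 1"
    by (auto simp: eventually_at)
  define r where "r = exp (- (2 * pi * y0 / real N))"
  have r: "0 < r" "r < 1" using N y0 by (auto simp: r_def)
  have "compact (\<phi> ` cball 0 r)"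
    by (intro compact_continuous_image holomorphic_on_imp_continuous_on holomorphic_on_subset[OF hol\<phi>]) (use r in auto)
  then have "bounded (\<phi> ` cball 0 r)" by (rule compact_imp_bounded)
  then obtain M where "\<forall>x\<in>cball 0 r. norm (\<phi> x) \<le> M"
    unfolding bounded_iff by auto
  then have M: "norm (\<phi> q) \<le> M" if "norm q \<le> r" for q
    using that by simp
  have M0: "M \<ge> 0" using M[of 0] r by (simp add: \<phi>_def)
  \<comment> \<open>The first two summands bound the difference quotient near 0; the last one serves
    norm q \<ge> \<delta>, where M is a bound for \<phi>.\<close>
  define C where "C = norm D + 1 + M / \<delta>"
  have C: "C \<ge> 0" using M0 \<delta> by (simp add: C_def)
  have bound: "norm (\<phi> q) \<le> C * norm q" if "norm q \<le> r" for q
  proof (cases "q = 0")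
    case True
    then show ?thesis by (simp add: \<phi>_def)
  next
    case False
    show ?thesis
    proof (cases "norm q < \<delta>")
      case True
      have "norm (\<phi> q / q) \<le> norm D + norm (\<phi> q / q - D)" by (metis norm_triangle_sub)
      also have "\<dots> \<le> norm D + 1" using \<delta>(2)[OF False True] by (simp add: dist_norm)
      also have "\<dots> \<le> C" using M0 \<delta> by (simp add: C_def)
      finally show ?thesis using False by (simp add: norm_divide field_simps)
    next
      case large: False
      have "M \<le> M / \<delta> * norm q" using large \<delta> M0 by (simp add: field_simps mult_left_mono)
      also have "\<dots> \<le> C * norm q" by (intro mult_right_mono) (auto simp: C_def)
      finally show ?thesis using M[OF that] by linarith
    qed
  qed
  show ?thesis
  proof (rule exI[of _ C], rule exI[of _ "2 * pi / real N"], intro conjI allI impI C)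
    show "2 * pi / real N > 0" using N by simp
    fix z assume z: "Im z \<ge> y0"
    then have zu: "z \<in> uhp" using y0 by (auto simp: uhp_def)
    have "Re (\<kappa> * z) = - (2 * pi / real N * Im z)" using N by (simp add: \<kappa>_def Re_divide_of_nat)
    then have nq: "norm (exp (\<kappa> * z)) = exp (- (2 * pi / real N) * Im z)" by simp
    have "2 * pi / real N * y0 \<le> 2 * pi / real N * Im z" using z by (intro mult_left_mono) auto
    then have "norm (exp (\<kappa> * z)) \<le> r" unfolding nq r_def by simp
    from bound[OF this] show "norm (h z) \<le> C * exp (- (2 * pi / real N) * Im z)"
      unfolding \<phi>_exp[OF zu] nq .
  qed
qed

subsection \<open>The slash action and the trace to level 1\<close>

fun mob :: "imat2 \<Rightarrow> complex \<Rightarrow> complex" where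
  "mob (a, b, c, d) z = (of_int a * z + of_int b) / (of_int c * z + of_int d)"

fun aut :: "imat2 \<Rightarrow> complex \<Rightarrow> complex" where
  "aut (a, b, c, d) z = of_int c * z + of_int d"

lemma slash_eq: "slash k f \<gamma> z = aut \<gamma> z powi (- k) * f (mob \<gamma> z)"
  by (cases \<gamma>) auto

lemma aut_nonzero:
  assumes "\<gamma> \<in> SL2Z" "z \<in> uhp"
  shows "aut \<gamma> z \<noteq> 0"
proof -
  obtain a b c d where \<gamma>: "\<gamma> = (a, b, c, d)" by (cases \<gamma>)
  show ?thesis
  proof
    assume "aut \<gamma> z = 0"
    then have 0: "of_int c * z + of_int d = 0" by (simp add: \<gamma>)
    then have "Im (of_int c * z + of_int d) = 0" by simp
    then have "c = 0" using assms(2) by (simp add: uhp_def)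
    with 0 have "d = 0" by simp
    with \<open>c = 0\<close> assms(1) show False by (simp add: \<gamma> SL2Z_def)
  qed
qed

lemma Im_mob:
  assumes "\<gamma> \<in> SL2Z" "z \<in> uhp"
  shows "Im (mob \<gamma> z) = Im z / (norm (aut \<gamma> z))\<^sup>2"
proof -
  obtain a b c d where \<gamma>: "\<gamma> = (a, b, c, d)" by (cases \<gamma>)
  have det: "real_of_int a * real_of_int d - real_of_int b * real_of_int c = 1"
    using assms(1) by (simp add: \<gamma> SL2Z_def flip: of_int_mult of_int_diff)
  have "mob \<gamma> z = (of_int a * z + of_int b) * cnj (aut \<gamma> z) / of_real ((norm (aut \<gamma> z))\<^sup>2)"
    using aut_nonzero[OF assms] unfolding \<gamma> mob.simps aut.simps
    by (subst complex_div_cnj) (simp add: complex_norm_square)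
  then have "Im (mob \<gamma> z) = Im ((of_int a * z + of_int b) * cnj (aut \<gamma> z)) / (norm (aut \<gamma> z))\<^sup>2"
    by (metis Im_divide_of_real)
  also have "Im ((of_int a * z + of_int b) * cnj (aut \<gamma> z)) = (real_of_int a * real_of_int d - real_of_int b * real_of_int c) * Im z"
    by (simp add: \<gamma> algebra_simps)
  finally show ?thesis by (simp add: det)
qed

lemma mob_uhp: "\<gamma> \<in> SL2Z \<Longrightarrow> z \<in> uhp \<Longrightarrow> mob \<gamma> z \<in> uhp"
  using aut_nonzero[of \<gamma> z] by (auto simp: uhp_def Im_mob)

lemma SL2Z_mult: "\<gamma> \<in> SL2Z \<Longrightarrow> \<delta> \<in> SL2Z \<Longrightarrow> imat2_mult \<gamma> \<delta> \<in> SL2Z"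
proof -
  have "(a * a' + b * c') * (c * b' + d * d') - (a * b' + b * d') * (c * a' + d * c') = (a * d - b * c) * (a' * d' - b' * c')"
    for a b c d a' b' c' d' :: int by (simp add: algebra_simps)
  then show "\<gamma> \<in> SL2Z \<Longrightarrow> \<delta> \<in> SL2Z \<Longrightarrow> imat2_mult \<gamma> \<delta> \<in> SL2Z"
    by (cases \<gamma>; cases \<delta>) (simp add: SL2Z_def)
qed

lemma aut_mult:
  assumes "\<delta> \<in> SL2Z" "z \<in> uhp"
  shows "aut (imat2_mult \<gamma> \<delta>) z = aut \<gamma> (mob \<delta> z) * aut \<delta> z"
  using aut_nonzero[OF assms] by (cases \<gamma>; cases \<delta>) (simp add: field_simps)

lemma mob_mult:
  assumes "\<gamma> \<in> SL2Z" "\<delta> \<in> SL2Z" "z \<in> uhp"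
  shows "mob (imat2_mult \<gamma> \<delta>) z = mob \<gamma> (mob \<delta> z)"
proof -
  obtain a b c d a' b' c' d' where \<gamma>: "\<gamma> = (a, b, c, d)" and \<delta>: "\<delta> = (a', b', c', d')" by (cases \<gamma>, cases \<delta>)
  have J: "aut \<delta> z \<noteq> 0" "aut \<gamma> (mob \<delta> z) \<noteq> 0"
    using assms by (auto simp: aut_nonzero mob_uhp)
  have num: "(of_int a * mob \<delta> z + of_int b) * aut \<delta> z = of_int (a * a' + b * c') * z + of_int (a * b' + b * d')"
    using J(1) by (simp add: \<delta> field_simps)
  have "mob (imat2_mult \<gamma> \<delta>) z = ((of_int a * mob \<delta> z + of_int b) * aut \<delta> z) / (aut \<gamma> (mob \<delta> z) * aut \<delta> z)"
    unfolding num aut_mult[OF assms(2,3), of \<gamma>, symmetric] by (simp add: \<gamma> \<delta>)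
  also have "\<dots> = (of_int a * mob \<delta> z + of_int b) / aut \<gamma> (mob \<delta> z)" using J by simp
  finally show ?thesis by (simp add: \<gamma>)
qed

lemma slash_mult:
  assumes "\<gamma> \<in> SL2Z" "\<delta> \<in> SL2Z" "z \<in> uhp"
  shows "slash k f (imat2_mult \<gamma> \<delta>) z = slash k (slash k f \<gamma>) \<delta> z"
  by (simp add: slash_eq mob_mult assms aut_mult power_int_mult_distrib)

lemma slash_cong: "(\<And>z. z \<in> uhp \<Longrightarrow> f z = g z) \<Longrightarrow> \<gamma> \<in> SL2Z \<Longrightarrow> z \<in> uhp \<Longrightarrow> slash k f \<gamma> z = slash k g \<gamma> z"
  by (simp add: slash_eq mob_uhp)

lemma Gamma0_SL2Z: "Gamma0 N \<subseteq> SL2Z"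
  by (auto simp: Gamma0_def SL2Z_def)

lemma Gamma0_1: "Gamma0 1 = SL2Z"
  by (auto simp: Gamma0_def SL2Z_def)

lemma slash_Gamma0_mult:
  assumes f: "cusp_form k N f" and "\<delta> \<in> Gamma0 N" "\<gamma> \<in> SL2Z" "z \<in> uhp"
  shows "slash k f (imat2_mult \<delta> \<gamma>) z = slash k f \<gamma> z"
proof -
  have "slash k f (imat2_mult \<delta> \<gamma>) z = slash k (slash k f \<delta>) \<gamma> z"
    using assms Gamma0_SL2Z by (intro slash_mult) auto
  also have "\<dots> = slash k f \<gamma> z"
    using assms by (intro slash_cong) (auto simp: cusp_form_def)
  finally show ?thesis .
qed

lemma holomorphic_slash:
  assumes "f holomorphic_on uhp" "\<gamma> \<in> SL2Z"
  shows "slash k f \<gamma> holomorphic_on uhp"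
proof -
  obtain a b c d where \<gamma>: "\<gamma> = (a, b, c, d)" by (cases \<gamma>)
  have nz: "of_int c * z + of_int d \<noteq> 0" if "z \<in> uhp" for z
    using aut_nonzero[OF assms(2) that] by (simp add: \<gamma>)
  have "(\<lambda>z. aut \<gamma> z powi (- k)) holomorphic_on uhp"
    unfolding \<gamma> aut.simps using nz by (intro holomorphic_intros) auto
  moreover have "mob \<gamma> holomorphic_on uhp"
    unfolding \<gamma> mob.simps[abs_def] using nz by (intro holomorphic_intros) auto
  then have "(f \<circ> mob \<gamma>) holomorphic_on uhp"
    by (rule holomorphic_on_compose_gen[OF _ assms(1)]) (intro image_subsetI mob_uhp[OF assms(2)])
  ultimately show ?thesis
    unfolding slash_eq[abs_def] by (auto intro!: holomorphic_on_mult simp: o_def)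
qed

lemma slash_decay:
  assumes f: "cusp_form k N f" and N: "N > 0" and \<gamma>: "\<gamma> \<in> SL2Z" and y0: "y0 > 0"
  shows "\<exists>C c. C \<ge> 0 \<and> c > 0 \<and> (\<forall>z. Im z \<ge> y0 \<longrightarrow> norm (slash k f \<gamma> z) \<le> C * exp (- c * Im z))"
proof (rule exp_decay[OF N])
  show "slash k f \<gamma> holomorphic_on uhp"
    using f \<gamma> by (intro holomorphic_slash) (auto simp: cusp_form_def)
  show "(slash k f \<gamma> \<longlongrightarrow> 0) (filtercomap Im at_top)"
    using f \<gamma> by (auto simp: cusp_form_def)
  fix z assume z: "z \<in> uhp"
  obtain a b c d where \<gamma>': "\<gamma> = (a, b, c, d)" by (cases \<gamma>)
  have det: "a * d - b * c = 1" using \<gamma> by (simp add: \<gamma>' SL2Z_def)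
  define n where "n = int N"
  \<comment> \<open>This is \<gamma> T^N \<gamma>^(-1). Its lower left entry is divisible by N, so
    f|\<gamma> has period N at every cusp.\<close>
  define g where "g = (1 - a * c * n, a * a * n, - (c * c * n), 1 + a * c * n)"
  have g: "g \<in> Gamma0 N"
    by (auto simp: g_def Gamma0_def n_def algebra_simps)
  have "imat2_mult g \<gamma> = (a, b + a * n * (a * d - b * c), c, d + c * n * (a * d - b * c))"
    by (simp add: g_def \<gamma>' algebra_simps)
  then have mult: "imat2_mult g \<gamma> = (a, b + a * n, c, d + c * n)" unfolding det by simp
  have "slash k f \<gamma> (z + of_nat N) = slash k f (a, b + a * n, c, d + c * n) z"
    by (simp add: \<gamma>' n_def algebra_simps)
  then have "slash k f \<gamma> (z + of_nat N) = slash k f (imat2_mult g \<gamma>) z"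
    unfolding mult .
  then show "slash k f \<gamma> (z + of_nat N) = slash k f \<gamma> z"
    using slash_Gamma0_mult[OF f g \<gamma> z] by simp
qed (rule y0)

section \<open>Cosets of the congruence subgroup and the trace\<close>

definition Imat :: imat2 where "Imat = (1, 0, 0, 1)"
definition STmat :: "int \<Rightarrow> imat2" where "STmat j = (0, - 1, 1, j)"
text \<open>Together with the identity, the matrices S T^j for these j represent the points of the
  projective line over Z/N. For N = 3 the residue -1 is taken instead of 2, to match the symmetry in
  T and its inverse.\<close>

definition Tset :: "nat \<Rightarrow> int set" where "Tset N = (if N = 2 then {0, 1} else {0, 1, - 1})"

lemma Imat_SL2Z: "Imat \<in> SL2Z" and STmat_SL2Z: "STmat j \<in> SL2Z"
  by (auto simp: Imat_def STmat_def SL2Z_def)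

lemma slash_Imat: "slash k f Imat z = f z"
  by (simp add: Imat_def)

definition coset :: "nat \<Rightarrow> imat2 \<Rightarrow> imat2 set" where
  "coset N \<gamma> = (\<lambda>\<delta>. imat2_mult \<delta> \<gamma>) ` Gamma0 N"

lemma imat2_mult_assoc: "imat2_mult (imat2_mult \<alpha> \<beta>) \<gamma> = imat2_mult \<alpha> (imat2_mult \<beta> \<gamma>)"
  by (cases \<alpha>; cases \<beta>; cases \<gamma>) (simp add: algebra_simps)

lemma imat2_mult_Imat: "imat2_mult Imat \<gamma> = \<gamma>" "imat2_mult \<gamma> Imat = \<gamma>"
  by (cases \<gamma>; simp add: Imat_def)+

fun minv :: "imat2 \<Rightarrow> imat2" where
  "minv (a, b, c, d) = (d, - b, - c, a)"

lemma minv: "\<gamma> \<in> SL2Z \<Longrightarrow> imat2_mult \<gamma> (minv \<gamma>) = Imat" "\<gamma> \<in> SL2Z \<Longrightarrow> imat2_mult (minv \<gamma>) \<gamma> = Imat"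
    "\<gamma> \<in> SL2Z \<Longrightarrow> minv \<gamma> \<in> SL2Z" "\<gamma> \<in> Gamma0 N \<Longrightarrow> minv \<gamma> \<in> Gamma0 N"
  by (cases \<gamma>; auto simp: Imat_def SL2Z_def Gamma0_def algebra_simps)+

lemma Gamma0_mult: "\<gamma> \<in> Gamma0 N \<Longrightarrow> \<delta> \<in> Gamma0 N \<Longrightarrow> imat2_mult \<gamma> \<delta> \<in> Gamma0 N"
proof -
  assume *: "\<gamma> \<in> Gamma0 N" "\<delta> \<in> Gamma0 N"
  obtain a b c d a' b' c' d' where \<gamma>: "\<gamma> = (a, b, c, d)" and \<delta>: "\<delta> = (a', b', c', d')" by (cases \<gamma>, cases \<delta>)
  have "imat2_mult \<gamma> \<delta> \<in> SL2Z" using * Gamma0_SL2Z by (intro SL2Z_mult) auto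
  moreover have "int N dvd c * a' + d * c'" using * by (auto simp: \<gamma> \<delta> Gamma0_def)
  ultimately show ?thesis by (simp add: \<gamma> \<delta> Gamma0_def SL2Z_def)
qed

lemma Imat_Gamma0: "Imat \<in> Gamma0 N"
  by (simp add: Imat_def Gamma0_def)

lemma coset_self: "\<gamma> \<in> coset N \<gamma>"
  unfolding coset_def using Imat_Gamma0 imat2_mult_Imat by (metis image_eqI)

lemma coset_eq_iff:
  assumes "\<gamma> \<in> SL2Z" "\<delta> \<in> SL2Z"
  shows "coset N \<gamma> = coset N \<delta> \<longleftrightarrow> imat2_mult \<gamma> (minv \<delta>) \<in> Gamma0 N"
proof
  assume "coset N \<gamma> = coset N \<delta>"
  then have "\<gamma> \<in> coset N \<delta>" using coset_self by blast
  then obtain g where "g \<in> Gamma0 N" "\<gamma> = imat2_mult g \<delta>" by (auto simp: coset_def)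
  then show "imat2_mult \<gamma> (minv \<delta>) \<in> Gamma0 N"
    using assms by (simp add: imat2_mult_assoc minv imat2_mult_Imat)
next
  define g where "g = imat2_mult \<gamma> (minv \<delta>)"
  assume "imat2_mult \<gamma> (minv \<delta>) \<in> Gamma0 N"
  then have g: "g \<in> Gamma0 N" by (simp add: g_def)
  have g\<delta>: "imat2_mult g \<delta> = \<gamma>" using assms by (simp add: g_def imat2_mult_assoc minv imat2_mult_Imat)
  have "imat2_mult h \<gamma> \<in> coset N \<delta>" if "h \<in> Gamma0 N" for h
    unfolding coset_def g\<delta>[symmetric] imat2_mult_assoc[symmetric] using that g by (intro imageI Gamma0_mult)
  moreover have "imat2_mult h \<delta> \<in> coset N \<gamma>" if "h \<in> Gamma0 N" for h
  proof -
    have "\<delta> = imat2_mult (minv g) \<gamma>"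
      using minv(2)[of g] subsetD[OF Gamma0_SL2Z g]
      by (simp add: g\<delta>[symmetric] imat2_mult_assoc[symmetric] imat2_mult_Imat)
    then have "imat2_mult h \<delta> = imat2_mult (imat2_mult h (minv g)) \<gamma>" by (simp add: imat2_mult_assoc)
    then show ?thesis unfolding coset_def using that g by (auto intro!: imageI Gamma0_mult minv)
  qed
  ultimately show "coset N \<gamma> = coset N \<delta>" by (auto simp: coset_def[of N \<gamma>] coset_def[of N \<delta>])
qed

lemma Gamma0_cosets_eq: "Gamma0_cosets N = coset N ` SL2Z"
  by (simp add: Gamma0_cosets_def coset_def[abs_def])

lemma cosets_list:
  assumes N: "N = 2 \<or> N = 3"
  shows "Gamma0_cosets N = insert (coset N Imat) ((\<lambda>j. coset N (STmat j)) ` Tset N)"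
    and "coset N Imat \<notin> (\<lambda>j. coset N (STmat j)) ` Tset N"
    and "inj_on (\<lambda>j. coset N (STmat j)) (Tset N)"
proof -
  have "\<exists>\<delta>\<in>insert Imat (STmat ` Tset N). coset N \<gamma> = coset N \<delta>" if \<gamma>: "\<gamma> \<in> SL2Z" for \<gamma>
  proof -
    obtain a b c d where \<gamma>': "\<gamma> = (a, b, c, d)" by (cases \<gamma>)
    have det: "a * d - b * c = 1" using \<gamma> by (simp add: \<gamma>' SL2Z_def)
    show ?thesis
    proof (cases "int N dvd c")
      case True
      then have "coset N \<gamma> = coset N Imat"
        unfolding coset_eq_iff[OF \<gamma> Imat_SL2Z] using det by (simp add: Imat_def \<gamma>' Gamma0_def)
      then show ?thesis by blast
    next
      case False
      \<comment> \<open>The bottom row (c, d) is proportional to (1, j) modulo N with j = d /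
        c.\<close>
      have "\<exists>j\<in>Tset N. int N dvd c * j - d"
      proof (cases "N = 2")
        case True
        with False have "odd c" by simp
        then have "int N dvd c * (if even d then 0 else 1) - d" using True by auto
        then show ?thesis using True by (auto simp: Tset_def split: if_splits)
      next
        case False
        with N have 3: "N = 3" by simp
        with \<open>\<not> int N dvd c\<close> have "\<not> 3 dvd c" by simp
        then have "3 dvd c * 0 - d \<or> 3 dvd c * 1 - d \<or> 3 dvd c * (-1) - d" by presburger
        then show ?thesis using 3 by (auto simp: Tset_def)
      qed
      then obtain j where j: "j \<in> Tset N" "int N dvd c * j - d" by blast
      have "imat2_mult \<gamma> (minv (STmat j)) \<in> SL2Z" using \<gamma> by (intro SL2Z_mult minv STmat_SL2Z)
      then have "coset N \<gamma> = coset N (STmat j)"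
        using \<gamma> j by (subst coset_eq_iff) (auto simp: STmat_SL2Z STmat_def \<gamma>' Gamma0_def SL2Z_def)
      then show ?thesis using j by blast
    qed
  qed
  then show "Gamma0_cosets N = insert (coset N Imat) ((\<lambda>j. coset N (STmat j)) ` Tset N)"
    unfolding Gamma0_cosets_eq using Imat_SL2Z STmat_SL2Z by fastforce
  have "\<not> int N dvd 1" using N by auto
  then show "coset N Imat \<notin> (\<lambda>j. coset N (STmat j)) ` Tset N"
    by (auto simp: coset_eq_iff Imat_SL2Z STmat_SL2Z) (auto simp: Imat_def STmat_def Gamma0_def)
  show "inj_on (\<lambda>j. coset N (STmat j)) (Tset N)"
  proof (rule inj_onI)
    fix i j assume ij: "i \<in> Tset N" "j \<in> Tset N" "coset N (STmat i) = coset N (STmat j)"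
    then have "int N dvd j - i"
      by (auto simp: coset_eq_iff STmat_SL2Z) (auto simp: STmat_def Gamma0_def)
    with ij(1,2) N show "i = j" by (auto simp: Tset_def split: if_splits)
  qed
qed

text \<open>The Petersson product picks its coset representatives by \<open>SOME\<close>; for a
  function that is constant on cosets they can be replaced by explicit ones.\<close>

lemma sum_cosets:
  fixes F :: "imat2 \<Rightarrow> complex"
  assumes N: "N = 2 \<or> N = 3" and F: "\<And>\<gamma> \<delta>. \<gamma> \<in> SL2Z \<Longrightarrow> \<delta> \<in> coset N \<gamma> \<Longrightarrow> F \<delta> = F \<gamma>"
  shows "(\<Sum>C\<in>Gamma0_cosets N. F (SOME \<gamma>. \<gamma> \<in> C)) = F Imat + (\<Sum>j\<in>Tset N. F (STmat j))"
proof -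
  have "(SOME \<gamma>'. \<gamma>' \<in> coset N \<gamma>) \<in> coset N \<gamma>" for \<gamma>
    using someI[of "\<lambda>x. x \<in> coset N \<gamma>", OF coset_self] .
  then have F': "F (SOME \<gamma>'. \<gamma>' \<in> coset N \<gamma>) = F \<gamma>" if "\<gamma> \<in> SL2Z" for \<gamma>
    using F that by blast
  have "finite (Tset N)" by (simp add: Tset_def)
  then show ?thesis
    unfolding cosets_list(1)[OF N]
    using cosets_list(2,3)[OF N] by (simp add: sum.reindex F' Imat_SL2Z STmat_SL2Z)
qed

definition trace1 :: "int \<Rightarrow> nat \<Rightarrow> (complex \<Rightarrow> complex) \<Rightarrow> complex \<Rightarrow> complex" where
  "trace1 k N f z = slash k f Imat z + (\<Sum>j\<in>Tset N. slash k f (STmat j) z)"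

lemma slash_coset:
  assumes "cusp_form k N f" "\<gamma> \<in> SL2Z" "\<delta> \<in> coset N \<gamma>" "z \<in> uhp"
  shows "slash k f \<delta> z = slash k f \<gamma> z"
proof -
  obtain g where "g \<in> Gamma0 N" "\<delta> = imat2_mult g \<gamma>" using assms(3) by (auto simp: coset_def)
  then show ?thesis using slash_Gamma0_mult[OF assms(1) _ assms(2,4)] by blast
qed

text \<open>Right multiplication by \<delta> permutes the cosets, and f|\<gamma> depends only on the
  coset of \<gamma>.\<close>

lemma slash_trace1:
  assumes N: "N = 2 \<or> N = 3" and f: "cusp_form k N f" and \<delta>: "\<delta> \<in> SL2Z" and z: "z \<in> uhp"
  shows "slash k (trace1 k N f) \<delta> z = trace1 k N f z"
    and "slash k (trace1 k N f) \<delta> z = slash k f (imat2_mult Imat \<delta>) z + (\<Sum>j\<in>Tset N. slash k f (imat2_mult (STmat j) \<delta>) z)"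
proof -
  show 1: "slash k (trace1 k N f) \<delta> z = slash k f (imat2_mult Imat \<delta>) z + (\<Sum>j\<in>Tset N. slash k f (imat2_mult (STmat j) \<delta>) z)"
    by (simp add: slash_mult Imat_SL2Z STmat_SL2Z \<delta> z)
       (simp add: slash_eq trace1_def ring_distribs sum_distrib_left)
  define F where "F = (\<lambda>\<gamma>. slash k f \<gamma> z)"
  define G where "G = (\<lambda>\<gamma>. slash k f (imat2_mult \<gamma> \<delta>) z)"
  have F: "F \<delta>' = F \<gamma>" if "\<gamma> \<in> SL2Z" "\<delta>' \<in> coset N \<gamma>" for \<gamma> \<delta>'
    unfolding F_def using slash_coset[OF f that z] .
  have co: "imat2_mult \<gamma>' \<delta> \<in> coset N (imat2_mult \<gamma> \<delta>)" if "\<gamma>' \<in> coset N \<gamma>" for \<gamma> \<gamma>'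
    using that by (auto simp: coset_def imat2_mult_assoc)
  have G: "G \<delta>' = G \<gamma>" if "\<gamma> \<in> SL2Z" "\<delta>' \<in> coset N \<gamma>" for \<gamma> \<delta>'
    unfolding G_def using that \<delta> z by (intro slash_coset[OF f] SL2Z_mult co)
  let ?R = "\<lambda>C. (\<lambda>\<gamma>. imat2_mult \<gamma> \<delta>) ` C"
  have R: "?R (coset N \<gamma>) = coset N (imat2_mult \<gamma> \<delta>)" for \<gamma>
    by (auto simp: coset_def imat2_mult_assoc image_image)
  have "bij_betw ?R (Gamma0_cosets N) (Gamma0_cosets N)"
  proof (rule bij_betw_byWitness[where f' = "\<lambda>C. (\<lambda>\<gamma>. imat2_mult \<gamma> (minv \<delta>)) ` C"])
    show "\<forall>C\<in>Gamma0_cosets N. (\<lambda>\<gamma>. imat2_mult \<gamma> (minv \<delta>)) ` ?R C = C"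
      using \<delta> by (simp add: image_image imat2_mult_assoc minv imat2_mult_Imat)
    show "\<forall>C\<in>Gamma0_cosets N. ?R ((\<lambda>\<gamma>. imat2_mult \<gamma> (minv \<delta>)) ` C) = C"
      using \<delta> by (simp add: image_image imat2_mult_assoc minv imat2_mult_Imat)
    show "?R ` Gamma0_cosets N \<subseteq> Gamma0_cosets N"
      unfolding Gamma0_cosets_eq using \<delta> by (auto simp: R intro!: imageI SL2Z_mult)
    show "(\<lambda>C. (\<lambda>\<gamma>. imat2_mult \<gamma> (minv \<delta>)) ` C) ` Gamma0_cosets N \<subseteq> Gamma0_cosets N"
    proof -
      have "(\<lambda>\<gamma>. imat2_mult \<gamma> (minv \<delta>)) ` coset N \<gamma> = coset N (imat2_mult \<gamma> (minv \<delta>))" for \<gamma>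
        by (auto simp: coset_def imat2_mult_assoc image_image)
      then show ?thesis
        unfolding Gamma0_cosets_eq using minv(3)[OF \<delta>] by (auto intro!: imageI SL2Z_mult)
    qed
  qed
  from sum.reindex_bij_betw[OF this, of "\<lambda>C. F (SOME \<gamma>. \<gamma> \<in> C)"]
  have "(\<Sum>C\<in>Gamma0_cosets N. F (SOME \<gamma>. \<gamma> \<in> ?R C)) = (\<Sum>C\<in>Gamma0_cosets N. F (SOME \<gamma>. \<gamma> \<in> C))" .
  also have "(\<Sum>C\<in>Gamma0_cosets N. F (SOME \<gamma>. \<gamma> \<in> ?R C)) = (\<Sum>C\<in>Gamma0_cosets N. G (SOME \<gamma>. \<gamma> \<in> C))"
  proof (rule sum.cong[OF refl])
    fix C assume "C \<in> Gamma0_cosets N"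
    then obtain \<gamma> where \<gamma>: "\<gamma> \<in> SL2Z" "C = coset N \<gamma>" by (auto simp: Gamma0_cosets_eq)
    have "(SOME \<gamma>'. \<gamma>' \<in> coset N \<alpha>) \<in> coset N \<alpha>" for \<alpha>
      using someI[of "\<lambda>x. x \<in> coset N \<alpha>", OF coset_self] .
    then have "F (SOME \<gamma>'. \<gamma>' \<in> coset N (imat2_mult \<gamma> \<delta>)) = F (imat2_mult \<gamma> \<delta>)"
      "G (SOME \<gamma>'. \<gamma>' \<in> coset N \<gamma>) = G \<gamma>"
      using F G \<gamma> \<delta> SL2Z_mult by blast+
    then show "F (SOME \<gamma>. \<gamma> \<in> ?R C) = G (SOME \<gamma>. \<gamma> \<in> C)"
      unfolding \<gamma>(2) R by (simp add: F_def G_def)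
  qed
  finally show "slash k (trace1 k N f) \<delta> z = trace1 k N f z"
    unfolding 1 using sum_cosets[OF N, of F, OF F] sum_cosets[OF N, of G, OF G] by (simp add: F_def G_def trace1_def)
qed

lemma cusp_form_trace1:
  assumes N: "N = 2 \<or> N = 3" and f: "cusp_form k N f"
  shows "cusp_form k 1 (trace1 k N f)"
  unfolding cusp_form_def Gamma0_1
proof (intro conjI ballI)
  show "trace1 k N f holomorphic_on uhp"
    unfolding trace1_def[abs_def] using f
    by (intro holomorphic_intros holomorphic_slash Imat_SL2Z STmat_SL2Z) (auto simp: cusp_form_def)
  fix \<gamma> assume \<gamma>: "\<gamma> \<in> SL2Z"
  show "slash k (trace1 k N f) \<gamma> z = trace1 k N f z" if "z \<in> uhp" for z
    using slash_trace1(1)[OF N f \<gamma> that] .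
  have "((\<lambda>z. slash k f (imat2_mult Imat \<gamma>) z + (\<Sum>j\<in>Tset N. slash k f (imat2_mult (STmat j) \<gamma>) z)) \<longlongrightarrow> 0 + (\<Sum>j\<in>Tset N. 0))
    (filtercomap Im at_top)"
    using f \<gamma> by (intro tendsto_add tendsto_sum) (auto simp: cusp_form_def intro!: SL2Z_mult Imat_SL2Z STmat_SL2Z)
  then have "((\<lambda>z. slash k f (imat2_mult Imat \<gamma>) z + (\<Sum>j\<in>Tset N. slash k f (imat2_mult (STmat j) \<gamma>) z)) \<longlongrightarrow> 0)
    (filtercomap Im at_top)" by simp
  then show "(slash k (trace1 k N f) \<gamma> \<longlongrightarrow> 0) (filtercomap Im at_top)"
  proof (rule Lim_transform_eventually)
    show "\<forall>\<^sub>F z in filtercomap Im at_top. slash k f (imat2_mult Imat \<gamma>) z + (\<Sum>j\<in>Tset N. slash k f (imat2_mult (STmat j) \<gamma>) z) = slash k (trace1 k N f) \<gamma> z"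
      unfolding eventually_Im_at_top
    proof (intro exI[of _ 1] allI impI)
      fix z :: complex assume "Im z \<ge> 1"
      then have "z \<in> uhp" by (simp add: uhp_def)
      then show "slash k f (imat2_mult Imat \<gamma>) z + (\<Sum>j\<in>Tset N. slash k f (imat2_mult (STmat j) \<gamma>) z) = slash k (trace1 k N f) \<gamma> z"
        using slash_trace1(2)[OF N f \<gamma>] by simp
    qed
  qed
qed

subsection \<open>Orthogonality to level 1\<close>

lemma fundamental_domain_uhp: "fundamental_domain \<subseteq> uhp"
  by (auto simp: fundamental_domain_def)

lemma fundamental_domain_Im:
  assumes "z \<in> fundamental_domain"
  shows "Im z \<ge> 1 / 2"
proof -
  have z: "Im z > 0" "\<bar>Re z\<bar> \<le> 1 / 2" "norm z \<ge> 1"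
    using assms by (auto simp: fundamental_domain_def uhp_def)
  have "1 \<le> (norm z)\<^sup>2" using z(3) by simp
  also have "(norm z)\<^sup>2 = (Re z)\<^sup>2 + (Im z)\<^sup>2" by (rule cmod_power2)
  also have "(Re z)\<^sup>2 \<le> (1 / 2)\<^sup>2" using z(2) by (metis abs_le_square_iff abs_of_nonneg zero_le_divide_1_iff zero_le_numeral)
  finally have "(1 / 2)\<^sup>2 \<le> (Im z)\<^sup>2" by (simp add: power2_eq_square)
  then show ?thesis using z(1) by (meson less_imp_le power2_le_imp_le)
qed

lemma fundamental_domain_borel: "fundamental_domain \<in> sets borel"
proof -
  have "fundamental_domain = {z. Im z > 0} \<inter> {z. \<bar>Re z\<bar> \<le> 1 / 2} \<inter> {z. norm z \<ge> 1}"
    by (auto simp: fundamental_domain_def uhp_def)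
  also have "\<dots> \<in> sets borel"
    by (intro sets.Int borel_open borel_closed open_halfspace_Im_gt closed_Collect_le continuous_intros)
  finally show ?thesis .
qed

text \<open>Boxes of measure 1, one for each integer height, cover the domain, and the bounds on
  them form a geometric series.\<close>

lemma set_integrable_fundamental_domain:
  fixes \<phi> :: "complex \<Rightarrow> complex"
  assumes cont: "continuous_on uhp \<phi>" and c: "c > 0"
    and bound: "\<And>z. Im z \<ge> 1 / 2 \<Longrightarrow> norm (\<phi> z) \<le> C * exp (- c * Im z)"
  shows "set_integrable lborel fundamental_domain \<phi>"
  unfolding set_integrable_def
proof (rule integrableI_bounded)
  show "(\<lambda>z. indicat_real fundamental_domain z *\<^sub>R \<phi> z) \<in> borel_measurable lborel"
    using borel_measurable_continuous_on_indicator[OF fundamental_domain_borel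
        continuous_on_subset[OF cont fundamental_domain_uhp]] by simp
  define B where "B = (\<lambda>n::nat. cbox (Complex (- 1 / 2) (real n)) (Complex (1 / 2) (real n + 1)))"
  have "0 \<le> C * exp (- c)" using bound[of \<i>] norm_ge_zero[of "\<phi> \<i>"] by (simp del: norm_ge_zero)
  then have C: "C \<ge> 0" by (simp add: zero_le_mult_iff)
  have le_suminf: "a n \<le> suminf a" for a :: "nat \<Rightarrow> ennreal" and n
    using sum_le_suminf[of a "{n}"] by simp
  have "ennreal (norm (indicat_real fundamental_domain z *\<^sub>R \<phi> z))
      \<le> suminf (\<lambda>n. ennreal (C * exp (- c * real n)) * indicator (B n) z)" for z
  proof (cases "z \<in> fundamental_domain")
    case True
    define n where "n = nat \<lfloor>Im z\<rfloor>"
    have Im: "Im z \<ge> 1 / 2" by (rule fundamental_domain_Im[OF True])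
    have n: "real n \<le> Im z" "Im z \<le> real n + 1" using Im unfolding n_def by linarith+
    have zB: "z \<in> B n" using True n by (auto simp: B_def in_cbox_complex_iff fundamental_domain_def)
    have "norm (\<phi> z) \<le> C * exp (- c * Im z)" by (rule bound[OF Im])
    also have "\<dots> \<le> C * exp (- c * real n)" using C c n by (intro mult_left_mono) auto
    finally have "ennreal (norm (indicat_real fundamental_domain z *\<^sub>R \<phi> z))
        \<le> ennreal (C * exp (- c * real n)) * indicator (B n) z"
      using True zB by (simp add: ennreal_leI)
    also have "\<dots> \<le> suminf (\<lambda>n. ennreal (C * exp (- c * real n)) * indicator (B n) z)"
      by (rule le_suminf)
    finally show ?thesis .
  qed simp
  then have "(\<integral>\<^sup>+z. ennreal (norm (indicat_real fundamental_domain z *\<^sub>R \<phi> z)) \<partial>lborel)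
      \<le> (\<integral>\<^sup>+z. suminf (\<lambda>n. ennreal (C * exp (- c * real n)) * indicator (B n) z) \<partial>lborel)"
    by (intro nn_integral_mono) auto
  also have "\<dots> = suminf (\<lambda>n. \<integral>\<^sup>+z. ennreal (C * exp (- c * real n)) * indicator (B n) z \<partial>lborel)"
    by (intro nn_integral_suminf) (auto simp: B_def)
  also have "\<dots> = suminf (\<lambda>n. ennreal (C * exp (- c * real n)) * emeasure lborel (B n))"
    by (intro arg_cong[of _ _ suminf] ext nn_integral_cmult_indicator) (auto simp: B_def)
  also have "\<dots> = suminf (\<lambda>n. ennreal (C * exp (- c) ^ n))"
  proof -
    have "emeasure lborel (B n) = 1" for n
      by (simp add: B_def emeasure_lborel_cbox_eq Basis_complex_def inner_complex_def)
    moreover have "exp (- c * real n) = exp (- c) ^ n" for n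
      by (simp add: exp_of_nat_mult[symmetric] mult.commute)
    ultimately show ?thesis by simp
  qed
  also have "\<dots> < \<infinity>"
  proof -
    have "summable (\<lambda>n. C * exp (- c) ^ n)" using c by (intro summable_mult summable_geometric) auto
    then have "suminf (\<lambda>n. ennreal (C * exp (- c) ^ n)) = ennreal (suminf (\<lambda>n. C * exp (- c) ^ n))"
      using C by (intro suminf_ennreal2) auto
    then show ?thesis by simp
  qed
  finally show "(\<integral>\<^sup>+z. ennreal (norm (indicat_real fundamental_domain z *\<^sub>R \<phi> z)) \<partial>lborel) < \<infinity>" .
qed

text \<open>The w-th power of x \<le> exp x at x = c y / w.\<close>

lemma power_le_exp:
  fixes c y :: real
  assumes "c > 0" "y \<ge> 0" "w > 0"
  shows "y ^ w \<le> (real w / c) ^ w * exp (c * y)"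
proof -
  have "c * y / real w \<le> exp (c * y / real w)"
    using exp_ge_add_one_self[of "c * y / real w"] by linarith
  then have "(c * y / real w) ^ w \<le> exp (c * y / real w) ^ w"
    using assms by (intro power_mono) auto
  also have "\<dots> = exp (c * y)" using assms by (simp add: exp_of_nat_mult[symmetric])
  finally have "(real w / c) ^ w * (c * y / real w) ^ w \<le> (real w / c) ^ w * exp (c * y)"
    using assms by (intro mult_left_mono) auto
  moreover have "(real w / c) ^ w * (c * y / real w) ^ w = y ^ w"
    using assms by (simp add: power_mult_distrib[symmetric])
  ultimately show ?thesis by simp
qed

text \<open>The Petersson product of \<open>f\<close> with its trace is the square norm of the trace in level 1.\<close>

lemma trace1_eq_0:
  assumes N: "N = 2 \<or> N = 3" and f: "newform k N f" and k: "k > 2" and z0: "z0 \<in> uhp"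
  shows "trace1 k N f z0 = 0"
proof -
  have cf: "cusp_form k N f" using f by (simp add: newform_def)
  define g where "g = trace1 k N f"
  have cg: "cusp_form k 1 g" unfolding g_def by (rule cusp_form_trace1[OF N cf])
  have hol: "f holomorphic_on uhp" "g holomorphic_on uhp" using cf cg by (auto simp: cusp_form_def)
  \<comment> \<open>The trace is itself an oldform generator: level M = 1 properly divides N, and d
    = 1.\<close>
  have "g \<in> oldform_generators k N"
    unfolding oldform_generators_def
    by (rule CollectI, rule exI[of _ g], rule exI[of _ 1], rule exI[of _ 1]) (use N cg in auto)
  then have pet: "petersson k N f g = 0" using f by (auto simp: newform_def)
  define w where "w = nat (k - 2)"
  have w: "w > 0" "k - 2 = int w" using k by (auto simp: w_def)
  define h where "h = (\<lambda>\<gamma> z. slash k f \<gamma> z * cnj (g z) * of_real (Im z ^ w))"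
  have integ: "set_integrable lborel fundamental_domain (h \<gamma>)" if \<gamma>: "\<gamma> \<in> SL2Z" for \<gamma>
  proof -
    obtain C1 c1 where 1: "C1 \<ge> 0" "c1 > 0" "\<And>z. Im z \<ge> 1 / 2 \<Longrightarrow> norm (slash k f \<gamma> z) \<le> C1 * exp (- c1 * Im z)"
      using slash_decay[OF cf _ \<gamma>, of "1 / 2"] N by auto
    obtain C2 c2 where 2: "C2 \<ge> 0" "c2 > 0" "\<And>z. Im z \<ge> 1 / 2 \<Longrightarrow> norm (g z) \<le> C2 * exp (- c2 * Im z)"
      using slash_decay[OF cg _ Imat_SL2Z, of "1 / 2"] by (auto simp: slash_Imat)
    show ?thesis
    proof (rule set_integrable_fundamental_domain[OF _ 1(2), of _ "C1 * C2 * (real w / c2) ^ w"])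
      show "continuous_on uhp (h \<gamma>)"
        unfolding h_def
        by (intro continuous_intros holomorphic_on_imp_continuous_on holomorphic_slash hol \<gamma>)
      fix z :: complex assume z: "Im z \<ge> 1 / 2"
      have "norm (h \<gamma> z) = norm (slash k f \<gamma> z) * norm (g z) * Im z ^ w"
        using z by (simp add: h_def norm_mult norm_power)
      \<comment> \<open>The decay of g is spent on the power of Im z; that of f|\<gamma> is left for
        integrability.\<close>
      also have "\<dots> \<le> (C1 * exp (- c1 * Im z)) * (C2 * exp (- c2 * Im z)) * ((real w / c2) ^ w * exp (c2 * Im z))"
        using z 1 2 w by (intro mult_mono power_le_exp) auto
      also have "\<dots> = C1 * C2 * (real w / c2) ^ w * exp (- c1 * Im z)"
        by (simp add: exp_minus field_simps)
      finally show "norm (h \<gamma> z) \<le> C1 * C2 * (real w / c2) ^ w * exp (- c1 * Im z)" .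
    qed
  qed
  define F where "F = (\<lambda>\<gamma>. LINT z:fundamental_domain|lborel. slash k f \<gamma> z * cnj (slash k g \<gamma> z) * of_real (Im z powi (k - 2)))"
  have Fh: "F \<gamma> = (LINT z:fundamental_domain|lborel. h \<gamma> z)" if \<gamma>: "\<gamma> \<in> SL2Z" for \<gamma>
    unfolding F_def
  proof (rule set_lebesgue_integral_cong)
    show "\<forall>z. z \<in> fundamental_domain \<longrightarrow> slash k f \<gamma> z * cnj (slash k g \<gamma> z) * of_real (Im z powi (k - 2)) = h \<gamma> z"
    proof (intro allI impI)
      fix z assume "z \<in> fundamental_domain"
      then have z: "z \<in> uhp" using fundamental_domain_uhp by auto
      show "slash k f \<gamma> z * cnj (slash k g \<gamma> z) * of_real (Im z powi (k - 2)) = h \<gamma> z"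
        using slash_trace1(1)[OF N cf \<gamma> z] w(2) by (simp add: h_def g_def)
    qed
  qed (use fundamental_domain_borel in simp)
  have F: "F \<delta> = F \<gamma>" if \<gamma>: "\<gamma> \<in> SL2Z" and \<delta>: "\<delta> \<in> coset N \<gamma>" for \<gamma> \<delta>
  proof -
    have \<delta>': "\<delta> \<in> SL2Z" using \<gamma> \<delta> Gamma0_SL2Z SL2Z_mult unfolding coset_def by blast
    show ?thesis
      unfolding Fh[OF \<gamma>] Fh[OF \<delta>']
      using fundamental_domain_borel fundamental_domain_uhp slash_coset[OF cf \<gamma> \<delta>]
      by (intro set_lebesgue_integral_cong) (auto simp: h_def)
  qed
  \<comment> \<open>Since g|\<gamma> = g, every coset integrand carries the same factor
    \<open>cnj (g z)\<close>, and the remaining factors sum to the trace g.\<close>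
  have sumh: "h Imat z + (\<Sum>j\<in>Tset N. h (STmat j) z) = of_real ((norm (g z))\<^sup>2 * Im z ^ w)" for z
  proof -
    have "h Imat z + (\<Sum>j\<in>Tset N. h (STmat j) z) = trace1 k N f z * cnj (g z) * of_real (Im z ^ w)"
      by (simp add: h_def trace1_def sum_distrib_right ring_distribs)
    then show ?thesis by (simp only: g_def of_real_mult complex_norm_square)
  qed
  have "0 = petersson k N f g" using pet by simp
  also have "\<dots> = F Imat + (\<Sum>j\<in>Tset N. F (STmat j))"
    using sum_cosets[OF N, of F, OF F] by (simp add: petersson_def Let_def F_def)
  also have "\<dots> = (LINT z:fundamental_domain|lborel. h Imat z + (\<Sum>j\<in>Tset N. h (STmat j) z))"
  proof -
    have "(LINT z:fundamental_domain|lborel. (\<Sum>j\<in>Tset N. h (STmat j) z)) = (\<Sum>j\<in>Tset N. F (STmat j))"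
      unfolding set_lebesgue_integral_def scaleR_sum_right
      using integ[OF STmat_SL2Z] unfolding set_integrable_def
      by (subst Bochner_Integration.integral_sum) (auto simp: Fh STmat_SL2Z set_lebesgue_integral_def)
    moreover have "set_integrable lborel fundamental_domain (\<lambda>z. \<Sum>j\<in>Tset N. h (STmat j) z)"
      unfolding set_integrable_def scaleR_sum_right
      using integ[OF STmat_SL2Z] unfolding set_integrable_def by (intro Bochner_Integration.integrable_sum) auto
    ultimately show ?thesis
      using integ[OF Imat_SL2Z] by (simp add: set_integral_add(2) Fh Imat_SL2Z)
  qed
  also have "\<dots> = (LINT z:fundamental_domain|lborel. of_real ((norm (g z))\<^sup>2 * Im z ^ w))"
  proof (rule set_lebesgue_integral_cong)
    show "\<forall>z. z \<in> fundamental_domain \<longrightarrow> h Imat z + (\<Sum>j\<in>Tset N. h (STmat j) z) = of_real ((norm (g z))\<^sup>2 * Im z ^ w)"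
      by (simp add: sumh)
  qed (use fundamental_domain_borel in simp)
  also have "\<dots> = of_real (LINT z:fundamental_domain|lborel. (norm (g z))\<^sup>2 * Im z ^ w)"
    by (rule set_integral_complex_of_real)
  finally have int0: "(LINT z:fundamental_domain|lborel. (norm (g z))\<^sup>2 * Im z ^ w) = 0" by simp
  have "set_integrable lborel fundamental_domain (\<lambda>z. h Imat z + (\<Sum>j\<in>Tset N. h (STmat j) z))"
    unfolding set_integrable_def scaleR_sum_right scaleR_add_right
    using integ[OF STmat_SL2Z] integ[OF Imat_SL2Z] unfolding set_integrable_def
    by (intro Bochner_Integration.integrable_add Bochner_Integration.integrable_sum) auto
  then have "set_integrable lborel fundamental_domain (\<lambda>z. complex_of_real ((norm (g z))\<^sup>2 * Im z ^ w))"
    unfolding sumh .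
  then have int: "integrable lborel (\<lambda>z. indicat_real fundamental_domain z * ((norm (g z))\<^sup>2 * Im z ^ w))"
    unfolding set_integrable_def scaleR_conv_of_real of_real_mult[symmetric] complex_of_real_integrable_eq by simp
  have nn: "indicat_real fundamental_domain z * ((norm (g z))\<^sup>2 * Im z ^ w) \<ge> 0" for z
    using fundamental_domain_Im[of z] by (auto simp: indicator_def)
  have AE: "AE z in lborel. indicat_real fundamental_domain z * ((norm (g z))\<^sup>2 * Im z ^ w) = 0"
    using int0 integral_nonneg_eq_0_iff_AE[OF int] nn unfolding set_lebesgue_integral_def by simp
  \<comment> \<open>Vanishing almost everywhere becomes vanishing on this open set by continuity,
    and then on the whole half plane by analytic continuation.\<close>
  define U where "U = {z. Im z > 0} \<inter> {z. \<bar>Re z\<bar> < 1 / 2} \<inter> {z. norm z > 1}"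
  have U: "open U" "U \<subseteq> fundamental_domain" "U \<subseteq> uhp"
    unfolding U_def
    by (intro open_Int open_halfspace_Im_gt open_Collect_less continuous_intros)
       (auto simp: fundamental_domain_def uhp_def)
  have "2 * \<i> \<in> U" by (simp add: U_def norm_mult)
  have gU: "g z = 0" if "z \<in> U" for z
  proof -
    define V where "V = {z \<in> U. g z \<noteq> 0}"
    have "continuous_on U g" using hol(2) U(3) holomorphic_on_imp_continuous_on continuous_on_subset by blast
    then have "open (g -` (- {0}) \<inter> U)"
      using continuous_on_open_vimage[OF U(1), of g] by (meson open_Compl closed_singleton)
    moreover have "g -` (- {0}) \<inter> U = V" by (auto simp: V_def)
    ultimately have "open V" by simp
    have "AE z in lborel. z \<notin> V"
      using AE
    proof eventually_elim
      case (elim z)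
      show ?case
      proof
        assume "z \<in> V"
        then have "z \<in> fundamental_domain" "g z \<noteq> 0" "Im z > 0" using U by (auto simp: V_def uhp_def)
        with elim show False by simp
      qed
    qed
    then have "V \<in> null_sets lborel" using \<open>open V\<close> by (simp add: AE_iff_null_sets)
    then have "negligible V" by (simp add: negligible_iff_null_sets null_sets_completionI)
    with \<open>open V\<close> have "V = {}" using open_not_negligible by blast
    then show ?thesis using that by (auto simp: V_def)
  qed
  have "g z0 = (\<lambda>_. 0) z0"
    by (rule analytic_continuation_open[OF U(1) _ _ _ U(3) hol(2) _ _ z0])
       (use open_uhp \<open>2 * \<i> \<in> U\<close> convex_connected[OF convex_uhp] gU in auto)
  then show ?thesis by (simp add: g_def)
qed

text \<open>For N = 2 the matrices ST and ST^(-1) lie in the same coset, so the symmetric form is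
  twice the trace; this is the origin of c = 2.\<close>

lemma three_term_relation:
  assumes N: "N = 2 \<or> N = 3" and f: "newform k N f" and k: "k > 2" and z: "z \<in> uhp"
  defines "c \<equiv> if N = 2 then 2 else 1"
  shows "c * (f z + slash k f (STmat 0) z) + slash k f (STmat 1) z + slash k f (STmat (- 1)) z = 0"
proof (cases "N = 2")
  case True
  have cf: "cusp_form k N f" using f by (simp add: newform_def)
  have "imat2_mult (STmat (- 1)) (minv (STmat 1)) \<in> Gamma0 N"
    using True by (simp add: STmat_def Gamma0_def)
  then have "coset N (STmat (- 1)) = coset N (STmat 1)"
    by (simp add: coset_eq_iff STmat_SL2Z)
  then have "STmat (- 1) \<in> coset N (STmat 1)" using coset_self by blast
  then have "slash k f (STmat (- 1)) z = slash k f (STmat 1) z"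
    by (intro slash_coset[OF cf STmat_SL2Z _ z])
  then have "c * (f z + slash k f (STmat 0) z) + slash k f (STmat 1) z + slash k f (STmat (- 1)) z = 2 * trace1 k N f z"
    using True by (simp add: c_def trace1_def Tset_def slash_Imat)
  then show ?thesis using trace1_eq_0[OF N f k z] by simp
next
  case False
  then show ?thesis
    using trace1_eq_0[OF N f k z] by (simp add: c_def trace1_def Tset_def slash_Imat algebra_simps)
qed

subsection \<open>Eichler integrals\<close>

text \<open>All vertical lines are included because a translation by an integer moves the
  line.\<close>

definition cusp_lim :: "(complex \<Rightarrow> complex) \<Rightarrow> complex \<Rightarrow> bool" where
  "cusp_lim G L \<longleftrightarrow> (\<forall>\<xi>::real. ((\<lambda>s::real. G (of_real \<xi> + \<i> * of_real s)) \<longlongrightarrow> L) at_top)"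

text \<open>The constants may depend on the strip, as the polynomial factor of the integrand grows
  with Re z.\<close>

definition strip_decay :: "(complex \<Rightarrow> complex) \<Rightarrow> bool" where
  "strip_decay h \<longleftrightarrow> (\<forall>B. \<exists>C c. c > 0 \<and> (\<forall>z. \<bar>Re z\<bar> \<le> B \<longrightarrow> Im z \<ge> 1 \<longrightarrow> norm (h z) \<le> C * exp (- c * Im z)))"

definition primitive :: "(complex \<Rightarrow> complex) \<Rightarrow> (complex \<Rightarrow> complex) \<Rightarrow> bool" where
  "primitive G h \<longleftrightarrow> (\<forall>z\<in>uhp. (G has_field_derivative h z) (at z))"

lemma cusp_limD: "cusp_lim G L \<Longrightarrow> ((\<lambda>s::real. G (of_real \<xi> + \<i> * of_real s)) \<longlongrightarrow> L) at_top"
  by (simp add: cusp_lim_def)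

lemma cusp_limD0: "cusp_lim G L \<Longrightarrow> ((\<lambda>s::real. G (\<i> * of_real s)) \<longlongrightarrow> L) at_top"
  using cusp_limD[of G L 0] by simp

lemma eventually_uhp_line: "\<forall>\<^sub>F s::real in at_top. of_real \<xi> + \<i> * of_real s \<in> uhp"
  using eventually_gt_at_top[of 0] by eventually_elim (simp add: uhp_def)

lemma primitive_exists:
  assumes "h holomorphic_on uhp"
  shows "\<exists>G. primitive G h"
proof -
  obtain G where "\<And>z. z \<in> uhp \<Longrightarrow> (G has_field_derivative h z) (at z within uhp)"
    using holomorphic_convex_primitive'[OF convex_uhp open_uhp assms] by blast
  then have "primitive G h" by (simp add: primitive_def at_within_open[OF _ open_uhp])
  then show ?thesis by blast
qed

lemma primitive_unique:
  assumes "primitive G h" "primitive H h"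
  shows "\<exists>c. \<forall>z\<in>uhp. G z = H z + c"
proof -
  have "\<exists>c. \<forall>z\<in>uhp. G z - H z = c"
  proof (rule has_field_derivative_zero_constant[OF convex_uhp])
    fix z assume "z \<in> uhp"
    then have "((\<lambda>z. G z - H z) has_field_derivative h z - h z) (at z)"
      using assms by (intro DERIV_diff) (auto simp: primitive_def)
    then show "((\<lambda>z. G z - H z) has_field_derivative 0) (at z within uhp)"
      by (simp add: has_field_derivative_at_within)
  qed
  then show ?thesis by (metis diff_add_cancel add.commute)
qed

lemma primitive_vertical:
  assumes "primitive G h" "s > 0"
  shows "((\<lambda>s. G (of_real \<xi> + \<i> * of_real s)) has_vector_derivative \<i> * h (of_real \<xi> + \<i> * of_real s)) (at s)"
proof -
  have "((\<lambda>s::real. of_real \<xi> + \<i> * of_real s) has_vector_derivative \<i>) (at s)"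
    by (auto intro!: derivative_eq_intros)
  moreover have "(G has_field_derivative h (of_real \<xi> + \<i> * of_real s)) (at (of_real \<xi> + \<i> * of_real s))"
    using assms by (simp add: primitive_def uhp_def)
  ultimately show ?thesis
    using field_vector_diff_chain_at[of "\<lambda>s::real. of_real \<xi> + \<i> * of_real s"] by (simp add: o_def)
qed

text \<open>On the imaginary axis the decay of the derivative gives a Cauchy sequence and a rate of
  convergence. Any other vertical line is compared with the axis along horizontal segments, on which
  the derivative is exponentially small.\<close>

lemma cusp_lim_exists:
  assumes G: "primitive G h" and h: "strip_decay h"
  shows "\<exists>L. cusp_lim G L"
proof -
  define p where "p = (\<lambda>\<xi> s::real. complex_of_real \<xi> + \<i> * of_real s)"
  have diff: "norm (G (p 0 t) - G (p 0 s)) \<le> C / c * exp (- c * s)"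
    if c: "c > 0" and C: "\<forall>z. \<bar>Re z\<bar> \<le> 0 \<longrightarrow> Im z \<ge> 1 \<longrightarrow> norm (h z) \<le> C * exp (- c * Im z)" and st: "1 \<le> s" "s < t" for C c s t
  proof -
    have "0 \<le> C * exp (- c)" using C[rule_format, of \<i>] norm_ge_zero[of "h \<i>"] by (simp del: norm_ge_zero)
    then have C0: "C \<ge> 0" by (simp add: zero_le_mult_iff)
    have der: "((\<lambda>s. G (p 0 s)) has_vector_derivative \<i> * h (p 0 x)) (at x)" if "x > 0" for x
      unfolding p_def by (rule primitive_vertical[OF G that])
    have "norm (G (p 0 t) - G (p 0 s)) \<le> - (C / c * exp (- c * t)) - - (C / c * exp (- c * s))"
    proof (rule differentiable_bound_general[where \<phi>' = "\<lambda>x. C * exp (- c * x)", OF st(2)])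
      show "continuous_on {s..t} (\<lambda>s. G (p 0 s))"
        using st by (intro continuous_at_imp_continuous_on ballI has_vector_derivative_continuous[OF der]) auto
      show "((\<lambda>s. G (p 0 s)) has_vector_derivative \<i> * h (p 0 x)) (at x)" if "s < x" for x
        using der that st by simp
      show "((\<lambda>s. - (C / c * exp (- c * s))) has_vector_derivative C * exp (- c * x)) (at x)" for x
        using c by (auto intro!: derivative_eq_intros simp flip: has_real_derivative_iff_has_vector_derivative)
      show "norm (\<i> * h (p 0 x)) \<le> C * exp (- c * x)" if "s < x" for x
        using C[rule_format, of "p 0 x"] that st by (simp add: p_def norm_mult)
    qed (intro continuous_intros)
    also have "\<dots> \<le> C / c * exp (- c * s)" using c C0 by simp
    finally show ?thesis .
  qed
  obtain C c where c: "c > 0" and C: "\<forall>z. \<bar>Re z\<bar> \<le> 0 \<longrightarrow> Im z \<ge> 1 \<longrightarrow> norm (h z) \<le> C * exp (- c * Im z)"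
    using h unfolding strip_decay_def by blast
  define X where "X = (\<lambda>n. G (p 0 (real n + 1)))"
  have decay0: "((\<lambda>s. K * exp (- c' * s)) \<longlongrightarrow> 0) at_top" if "c' > 0" for K c' :: real
    using that by real_asymp
  have "Cauchy X"
  proof (rule CauchyI')
    fix e :: real assume "e > 0"
    then have "\<forall>\<^sub>F s in at_top. C / c * exp (- c * s) < e"
      using order_tendstoD(2)[OF decay0[OF c]] by blast
    then obtain M where M: "\<And>s. s \<ge> M \<Longrightarrow> C / c * exp (- c * s) < e" by (auto simp: eventually_at_top_linorder)
    show "\<exists>M. \<forall>m\<ge>M. \<forall>n>m. dist (X m) (X n) < e"
    proof (intro exI[of _ "nat \<lceil>M\<rceil>"] allI impI)
      fix m n assume mn: "nat \<lceil>M\<rceil> \<le> m" "m < n"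
      have "dist (X m) (X n) \<le> C / c * exp (- c * (real m + 1))"
        using diff[OF c C, of "real m + 1" "real n + 1"] mn by (simp add: X_def dist_norm norm_minus_commute)
      also have "\<dots> < e" using mn(1) by (intro M) linarith
      finally show "dist (X m) (X n) < e" .
    qed
  qed
  then obtain L where L: "X \<longlonglongrightarrow> L" using Cauchy_convergent convergent_def by blast
  have bound: "norm (G (p 0 s) - L) \<le> C / c * exp (- c * s)" if "s \<ge> 1" for s
  proof (rule tendsto_upperbound)
    show "(\<lambda>n. norm (G (p 0 s) - X n)) \<longlonglongrightarrow> norm (G (p 0 s) - L)" by (intro tendsto_intros L)
    show "\<forall>\<^sub>F n in sequentially. norm (G (p 0 s) - X n) \<le> C / c * exp (- c * s)"
      using eventually_gt_at_top[of "nat \<lceil>s\<rceil>"]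
    proof eventually_elim
      case (elim n)
      then have "s < real n + 1" by linarith
      from diff[OF c C that this] show ?case by (simp add: X_def norm_minus_commute)
    qed
  qed simp
  have lim0: "((\<lambda>s. G (p 0 s) - L) \<longlongrightarrow> 0) at_top"
  proof (rule Lim_null_comparison[OF _ decay0[OF c]])
    show "\<forall>\<^sub>F s in at_top. norm (G (p 0 s) - L) \<le> C / c * exp (- c * s)"
      using eventually_ge_at_top[of 1] by eventually_elim (rule bound)
  qed
  have "((\<lambda>s. G (p \<xi> s)) \<longlongrightarrow> L) at_top" for \<xi>
  proof -
    obtain C' c' where c': "c' > 0" and C': "\<forall>z. \<bar>Re z\<bar> \<le> \<bar>\<xi>\<bar> \<longrightarrow> Im z \<ge> 1 \<longrightarrow> norm (h z) \<le> C' * exp (- c' * Im z)"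
      using h unfolding strip_decay_def by blast
    have "((\<lambda>s. G (p \<xi> s) - G (p 0 s)) \<longlongrightarrow> 0) at_top"
    proof (rule Lim_null_comparison[OF _ decay0[OF c', of "C' * \<bar>\<xi>\<bar>"]])
      show "\<forall>\<^sub>F s in at_top. norm (G (p \<xi> s) - G (p 0 s)) \<le> C' * \<bar>\<xi>\<bar> * exp (- c' * s)"
        using eventually_ge_at_top[of 1]
      proof eventually_elim
        case (elim s)
        have seg: "\<bar>Re z\<bar> \<le> \<bar>\<xi>\<bar> \<and> Im z = s" if z: "z \<in> closed_segment (p \<xi> s) (p 0 s)" for z
        proof -
          obtain u where u: "0 \<le> u" "u \<le> 1" "z = (1 - u) *\<^sub>R p \<xi> s + u *\<^sub>R p 0 s"
            using z by (auto simp: in_segment)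
          have "\<bar>Re z\<bar> = (1 - u) * \<bar>\<xi>\<bar>" using u by (simp add: p_def abs_mult)
          also have "\<dots> \<le> 1 * \<bar>\<xi>\<bar>" using u by (intro mult_right_mono) auto
          finally have "\<bar>Re z\<bar> \<le> \<bar>\<xi>\<bar>" by simp
          moreover have "Im z = s" unfolding u(3) by (simp add: p_def algebra_simps)
          ultimately show ?thesis by simp
        qed
        have "norm (G (p \<xi> s) - G (p 0 s)) \<le> C' * exp (- c' * s) * norm (p \<xi> s - p 0 s)"
        proof (rule field_differentiable_bound[where S = "closed_segment (p \<xi> s) (p 0 s)" and f' = h])
          fix z assume z: "z \<in> closed_segment (p \<xi> s) (p 0 s)"
          have "z \<in> uhp" using seg[OF z] elim by (simp add: uhp_def)
          then show "(G has_field_derivative h z) (at z within closed_segment (p \<xi> s) (p 0 s))"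
            using G by (simp add: primitive_def has_field_derivative_at_within)
          show "norm (h z) \<le> C' * exp (- c' * s)" using C' seg[OF z] elim by metis
        qed auto
        also have "norm (p \<xi> s - p 0 s) = \<bar>\<xi>\<bar>" by (simp add: p_def)
        finally show ?case by (simp add: mult_ac)
      qed
    qed
    from tendsto_add[OF tendsto_add[OF this lim0] tendsto_const[of L]] show ?thesis by simp
  qed
  then show ?thesis unfolding cusp_lim_def p_def by blast
qed

definition exp_small :: "(complex \<Rightarrow> complex) \<Rightarrow> bool" where
  "exp_small f \<longleftrightarrow> (\<exists>C c. C \<ge> 0 \<and> c > 0 \<and> (\<forall>z. Im z \<ge> 1 \<longrightarrow> norm (f z) \<le> C * exp (- c * Im z)))"

lemma power_le_exp':
  fixes c y :: real
  assumes "c > 0" "y \<ge> 0"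
  shows "y ^ w \<le> (if w = 0 then 1 else (real w / c) ^ w) * exp (c * y)"
  using power_le_exp[OF assms, of w] assms by (auto simp: mult_nonneg_nonneg)

lemma norm_linear_le: "norm (z * y - x) \<le> (norm x + norm y) * (1 + norm z)" for x y z :: complex
proof -
  have "norm (z * y - x) \<le> norm z * norm y + norm x"
    using norm_triangle_ineq4[of "z * y" x] by (simp add: norm_mult)
  also have "\<dots> \<le> (norm x + norm y) * (1 + norm z)" by (simp add: algebra_simps)
  finally show ?thesis .
qed

text \<open>Half of the exponential decay pays for the polynomial factor.\<close>

lemma strip_decay_form:
  assumes "exp_small f"
  shows "strip_decay (\<lambda>z. f z * (z * y - x) ^ w)"
  unfolding strip_decay_def
proof
  fix B :: real
  obtain C c where C: "C \<ge> 0" "c > 0" "\<And>z. Im z \<ge> 1 \<Longrightarrow> norm (f z) \<le> C * exp (- c * Im z)"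
    using assms unfolding exp_small_def by blast
  define K where "K = (if w = 0 then 1 else (real w / (c / 2)) ^ w)"
  define A where "A = norm x + norm y"
  have A: "A \<ge> 0" by (simp add: A_def)
  show "\<exists>C c. c > 0 \<and> (\<forall>z. \<bar>Re z\<bar> \<le> B \<longrightarrow> Im z \<ge> 1 \<longrightarrow> norm (f z * (z * y - x) ^ w) \<le> C * exp (- c * Im z))"
  proof (rule exI[of _ "C * (A ^ w * (K * exp (c / 2 * (1 + B))))"], rule exI[of _ "c / 2"], intro conjI allI impI)
    show "c / 2 > 0" using C by simp
    fix z assume z: "\<bar>Re z\<bar> \<le> B" "Im z \<ge> 1"
    have nz: "norm z \<le> B + Im z" using cmod_le[of z] z by linarith
    have "norm (z * y - x) \<le> A * (1 + norm z)" unfolding A_def by (rule norm_linear_le)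
    also have "\<dots> \<le> A * (1 + B + Im z)" using nz A by (intro mult_left_mono) auto
    finally have "norm (z * y - x) ^ w \<le> (A * (1 + B + Im z)) ^ w" by (intro power_mono) auto
    also have "\<dots> = A ^ w * (1 + B + Im z) ^ w" by (rule power_mult_distrib)
    also have "\<dots> \<le> A ^ w * (K * exp (c / 2 * (1 + B + Im z)))"
      unfolding K_def using C z A by (intro mult_left_mono power_le_exp') auto
    finally have "norm (f z * (z * y - x) ^ w) \<le> (C * exp (- c * Im z)) * (A ^ w * (K * exp (c / 2 * (1 + B + Im z))))"
      unfolding norm_mult norm_power using C z by (intro mult_mono) auto
    also have "\<dots> = C * (A ^ w * (K * exp (c / 2 * (1 + B)))) * (exp (- c * Im z) * exp (c / 2 * Im z))"
      by (simp add: distrib_left exp_add mult_ac)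
    also have "exp (- c * Im z) * exp (c / 2 * Im z) = exp (- (c / 2) * Im z)"
      by (simp add: exp_add[symmetric])
    finally show "norm (f z * (z * y - x) ^ w) \<le> C * (A ^ w * (K * exp (c / 2 * (1 + B)))) * exp (- (c / 2) * Im z)" .
  qed
qed

lemma exp_small_slash:
  assumes "cusp_form k N f" "N > 0" "\<gamma> \<in> SL2Z"
  shows "exp_small (slash k f \<gamma>)"
  using slash_decay[OF assms, of 1] unfolding exp_small_def by auto

lemma exp_small_cusp_form: "cusp_form k N f \<Longrightarrow> N > 0 \<Longrightarrow> exp_small f"
  using exp_small_slash[OF _ _ Imat_SL2Z, of k N f] unfolding exp_small_def slash_Imat by blast

text \<open>Substitution u = \<gamma> z with automorphy factor J: the derivative is J^(-2), the
  linear form u y - x is a transformed linear form divided by J, and the total J^(-w-2) is the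
  factor of weight k.\<close>

lemma primitive_slash:
  assumes k: "k = int w + 2" and G: "primitive G (\<lambda>z. f z * (z * y - x) ^ w)" and \<gamma>: "(a, b, c, d) \<in> SL2Z"
  shows "primitive (\<lambda>z. G (mob (a, b, c, d) z))
    (\<lambda>z. slash k f (a, b, c, d) z * (z * (of_int a * y - of_int c * x) - (of_int d * x - of_int b * y)) ^ w)"
  unfolding primitive_def
proof
  fix z assume z: "z \<in> uhp"
  define J where "J = of_int c * z + of_int d"
  have J: "J \<noteq> 0" using aut_nonzero[OF \<gamma> z] by (simp add: J_def)
  define u where "u = mob (a, b, c, d) z"
  have u: "u = (of_int a * z + of_int b) / J" by (simp add: u_def J_def)
  have det: "complex_of_int a * of_int d - of_int b * of_int c = 1"
    using \<gamma> by (simp add: SL2Z_def flip: of_int_mult of_int_diff)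
  have "(mob (a, b, c, d) has_field_derivative (of_int a * J - (of_int a * z + of_int b) * of_int c) / (J * J)) (at z)"
    unfolding mob.simps[abs_def] J_def by (rule derivative_eq_intros refl | use J J_def in simp)+
  moreover have "of_int a * J - (of_int a * z + of_int b) * of_int c = 1"
    using det by (simp add: J_def algebra_simps)
  ultimately have "(mob (a, b, c, d) has_field_derivative 1 / (J * J)) (at z)" by simp
  moreover have "(G has_field_derivative f u * (u * y - x) ^ w) (at (mob (a, b, c, d) z))"
    using G mob_uhp[OF \<gamma> z] by (simp only: primitive_def u_def)
  ultimately have "((\<lambda>z. G (mob (a, b, c, d) z)) has_field_derivative f u * (u * y - x) ^ w * (1 / (J * J))) (at z)"
    by (intro DERIV_chain2[where f = G and g = "mob (a, b, c, d)"])
  moreover have "f u * (u * y - x) ^ w * (1 / (J * J))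
    = slash k f (a, b, c, d) z * (z * (of_int a * y - of_int c * x) - (of_int d * x - of_int b * y)) ^ w"
  proof -
    have "u * y - x = (z * (of_int a * y - of_int c * x) - (of_int d * x - of_int b * y)) / J"
      using J by (simp add: u field_simps) (simp add: J_def algebra_simps)
    moreover have "J powi (- k) = 1 / (J ^ w * (J * J))"
    proof -
      have "J powi k = J ^ (w + 2)" unfolding k by (metis of_nat_add of_nat_numeral power_int_of_nat)
      then show ?thesis by (simp add: power_int_minus power_add power2_eq_square divide_inverse)
    qed
    moreover have "slash k f (a, b, c, d) z = J powi (- k) * f u"
      by (simp only: slash_eq u_def J_def aut.simps)
    ultimately show ?thesis by (simp only: power_divide) simp
  qed
  ultimately show "((\<lambda>z. G (mob (a, b, c, d) z)) has_field_derivative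
    slash k f (a, b, c, d) z * (z * (of_int a * y - of_int c * x) - (of_int d * x - of_int b * y)) ^ w) (at z)" by simp
qed

lemma primitive_cong: "primitive G h \<Longrightarrow> (\<And>z. z \<in> uhp \<Longrightarrow> h z = h' z) \<Longrightarrow> primitive G h'"
  by (simp add: primitive_def)

text \<open>The primitive is normalised to vanish at \<open>i\<infinity>\<close>; \<open>eichler_0\<close> is then its limit at the cusp 0.\<close>

definition eichler :: "int \<Rightarrow> (complex \<Rightarrow> complex) \<Rightarrow> complex \<Rightarrow> complex \<Rightarrow> complex \<Rightarrow> complex" where
  "eichler k f x y = (SOME G. primitive G (\<lambda>z. f z * (z * y - x) ^ nat (k - 2)) \<and> cusp_lim G 0)"

definition eichler_0 :: "int \<Rightarrow> (complex \<Rightarrow> complex) \<Rightarrow> complex \<Rightarrow> complex \<Rightarrow> complex" where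
  "eichler_0 k f x y = (SOME L. cusp_lim (\<lambda>z. eichler k f x y (- 1 / z)) L)"

lemma eichler:
  assumes "cusp_form k N f" "N > 0"
  shows "primitive (eichler k f x y) (\<lambda>z. f z * (z * y - x) ^ nat (k - 2))" "cusp_lim (eichler k f x y) 0"
proof -
  define h where "h = (\<lambda>z. f z * (z * y - x) ^ nat (k - 2))"
  have "f holomorphic_on uhp" using assms by (simp add: cusp_form_def)
  then have "h holomorphic_on uhp" unfolding h_def by (intro holomorphic_intros)
  then obtain G where G: "primitive G h" using primitive_exists by blast
  have "strip_decay h" unfolding h_def by (intro strip_decay_form exp_small_cusp_form[OF assms])
  then obtain L where L: "cusp_lim G L" using cusp_lim_exists[OF G] by blast
  have "primitive (\<lambda>z. G z - L) h"
    using G unfolding primitive_def by (auto intro!: derivative_eq_intros)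
  moreover have "cusp_lim (\<lambda>z. G z - L) 0"
    using tendsto_diff[OF cusp_limD[OF L] tendsto_const[of L]] unfolding cusp_lim_def by simp
  ultimately have "\<exists>G. primitive G h \<and> cusp_lim G 0" by blast
  from someI_ex[OF this]
  show "primitive (eichler k f x y) (\<lambda>z. f z * (z * y - x) ^ nat (k - 2))" "cusp_lim (eichler k f x y) 0"
    unfolding eichler_def h_def by blast+
qed

lemma mob_STmat: "mob (STmat j) z = - 1 / (z + of_int j)"
  by (simp add: STmat_def)

text \<open>The arguments -y and x + j y are chosen such that S T^j transforms the linear form back
  into z y - x; all terms of the trace relation then share the same polynomial factor.\<close>

lemma primitive_STmat:
  assumes "cusp_form k N f" "N > 0" "k \<ge> 2"
  shows "primitive (\<lambda>z. eichler k f (- y) (x + of_int j * y) (mob (STmat j) z))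
    (\<lambda>z. slash k f (STmat j) z * (z * y - x) ^ nat (k - 2))"
proof -
  have k: "k = int (nat (k - 2)) + 2" using assms(3) by simp
  have e: "of_int 0 * (x + of_int j * y) - of_int 1 * (- y) = y" "of_int j * (- y) - of_int (- 1) * (x + of_int j * y) = x"
    by simp_all
  show ?thesis
    using primitive_slash[OF k eichler(1)[OF assms(1,2)] STmat_SL2Z[of j, unfolded STmat_def], of "- y" "x + of_int j * y"]
    unfolding e STmat_def .
qed

lemma eichler_0:
  assumes "cusp_form k N f" "N > 0" "k \<ge> 2"
  shows "cusp_lim (\<lambda>z. eichler k f x y (- 1 / z)) (eichler_0 k f x y)"
proof -
  \<comment> \<open>The map z to -1/z carries the cusp 0 to infinity, and f|S decays there too.
    Taking y, - x for x, y in \<open>primitive_STmat\<close> at j = 0 produces the arguments x,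
    y.\<close>
  have "strip_decay (\<lambda>z. slash k f (STmat 0) z * (z * (- x) - y) ^ nat (k - 2))"
    by (intro strip_decay_form exp_small_slash[OF assms(1,2)] STmat_SL2Z)
  from cusp_lim_exists[OF primitive_STmat[OF assms, of "- x" y 0] this]
  have "\<exists>L. cusp_lim (\<lambda>z. eichler k f x y (- 1 / z)) L" by (simp add: mob_STmat)
  from someI_ex[OF this] show ?thesis unfolding eichler_0_def .
qed

lemma eichler_unique:
  assumes "cusp_form k N f" "N > 0" "primitive H (\<lambda>z. f z * (z * y - x) ^ nat (k - 2))" "cusp_lim H 0" "z \<in> uhp"
  shows "H z = eichler k f x y z"
proof -
  obtain c where c: "\<And>z. z \<in> uhp \<Longrightarrow> H z = eichler k f x y z + c"
    using primitive_unique[OF assms(3) eichler(1)[OF assms(1,2)]] by blast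
  have "((\<lambda>s. eichler k f x y (\<i> * of_real s) + c) \<longlongrightarrow> 0 + c) at_top"
    by (intro tendsto_intros cusp_limD0 eichler(2)[OF assms(1,2)])
  moreover have "((\<lambda>s. eichler k f x y (\<i> * of_real s) + c) \<longlongrightarrow> 0) at_top"
    by (rule Lim_transform_eventually[OF cusp_limD0[OF assms(4)]])
       (use eventually_uhp_line[of 0] c in \<open>auto elim!: eventually_mono\<close>)
  ultimately have "c = 0" using tendsto_unique[OF trivial_limit_at_top_linorder] by fastforce
  then show ?thesis using c[OF assms(5)] by simp
qed

text \<open>Translations fix the cusp at infinity, so the normalisation is preserved and no constant
  of integration appears.\<close>

lemma eichler_translate:
  assumes f: "cusp_form k N f" "N > 0" and k: "k \<ge> 2" and z: "z \<in> uhp"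
  shows "eichler k f x y (z + of_int m) = eichler k f (x - of_int m * y) y z"
proof (rule eichler_unique[OF f _ _ z])
  have T: "(1, m, 0, 1) \<in> SL2Z" "(1, m, 0, 1) \<in> Gamma0 N" by (auto simp: SL2Z_def Gamma0_def)
  have "primitive (\<lambda>z. eichler k f x y (z + of_int m)) (\<lambda>z. slash k f (1, m, 0, 1) z * (z * y - (x - of_int m * y)) ^ nat (k - 2))"
    using primitive_slash[OF _ eichler(1)[OF f] T(1), of k x y] k by simp
  then show "primitive (\<lambda>z. eichler k f x y (z + of_int m)) (\<lambda>z. f z * (z * y - (x - of_int m * y)) ^ nat (k - 2))"
    by (rule primitive_cong) (use f T(2) in \<open>simp only: cusp_form_def\<close>)
  show "cusp_lim (\<lambda>z. eichler k f x y (z + of_int m)) 0"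
    unfolding cusp_lim_def
  proof
    fix \<xi> :: real
    have "complex_of_real \<xi> + \<i> * of_real s + of_int m = of_real (\<xi> + of_int m) + \<i> * of_real s" for s by simp
    then show "((\<lambda>s. eichler k f x y (of_real \<xi> + \<i> * of_real s + of_int m)) \<longlongrightarrow> 0) at_top"
      using cusp_limD[OF eichler(2)[OF f], of x y "\<xi> + of_int m"] by (simp only:)
  qed
qed

lemma eventually_constD:
  fixes K :: complex
  assumes "(g \<longlongrightarrow> L) (at_top :: real filter)" "\<And>s. s > 0 \<Longrightarrow> g s = K"
  shows "K = L"
proof -
  have "(g \<longlongrightarrow> K) at_top"
    by (rule tendsto_eventually) (use eventually_gt_at_top[of "0 :: real"] in eventually_elim, use assms(2) in simp)
  then show ?thesis using tendsto_unique[OF trivial_limit_at_top_linorder _ assms(1)] by blast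
qed

lemma primitive_lincomb:
  "primitive G h \<Longrightarrow> primitive G' h' \<Longrightarrow> primitive (\<lambda>z. G z + G' z) (\<lambda>z. h z + h' z)"
  "primitive G h \<Longrightarrow> primitive (\<lambda>z. c * G z) (\<lambda>z. c * h z)"
  unfolding primitive_def by (auto intro!: DERIV_add DERIV_cmult)

text \<open>The combination of Eichler integrals given by \<open>three_term_relation\<close> is constant;
  the two sides are its limits at \<open>i\<infinity>\<close> and at \<open>0\<close>.\<close>

lemma eichler_relation:
  assumes N: "N = 2 \<or> N = 3" and f: "newform k N f" and k: "k > 2"
  defines "c \<equiv> if N = 2 then 2 else 1" and "E \<equiv> eichler_0 k f"
  shows "c * E (- Y) X + E (- Y) (X + Y) + E (- Y) (X - Y) = c * E X Y + E X (X + Y) + E (- X) (X - Y)"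
proof -
  have cf: "cusp_form k N f" using f by (simp add: newform_def)
  have N0: "N > 0" using N by auto
  have k2: "k \<ge> 2" using k by simp
  define G where "G = eichler k f"
  note eich = eichler[OF cf N0, folded G_def]
  note E0 = eichler_0[OF cf N0 k2, folded G_def E_def]
  have E0lim: "((\<lambda>s. G x y (- 1 / (of_real \<xi> + \<i> * of_real s))) \<longlongrightarrow> E x y) at_top" for x y \<xi>
    using cusp_limD[OF E0] .
  have Glim: "((\<lambda>s. G x y (\<i> * of_real s)) \<longlongrightarrow> 0) at_top" for x y
    by (rule cusp_limD0[OF eich(2)])
  \<comment> \<open>Each summand is a primitive of one slash term times the common factor (z Y -
    X)^(k-2); the derivatives add up to the three-term relation times that factor.\<close>
  define \<Phi> where "\<Phi> = (\<lambda>z. c * (G X Y z + G (- Y) X (- 1 / z)) + G (- Y) (X + Y) (- 1 / (z + 1)) + G (- Y) (X - Y) (- 1 / (z - 1)))"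
  have prim: "primitive (\<lambda>z. G (- Y) (X + of_int j * Y) (- 1 / (z + of_int j))) (\<lambda>z. slash k f (STmat j) z * (z * Y - X) ^ nat (k - 2))" for j
    using primitive_STmat[OF cf N0 k2, of Y X j, folded G_def] unfolding mob_STmat .
  have "primitive \<Phi> (\<lambda>z. c * (f z * (z * Y - X) ^ nat (k - 2) + slash k f (STmat 0) z * (z * Y - X) ^ nat (k - 2))
     + slash k f (STmat 1) z * (z * Y - X) ^ nat (k - 2) + slash k f (STmat (- 1)) z * (z * Y - X) ^ nat (k - 2))"
    using prim[of 0] prim[of 1] prim[of "- 1"] eich(1)[of X Y]
    unfolding \<Phi>_def by (intro primitive_lincomb) simp_all
  then have "primitive \<Phi> (\<lambda>z. 0)"
  proof (rule primitive_cong)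
    fix z assume z: "z \<in> uhp"
    have "(c * (f z + slash k f (STmat 0) z) + slash k f (STmat 1) z + slash k f (STmat (- 1)) z) * (z * Y - X) ^ nat (k - 2) = 0"
      using three_term_relation[OF N f k z] unfolding c_def by simp
    then show "c * (f z * (z * Y - X) ^ nat (k - 2) + slash k f (STmat 0) z * (z * Y - X) ^ nat (k - 2))
     + slash k f (STmat 1) z * (z * Y - X) ^ nat (k - 2) + slash k f (STmat (- 1)) z * (z * Y - X) ^ nat (k - 2) = 0"
      by (simp only: ring_distribs mult.assoc)
  qed
  then obtain K where K: "\<And>z. z \<in> uhp \<Longrightarrow> \<Phi> z = K"
    using primitive_unique[of \<Phi> "\<lambda>z. 0" "\<lambda>z. 0"] by (auto simp: primitive_def)
  have "K = c * (0 + E (- Y) X) + E (- Y) (X + Y) + E (- Y) (X - Y)"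
  proof (rule eventually_constD)
    have "((\<lambda>s. c * (G X Y (\<i> * of_real s) + G (- Y) X (- 1 / (of_real 0 + \<i> * of_real s)))
        + G (- Y) (X + Y) (- 1 / (of_real 1 + \<i> * of_real s)) + G (- Y) (X - Y) (- 1 / (of_real (- 1) + \<i> * of_real s)))
      \<longlongrightarrow> c * (0 + E (- Y) X) + E (- Y) (X + Y) + E (- Y) (X - Y)) at_top"
      by (intro tendsto_intros E0lim Glim)
    then show "((\<lambda>s. \<Phi> (\<i> * of_real s)) \<longlongrightarrow> c * (0 + E (- Y) X) + E (- Y) (X + Y) + E (- Y) (X - Y)) at_top"
      by (simp add: \<Phi>_def add.commute)
    show "\<Phi> (\<i> * of_real s) = K" if "s > 0" for s using that by (intro K) (simp add: uhp_def)
  qed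
  moreover have "K = c * (E X Y + 0) + E X (X + Y) + E (- X) (X - Y)"
  proof (rule eventually_constD)
    \<comment> \<open>Now z = i/s tends to 0. There -1/(z + 1) and -1/(z - 1) tend to -1 and 1;
      translating them by 1 and -1 gives points u and v that tend to 0, at the price of the changed
      first arguments X and -X.\<close>
    define g where "g = (\<lambda>s::real. c * (G X Y (- 1 / (of_real 0 + \<i> * of_real s)) + G (- Y) X (\<i> * of_real s))
        + G X (X + Y) (- 1 / (of_real (- 1) + \<i> * of_real s)) + G (- X) (X - Y) (- 1 / (of_real 1 + \<i> * of_real s)))"
    show "(g \<longlongrightarrow> c * (E X Y + 0) + E X (X + Y) + E (- X) (X - Y)) at_top"
      unfolding g_def by (intro tendsto_intros E0lim Glim)
    fix s :: real assume s: "s > 0"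
    define u v where "u = - 1 / (of_real (- 1) + \<i> * of_real s)" and "v = - 1 / (of_real 1 + \<i> * of_real s)"
    have nz: "\<i> * of_real s - 1 \<noteq> 0" "\<i> * of_real s + 1 \<noteq> 0" "\<i> + of_real s \<noteq> 0" "\<i> - of_real s \<noteq> 0"
      using s by (auto simp: complex_eq_iff)
    have uv: "u \<in> uhp" "v \<in> uhp"
      using mob_uhp[OF STmat_SL2Z, of "\<i> * of_real s" "- 1"] mob_uhp[OF STmat_SL2Z, of "\<i> * of_real s" 1] s
      by (simp_all add: mob_STmat u_def v_def uhp_def add.commute)
    define z where "z = \<i> / of_real s"
    have z: "- 1 / z = \<i> * of_real s" "z = - 1 / (\<i> * of_real s)"
      using s by (simp_all add: z_def field_simps)
    have z1: "- 1 / (z + 1) = u + of_int (- 1)"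
    proof -
      have "z + 1 = (\<i> + of_real s) / of_real s" using s by (simp add: z_def field_simps)
      then have "- 1 / (z + 1) = - (of_real s / (\<i> + of_real s))" by simp
      also have "\<dots> = - ((\<i> * of_real s) / (\<i> * (\<i> + of_real s)))" by simp
      also have "\<dots> = - ((1 + \<i> * (\<i> + of_real s)) / (\<i> * (\<i> + of_real s)))" by (simp add: distrib_left)
      also have "\<dots> = - 1 / (\<i> * (\<i> + of_real s)) - 1" using nz by (simp add: add_divide_distrib)
      also have "\<dots> = u + of_int (- 1)" by (simp add: u_def distrib_left)
      finally show ?thesis .
    qed
    have z2: "- 1 / (z - 1) = v + of_int 1"
    proof -
      have "z - 1 = - ((of_real s - \<i>) / of_real s)" using s by (simp add: z_def field_simps)
      then have "- 1 / (z - 1) = of_real s / (of_real s - \<i>)" by simp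
      also have "\<dots> = (\<i> * of_real s) / (\<i> * (of_real s - \<i>))" by simp
      also have "\<dots> = (\<i> * (of_real s - \<i>) - 1) / (\<i> * (of_real s - \<i>))" by (simp add: right_diff_distrib)
      also have "\<dots> = - 1 / (\<i> * (of_real s - \<i>)) + 1" using nz by (simp add: diff_divide_distrib)
      also have "\<dots> = v + of_int 1" by (simp add: v_def right_diff_distrib add.commute)
      finally show ?thesis .
    qed
    have "G (- Y) (X + Y) (- 1 / (z + 1)) = G X (X + Y) u"
      unfolding z1 G_def eichler_translate[OF cf N0 k2 uv(1)] by simp
    moreover have "G (- Y) (X - Y) (- 1 / (z - 1)) = G (- X) (X - Y) v"
      unfolding z2 G_def eichler_translate[OF cf N0 k2 uv(2)] by simp
    moreover have "\<Phi> z = K" using s by (intro K) (simp add: uhp_def z_def)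
    moreover have "g s = c * (G X Y z + G (- Y) X (- 1 / z)) + G X (X + Y) u + G (- X) (X - Y) v"
      by (simp only: g_def u_def v_def of_real_0 add_0_left z(1) z(2)[symmetric])
    ultimately show "g s = K" by (simp only: \<Phi>_def)
  qed
  ultimately show ?thesis by simp
qed

text \<open>The substitution z to -1/(N z) exchanges the two cusps and, by the eigenvalue equation,
  reproduces f with the factor \<epsilon> N^(h+1) z^(2h+2). The two primitives differ by a constant,
  which is evaluated at both cusps.\<close>

lemma eichler_fricke:
  assumes f: "cusp_form k N f" "N > 0" and k: "k = 2 * int h + 2"
    and AL: "\<forall>z\<in>uhp. atkin_lehner k N f z = \<epsilon> * f z"
  shows "eichler_0 k f x y = - \<epsilon> / of_nat N ^ h * eichler_0 k f (- y) (of_nat N * x)"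
proof -
  have k2: "k \<ge> 2" using k by simp
  have w: "nat (k - 2) = 2 * h" using k by simp
  define n :: complex where "n = of_nat N"
  have n: "n \<noteq> 0" using f by (simp add: n_def)
  have f_fricke: "f (- 1 / (n * z)) = \<epsilon> * (n * n ^ h) * (z ^ (2 * h) * z ^ 2) * f z" if z: "z \<in> uhp" for z
  proof -
    have "z \<noteq> 0" using z by (auto simp: uhp_def)
    have "real N powr (- of_int k / 2) = inverse (real N ^ (h + 1))"
    proof -
      have "- of_int k / 2 = - real (h + 1)" using k by simp
      then show ?thesis using f(2) by (simp only: powr_minus powr_realpow of_nat_0_less_iff)
    qed
    then have "of_real (real N powr (- of_int k / 2)) = inverse (n ^ (h + 1))" by (simp add: n_def)
    moreover have "z powi (- k) = inverse (z ^ (2 * h + 2))"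
    proof -
      have "k = int (2 * h + 2)" using k by simp
      then show ?thesis by (simp only: power_int_minus power_int_of_nat)
    qed
    moreover have "of_real (real N powr (- of_int k / 2)) * z powi (- k) * f (- 1 / (n * z)) = \<epsilon> * f z"
      using AL z by (simp only: atkin_lehner_def n_def)
    ultimately have "inverse (n ^ (h + 1)) * inverse (z ^ (2 * h + 2)) * f (- 1 / (n * z)) = \<epsilon> * f z"
      by (simp only:)
    then have "f (- 1 / (n * z)) = \<epsilon> * n ^ (h + 1) * z ^ (2 * h + 2) * f z"
      using n \<open>z \<noteq> 0\<close> by (simp add: field_simps)
    then show ?thesis by (simp add: power_add power2_eq_square mult_ac)
  qed
  have "primitive (\<lambda>z. eichler k f x y (- 1 / (n * z))) (\<lambda>z. \<epsilon> / n ^ h * (f z * (z * (n * x) - (- y)) ^ nat (k - 2)))"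
    unfolding primitive_def
  proof
    fix z assume z: "z \<in> uhp"
    then have z0: "z \<noteq> 0" by (auto simp: uhp_def)
    have u: "- 1 / (n * z) \<in> uhp"
    proof -
      have "- 1 / (n * z) = of_real (1 / real N) * (- 1 / z)" by (simp add: n_def)
      moreover have "Im (- 1 / z) > 0"
        using mob_uhp[OF STmat_SL2Z z, of 0] by (simp add: mob_STmat uhp_def)
      moreover have "Im (of_real r * q) = r * Im q" for r q by simp
      moreover have "1 / real N > 0" using f(2) by simp
      ultimately have "Im (- 1 / (n * z)) > 0" by (simp only: mult_pos_pos)
      then show ?thesis by (simp add: uhp_def)
    qed
    have "((\<lambda>z. - 1 / (n * z)) has_field_derivative 1 / (n * z ^ 2)) (at z)"
      using n z0 by (auto intro!: derivative_eq_intros simp: field_simps power2_eq_square)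
    moreover have "(eichler k f x y has_field_derivative f (- 1 / (n * z)) * (- 1 / (n * z) * y - x) ^ (2 * h)) (at (- 1 / (n * z)))"
      using eichler(1)[OF f, of x y] u unfolding primitive_def w by blast
    ultimately have "((\<lambda>z. eichler k f x y (- 1 / (n * z))) has_field_derivative
        f (- 1 / (n * z)) * (- 1 / (n * z) * y - x) ^ (2 * h) * (1 / (n * z ^ 2))) (at z)"
      by (intro DERIV_chain2[where f = "eichler k f x y" and g = "\<lambda>z. - 1 / (n * z)"])
    moreover have "f (- 1 / (n * z)) * (- 1 / (n * z) * y - x) ^ (2 * h) * (1 / (n * z ^ 2))
       = \<epsilon> / n ^ h * (f z * (z * (n * x) - (- y)) ^ nat (k - 2))"
    proof -
      have "- 1 / (n * z) * y - x = - ((z * (n * x) + y) / (n * z))" using n z0 by (simp add: field_simps)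
      then have e1: "(- 1 / (n * z) * y - x) ^ (2 * h) = (z * (n * x) + y) ^ (2 * h) / (n ^ (2 * h) * z ^ (2 * h))"
        by (simp add: power_divide power_mult_distrib)
      have e2: "\<epsilon> * (n * n ^ h) * (z ^ (2 * h) * z ^ 2) * F * (A / (n ^ (2 * h) * z ^ (2 * h))) * (1 / (n * z ^ 2)) = \<epsilon> / n ^ h * (F * A)" for F A
        using n z0 by (simp add: field_simps power_mult power2_eq_square power_mult_distrib)
      show ?thesis
        unfolding f_fricke[OF z] w e1 e2 by (simp only: diff_minus_eq_add)
    qed
    ultimately show "((\<lambda>z. eichler k f x y (- 1 / (n * z))) has_field_derivative
        \<epsilon> / n ^ h * (f z * (z * (n * x) - (- y)) ^ nat (k - 2))) (at z)" by simp
  qed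
  moreover have "primitive (\<lambda>z. \<epsilon> / n ^ h * eichler k f (- y) (n * x) z) (\<lambda>z. \<epsilon> / n ^ h * (f z * (z * (n * x) - (- y)) ^ nat (k - 2)))"
    by (intro primitive_lincomb eichler(1)[OF f])
  ultimately obtain K where K: "\<And>z. z \<in> uhp \<Longrightarrow> eichler k f x y (- 1 / (n * z)) = \<epsilon> / n ^ h * eichler k f (- y) (n * x) z + K"
    using primitive_unique by blast
  have Ns: "filterlim (\<lambda>s. real N * s) at_top at_top"
    using f(2) by (intro filterlim_tendsto_pos_mult_at_top[OF tendsto_const _ filterlim_ident]) simp
  have E0: "((\<lambda>s. eichler k f x y (- 1 / (\<i> * of_real (real N * s)))) \<longlongrightarrow> eichler_0 k f x y) at_top" for x y
    using filterlim_compose[OF cusp_limD0[OF eichler_0[OF f k2]] Ns] .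
  \<comment> \<open>At z = i s, s to infinity: the transformed point tends to the cusp 0.\<close>
  have "K = eichler_0 k f x y - \<epsilon> / n ^ h * 0"
  proof (rule eventually_constD)
    show "((\<lambda>s. eichler k f x y (- 1 / (\<i> * of_real (real N * s))) - \<epsilon> / n ^ h * eichler k f (- y) (n * x) (\<i> * of_real s))
       \<longlongrightarrow> eichler_0 k f x y - \<epsilon> / n ^ h * 0) at_top"
      by (intro tendsto_intros E0 cusp_limD0 eichler(2)[OF f])
    fix s :: real assume "s > 0"
    then have "\<i> * of_real s \<in> uhp" by (simp add: uhp_def)
    from K[OF this] show "eichler k f x y (- 1 / (\<i> * of_real (real N * s))) - \<epsilon> / n ^ h * eichler k f (- y) (n * x) (\<i> * of_real s) = K"
      by (simp add: n_def mult_ac)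
  qed
  \<comment> \<open>At z = -1/(i N s): now the transformed point i s tends to infinity, and z tends
    to 0.\<close>
  moreover have "K = 0 - \<epsilon> / n ^ h * eichler_0 k f (- y) (n * x)"
  proof (rule eventually_constD)
    show "((\<lambda>s. eichler k f x y (\<i> * of_real s) - \<epsilon> / n ^ h * eichler k f (- y) (n * x) (- 1 / (\<i> * of_real (real N * s))))
       \<longlongrightarrow> 0 - \<epsilon> / n ^ h * eichler_0 k f (- y) (n * x)) at_top"
      by (intro tendsto_intros E0 cusp_limD0 eichler(2)[OF f])
    fix s :: real assume s: "s > 0"
    define z where "z = - 1 / (\<i> * of_real (real N * s))"
    have "z = of_real (1 / (real N * s)) * \<i>" using s f(2) by (simp add: z_def field_simps)
    then have zu: "z \<in> uhp" using s f(2) by (simp add: uhp_def)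
    have ze: "- 1 / (n * z) = \<i> * of_real s" using s f(2) by (simp add: z_def n_def field_simps)
    show "eichler k f x y (\<i> * of_real s) - \<epsilon> / n ^ h * eichler k f (- y) (n * x) (- 1 / (\<i> * of_real (real N * s))) = K"
      using K[OF zu] unfolding ze z_def[symmetric] by simp
  qed
  ultimately show ?thesis by (simp add: n_def)
qed

subsection \<open>Period integrals\<close>

text \<open>For t \<ge> 1 this is the decay of f. For t < 1 it follows from the decay of f|S at i/t,
  which also absorbs the factor t^(-k).\<close>

lemma axis_bound:
  assumes f: "cusp_form k N f" "N > 0" and k: "k \<ge> 2"
  shows "\<exists>C c. c > 0 \<and> (\<forall>t>0. norm (f (\<i> * of_real t)) * (1 + t) ^ w \<le> C * exp (- c * t))"
proof -
  obtain C1 c1 where 1: "C1 \<ge> 0" "c1 > 0" "\<And>z. Im z \<ge> 1 \<Longrightarrow> norm (f z) \<le> C1 * exp (- c1 * Im z)"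
    using exp_small_cusp_form[OF f] unfolding exp_small_def by blast
  obtain C2 c2 where 2: "C2 \<ge> 0" "c2 > 0" "\<And>z. Im z \<ge> 1 \<Longrightarrow> norm (slash k f (STmat 0) z) \<le> C2 * exp (- c2 * Im z)"
    using exp_small_slash[OF f STmat_SL2Z] unfolding exp_small_def by blast
  define K1 where "K1 = (if w = 0 then 1 else (real w / (c1 / 2)) ^ w)"
  define K2 where "K2 = (if nat k = 0 then 1 else (real (nat k) / c2) ^ nat k)"
  have K: "K1 \<ge> 0" "K2 \<ge> 0" using 1 2 by (auto simp: K1_def K2_def)
  define c where "c = c1 / 2"
  have c: "c > 0" using 1 by (simp add: c_def)
  define A where "A = C1 * (K1 * exp c)"
  define B where "B = C2 * K2 * 2 ^ w * exp c"
  have AB: "A \<ge> 0" "B \<ge> 0" using 1 2 K by (auto simp: A_def B_def)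
  have "norm (f (\<i> * of_real t)) * (1 + t) ^ w \<le> (A + B) * exp (- c * t)" if t: "t > 0" for t
  proof (cases "t \<ge> 1")
    case True
    have "norm (f (\<i> * of_real t)) * (1 + t) ^ w \<le> (C1 * exp (- c1 * t)) * (K1 * exp (c * (1 + t)))"
      unfolding K1_def c_def using 1(3)[of "\<i> * of_real t"] 1 True by (intro mult_mono power_le_exp') auto
    also have "\<dots> = A * (exp (- c1 * t) * exp (c * t))"
      by (simp add: A_def distrib_left exp_add mult_ac)
    also have "exp (- c1 * t) * exp (c * t) = exp (- c * t)"
      by (simp add: exp_add[symmetric] c_def)
    also have "A * exp (- c * t) \<le> (A + B) * exp (- c * t)" using AB by (intro mult_right_mono) auto
    finally show ?thesis .
  next
    case False
    define z where "z = \<i> / of_real t"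
    have z: "- 1 / z = \<i> * of_real t" using t by (simp add: z_def field_simps)
    have nz: "norm z = 1 / t" "Im z = 1 / t" using t by (simp_all add: z_def norm_divide)
    have "slash k f (STmat 0) z = z powi (- k) * f (\<i> * of_real t)"
      using z by (simp add: STmat_def)
    then have "norm (slash k f (STmat 0) z) = norm z powi (- k) * norm (f (\<i> * of_real t))"
      by (simp add: norm_mult norm_power_int)
    also have "norm z powi (- k) = t ^ nat k"
      using t k by (simp add: nz power_int_minus power_int_def field_simps)
    finally have "norm (f (\<i> * of_real t)) = (1 / t) ^ nat k * norm (slash k f (STmat 0) z)"
      using t by (simp add: field_simps)
    also have "\<dots> \<le> (K2 * exp (c2 * (1 / t))) * (C2 * exp (- c2 * (1 / t)))"
      unfolding K2_def using 2(3)[of z] 2 t False nz by (intro mult_mono power_le_exp') auto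
    also have "\<dots> = C2 * K2" by (simp add: exp_minus)
    finally have f1: "norm (f (\<i> * of_real t)) \<le> C2 * K2" .
    have "norm (f (\<i> * of_real t)) * (1 + t) ^ w \<le> (C2 * K2) * 2 ^ w"
      using f1 t False 2 K by (intro mult_mono power_mono) auto
    also have "\<dots> \<le> (C2 * K2) * 2 ^ w * (exp c * exp (- c * t))"
    proof -
      have "c * t \<le> c * 1" using c False by (intro mult_left_mono) auto
      then have "exp c * exp (- c * t) \<ge> 1" by (simp add: exp_add[symmetric])
      from mult_left_mono[OF this, of "C2 * K2 * 2 ^ w"] show ?thesis using 2 K by simp
    qed
    also have "\<dots> = B * exp (- c * t)" by (simp add: B_def)
    also have "\<dots> \<le> (A + B) * exp (- c * t)" using AB by (intro mult_right_mono) auto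
    finally show ?thesis .
  qed
  then show ?thesis using c by blast
qed

text \<open>The truncation is symmetric under t to 1/t, so that both ends run into the cusps
  together; dominated convergence applies.\<close>

lemma integral_positive_axis:
  fixes \<phi> :: "real \<Rightarrow> complex"
  assumes cont: "continuous_on {0<..} \<phi>" and c: "c > 0"
    and bound: "\<And>t. t > 0 \<Longrightarrow> norm (\<phi> t) \<le> C * exp (- c * t)"
  shows "\<phi> integrable_on {0<..}"
    and "(\<lambda>n. integral {1 / (real n + 1)..real n + 1} \<phi>) \<longlonglongrightarrow> integral {0<..} \<phi>"
proof -
  define g where "g = (\<lambda>n::nat. \<lambda>t. if t \<in> {1 / (real n + 1)..real n + 1} then \<phi> t else 0)"
  have sub: "{1 / (real n + 1)..real n + 1} \<subseteq> {0<..}" for n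
  proof
    fix t assume t: "t \<in> {1 / (real n + 1)..real n + 1}"
    have "0 < 1 / (real n + 1)" by simp
    with t show "t \<in> {0<..}" by (meson atLeastAtMost_iff greaterThan_iff less_le_trans)
  qed
  have int: "(g n has_integral integral {1 / (real n + 1)..real n + 1} \<phi>) {0<..}" for n
    unfolding g_def has_integral_restrict[OF sub]
    by (intro integrable_integral integrable_continuous_interval continuous_on_subset[OF cont sub])
  have h: "(\<lambda>t. C * exp (- c * t)) integrable_on {0<..}"
  proof -
    have "((\<lambda>t. exp (- c * t)) has_integral exp (- c * 0) / c) {0..}"
      by (rule has_integral_exp_minus_to_infinity[OF c])
    then have "((\<lambda>t. exp (- c * t)) has_integral exp (- c * 0) / c) {0<..}"
      by (rule has_integral_spike_set_eq[THEN iffD1, rotated 2])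
         (auto intro: negligible_subset[of "{0}"])
    then show ?thesis by (intro integrable_on_mult_right) (auto simp: integrable_on_def)
  qed
  have C: "C \<ge> 0"
  proof -
    have "0 \<le> C * exp (- c)" using bound[of 1] norm_ge_zero[of "\<phi> 1"] by (simp del: norm_ge_zero)
    then show ?thesis by (simp add: zero_le_mult_iff)
  qed
  have le: "norm (g n t) \<le> C * exp (- c * t)" if "t \<in> {0<..}" for n t
    using bound[of t] that C by (auto simp: g_def)
  have conv: "(\<lambda>n. g n t) \<longlonglongrightarrow> \<phi> t" if t: "t \<in> {0<..}" for t
  proof (rule tendsto_eventually)
    show "\<forall>\<^sub>F n in sequentially. g n t = \<phi> t"
      using eventually_ge_at_top[of "nat \<lceil>t + 1 / t\<rceil>"]
    proof eventually_elim
      case (elim n)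
      have "t + 1 / t \<le> real n" using elim by linarith
      moreover have "0 < 1 / t" "0 < t" using t by auto
      ultimately have "t \<le> real n + 1" "1 / t \<le> real n + 1" by linarith+
      then have "1 / (real n + 1) \<le> t" using t by (simp add: field_simps)
      then show ?case using \<open>t \<le> real n + 1\<close> by (simp add: g_def)
    qed
  qed
  have gi: "g n integrable_on {0<..}" for n using int by (auto simp: integrable_on_def)
  show "\<phi> integrable_on {0<..}"
    by (rule dominated_convergence(1)[OF gi h le conv])
  have "(\<lambda>n. integral {0<..} (g n)) \<longlonglongrightarrow> integral {0<..} \<phi>"
    by (rule dominated_convergence(2)[OF gi h le conv])
  then show "(\<lambda>n. integral {1 / (real n + 1)..real n + 1} \<phi>) \<longlonglongrightarrow> integral {0<..} \<phi>"
    by (simp add: integral_unique[OF int])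
qed

lemma continuous_on_axis:
  assumes "cusp_form k N f"
  shows "continuous_on {0<..} (\<lambda>t::real. f (\<i> * of_real t))"
proof -
  have "f holomorphic_on uhp" using assms by (simp add: cusp_form_def)
  then have "continuous_on uhp f" by (rule holomorphic_on_imp_continuous_on)
  then show ?thesis
    by (rule continuous_on_compose2) (auto intro!: continuous_intros simp: uhp_def)
qed

text \<open>The minus sign is due to the normalisation: the primitive vanishes at infinity, and the
  cusp 0 is the lower end of the path.\<close>

lemma period_integral_eichler:
  assumes f: "cusp_form k N f" "N > 0" and k: "k \<ge> 2"
  shows "period_integral k f x y = - eichler_0 k f x y"
proof -
  define w where "w = nat (k - 2)"
  define \<phi> where "\<phi> = (\<lambda>t::real. \<i> * f (\<i> * of_real t) * ((\<i> * of_real t) * y - x) ^ w)"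
  define G where "G = eichler k f x y"
  obtain C c where C: "c > 0" "\<And>t. t > 0 \<Longrightarrow> norm (f (\<i> * of_real t)) * (1 + t) ^ w \<le> C * exp (- c * t)"
    using axis_bound[OF f k, of w] by blast
  define A where "A = norm x + norm y"
  have A: "A \<ge> 0" by (simp add: A_def)
  have "(\<lambda>n. integral {1 / (real n + 1)..real n + 1} \<phi>) \<longlonglongrightarrow> integral {0<..} \<phi>"
  proof (rule integral_positive_axis(2)[OF _ C(1), of _ "A ^ w * C"])
    show "continuous_on {0<..} \<phi>" unfolding \<phi>_def by (intro continuous_intros continuous_on_axis[OF f(1)])
    fix t :: real assume t: "t > 0"
    have "norm ((\<i> * of_real t) * y - x) \<le> A * (1 + t)"
      using norm_linear_le[of "\<i> * of_real t" y x] t by (simp add: A_def norm_mult)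
    then have "norm (\<phi> t) \<le> norm (f (\<i> * of_real t)) * (A * (1 + t)) ^ w"
      unfolding \<phi>_def norm_mult norm_power using t by (auto intro!: mult_mono power_mono)
    also have "\<dots> = A ^ w * (norm (f (\<i> * of_real t)) * (1 + t) ^ w)" by (simp add: power_mult_distrib)
    also have "\<dots> \<le> A ^ w * (C * exp (- c * t))" using C(2)[OF t] A by (intro mult_left_mono) auto
    finally show "norm (\<phi> t) \<le> A ^ w * C * exp (- c * t)" by simp
  qed
  moreover have "integral {1 / (real n + 1)..real n + 1} \<phi> = G (\<i> * of_real (real n + 1)) - G (\<i> * of_real (1 / (real n + 1)))" for n
  proof (rule integral_unique, rule fundamental_theorem_of_calculus)
    have "1 \<le> (real n + 1) * (real n + 1)" using mult_mono[of 1 "real n + 1" 1 "real n + 1"] by simp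
    then show "1 / (real n + 1) \<le> real n + 1" by (simp add: field_simps)
    fix t assume "t \<in> {1 / (real n + 1)..real n + 1}"
    moreover have "0 < 1 / (real n + 1)" by simp
    ultimately have "t > 0" by (meson atLeastAtMost_iff less_le_trans)
    from primitive_vertical[OF eichler(1)[OF f, of x y] this, of 0]
    show "((\<lambda>t. G (\<i> * of_real t)) has_vector_derivative \<phi> t) (at t within {1 / (real n + 1)..real n + 1})"
      by (simp add: \<phi>_def G_def w_def has_vector_derivative_at_within mult.assoc)
  qed
  ultimately have "(\<lambda>n. G (\<i> * of_real (real n + 1)) - G (\<i> * of_real (1 / (real n + 1)))) \<longlonglongrightarrow> integral {0<..} \<phi>"
    by simp
  moreover have "(\<lambda>n. G (\<i> * of_real (real n + 1)) - G (\<i> * of_real (1 / (real n + 1)))) \<longlonglongrightarrow> 0 - eichler_0 k f x y"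
  proof (intro tendsto_diff)
    have top: "filterlim (\<lambda>n::nat. real n + 1) at_top sequentially" by real_asymp
    show "(\<lambda>n. G (\<i> * of_real (real n + 1))) \<longlonglongrightarrow> 0"
      unfolding G_def by (rule filterlim_compose[OF cusp_limD0[OF eichler(2)[OF f]] top])
    have "- 1 / (\<i> * of_real (real n + 1)) = \<i> * of_real (1 / (real n + 1))" for n
    proof -
      have "- 1 / (\<i> * q) = \<i> * (1 / q)" if "q \<noteq> 0" for q :: complex using that by (simp add: field_simps)
      moreover have "complex_of_real (real n + 1) \<noteq> 0" by (simp only: of_real_eq_0_iff)
      ultimately show ?thesis by (simp only: of_real_divide of_real_1)
    qed
    then show "(\<lambda>n. G (\<i> * of_real (1 / (real n + 1)))) \<longlonglongrightarrow> eichler_0 k f x y"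
      using filterlim_compose[OF cusp_limD0[OF eichler_0[OF f k, of x y]] top] unfolding G_def by (simp only:)
  qed
  ultimately have "integral {0<..} \<phi> = 0 - eichler_0 k f x y" by (rule LIMSEQ_unique)
  then show ?thesis by (simp add: period_integral_def \<phi>_def w_def)
qed

definition moment :: "(complex \<Rightarrow> complex) \<Rightarrow> nat \<Rightarrow> complex" where
  "moment f j = integral {0<..} (\<lambda>t::real. \<i> * f (\<i> * of_real t) * (\<i> * of_real t) ^ j)"

lemma period_integral_sum:
  assumes f: "cusp_form k N f" "N > 0" and k: "k \<ge> 2" and w: "w = nat (k - 2)"
  shows "period_integral k f x y = (\<Sum>j\<le>w. of_nat (w choose j) * moment f j * (- x) ^ (w - j) * y ^ j)"
proof -
  have integrable: "(\<lambda>t::real. \<i> * f (\<i> * of_real t) * (\<i> * of_real t) ^ j) integrable_on {0<..}" if j: "j \<le> w" for j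
  proof -
    obtain C c where C: "c > 0" "\<And>t. t > 0 \<Longrightarrow> norm (f (\<i> * of_real t)) * (1 + t) ^ w \<le> C * exp (- c * t)"
      using axis_bound[OF f k, of w] by blast
    show ?thesis
    proof (rule integral_positive_axis(1)[OF _ C(1), of _ C])
      show "continuous_on {0<..} (\<lambda>t::real. \<i> * f (\<i> * of_real t) * (\<i> * of_real t) ^ j)"
        by (intro continuous_intros continuous_on_axis[OF f(1)])
      fix t :: real assume t: "t > 0"
      have "t ^ j \<le> (1 + t) ^ j" using t by (intro power_mono) auto
      also have "\<dots> \<le> (1 + t) ^ w" using t j by (intro power_increasing) auto
      finally have "norm (\<i> * f (\<i> * of_real t) * (\<i> * of_real t) ^ j) \<le> norm (f (\<i> * of_real t)) * (1 + t) ^ w"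
        using t by (auto simp: norm_mult norm_power power_mult_distrib intro!: mult_left_mono)
      also have "\<dots> \<le> C * exp (- c * t)" by (rule C(2)[OF t])
      finally show "norm (\<i> * f (\<i> * of_real t) * (\<i> * of_real t) ^ j) \<le> C * exp (- c * t)" .
    qed
  qed
  have "period_integral k f x y = integral {0<..} (\<lambda>t::real. \<Sum>j\<le>w. (\<i> * f (\<i> * of_real t) * (\<i> * of_real t) ^ j) * (of_nat (w choose j) * (- x) ^ (w - j) * y ^ j))"
    unfolding period_integral_def w[symmetric] unfolding diff_conv_add_uminus binomial_ring
    by (simp add: sum_distrib_left power_mult_distrib mult_ac)
  also have "\<dots> = (\<Sum>j\<le>w. integral {0<..} (\<lambda>t::real. (\<i> * f (\<i> * of_real t) * (\<i> * of_real t) ^ j) * (of_nat (w choose j) * (- x) ^ (w - j) * y ^ j)))"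
    by (intro integral_sum integrable_on_mult_left integrable) auto
  also have "\<dots> = (\<Sum>j\<le>w. of_nat (w choose j) * moment f j * (- x) ^ (w - j) * y ^ j)"
    by (intro sum.cong refl, subst integral_mult_left) (simp only: moment_def mult_ac)
  finally show ?thesis .
qed

text \<open>As a polynomial over the ring of polynomials in x, the difference would have every
  constant as a root. This justifies the definite description in \<open>period_poly\<close>.\<close>

lemma poly2_unique:
  assumes "\<And>x y. poly2 P x y = poly2 Q x y"
  shows "P = Q"
proof (rule ccontr)
  assume "P \<noteq> Q"
  then have "finite {q. poly (P - Q) q = 0}" by (intro poly_roots_finite) simp
  moreover have "poly (P - Q) [:y:] = 0" for y
  proof -
    have "poly (poly (P - Q) [:y:]) x = 0" for x using assms[of x y] by (simp add: poly2_def)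
    then show ?thesis using poly_all_0_iff_0 by blast
  qed
  then have "range (\<lambda>y. [:y:]) \<subseteq> {q. poly (P - Q) q = 0}" by auto
  ultimately have "finite (range (\<lambda>y::complex. [:y:]))" by (rule finite_subset[rotated])
  moreover have "inj (\<lambda>y::complex. [:y:])" by (simp add: inj_on_def)
  ultimately show False using finite_imageD infinite_UNIV_char_0 by blast
qed

lemma period_poly_eq:
  assumes f: "cusp_form k N f" "N > 0" and k: "k \<ge> 2" and w: "w = nat (k - 2)"
  shows "period_poly k f = (\<Sum>j\<le>w. monom (monom (of_nat (w choose j) * moment f j * (- 1) ^ (w - j)) (w - j)) j)"
    (is "_ = ?P")
  unfolding period_poly_def
proof (rule the_equality)
  show "\<forall>x y. poly2 ?P x y = period_integral k f x y"
  proof (intro allI)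
    fix x y
    have "poly2 ?P x y = (\<Sum>j\<le>w. of_nat (w choose j) * moment f j * (- 1) ^ (w - j) * x ^ (w - j) * y ^ j)"
      by (simp add: poly2_def poly_sum poly_monom poly_const_pow mult_ac)
    also have "\<dots> = period_integral k f x y"
      unfolding period_integral_sum[OF assms]
      by (intro sum.cong refl) (simp add: power_minus[of x] mult_ac)
    finally show "poly2 ?P x y = period_integral k f x y" .
  qed
  then show "P = ?P" if "\<forall>x y. poly2 P x y = period_integral k f x y" for P
    using that by (intro poly2_unique) simp
qed

lemma coeff_even_restricted:
  assumes "i \<le> w" "j \<le> w" "even i" "even j" "(i, j) \<noteq> (w, 0)" "(i, j) \<noteq> (0, w)"
  shows "coeff (coeff (even_restricted w P) j) i = coeff (coeff P j) i"
proof -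
  define S where "S = {(i, j). i \<le> w \<and> j \<le> w \<and> even i \<and> even j \<and> (i, j) \<noteq> (w, 0) \<and> (i, j) \<noteq> (0, w)}"
  have "finite S" by (rule finite_subset[of _ "{..w} \<times> {..w}"]) (auto simp: S_def)
  have "coeff (coeff (even_restricted w P) j) i = (\<Sum>p\<in>S. if p = (i, j) then coeff (coeff P j) i else 0)"
    unfolding even_restricted_def S_def[symmetric] coeff_sum
    by (intro sum.cong refl) (auto split: if_splits)
  also have "\<dots> = coeff (coeff P j) i" using \<open>finite S\<close> assms by (simp add: S_def)
  finally show ?thesis .
qed

lemma coeff_period_poly_ev0:
  assumes f: "cusp_form k N f" "N > 0" and k: "k \<ge> 2" and w: "w = nat (k - 2)"
    and j: "even w" "even j" "0 < j" "j < w"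
  shows "coeff (coeff (period_poly_ev0 k f) j) (w - j) = of_nat (w choose j) * moment f j"
proof -
  have "coeff (coeff (period_poly_ev0 k f) j) (w - j) = coeff (coeff (period_poly k f) j) (w - j)"
    unfolding period_poly_ev0_def w[symmetric] using j by (intro coeff_even_restricted) auto
  also have "coeff (period_poly k f) j = monom (of_nat (w choose j) * moment f j * (- 1) ^ (w - j)) (w - j)"
    unfolding period_poly_eq[OF f k w] using j by (intro coeff_sum_monom) auto
  finally show ?thesis using j by simp
qed

subsection \<open>Coefficients of the period relations\<close>

lemma coeff_linear_power_binomial:
  "coeff ([:1, s:] ^ j) n = of_nat (j choose n) * s ^ n" for s :: complex
proof (cases "n \<le> j")
  case True
  then show ?thesis by (simp add: coeff_linear_poly_power)
next
  case False
  have "degree ([:1, s:] ^ j) \<le> 1 * j"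
    by (rule order_trans[OF degree_power_le]) (auto intro: mult_right_mono)
  then show ?thesis using False by (simp add: coeff_eq_0)
qed

lemma coeff_sum_monom_rev:
  "n \<le> w \<Longrightarrow> coeff (\<Sum>j\<le>w. monom (g j) (w - j)) n = g (w - n)" for g :: "nat \<Rightarrow> complex"
proof -
  assume n: "n \<le> w"
  have "(\<Sum>j\<le>w. monom (g j) (w - j)) = (\<Sum>j\<le>w. monom (g (w - j)) j)"
    by (rule sum.reindex_bij_witness[of _ "\<lambda>j. w - j" "\<lambda>j. w - j"]) auto
  then show ?thesis using n by (simp add: coeff_sum_monom)
qed

text \<open>R is the period relation with X = 1 and Y = y, and the coefficients of y^n are compared.
  Pairing 1 + y with 1 - y gives the factor 1 + (-1)^j, which kills odd j. The terms j = 0 and j = w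
  drop out because their binomials vanish or cancel, so only the coefficients of the restricted even
  polynomial remain.\<close>

lemma three_term_coeffs:
  fixes b :: "nat \<Rightarrow> complex" and c :: complex and w :: nat
  assumes r: "\<And>x y. r x y = (\<Sum>j\<le>w. b j * (- x) ^ (w - j) * y ^ j)"
    and R: "\<And>y. c * r (- y) 1 + r (- y) (1 + y) + r (- y) (1 - y) = c * r 1 y + r 1 (1 + y) + r (- 1) (1 - y)"
    and w: "even w" and n: "even n" "0 < n" "n < w"
  shows "(\<Sum>j | even j \<and> 0 < j \<and> j < w. b j * (of_nat (j choose (w - n)) - of_nat (j choose n))) = c / 2 * (b n - b (w - n))"
proof -
  define Q1 where "Q1 = Polynomial.smult c (\<Sum>j\<le>w. monom (b j) (w - j))
    + (\<Sum>j\<le>w. Polynomial.smult (b j) (monom 1 (w - j) * ([:1, 1:] ^ j + [:1, - 1:] ^ j)))"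
  define Q2 where "Q2 = Polynomial.smult c (\<Sum>j\<le>w. monom ((- 1) ^ (w - j) * b j) j)
    + (\<Sum>j\<le>w. Polynomial.smult (b j) (Polynomial.smult ((- 1) ^ (w - j)) ([:1, 1:] ^ j) + [:1, - 1:] ^ j))"
  have "poly Q1 y = poly Q2 y" for y
  proof -
    have "poly Q1 y = c * r (- y) 1 + r (- y) (1 + y) + r (- y) (1 - y)"
      by (simp add: Q1_def r poly_sum poly_monom sum.distrib[symmetric] algebra_simps)
    moreover have "poly Q2 y = c * r 1 y + r 1 (1 + y) + r (- 1) (1 - y)"
      by (simp add: Q2_def r poly_sum poly_monom sum.distrib[symmetric] algebra_simps)
    ultimately show ?thesis using R by simp
  qed
  then have "Q1 = Q2" using poly_eq_poly_eq_iff by blast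
  then have "coeff Q1 n = coeff Q2 n" by simp
  moreover have "coeff Q1 n = c * b (w - n) + (\<Sum>j\<le>w. b j * of_nat (j choose (w - n)) * (1 + (- 1) ^ j))"
  proof -
    have t: "coeff (Polynomial.smult (b j) (monom 1 (w - j) * ([:1, 1:] ^ j + [:1, - 1:] ^ j))) n = b j * of_nat (j choose (w - n)) * (1 + (- 1) ^ j)"
      if j: "j \<le> w" for j
    proof (cases "n < w - j")
      case True
      then have "j < w - n" using n by linarith
      then show ?thesis using True by (simp add: coeff_monom_mult binomial_eq_0)
    next
      case False
      then have e: "n - (w - j) = j - (w - n)" "w - n \<le> j" using n j by auto
      \<comment> \<open>Since w - n is even, shifting by it leaves the sign from 1 - y
        unchanged.\<close>
      have "even (j - (w - n)) \<longleftrightarrow> even j" using w n e(2) by auto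
      then have "(- 1) ^ (j - (w - n)) = ((- 1) ^ j :: complex)"
        by (simp add: minus_one_power_iff)
      then show ?thesis
        using False e(2) by (simp add: coeff_monom_mult coeff_linear_power_binomial e(1) binomial_symmetric[of "w - n" j, symmetric] distrib_left)
    qed
    have "coeff (\<Sum>j\<le>w. monom (b j) (w - j)) n = b (w - n)"
      using n by (intro coeff_sum_monom_rev) simp
    moreover have "coeff (\<Sum>j\<le>w. Polynomial.smult (b j) (monom 1 (w - j) * ([:1, 1:] ^ j + [:1, - 1:] ^ j))) n
        = (\<Sum>j\<le>w. b j * of_nat (j choose (w - n)) * (1 + (- 1) ^ j))"
      unfolding coeff_sum by (intro sum.cong refl t) simp
    ultimately show ?thesis by (simp only: Q1_def coeff_add coeff_smult)
  qed
  moreover have "coeff Q2 n = c * b n + (\<Sum>j\<le>w. b j * of_nat (j choose n) * (1 + (- 1) ^ j))"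
  proof -
    have t: "coeff (Polynomial.smult (b j) (Polynomial.smult ((- 1) ^ (w - j)) ([:1, 1:] ^ j) + [:1, - 1:] ^ j)) n = b j * of_nat (j choose n) * (1 + (- 1) ^ j)"
      if j: "j \<le> w" for j
      using w n j by (simp add: coeff_linear_power_binomial minus_one_power_iff)
    have "coeff (\<Sum>j\<le>w. monom ((- 1) ^ (w - j) * b j) j) n = b n"
      using w n by (subst coeff_sum_monom) auto
    moreover have "coeff (\<Sum>j\<le>w. Polynomial.smult (b j) (Polynomial.smult ((- 1) ^ (w - j)) ([:1, 1:] ^ j) + [:1, - 1:] ^ j)) n
        = (\<Sum>j\<le>w. b j * of_nat (j choose n) * (1 + (- 1) ^ j))"
      unfolding coeff_sum by (intro sum.cong refl t) simp
    ultimately show ?thesis by (simp only: Q2_def coeff_add coeff_smult)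
  qed
  ultimately have "(\<Sum>j\<le>w. b j * (of_nat (j choose (w - n)) - of_nat (j choose n)) * (1 + (- 1) ^ j)) = c * (b n - b (w - n))"
    by (simp add: left_diff_distrib right_diff_distrib sum_subtractf) (simp add: algebra_simps)
  moreover have "(\<Sum>j\<le>w. b j * (of_nat (j choose (w - n)) - of_nat (j choose n)) * (1 + (- 1) ^ j))
      = (\<Sum>j | even j \<and> 0 < j \<and> j < w. b j * (of_nat (j choose (w - n)) - of_nat (j choose n)) * 2)"
  proof (rule sum.mono_neutral_cong_right)
    show "\<forall>j\<in>{..w} - {j. even j \<and> 0 < j \<and> j < w}. b j * (of_nat (j choose (w - n)) - of_nat (j choose n)) * (1 + (- 1) ^ j) = 0"
    proof
      fix j assume "j \<in> {..w} - {j. even j \<and> 0 < j \<and> j < w}"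
      then have "odd j \<or> j = 0 \<or> j = w" by auto
      then show "b j * (of_nat (j choose (w - n)) - of_nat (j choose n)) * (1 + (- 1) ^ j) = 0"
        using n binomial_symmetric[of n w] by (auto simp: binomial_eq_0)
    qed
  qed auto
  ultimately show ?thesis by (simp add: sum_distrib_right[symmetric])
qed

text \<open>The same comparison of coefficients for the Atkin-Lehner relation; since r is
  homogeneous of degree w, the level enters through powers of q.\<close>

lemma fricke_coeffs:
  fixes b :: "nat \<Rightarrow> complex" and A q :: complex and w :: nat
  assumes r: "\<And>x y. r x y = (\<Sum>j\<le>w. b j * (- x) ^ (w - j) * y ^ j)"
    and R: "\<And>y. r 1 y = A * r (- y) q" and w: "even w" and n: "even n" "n \<le> w"
  shows "b n = A * b (w - n) * q ^ (w - n)"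
proof -
  define Q1 where "Q1 = (\<Sum>j\<le>w. monom ((- 1) ^ (w - j) * b j) j)"
  define Q2 where "Q2 = Polynomial.smult A (\<Sum>j\<le>w. monom (b j * q ^ j) (w - j))"
  have "poly Q1 y = poly Q2 y" for y
  proof -
    have "poly Q1 y = r 1 y" by (simp add: Q1_def r poly_sum poly_monom mult_ac)
    moreover have "poly Q2 y = A * r (- y) q" by (simp add: Q2_def r poly_sum poly_monom mult_ac)
    ultimately show ?thesis using R by simp
  qed
  then have "Q1 = Q2" using poly_eq_poly_eq_iff by blast
  then have "coeff Q1 n = coeff Q2 n" by simp
  moreover have "coeff Q1 n = b n" unfolding Q1_def using w n by (subst coeff_sum_monom) auto
  moreover have "coeff Q2 n = A * b (w - n) * q ^ (w - n)"
    unfolding Q2_def coeff_smult using n by (subst coeff_sum_monom_rev) auto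
  ultimately show ?thesis by simp
qed

section \<open>Positions in the matrix and exponents of the period polynomial\<close>

lemma odd_pairs_eq: "odd_pairs k = map (\<lambda>m. (nat k - m, m)) (filter odd [3..<nat k - 2])"
proof -
  have "concat (map (\<lambda>m. if odd m then [(nat k - m, m)] else []) xs) = map (\<lambda>m. (nat k - m, m)) (filter odd xs)" for xs
    by (induction xs) auto
  then show ?thesis by (simp add: odd_pairs_def)
qed

text \<open>On the sorted list of second components the map m to k - m is order reversing and
  preserves the set, so reversing the list amounts to exchanging components.\<close>

lemma odd_pairs_rev_eq:
  assumes "even (nat k)"
  shows "odd_pairs_rev k = map (\<lambda>(a, b). (b, a)) (odd_pairs k)"
proof -
  define K where "K = nat k"
  define L where "L = filter odd [3..<K - 2]"
  have L: "sorted L" "distinct L" "set L = {m. 3 \<le> m \<and> m < K - 2 \<and> odd m}"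
    by (auto simp: L_def sorted_wrt_filter)
  have K: "even K" using assms by (simp add: K_def)
  have "L = rev (map (\<lambda>m. K - m) L)"
  proof (rule sorted_distinct_set_unique)
    show "sorted (rev (map (\<lambda>m. K - m) L))"
      unfolding sorted_wrt_rev sorted_wrt_map by (rule sorted_wrt_mono_rel[OF _ L(1)]) auto
    have "inj_on (\<lambda>m. K - m) (set L)" by (rule inj_onI) (auto simp: L(3))
    then show "distinct (rev (map (\<lambda>m. K - m) L))" using L(2) by (simp add: distinct_map)
    have "(\<lambda>m. K - m) ` {m. 3 \<le> m \<and> m < K - 2 \<and> odd m} = {m. 3 \<le> m \<and> m < K - 2 \<and> odd m}"
    proof (intro equalityI subsetI)
      fix m assume "m \<in> {m. 3 \<le> m \<and> m < K - 2 \<and> odd m}"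
      then have "m = K - (K - m)" "K - m \<in> {m. 3 \<le> m \<and> m < K - 2 \<and> odd m}" using K by auto
      then show "m \<in> (\<lambda>m. K - m) ` {m. 3 \<le> m \<and> m < K - 2 \<and> odd m}" by (rule image_eqI)
    qed (use K in auto)
    then show "set L = set (rev (map (\<lambda>m. K - m) L))" by (simp add: L(3))
  qed (use L in auto)
  then have rev: "rev L = map (\<lambda>m. K - m) L" by (metis rev_rev_ident)
  have "odd_pairs_rev k = map (\<lambda>m. (K - m, m)) (rev L)"
    by (simp add: odd_pairs_rev_def odd_pairs_eq K_def[symmetric] L_def[symmetric] rev_map)
  also have "\<dots> = map (\<lambda>m. (m, K - m)) L"
    unfolding rev by (auto simp: L(3))
  also have "\<dots> = map (\<lambda>(a, b). (b, a)) (odd_pairs k)"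
    by (simp add: odd_pairs_eq K_def[symmetric] L_def[symmetric])
  finally show ?thesis .
qed

lemma odd_pairs_nth:
  assumes "i < length (odd_pairs k)" and k: "even (nat k)"
  obtains m where "odd_pairs k ! i = (nat k - m, m)" "3 \<le> m" "3 \<le> nat k - m" "m \<le> nat k" "odd m" "odd (nat k - m)"
proof -
  have "odd_pairs k ! i \<in> set (odd_pairs k)" using assms by simp
  then obtain m where m: "odd_pairs k ! i = (nat k - m, m)" "3 \<le> m" "m < nat k - 2" "odd m"
    by (auto simp: odd_pairs_eq)
  moreover have "3 \<le> nat k - m" "m \<le> nat k" "odd (nat k - m)" using m k by auto
  ultimately show ?thesis using that by blast
qed

text \<open>Row (m1, m2) corresponds to the exponent j = m1 - 1 of y.\<close>

lemma sum_odd_pairs: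
  fixes F :: "nat \<times> nat \<Rightarrow> complex"
  assumes k: "even (nat k)" and w: "nat k = w + 2"
  shows "(\<Sum>i<length (odd_pairs k). F (odd_pairs k ! i)) = (\<Sum>j | even j \<and> 0 < j \<and> j < w. F (j + 1, w - j + 1))"
proof -
  define L where "L = filter odd [3..<nat k - 2]"
  have "(\<Sum>i<length (odd_pairs k). F (odd_pairs k ! i)) = sum_list (map F (odd_pairs k))"
    by (simp add: sum_list_sum_nth atLeast0LessThan)
  also have "\<dots> = (\<Sum>m\<leftarrow>L. F (nat k - m, m))" by (simp add: odd_pairs_eq L_def o_def)
  also have "\<dots> = (\<Sum>m\<in>set L. F (nat k - m, m))"
    by (rule sum_list_distinct_conv_sum_set) (simp add: L_def)
  also have "\<dots> = (\<Sum>j | even j \<and> 0 < j \<and> j < w. F (j + 1, w - j + 1))"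
  proof (rule sum.reindex_bij_witness[of _ "\<lambda>j. w - j + 1" "\<lambda>m. w + 1 - m"])
    fix a assume "a \<in> set L"
    then have a: "3 \<le> a" "a < w" "odd a" using w by (auto simp: L_def)
    then show "w - (w + 1 - a) + 1 = a" "w + 1 - a \<in> {j. even j \<and> 0 < j \<and> j < w}" using k w by auto
    have "w + 1 - a + 1 = nat k - a" "w - (w + 1 - a) + 1 = a" using a w by auto
    then show "F (w + 1 - a + 1, w - (w + 1 - a) + 1) = F (nat k - a, a)" by (simp only:)
  next
    fix b assume "b \<in> {j. even j \<and> 0 < j \<and> j < w}"
    then have b: "even b" "0 < b" "b < w" by auto
    have "even w" using k w by simp
    then have "b + 2 \<le> w" using b by presburger
    then show "w + 1 - (w - b + 1) = b" "w - b + 1 \<in> set L" using b k w by (auto simp: L_def)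
  qed
  finally show ?thesis .
qed

lemma c1_eps:
  assumes "N = 2 \<or> N = 3"
  shows "c1 N (eps N) (Suc j) = (1 / of_nat N ^ j - 1) / (if N = 2 then 1 else 2)"
proof (cases "N = 2")
  case True
  then show ?thesis using eps_facts(3)[OF assms] by (simp add: c1_def)
next
  case False
  then have "N = 3" using assms by simp
  then show ?thesis using eps_facts(3)[OF assms] by (simp add: c1_def)
qed

lemma c1_eps_nonzero:
  assumes N: "N = 2 \<or> N = 3" and m: "m \<ge> 3"
  shows "c1 N (eps N) m \<noteq> 0"
proof -
  obtain j where j: "m = Suc j" "j > 0" using m by (cases m) auto
  have "1 < (of_nat N :: rat) ^ j" using N j by (intro one_less_power) auto
  then have "1 / (of_nat N :: rat) ^ j \<noteq> 1" by auto
  then show ?thesis unfolding j c1_eps[OF N] by auto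
qed

lemma DC_entry:
  assumes N: "N = 2 \<or> N = 3" and k: "even (nat k)"
    and i: "i < length (odd_pairs k)" "odd_pairs k ! i = (m1, m2)"
    and j: "j < length (odd_pairs k)" "odd_pairs k ! j = (n2, n1)"
  shows "(D_mat N k * C_mat N k) $$ (i, j) = (if m1 = n1 then c1 N (eps N) m2 else 0)
    + (of_nat ((m1 - 1) choose (n2 - 1)) - of_nat ((m1 - 1) choose (n1 - 1)))"
proof -
  let ?d = "length (odd_pairs k)"
  have m: "m1 \<ge> 3" "m2 \<ge> 3" "odd m1" "odd m2" "m1 + m2 = nat k"
    by (rule odd_pairs_nth[OF i(1) k]; use i(2) in simp)+
  have n: "n1 \<ge> 3" "n2 \<ge> 3" "odd n1" "odd n2" "n1 + n2 = nat k"
    by (rule odd_pairs_nth[OF j(1) k]; use j(2) in simp)+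
  \<comment> \<open>Columns are listed in reverse order, so position j, which in row order is (n2,
    n1), stands for the column (n1, n2).\<close>
  have "odd_pairs_rev k ! j = (n1, n2)" using j by (simp add: odd_pairs_rev_eq[OF k])
  then have C: "C_mat N k $$ (i, j) = C_entry N (m1, m2) (n1, n2)"
    using i j by (simp add: C_mat_def)
  have "(D_mat N k * C_mat N k) $$ (i, j) = (\<Sum>l\<in>{0..<?d}. D_mat N k $$ (i, l) * C_mat N k $$ (l, j))"
    using i j by (simp add: D_mat_def C_mat_def scalar_prod_def)
  also have "\<dots> = (\<Sum>l\<in>{0..<?d}. if l = i then inverse (c1 N (eps N) m1) * C_mat N k $$ (i, j) else 0)"
    using i by (intro sum.cong refl) (auto simp: D_mat_def)
  also have "\<dots> = inverse (c1 N (eps N) m1) * C_entry N (m1, m2) (n1, n2)" using i C by simp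
  also have "C_entry N (m1, m2) (n1, n2) = c1 N (eps N) m1 * ((if m1 = n1 then c1 N (eps N) m2 else 0)
    + (of_nat ((m1 - 1) choose (n2 - 1)) - of_nat ((m1 - 1) choose (n1 - 1))))"
    using m n by (intro C_entry_eq[OF N]) auto
  \<comment> \<open>The diagonal matrix cancels exactly the factor that the first derivation
    contributes to the whole row.\<close>
  finally show ?thesis using c1_eps_nonzero[OF N m(1)] by (simp add: mult.assoc[symmetric])
qed

theorem theorem2:
  fixes k :: int and N :: nat and f :: "complex \<Rightarrow> complex" and \<epsilon> :: complex
  assumes "even k"
    and "N = 2 \<or> N = 3"
    and "newform k N f"
    and "\<epsilon> = 1 \<or> \<epsilon> = - 1"
    and "\<forall>z\<in>uhp. atkin_lehner k N f z = \<epsilon> * f z"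
  shows "mat_of_row (period_vec k f) * map_mat of_rat (D_mat N k * C_mat N k)
       = mu N k \<epsilon> \<cdot>\<^sub>m mat_of_row (period_vec k f)"
proof -
  note N = assms(2)
  have N0: "N > 0" using N by auto
  have cf: "cusp_form k N f" using assms(3) by (simp add: newform_def)
  let ?d = "length (odd_pairs k)"
  have ek: "even (nat k)" using assms(1) by (cases "k \<ge> 0") (auto simp: even_nat_iff)
  have dim: "dim_vec (period_vec k f) = ?d" by (simp add: period_vec_def)
  show ?thesis
  proof (rule eq_matI)
    fix i j assume "i < dim_row (mu N k \<epsilon> \<cdot>\<^sub>m mat_of_row (period_vec k f))"
      and "j < dim_col (mu N k \<epsilon> \<cdot>\<^sub>m mat_of_row (period_vec k f))"
    then have i: "i = 0" and j: "j < ?d" using dim by auto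
    obtain m where m: "odd_pairs k ! j = (nat k - m, m)" "3 \<le> m" "3 \<le> nat k - m" "m \<le> nat k" "odd m" "odd (nat k - m)"
      using odd_pairs_nth[OF j ek] .
    \<comment> \<open>A column exists only for k \<ge> 6, so the weight condition needs no separate
      hypothesis; for smaller k the matrices are empty.\<close>
    have k: "k > 2" "k \<ge> 2" using m by linarith+
    obtain h where h: "k = 2 * int h + 2"
    proof
      show "k = 2 * int (nat (k div 2 - 1)) + 2" using assms(1) k by auto
    qed
    define w where "w = 2 * h"
    have w: "w = nat (k - 2)" "nat k = w + 2" "even w" using h by (auto simp: w_def)
    \<comment> \<open>Position j belongs to the column (m, k - m), but to the vector entry at (k -
      m, m). The sum over the column will involve b n, while the entry to be reproduced is b (w -
      n).\<close>
    define n where "n = m - 1"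
    have n: "even n" "0 < n" "n < w" "m = n + 1" "nat k - m = w - n + 1"
      using m w by (auto simp: n_def)
    define b where "b = (\<lambda>j. of_nat (w choose j) * moment f j)"
    define r where "r x y = (\<Sum>j\<le>w. b j * (- x) ^ (w - j) * y ^ j)" for x y
    have rE: "r x y = - eichler_0 k f x y" for x y
      using period_integral_sum[OF cf N0 k(2) w(1), of x y] period_integral_eichler[OF cf N0 k(2), of x y]
      by (simp add: r_def b_def)
    have vec: "period_vec k f $ l = b (fst (odd_pairs k ! l) - 1)" if l: "l < ?d" for l
    proof -
      obtain m' where m': "odd_pairs k ! l = (nat k - m', m')" "3 \<le> m'" "3 \<le> nat k - m'" "m' \<le> nat k" "odd m'" "odd (nat k - m')"
        using odd_pairs_nth[OF l ek] .
      have "period_vec k f $ l = coeff (coeff (period_poly_ev0 k f) (nat k - m' - 1)) (m' - 1)"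
        using l m' by (simp add: period_vec_def vec_of_list_index)
      also have "m' - 1 = w - (nat k - m' - 1)" using m' w by auto
      also have "coeff (coeff (period_poly_ev0 k f) (nat k - m' - 1)) (w - (nat k - m' - 1)) = b (nat k - m' - 1)"
        unfolding b_def using m' w by (intro coeff_period_poly_ev0[OF cf N0 k(2) w(1,3)]) auto
      finally show ?thesis using m' by simp
    qed
    define c :: complex where "c = (if N = 2 then 2 else 1)"
    have three: "(\<Sum>j | even j \<and> 0 < j \<and> j < w. b j * (of_nat (j choose (w - n)) - of_nat (j choose n))) = c / 2 * (b n - b (w - n))"
    proof (rule three_term_coeffs[of r, OF r_def _ w(3) n(1-3)])
      fix y
      show "c * r (- y) 1 + r (- y) (1 + y) + r (- y) (1 - y) = c * r 1 y + r 1 (1 + y) + r (- 1) (1 - y)"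
        using eichler_relation[OF N assms(3) k(1), of y 1] unfolding rE c_def by (simp add: algebra_simps)
    qed
    have "b n = - \<epsilon> / of_nat N ^ h * b (w - n) * of_nat N ^ (w - n)"
    proof (rule fricke_coeffs[of r, OF r_def _ w(3) n(1) less_imp_le[OF n(3)]])
      show "r 1 y = - \<epsilon> / of_nat N ^ h * r (- y) (of_nat N)" for y
        using eichler_fricke[OF cf N0 h assms(5), of 1 y] unfolding rE by simp
    qed
    \<comment> \<open>Divided by N^(w-n) so as to match the power of N in c1 at m2 = w - n +
      1.\<close>
    then have fricke: "b n / of_nat N ^ (w - n) = - \<epsilon> / of_nat N ^ h * b (w - n)"
      using N0 by simp
    define F where "F = (\<lambda>(m1, m2). b (m1 - 1) * ((if m1 = m then of_rat (c1 N (eps N) m2) else 0)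
      + (of_nat ((m1 - 1) choose (w - n)) - of_nat ((m1 - 1) choose n))))"
    have "(mat_of_row (period_vec k f) * map_mat of_rat (D_mat N k * C_mat N k)) $$ (i, j)
      = (\<Sum>l<?d. period_vec k f $ l * of_rat ((D_mat N k * C_mat N k) $$ (l, j)))"
      using i j dim by (simp add: scalar_prod_def D_mat_def C_mat_def atLeast0LessThan)
    also have "\<dots> = (\<Sum>l<?d. F (odd_pairs k ! l))"
    proof (rule sum.cong[OF refl])
      fix l assume "l \<in> {..<?d}"
      then have l: "l < ?d" by simp
      obtain m1 m2 where p: "odd_pairs k ! l = (m1, m2)" by force
      show "period_vec k f $ l * of_rat ((D_mat N k * C_mat N k) $$ (l, j)) = F (odd_pairs k ! l)"
        unfolding DC_entry[OF N ek l p j m(1)] vec[OF l] p F_def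
        using n by (simp add: of_rat_add of_rat_diff)
    qed
    also have "\<dots> = (\<Sum>j | even j \<and> 0 < j \<and> j < w. F (j + 1, w - j + 1))"
      by (rule sum_odd_pairs[OF ek w(2)])
    also have "\<dots> = (\<Sum>j | even j \<and> 0 < j \<and> j < w. if j = n then b n * of_rat (c1 N (eps N) (Suc (w - n))) else 0)
      + (\<Sum>j | even j \<and> 0 < j \<and> j < w. b j * (of_nat (j choose (w - n)) - of_nat (j choose n)))"
      unfolding sum.distrib[symmetric] by (intro sum.cong refl) (auto simp: F_def n(4) distrib_left)
    also have "(\<Sum>j | even j \<and> 0 < j \<and> j < w. if j = n then b n * of_rat (c1 N (eps N) (Suc (w - n))) else 0)
      = b n * of_rat (c1 N (eps N) (Suc (w - n)))"
      using n by simp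
    also have "of_rat (c1 N (eps N) (Suc (w - n))) = (1 / of_nat N ^ (w - n) - 1) * (c / 2)"
      unfolding c1_eps[OF N] using N by (auto simp: c_def of_rat_divide of_rat_diff of_rat_power)
    \<comment> \<open>The summand -1 in c1 produces - (c/2) b n, which cancels against the
      three-term relation; b (w - n) and the Atkin-Lehner term remain.\<close>
    also have "b n * ((1 / of_nat N ^ (w - n) - 1) * (c / 2))
      + (\<Sum>j | even j \<and> 0 < j \<and> j < w. b j * (of_nat (j choose (w - n)) - of_nat (j choose n)))
      = c / 2 * (b n / of_nat N ^ (w - n) - b (w - n))"
      unfolding three by (simp add: algebra_simps)
    also have "\<dots> = - (c / 2) * (1 + \<epsilon> / of_nat N ^ h) * b (w - n)"
      unfolding fricke by (simp add: algebra_simps)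
    also have "- (c / 2) * (1 + \<epsilon> / of_nat N ^ h) = mu N k \<epsilon>"
    proof -
      have "(k - 2) div 2 = int h" using h by simp
      moreover have "c / 2 = (if N = 2 then 1 else 1 / 2)" by (simp add: c_def)
      ultimately show ?thesis using N by (auto simp: mu_def)
    qed
    also have "mu N k \<epsilon> * b (w - n) = (mu N k \<epsilon> \<cdot>\<^sub>m mat_of_row (period_vec k f)) $$ (i, j)"
      using i j dim m n by (simp add: vec)
    finally show "(mat_of_row (period_vec k f) * map_mat of_rat (D_mat N k * C_mat N k)) $$ (i, j)
      = (mu N k \<epsilon> \<cdot>\<^sub>m mat_of_row (period_vec k f)) $$ (i, j)" .
  qed (simp_all add: dim D_mat_def C_mat_def)
qed

end
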